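(* Let $0<R<1$ and $c\in(1-R^2,1]$ be fixed, and let $N_c=\lfloor cN\rfloor$. Let $\mathcal{G}_{N,c,R}$ denote the Ginibre ensemble of size $N$ conditioned on the event that exactly $N_c$ of its points satisfy $|\lambda|>R$. Then, as $N\to\infty$: 1. In the region $\{\lambda\in\mathbb{C}:|\lambda|<R\}$, $\mathcal{G}_{N,c,R}$ behaves asymptotically as $\sqrt{\frac{N-N_c}{N}}\cdot\mathcal{G}_{N-N_c}$, i.e. the Ginibre ensemble of size $N-N_c$ with all points multiplied by $\sqrt{\frac{N-N_c}{N}}$. 2. For any $\epsilon>0$, in the region $\{\lambda\in\mathbb{C}:|\lambda|>R+\epsilon\}$, $\mathcal{G}_{N,c,R}$ behaves asymptotically as the Ginibre ensemble $\mathcal{G}_N$ of size $N$. 3. In the region $\mathbb{C}_+=\{z\in\mathbb{C}:\Re z>0\}$, the rescaled process $\bigl\{\tfrac{N(R^2-1+c)}{R}(\lambda-R):\lambda\in\mathcal{G}_{N,c,R}\bigr\}$ behaves asymptotically as the determinantal point process $\mathcal{X}$ on $\mathbb{C}_+$ with kernel $$K_{\mathcal{X}}(z,w)=\frac{1-(z+\overline{w}+1)e^{-z-\overline{w}}}{\pi(z+\overline{w})^2}$$ with respect to Lebesgue measure on $\mathbb{C}_+$.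
   Context: The Ginibre ensemble $\mathcal{G}_N$ of size $N$ is the random point set $\{\lambda_1,\dots,\lambda_N\}\subset\mathbb{C}$ whose joint law on $\mathbb{C}^N$ has density $\frac{1}{Z_N}\prod_{1\le j<k\le N}|\lambda_k-\lambda_j|^2\prod_{j=1}^N e^{-N|\lambda_j|^2}$ with respect to Lebesgue measure; $\mathcal{G}_0$ is the empty process. Asymptotic behaviour: let $A_N,B_N$ be two sequences of point processes in $\mathbb{C}$ and $U\subseteq\mathbb{C}$ an open set. We say that $A_N$ behaves asymptotically as $B_N$ in the region $U$ if for every natural number $k\ge1$ and every Lipschitz function $f:\mathbb{C}^k\to\mathbb{C}$ with compact support contained in $U^k$, $$\mathbb{E}_{X\sim A_N}\Bigl(\sum_{x_1,\dots,x_k\in X}f(x_1,\dots,x_k)\Bigr)=\mathbb{E}_{X\sim B_N}\Bigl(\sum_{x_1,\dots,x_k\in X}f(x_1,\dots,x_k)\Bigr)+o(c_N^k)\quad(N\to\infty),$$ where $c_N=\mathbb{E}_{X\sim B_N}\bigl(\#(X\cap D(0,1))\bigr)$, $D(0,1)$ is the unit disk, and the sums run over ordered $k$-tuples of distinct points of $X$. A determinantal point process with kernel $K$ with respect to Lebesgue measure is a point process with $k$-point correlation functions $\det(K(x_i,x_j))_{i,j=1}^k$ for all $k$. *)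

theory Defs
  imports
    "HOL-Probability.Probability"
    "HOL-Library.Landau_Symbols"
    "Jordan_Normal_Form.Determinant"
begin

hide_const (open) Determinants.det

text \<open>
  A point process on an open set \<open>E\<close> is represented by its law, a probability measure on the
  locally finite subsets of \<open>E\<close> with the \<open>\<sigma>\<close>-algebra generated by the counts
  \<open>X \<mapsto> #(X \<inter> B)\<close> for \<open>B\<close> Borel and relatively compact in \<open>E\<close>.
\<close>

definition configurations :: "complex set \<Rightarrow> complex set set" where
  "configurations E = {X. X \<subseteq> E \<and> (\<forall>K. compact K \<and> K \<subseteq> E \<longrightarrow> finite (X \<inter> K))}"

definition config_space :: "complex set \<Rightarrow> complex set measure" where
  "config_space E = sigma (configurations E)
     {{X \<in> configurations E. card (X \<inter> B) = n} | B n.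
        B \<in> sets borel \<and> (\<exists>K. compact K \<and> K \<subseteq> E \<and> B \<subseteq> K)}"

definition point_process :: "complex set \<Rightarrow> complex set measure \<Rightarrow> bool" where
  "point_process E P \<longleftrightarrow> prob_space P \<and> space P = configurations E \<and> sets P = sets (config_space E)"

definition map_process :: "(complex \<Rightarrow> complex) \<Rightarrow> complex set measure \<Rightarrow> complex set measure" where
  "map_process g P = distr P (config_space UNIV) (\<lambda>X. g ` X)"

text \<open>
  Points of \<open>E\<^sup>k\<close> are functions in \<open>{..<k} \<rightarrow>\<^sub>E E\<close>, the carrier of the product measure
  and of the product topology over the index set \<open>{..<k}\<close>; functions on \<open>E\<^sup>k\<close> are only
  ever considered on this carrier.
\<close>

definition distinct_tuples :: "nat \<Rightarrow> complex set \<Rightarrow> (nat \<Rightarrow> complex) set" where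
  "distinct_tuples k X = {x \<in> {..<k} \<rightarrow>\<^sub>E X. inj_on x {..<k}}"

definition lipschitz_tuples :: "nat \<Rightarrow> ((nat \<Rightarrow> complex) \<Rightarrow> complex) \<Rightarrow> bool" where
  "lipschitz_tuples k f \<longleftrightarrow>
     (\<exists>L. \<forall>x \<in> {..<k} \<rightarrow>\<^sub>E UNIV. \<forall>y \<in> {..<k} \<rightarrow>\<^sub>E UNIV.
        cmod (f x - f y) \<le> L * L2_set (\<lambda>i. dist (x i) (y i)) {..<k})"

definition tuple_support :: "nat \<Rightarrow> ((nat \<Rightarrow> complex) \<Rightarrow> complex) \<Rightarrow> (nat \<Rightarrow> complex) set" where
  "tuple_support k f =
     product_topology (\<lambda>_. euclidean) {..<k} closure_of {x \<in> {..<k} \<rightarrow>\<^sub>E UNIV. f x \<noteq> 0}"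

definition test_function :: "nat \<Rightarrow> complex set \<Rightarrow> ((nat \<Rightarrow> complex) \<Rightarrow> complex) \<Rightarrow> bool" where
  "test_function k U f \<longleftrightarrow> lipschitz_tuples k f \<and>
     compactin (product_topology (\<lambda>_. euclidean) {..<k}) (tuple_support k f) \<and>
     tuple_support k f \<subseteq> ({..<k} \<rightarrow>\<^sub>E U)"

text \<open>
  For a test function supported in \<open>U\<^sup>k\<close> and a locally finite \<open>X\<close>, only finitely many terms
  of the unordered sum below are nonzero, so it is a finite sum even if \<open>X\<close> is infinite.
\<close>

definition expected_tuple_sum ::
  "complex set measure \<Rightarrow> nat \<Rightarrow> ((nat \<Rightarrow> complex) \<Rightarrow> complex) \<Rightarrow> complex" where
  "expected_tuple_sum P k f = (LINT X|P. (\<Sum>\<^sub>\<infinity>x \<in> distinct_tuples k X. f x))"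

definition expected_count :: "complex set measure \<Rightarrow> complex set \<Rightarrow> real" where
  "expected_count P B = (LINT X|P. real (card (X \<inter> B)))"

definition behaves_asymptotically_as ::
  "(nat \<Rightarrow> complex set measure) \<Rightarrow> (nat \<Rightarrow> complex set measure) \<Rightarrow> complex set \<Rightarrow> bool" where
  "behaves_asymptotically_as A B U \<longleftrightarrow>
     (\<forall>k \<ge> 1. \<forall>f. test_function k U f \<longrightarrow>
        (\<lambda>N. expected_tuple_sum (A N) k f - expected_tuple_sum (B N) k f)
          \<in> o(\<lambda>N. complex_of_real (expected_count (B N) (ball 0 1) ^ k)))"

definition correlation_function ::
  "complex set \<Rightarrow> complex set measure \<Rightarrow> nat \<Rightarrow> ((nat \<Rightarrow> complex) \<Rightarrow> real) \<Rightarrow> bool" where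
  "correlation_function E P k \<rho> \<longleftrightarrow>
     \<rho> \<in> borel_measurable (Pi\<^sub>M {..<k} (\<lambda>_. restrict_space lborel E)) \<and>
     (\<forall>x \<in> {..<k} \<rightarrow>\<^sub>E E. 0 \<le> \<rho> x) \<and>
     (\<forall>f :: (nat \<Rightarrow> complex) \<Rightarrow> ennreal.
        f \<in> borel_measurable (Pi\<^sub>M {..<k} (\<lambda>_. restrict_space lborel E)) \<longrightarrow>
        (\<integral>\<^sup>+X. (\<integral>\<^sup>+x. f x \<partial>count_space (distinct_tuples k X)) \<partial>P) =
        (\<integral>\<^sup>+x. f x * ennreal (\<rho> x) \<partial>Pi\<^sub>M {..<k} (\<lambda>_. restrict_space lborel E)))"

definition determinantal_process ::
  "complex set \<Rightarrow> (complex \<Rightarrow> complex \<Rightarrow> complex) \<Rightarrow> complex set measure \<Rightarrow> bool" where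
  "determinantal_process E K P \<longleftrightarrow> point_process E P \<and>
     (\<forall>k \<ge> 1. \<exists>\<rho>. correlation_function E P k \<rho> \<and>
        (\<forall>x \<in> {..<k} \<rightarrow>\<^sub>E E.
           complex_of_real (\<rho> x) = Determinant.det (Matrix.mat k k (\<lambda>(i, j). K (x i) (x j)))))"

definition ginibre_weight :: "nat \<Rightarrow> (nat \<Rightarrow> complex) \<Rightarrow> real" where
  "ginibre_weight N x =
     (\<Prod>k<N. \<Prod>j<k. (cmod (x k - x j))\<^sup>2) * (\<Prod>j<N. exp (- real N * (cmod (x j))\<^sup>2))"

definition ginibre_law :: "nat \<Rightarrow> (nat \<Rightarrow> complex) measure" where
  "ginibre_law N = density (Pi\<^sub>M {..<N} (\<lambda>_. lborel))
     (\<lambda>x. ennreal (ginibre_weight N x / (LINT y|Pi\<^sub>M {..<N} (\<lambda>_. lborel). ginibre_weight N y)))"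

text \<open>For \<open>N = 0\<close> the law below is the point mass at the empty configuration.\<close>

definition ginibre :: "nat \<Rightarrow> complex set measure" where
  "ginibre N = distr (ginibre_law N) (config_space UNIV) (\<lambda>x. x ` {..<N})"

definition conditioned_ginibre :: "nat \<Rightarrow> nat \<Rightarrow> real \<Rightarrow> complex set measure" where
  "conditioned_ginibre N m R = uniform_measure (ginibre N)
     {X \<in> space (ginibre N). finite X \<and> card {z \<in> X. R < cmod z} = m}"

definition edge_kernel :: "complex \<Rightarrow> complex \<Rightarrow> complex" where
  "edge_kernel z w =
     (1 - (z + cnj w + 1) * exp (- z - cnj w)) / (complex_of_real pi * (z + cnj w)\<^sup>2)"

end

theory Submission
  imports Defs
begin

text \<open>
  The Ginibre weight is a squared Vandermonde determinant, and monomials are orthogonal on every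
  radial set. Hence the ensemble conditioned on having \<open>m\<close> points in \<open>{|\<lambda>| > R}\<close> is a mixture of
  determinantal processes: one draws a random set \<open>T\<close> of \<open>m\<close> modes, namely independent Bernoulli
  choices conditioned on their sum, and outside the disc the points form the determinantal process
  spanned by the modes in \<open>T\<close>, inside the disc the one spanned by the other modes. The success
  probability of mode \<open>j\<close> is the Poisson distribution function of parameter \<open>N R\<^sup>2\<close> at \<open>j\<close>, whose odds
  grow so fast that \<open>T\<close> is, up to \<open>o(N)\<close> modes, the top segment \<open>{N - m..<N}\<close>.

  In the bulk only the diagonal of the kernel survives at scale \<open>N\<close>, and it is a Poisson probability
  of a window of modes. At the edge the kernel is a Riemann sum over modes: the hazard rate of the
  Poisson law at \<open>N x\<close> tends to \<open>1 - x / R\<^sup>2\<close> and the mode functions to exponentials, which yields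
  the edge kernel up to a unimodular conjugation that does not affect determinants.
\<close>

text \<open>Conditioning destroys the determinantal structure: a kernel exists only once the set
  \<open>T\<close> of modes is fixed, and the law of \<open>T\<close> is never computed. Exchanging
  one element of \<open>T\<close> for one outside it changes the weight by a ratio of odds, and this
  bounds the probability of each single wrong membership. The modes left uncertain, near
  \<open>N - m\<close>, are harmless: in the bulk they live near one circle, and at the edge they
  are a vanishing fraction of all modes. The processes are not compared directly. In the bulk both
  expectations, divided by \<open>N ^ k\<close>, tend to the same integral while \<open>c_N\<close>
  is of exact order \<open>N\<close>. The exception is \<open>c = 1\<close> inside the disc: the
  reference process is empty, \<open>c_N = 0\<close>, and the little-o demands equality. The edge
  scale comes from the modes between \<open>(1 - c) * N\<close> and \<open>R\<^sup>2 * N\<close>: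
  unconditioned they live inside the circle, but they are forced outside and pile up within distance
  of order \<open>1 / N\<close> of it. The length \<open>R\<^sup>2 - 1 + c\<close> of this window
  fixes the dilation, and integrating a linear function times an exponential over it gives the
  numerator of the kernel.\<close>

abbreviation (input) cplx :: "real \<Rightarrow> complex" where
  "cplx \<equiv> of_real"

abbreviation lborel_on :: "'i set \<Rightarrow> ('i \<Rightarrow> complex) measure" where
  "lborel_on I \<equiv> Pi\<^sub>M I (\<lambda>_. lborel)"

abbreviation restricted_lborels :: "nat \<Rightarrow> complex set \<Rightarrow> (nat \<Rightarrow> complex) measure" where
  "restricted_lborels k E \<equiv> Pi\<^sub>M {..<k} (\<lambda>_. restrict_space lborel E)"

abbreviation lborels :: "nat \<Rightarrow> (nat \<Rightarrow> complex) measure" where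
  "lborels k \<equiv> Pi\<^sub>M {..<k} (\<lambda>_. lborel)"

abbreviation tuples :: "nat \<Rightarrow> 'a set \<Rightarrow> (nat \<Rightarrow> 'a) set" where
  "tuples k S \<equiv> {..<k} \<rightarrow>\<^sub>E S"

interpretation lborel_product: product_sigma_finite "\<lambda>_. lborel :: complex measure"
  by standard

lemma borel_measurable_cnj [measurable (raw)]:
  "f \<in> borel_measurable M \<Longrightarrow> (\<lambda>x. cnj (f x)) \<in> borel_measurable M"
  by (rule borel_measurable_continuous_on[OF continuous_on_cnj[OF continuous_on_id]])

section \<open>Radial and affine changes of variables\<close>

lemma nn_integral_lborel_translate:
  fixes f :: "complex \<Rightarrow> ennreal"
  assumes [measurable]: "f \<in> borel_measurable borel"
  shows "(\<integral>\<^sup>+z. f (w + z) \<partial>lborel) = (\<integral>\<^sup>+z. f z \<partial>lborel)"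
  by (subst (2) lborel_distr_plus[of w, symmetric]) (simp add: nn_integral_distr)

text \<open>Translation invariance and Fubini suffice, tested against the unit disc, whose rotation
  invariance is evident. Integrating \<open>d x * g (x + u * y)\<close> over \<open>y\<close> first
  gives the rotated measure; shifting \<open>x\<close> by \<open>u * y\<close> and then integrating
  over \<open>y\<close> gives the original one. Both carry the area of the disc as a factor, which
  cancels.\<close>

lemma lborel_distr_rotation:
  fixes u :: complex
  assumes u: "cmod u = 1"
  shows "distr lborel borel ((*) u) = lborel"
proof (rule measure_eqI)
  let ?D = "ball (0::complex) 1"
  have D0: "emeasure lborel ?D \<noteq> 0" "emeasure lborel ?D \<noteq> \<infinity>"
    by (auto simp: emeasure_ball unit_ball_vol_2 ennreal_mult_eq_top_iff)
  fix B :: "complex set" assume "B \<in> sets (distr lborel borel ((*) u))"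
  then have B[measurable]: "B \<in> sets borel" by simp
  define g where "g = (indicator B :: complex \<Rightarrow> ennreal)"
  define d where "d = (indicator ?D :: complex \<Rightarrow> ennreal)"
  have [measurable]: "g \<in> borel_measurable borel" "d \<in> borel_measurable borel"
    by (auto simp: g_def d_def intro!: borel_measurable_indicator)
  have shift_g: "(\<integral>\<^sup>+y. g (u * y) \<partial>lborel) = (\<integral>\<^sup>+y. g (x + u * y) \<partial>lborel)" for x
  proof -
    have "(\<integral>\<^sup>+y. g (u * y) \<partial>lborel) = (\<integral>\<^sup>+y. g (u * (x / u + y)) \<partial>lborel)"
      by (rule nn_integral_lborel_translate[symmetric]) measurable
    also have "\<dots> = (\<integral>\<^sup>+y. g (x + u * y) \<partial>lborel)"
      using u by (intro nn_integral_cong arg_cong[where f=g]) (auto simp: algebra_simps)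
    finally show ?thesis .
  qed
  have shift_dg: "(\<integral>\<^sup>+x. d x * g (x + u * y) \<partial>lborel) = (\<integral>\<^sup>+x. d (x - u * y) * g x \<partial>lborel)" for y
  proof -
    have "(\<integral>\<^sup>+x. d (x - u * y) * g x \<partial>lborel) = (\<integral>\<^sup>+x. d (u * y + x - u * y) * g (u * y + x) \<partial>lborel)"
      by (rule nn_integral_lborel_translate[symmetric]) measurable
    then show ?thesis
      by (simp add: add.commute)
  qed
  have d_int: "(\<integral>\<^sup>+y. d (x - u * y) * g x \<partial>lborel) = emeasure lborel ?D * g x" for x
  proof -
    have d_eq: "d (x - u * y) = indicator (ball (x / u) 1) y" for y
    proof -
      have "x - u * y = u * (x / u - y)" using u by (auto simp: algebra_simps)
      then have "cmod (x - u * y) = cmod (x / u - y)" using u by (simp add: norm_mult)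
      then show ?thesis by (simp only: d_def indicator_def mem_ball dist_norm diff_0 norm_minus_cancel)
    qed
    have "(\<integral>\<^sup>+y. d (x - u * y) * g x \<partial>lborel) = (\<integral>\<^sup>+y. d (x - u * y) \<partial>lborel) * g x"
      by (rule nn_integral_multc) measurable
    also have "(\<integral>\<^sup>+y. d (x - u * y) \<partial>lborel) = emeasure lborel (ball (x / u) 1)" by (simp add: d_eq)
    also have "\<dots> = emeasure lborel ?D" by (simp add: emeasure_ball)
    finally show ?thesis .
  qed
  have "emeasure lborel ?D * (\<integral>\<^sup>+y. g (u * y) \<partial>lborel) = (\<integral>\<^sup>+x. d x \<partial>lborel) * (\<integral>\<^sup>+y. g (u * y) \<partial>lborel)"
    by (simp add: d_def)
  also have "\<dots> = (\<integral>\<^sup>+x. d x * (\<integral>\<^sup>+y. g (u * y) \<partial>lborel) \<partial>lborel)"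
    by (rule nn_integral_multc[symmetric]) measurable
  also have "\<dots> = (\<integral>\<^sup>+x. d x * (\<integral>\<^sup>+y. g (x + u * y) \<partial>lborel) \<partial>lborel)"
    by (intro nn_integral_cong arg_cong[OF shift_g])
  also have "\<dots> = (\<integral>\<^sup>+x. (\<integral>\<^sup>+y. d x * g (x + u * y) \<partial>lborel) \<partial>lborel)"
    by (intro nn_integral_cong nn_integral_cmult[symmetric]) measurable
  also have "\<dots> = (\<integral>\<^sup>+y. (\<integral>\<^sup>+x. d x * g (x + u * y) \<partial>lborel) \<partial>lborel)"
    by (rule lborel_pair.Fubini') measurable
  also have "\<dots> = (\<integral>\<^sup>+y. (\<integral>\<^sup>+x. d (x - u * y) * g x \<partial>lborel) \<partial>lborel)"
    by (simp only: shift_dg)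
  also have "\<dots> = (\<integral>\<^sup>+x. (\<integral>\<^sup>+y. d (x - u * y) * g x \<partial>lborel) \<partial>lborel)"
    by (rule lborel_pair.Fubini') measurable
  also have "\<dots> = (\<integral>\<^sup>+x. emeasure lborel ?D * g x \<partial>lborel)"
    by (simp only: d_int)
  also have "\<dots> = emeasure lborel ?D * (\<integral>\<^sup>+x. g x \<partial>lborel)"
    by (rule nn_integral_cmult) measurable
  finally have "(\<integral>\<^sup>+y. g (u * y) \<partial>lborel) = (\<integral>\<^sup>+x. g x \<partial>lborel)"
    using D0 by (simp only: ennreal_mult_cancel_left) auto
  moreover have "(\<integral>\<^sup>+y. g (u * y) \<partial>lborel) = emeasure (distr lborel borel ((*) u)) B"
  proof -
    have "emeasure (distr lborel borel ((*) u)) B = (\<integral>\<^sup>+y. g y \<partial>distr lborel borel ((*) u))"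
      by (simp add: g_def)
    also have "\<dots> = (\<integral>\<^sup>+y. g (u * y) \<partial>lborel)"
      by (subst nn_integral_distr) auto
    finally show ?thesis by simp
  qed
  ultimately show "emeasure (distr lborel borel ((*) u)) B = emeasure lborel B"
    by (simp add: g_def)
qed simp

lemma lborel_integral_rotation:
  fixes f :: "complex \<Rightarrow> 'b::{banach, second_countable_topology}"
  assumes "cmod u = 1" and [measurable]: "f \<in> borel_measurable borel"
  shows "(LINT z|lborel. f (u * z)) = (LINT z|lborel. f z)"
  by (subst (2) lborel_distr_rotation[OF assms(1), symmetric]) (simp add: integral_distr)

text \<open>A disc of radius \<open>sqrt a\<close> has area \<open>pi * a\<close>, linear in
  \<open>a\<close>. Hence the squared modulus, not the modulus, is the radial coordinate used
  throughout; in it the modes turn into Erlang densities.\<close>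

lemma lborel_distr_cmod_power2:
  "distr lborel borel (\<lambda>z::complex. (cmod z)\<^sup>2) = density lborel (\<lambda>t. ennreal pi * indicator {0..} t)"
  (is "?L = ?R")
proof (rule measure_eqI_generator_eq[where E="range (\<lambda>a::real. {..a})" and \<Omega>=UNIV and A="\<lambda>n. {..real n}"])
  show "Int_stable (range (\<lambda>a::real. {..a}))" by (auto simp: Int_stable_def)
  show "sets ?L = sigma_sets UNIV (range (\<lambda>a::real. {..a}))"
       "sets ?R = sigma_sets UNIV (range (\<lambda>a::real. {..a}))"
    by (simp_all add: borel_eq_atMost)
  show "range (\<lambda>n. {..real n}) \<subseteq> range (\<lambda>a::real. {..a})" by auto
  show "(\<Union>n. {..real n}) = UNIV" using real_arch_simple by auto
  have L: "emeasure ?L {..a} = ennreal (pi * max a 0)" for a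
  proof (cases "a \<ge> 0")
    case True
    have "emeasure ?L {..a} = emeasure lborel ((\<lambda>z::complex. (cmod z)\<^sup>2) -` {..a})"
      by (subst emeasure_distr) auto
    also have "(\<lambda>z::complex. (cmod z)\<^sup>2) -` {..a} = cball 0 (sqrt a)"
    proof -
      have "(cmod z)\<^sup>2 \<le> a \<longleftrightarrow> cmod z \<le> sqrt a" for z :: complex
        using True real_sqrt_le_iff[of "(cmod z)\<^sup>2" a] by simp
      then show ?thesis by auto
    qed
    also have "emeasure lborel (cball (0::complex) (sqrt a)) = ennreal (pi * a)"
      using True by (simp add: emeasure_cball unit_ball_vol_2)
    finally show ?thesis using True by simp
  next
    case False
    have "emeasure ?L {..a} = emeasure lborel ((\<lambda>z::complex. (cmod z)\<^sup>2) -` {..a})"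
      by (subst emeasure_distr) auto
    also have "(\<lambda>z::complex. (cmod z)\<^sup>2) -` {..a} = {}"
    proof -
      have "\<not> (cmod z)\<^sup>2 \<le> a" for z :: complex
        using False zero_le_power2[of "cmod z"] by linarith
      then show ?thesis by auto
    qed
    finally show ?thesis using False by simp
  qed
  have R: "emeasure ?R {..a} = ennreal (pi * max a 0)" for a
  proof -
    have "emeasure ?R {..a} = (\<integral>\<^sup>+t. ennreal pi * indicator {0..a} t \<partial>lborel)"
      by (subst emeasure_density) (auto intro!: nn_integral_cong simp: indicator_def)
    also have "\<dots> = ennreal pi * emeasure lborel {0..a}"
      by (simp add: nn_integral_cmult)
    also have "\<dots> = ennreal (pi * max a 0)"
      by (simp add: emeasure_lborel_Icc_eq max_def ennreal_mult)
    finally show ?thesis .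
  qed
  show "emeasure ?L X = emeasure ?R X" if "X \<in> range (\<lambda>a::real. {..a})" for X
    using that L R by auto
  show "emeasure ?L {..real n} \<noteq> \<infinity>" for n by (simp add: L)
qed auto

lemma nn_integral_radial:
  fixes f :: "real \<Rightarrow> ennreal"
  assumes [measurable]: "f \<in> borel_measurable borel"
  shows "(\<integral>\<^sup>+z. f ((cmod z)\<^sup>2) \<partial>lborel) = ennreal pi * (\<integral>\<^sup>+t. f t * indicator {0..} t \<partial>lborel)"
proof -
  have "(\<integral>\<^sup>+z. f ((cmod z)\<^sup>2) \<partial>lborel) = (\<integral>\<^sup>+t. f t \<partial>distr lborel borel (\<lambda>z::complex. (cmod z)\<^sup>2))"
    by (simp add: nn_integral_distr)
  also have "\<dots> = (\<integral>\<^sup>+t. ennreal pi * (f t * indicator {0..} t) \<partial>lborel)"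
    unfolding lborel_distr_cmod_power2
    by (subst nn_integral_density) (auto intro!: nn_integral_cong simp: mult_ac)
  also have "\<dots> = ennreal pi * (\<integral>\<^sup>+t. f t * indicator {0..} t \<partial>lborel)"
    by (simp add: nn_integral_cmult)
  finally show ?thesis .
qed

lemma PiM_lborel_reindex:
  fixes h :: "'i \<Rightarrow> 'j"
  assumes h: "bij_betw h I J" and I: "finite I"
  shows "distr (lborel_on J) (lborel_on I) (\<lambda>x. \<lambda>i\<in>I. x (h i)) =
    lborel_on I"
proof (rule lborel_product.PiM_eqI)
  have J: "finite J" using h I bij_betw_finite by blast
  have hJ: "h i \<in> J" if "i \<in> I" for i using h that by (auto simp: bij_betw_def)
  fix A :: "'i \<Rightarrow> complex set" assume A: "\<And>i. i \<in> I \<Longrightarrow> A i \<in> sets lborel"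
  let ?g = "the_inv_into I h"
  have g: "?g (h i) = i" if "i \<in> I" for i using h that by (auto simp: bij_betw_def the_inv_into_f_f)
  have gI: "?g j \<in> I" if "j \<in> J" for j
    using h that by (metis bij_betw_def bij_betw_the_inv_into imageI)
  have hg: "h (?g j) = j" if "j \<in> J" for j
    using h that by (simp add: bij_betw_def f_the_inv_into_f)
  have meas: "(\<lambda>x. \<lambda>i\<in>I. x (h i)) \<in> measurable (lborel_on J) (lborel_on I)"
    using hJ by (intro measurable_restrict measurable_component_singleton) auto
  have eq: "(\<lambda>x. \<lambda>i\<in>I. x (h i)) -` Pi\<^sub>E I A \<inter> space (lborel_on J) = Pi\<^sub>E J (\<lambda>j. A (?g j))"
  proof (intro equalityI subsetI)
    fix x assume "x \<in> (\<lambda>x. \<lambda>i\<in>I. x (h i)) -` Pi\<^sub>E I A \<inter> space (lborel_on J)"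
    then have "\<And>i. i \<in> I \<Longrightarrow> x (h i) \<in> A i" "x \<in> extensional J"
      by (auto simp: space_PiM PiE_iff)
    then show "x \<in> Pi\<^sub>E J (\<lambda>j. A (?g j))" using gI hg by (force simp: PiE_iff)
  next
    fix x assume "x \<in> Pi\<^sub>E J (\<lambda>j. A (?g j))"
    then show "x \<in> (\<lambda>x. \<lambda>i\<in>I. x (h i)) -` Pi\<^sub>E I A \<inter> space (lborel_on J)"
      using hJ g by (force simp: space_PiM PiE_iff)
  qed
  have "emeasure (distr (lborel_on J) (lborel_on I) (\<lambda>x. \<lambda>i\<in>I. x (h i))) (Pi\<^sub>E I A)
     = emeasure (lborel_on J) (Pi\<^sub>E J (\<lambda>j. A (?g j)))"
    using A I by (subst emeasure_distr[OF meas]) (auto intro!: sets_PiM_I_finite simp: eq)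
  also have "\<dots> = (\<Prod>j\<in>J. emeasure lborel (A (?g j)))"
    using J gI A by (intro lborel_product.emeasure_PiM) auto
  also have "\<dots> = (\<Prod>i\<in>I. emeasure lborel (A i))"
    using h g by (subst prod.reindex_bij_betw[OF h, symmetric]) auto
  finally show "emeasure (distr (lborel_on J) (lborel_on I) (\<lambda>x. \<lambda>i\<in>I. x (h i))) (Pi\<^sub>E I A)
     = (\<Prod>i\<in>I. emeasure lborel (A i))" .
qed (use I in auto)

lemma PiM_lborel_integral_reindex:
  fixes f :: "('i \<Rightarrow> complex) \<Rightarrow> 'b::{banach, second_countable_topology}"
  assumes h: "bij_betw h I J" and I: "finite I"
    and f: "f \<in> borel_measurable (lborel_on I)"
  shows "(LINT x|lborel_on J. f (\<lambda>i\<in>I. x (h i))) = (LINT x|lborel_on I. f x)"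
proof -
  have "(\<lambda>x. \<lambda>i\<in>I. x (h i)) \<in> measurable (lborel_on J) (lborel_on I)"
    using h by (intro measurable_restrict measurable_component_singleton) (auto simp: bij_betw_def)
  from integral_distr[OF this f] show ?thesis
    by (simp only: PiM_lborel_reindex[OF h I])
qed

lemma PiM_lborel_affine:
  fixes s :: real and b :: complex
  assumes s: "s \<noteq> 0" and I: "finite I"
  shows "lborel_on I =
    density (distr (lborel_on I) (lborel_on I) (\<lambda>x. \<lambda>i\<in>I. b + s *\<^sub>R x i))
      (\<lambda>_. ennreal ((s\<^sup>2) ^ card I))"
proof (rule lborel_product.PiM_eqI[symmetric])
  fix A :: "'a \<Rightarrow> complex set" assume A: "\<And>i. i \<in> I \<Longrightarrow> A i \<in> sets lborel"
  have meas: "(\<lambda>x. \<lambda>i\<in>I. b + s *\<^sub>R x i) \<in> measurable (lborel_on I) (lborel_on I)"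
    by (intro measurable_restrict) (auto intro!: measurable_compose[OF measurable_component_singleton])
  have eq: "(\<lambda>x. \<lambda>i\<in>I. b + s *\<^sub>R x i) -` Pi\<^sub>E I A \<inter> space (lborel_on I)
      = Pi\<^sub>E I (\<lambda>i. (\<lambda>z. b + s *\<^sub>R z) -` A i)"
    by (auto simp: space_PiM PiE_iff extensional_def)
  have 1: "emeasure lborel (A i) = ennreal (s\<^sup>2) * emeasure lborel ((\<lambda>z. b + s *\<^sub>R z) -` A i)" if "i \<in> I" for i
  proof -
    have "emeasure lborel (A i) = emeasure (density (distr lborel borel (\<lambda>z. b + s *\<^sub>R z)) (\<lambda>_. \<bar>s\<bar>^DIM(complex))) (A i)"
      using lborel_affine[OF s, of b] by simp
    also have "\<dots> = ennreal (s\<^sup>2) * emeasure (distr lborel borel (\<lambda>z. b + s *\<^sub>R z)) (A i)"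
      using A[OF that] by (subst emeasure_density) (auto simp: nn_integral_cmult power2_eq_square)
    also have "\<dots> = ennreal (s\<^sup>2) * emeasure lborel ((\<lambda>z. b + s *\<^sub>R z) -` A i)"
      using A[OF that] by (subst emeasure_distr) auto
    finally show ?thesis .
  qed
  have "emeasure (density (distr (lborel_on I) (lborel_on I) (\<lambda>x. \<lambda>i\<in>I. b + s *\<^sub>R x i))
      (\<lambda>_. ennreal ((s\<^sup>2) ^ card I))) (Pi\<^sub>E I A)
     = ennreal ((s\<^sup>2) ^ card I) * emeasure (lborel_on I) (Pi\<^sub>E I (\<lambda>i. (\<lambda>z. b + s *\<^sub>R z) -` A i))"
    using A I by (subst emeasure_density_const, simp_all, subst emeasure_distr[OF meas]) (auto intro!: sets_PiM_I_finite simp: eq)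
  also have "emeasure (lborel_on I) (Pi\<^sub>E I (\<lambda>i. (\<lambda>z. b + s *\<^sub>R z) -` A i))
     = (\<Prod>i\<in>I. emeasure lborel ((\<lambda>z. b + s *\<^sub>R z) -` A i))"
  proof (rule lborel_product.emeasure_PiM[OF I])
    fix i assume "i \<in> I"
    have [measurable]: "A i \<in> sets borel" using A[OF \<open>i \<in> I\<close>] by simp
    have "(\<lambda>z. b + s *\<^sub>R z) -` A i \<inter> space borel \<in> sets borel"
      by (rule measurable_sets[of _ borel borel]) auto
    then show "(\<lambda>z. b + s *\<^sub>R z) -` A i \<in> sets lborel" by simp
  qed
  also have "ennreal ((s\<^sup>2) ^ card I) * (\<Prod>i\<in>I. emeasure lborel ((\<lambda>z. b + s *\<^sub>R z) -` A i)) =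
     (\<Prod>i\<in>I. emeasure lborel (A i))"
    by (simp add: 1 prod.distrib ennreal_power)
  finally show "emeasure (density (distr (lborel_on I) (lborel_on I) (\<lambda>x. \<lambda>i\<in>I. b + s *\<^sub>R x i))
      (\<lambda>_. ennreal ((s\<^sup>2) ^ card I))) (Pi\<^sub>E I A)
     = (\<Prod>i\<in>I. emeasure lborel (A i))" .
qed (use I in auto)

lemma PiM_lborel_integral_affine:
  fixes f :: "('i \<Rightarrow> complex) \<Rightarrow> 'b::{banach, second_countable_topology}"
  assumes s: "s \<noteq> 0" and I: "finite I"
    and f: "f \<in> borel_measurable (lborel_on I)"
  shows "(LINT x|lborel_on I. f x) =
    (s\<^sup>2) ^ card I *\<^sub>R (LINT x|lborel_on I. f (\<lambda>i\<in>I. b + s *\<^sub>R x i))"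
proof -
  have meas: "(\<lambda>x. \<lambda>i\<in>I. b + s *\<^sub>R x i) \<in> measurable (lborel_on I) (lborel_on I)"
    by (intro measurable_restrict) (auto intro!: measurable_compose[OF measurable_component_singleton])
  have "(LINT x|lborel_on I. f x) = (LINT x|density (distr (lborel_on I) (lborel_on I) (\<lambda>x. \<lambda>i\<in>I. b + s *\<^sub>R x i))
      (\<lambda>_. ennreal ((s\<^sup>2) ^ card I)). f x)"
    using PiM_lborel_affine[OF s I, of b] by simp
  also have "\<dots> = (s\<^sup>2) ^ card I *\<^sub>R
     (LINT x|(distr (lborel_on I) (lborel_on I) (\<lambda>x. \<lambda>i\<in>I. b + s *\<^sub>R x i)). f x)"
    using f by (subst integral_density) auto
  also have "\<dots> = (s\<^sup>2) ^ card I *\<^sub>R (LINT x|lborel_on I. f (\<lambda>i\<in>I. b + s *\<^sub>R x i))"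
    using meas f by (simp add: integral_distr)
  finally show ?thesis .
qed

section \<open>Determinants and orthogonal modes\<close>

text \<open>Written on index functions instead of matrices, so that the product belonging to a
  permutation can be integrated coordinate by coordinate; \<open>det_eq_leibniz_det\<close> is the
  link to matrix determinants.\<close>

definition leibniz_det :: "nat \<Rightarrow> (nat \<Rightarrow> nat \<Rightarrow> 'a::comm_ring_1) \<Rightarrow> 'a" where
  "leibniz_det n M = (\<Sum>\<pi> | \<pi> permutes {..<n}. of_int (sign \<pi>) * (\<Prod>i<n. M i (\<pi> i)))"

abbreviation kernel_det :: "nat \<Rightarrow> ('a \<Rightarrow> 'a \<Rightarrow> complex) \<Rightarrow> (nat \<Rightarrow> 'a) \<Rightarrow> complex" where
  "kernel_det k K y \<equiv> leibniz_det k (\<lambda>i j. K (y i) (y j))"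

abbreviation kernel_integral :: "nat \<Rightarrow> ((nat \<Rightarrow> complex) \<Rightarrow> complex) \<Rightarrow> (complex \<Rightarrow> complex \<Rightarrow> complex) \<Rightarrow> complex" where
  "kernel_integral k F K \<equiv> LINT y|lborels k. F y * kernel_det k K y"

abbreviation ball_test :: "(nat \<Rightarrow> complex) \<Rightarrow> complex" where
  "ball_test y \<equiv> indicator (ball 0 1) (y 0)"

lemma det_eq_leibniz_det:
  "Determinant.det (Matrix.mat n n (\<lambda>(i, j). M i j)) = leibniz_det n M"
  by (auto simp: Determinant.det_def leibniz_det_def atLeast0LessThan permutes_in_image intro!: sum.cong prod.cong)

lemma leibniz_det_cong:
  "(\<And>i j. i < n \<Longrightarrow> j < n \<Longrightarrow> M i j = M' i j) \<Longrightarrow> leibniz_det n M = leibniz_det n M'"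
  unfolding leibniz_det_def
  by (intro sum.cong prod.cong arg_cong2[where f="(*)"] refl) (auto dest: permutes_in_image)

lemma leibniz_det_permute_rows:
  assumes p: "p permutes {..<n}"
  shows "leibniz_det n (\<lambda>i j. M (p i) j) = of_int (sign p) * leibniz_det n M"
proof -
  have "leibniz_det n (\<lambda>i j. M (p i) j) =
      (\<Sum>\<pi> | \<pi> permutes {..<n}. of_int (sign (\<pi> \<circ> p)) * (\<Prod>i<n. M (p i) ((\<pi> \<circ> p) i)))"
    unfolding leibniz_det_def by (rule sum_permutations_compose_right[OF p])
  also have "\<dots> = (\<Sum>\<pi> | \<pi> permutes {..<n}. of_int (sign p) * (of_int (sign \<pi>) * (\<Prod>i<n. M i (\<pi> i))))"
  proof (intro sum.cong refl)
    fix \<pi> assume "\<pi> \<in> {\<pi>. \<pi> permutes {..<n}}"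
    then have \<pi>: "\<pi> permutes {..<n}" by simp
    have "sign (\<pi> \<circ> p) = sign \<pi> * sign p"
      using p \<pi> by (intro sign_compose) (auto simp: permutation_permutes)
    moreover have "(\<Prod>i<n. M (p i) ((\<pi> \<circ> p) i)) = (\<Prod>i<n. M i (\<pi> i))"
      using prod.permute[OF p, of "\<lambda>i. M i (\<pi> i)"] by (simp add: o_def)
    ultimately show "of_int (sign (\<pi> \<circ> p)) * (\<Prod>i<n. M (p i) ((\<pi> \<circ> p) i)) =
        of_int (sign p) * (of_int (sign \<pi>) * (\<Prod>i<n. M i (\<pi> i)))"
      by (simp add: mult_ac)
  qed
  finally show ?thesis by (simp add: leibniz_det_def sum_distrib_left)
qed

lemma leibniz_det_identical_rows:
  fixes M :: "nat \<Rightarrow> nat \<Rightarrow> 'a::comm_ring_1"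
  assumes "a < n" "b < n" "a \<noteq> b" "\<And>j. j < n \<Longrightarrow> M a j = M b j"
  shows "leibniz_det n M = 0"
proof -
  have "Matrix.row (Matrix.mat n n (\<lambda>(i, j). M i j)) a = Matrix.row (Matrix.mat n n (\<lambda>(i, j). M i j)) b"
    using assms by (intro eq_vecI) auto
  then show ?thesis
    using assms by (subst det_eq_leibniz_det[symmetric]) (rule det_identical_rows[of _ n a b], auto)
qed

text \<open>A permutation visits each index once as a row and once as a column, so in every Leibniz
  term each phase meets its own conjugate.\<close>

lemma leibniz_det_conjugate_phase:
  fixes K :: "nat \<Rightarrow> nat \<Rightarrow> complex"
  assumes "\<And>i. i < n \<Longrightarrow> cmod (\<theta> i) = 1"
  shows "leibniz_det n (\<lambda>i j. \<theta> i * cnj (\<theta> j) * K i j) = leibniz_det n K"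
  unfolding leibniz_det_def
proof (intro sum.cong refl)
  fix \<pi> assume "\<pi> \<in> {\<pi>. \<pi> permutes {..<n}}"
  then have \<pi>: "\<pi> permutes {..<n}" by simp
  have "(\<Prod>i<n. \<theta> i * cnj (\<theta> (\<pi> i)) * K i (\<pi> i)) =
      (\<Prod>i<n. \<theta> i) * (\<Prod>i<n. cnj (\<theta> (\<pi> i))) * (\<Prod>i<n. K i (\<pi> i))"
    by (simp add: prod.distrib)
  also have "(\<Prod>i<n. cnj (\<theta> (\<pi> i))) = (\<Prod>i<n. cnj (\<theta> i))"
    using prod.permute[OF \<pi>, of "\<lambda>i. cnj (\<theta> i)"] by (simp add: o_def)
  also have "(\<Prod>i<n. \<theta> i) * (\<Prod>i<n. cnj (\<theta> i)) = (\<Prod>i<n. \<theta> i * cnj (\<theta> i))"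
    by (simp add: prod.distrib)
  also have "\<dots> = 1"
    using assms by (intro prod.neutral) (auto simp: complex_norm_square[symmetric])
  finally show "of_int (sign \<pi>) * (\<Prod>i<n. \<theta> i * cnj (\<theta> (\<pi> i)) * K i (\<pi> i)) =
      of_int (sign \<pi>) * (\<Prod>i<n. K i (\<pi> i))" by simp
qed

text \<open>Induction on the size. As a polynomial in the last node the determinant has degree at
  most \<open>n\<close>, vanishes at the earlier nodes, and has the smaller determinant as leading
  coefficient. Subtracting the expected product leaves a polynomial of degree below \<open>n\<close>
  with \<open>n\<close> distinct roots. If earlier nodes coincide, both sides are zero.\<close>

lemma leibniz_det_vandermonde:
  fixes x :: "nat \<Rightarrow> 'a::{idom}"
  shows "leibniz_det n (\<lambda>i j. x i ^ j) = (\<Prod>k<n. \<Prod>j<k. (x k - x j))"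
proof (induction n)
  case 0
  show ?case by (simp add: leibniz_det_def)
next
  case (Suc n)
  \<comment> \<open>The cofactors along the last row do not see its entries, so they are the
    coefficients of the determinant as a polynomial in the last node.\<close>
  define c where "c j = cofactor (Matrix.mat (Suc n) (Suc n) (\<lambda>(i, j). x i ^ j)) n j" for j
  have exp: "leibniz_det (Suc n) (\<lambda>i j. (x(n := y)) i ^ j) = (\<Sum>j<Suc n. y ^ j * c j)" for y
  proof -
    let ?A = "Matrix.mat (Suc n) (Suc n) (\<lambda>(i, j). (x(n := y)) i ^ j)"
    have "leibniz_det (Suc n) (\<lambda>i j. (x(n := y)) i ^ j) = (\<Sum>j<Suc n. ?A $$ (n, j) * cofactor ?A n j)"
      by (subst det_eq_leibniz_det[symmetric], rule laplace_expansion_row) auto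
    also have "\<dots> = (\<Sum>j<Suc n. y ^ j * c j)"
    proof (intro sum.cong refl)
      fix j assume "j \<in> {..<Suc n}"
      have "mat_delete ?A n j = mat_delete (Matrix.mat (Suc n) (Suc n) (\<lambda>(i, j). x i ^ j)) n j"
        by (rule eq_matI) (auto simp: mat_delete_def)
      then show "?A $$ (n, j) * cofactor ?A n j = y ^ j * c j"
        using \<open>j \<in> {..<Suc n}\<close> by (simp add: c_def cofactor_def)
    qed
    finally show ?thesis .
  qed
  have cn: "c n = leibniz_det n (\<lambda>i j. x i ^ j)"
  proof -
    have "mat_delete (Matrix.mat (Suc n) (Suc n) (\<lambda>(i, j). x i ^ j)) n n = Matrix.mat n n (\<lambda>(i, j). x i ^ j)"
      by (rule eq_matI) (auto simp: mat_delete_def)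
    then show ?thesis by (simp add: c_def cofactor_def det_eq_leibniz_det[symmetric] flip: mult_2)
  qed
  show ?case
  proof (cases "inj_on x {..<n}")
    case False
    then obtain a b where ab: "a < n" "b < n" "a \<noteq> b" "x a = x b" by (auto simp: inj_on_def)
    have "leibniz_det (Suc n) (\<lambda>i j. x i ^ j) = 0"
      using ab by (intro leibniz_det_identical_rows[of a _ b]) auto
    moreover have "(\<Prod>k<n. \<Prod>j<k. (x k - x j)) = 0"
      unfolding Suc.IH[symmetric]
      using ab by (intro leibniz_det_identical_rows[of a _ b]) auto
    ultimately show ?thesis by simp
  next
    case True
    define p where "p = (\<Sum>j<Suc n. monom (c j) j)"
    define q where "q = Polynomial.smult (c n) (\<Prod>j<n. [:- x j, 1:])"
    have p_eval: "poly p y = leibniz_det (Suc n) (\<lambda>i j. (x(n := y)) i ^ j)" for y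
      unfolding exp by (simp add: p_def poly_sum poly_monom mult.commute)
    have degm: "degree (\<Prod>j<n. [:- x j, 1:]) = n"
      by (subst degree_prod_eq_sum_degree) auto
    have leadm: "coeff (\<Prod>j<n. [:- x j, 1:]) n = 1"
      using lead_coeff_prod[of "\<lambda>j. [:- x j, 1:]" "{..<n}"] degm by simp
    have "p - q = 0"
    proof (rule ccontr)
      assume ne: "p - q \<noteq> 0"
      have "degree (p - q) < n \<or> p - q = 0"
      proof -
        have dp: "degree p \<le> n" unfolding p_def
          by (intro degree_sum_le) (auto intro: order.trans[OF degree_monom_le])
        have dq: "degree q \<le> n" unfolding q_def using degm by (metis degree_smult_le)
        have "degree (p - q) \<le> n" using dp dq by (rule degree_diff_le)
        moreover have "coeff (p - q) n = 0"
          by (simp add: p_def q_def leadm coeff_sum)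
        ultimately show ?thesis
          by (metis leading_coeff_0_iff nat_less_le)
      qed
      then have "degree (p - q) < n" using ne by simp
      moreover have "x ` {..<n} \<subseteq> {y. poly (p - q) y = 0}"
      proof
        fix y assume "y \<in> x ` {..<n}"
        then obtain i where i: "i < n" and y: "y = x i" by auto
        have "poly p (x i) = 0" unfolding p_eval
          using i by (intro leibniz_det_identical_rows[of i _ n]) auto
        moreover have "poly q (x i) = 0"
          using i by (auto simp: q_def poly_prod)
        ultimately show "y \<in> {y. poly (p - q) y = 0}" by (simp add: y)
      qed
      then have "card (x ` {..<n}) \<le> card {y. poly (p - q) y = 0}"
        using ne by (intro card_mono poly_roots_finite)
      ultimately show False
        using card_poly_roots_bound[OF ne] True by (simp add: card_image)
    qed
    then have "leibniz_det (Suc n) (\<lambda>i j. x i ^ j) = poly q (x n)"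
      using p_eval[of "x n"] by simp
    also have "\<dots> = (\<Prod>k<Suc n. \<Prod>j<k. (x k - x j))"
      by (simp add: q_def cn Suc.IH poly_prod)
    finally show ?thesis .
  qed
qed

definition inj_tuples :: "nat \<Rightarrow> 'a set \<Rightarrow> (nat \<Rightarrow> 'a) set" where
  "inj_tuples k S = {\<iota> \<in> tuples k S. inj_on \<iota> {..<k}}"

lemma finite_inj_tuples: "finite S \<Longrightarrow> finite (inj_tuples k S)"
  unfolding inj_tuples_def by (rule finite_subset[of _ "tuples k S"]) (auto intro: finite_PiE)

text \<open>In the spirit of Cauchy-Binet: one mode is chosen for each row, and a repeated choice
  produces two equal rows, so only injective choices survive. Replacing the permutation by its
  inverse moves it from the points to the modes; then every factor depends on a single point and can
  be integrated separately.\<close>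

lemma leibniz_det_gram:
  fixes u :: "nat \<Rightarrow> 'a \<Rightarrow> complex" and v :: "nat \<Rightarrow> 'a \<Rightarrow> complex"
  assumes T: "finite T"
  shows "leibniz_det k (\<lambda>i j. \<Sum>l\<in>T. u l (x i) * v l (x j)) =
    (\<Sum>\<iota>\<in>inj_tuples k T. \<Sum>\<pi> | \<pi> permutes {..<k}. of_int (sign \<pi>) * (\<Prod>i<k. u (\<iota> i) (x i) * v (\<iota> (\<pi> i)) (x i)))"
proof -
  have "leibniz_det k (\<lambda>i j. \<Sum>l\<in>T. u l (x i) * v l (x j)) =
     (\<Sum>\<pi> | \<pi> permutes {..<k}. \<Sum>\<iota>\<in>tuples k T. of_int (sign \<pi>) * (\<Prod>i<k. u (\<iota> i) (x i) * v (\<iota> i) (x (\<pi> i))))"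
    unfolding leibniz_det_def
    by (subst prod_sum_PiE) (auto simp: T sum_distrib_left)
  also have "\<dots> = (\<Sum>\<iota>\<in>tuples k T. \<Sum>\<pi> | \<pi> permutes {..<k}. of_int (sign \<pi>) * (\<Prod>i<k. u (\<iota> i) (x i) * v (\<iota> i) (x (\<pi> i))))"
    by (rule sum.swap)
  also have "\<dots> = (\<Sum>\<iota>\<in>tuples k T. (\<Prod>i<k. u (\<iota> i) (x i)) * leibniz_det k (\<lambda>i j. v (\<iota> i) (x j)))"
    by (simp add: leibniz_det_def sum_distrib_left prod.distrib mult_ac)
  also have "\<dots> = (\<Sum>\<iota>\<in>inj_tuples k T. (\<Prod>i<k. u (\<iota> i) (x i)) * leibniz_det k (\<lambda>i j. v (\<iota> i) (x j)))"
  proof (rule sum.mono_neutral_right)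
    show "finite (tuples k T)" using T by (auto intro: finite_PiE)
    show "\<forall>\<iota>\<in>(tuples k T) - inj_tuples k T. (\<Prod>i<k. u (\<iota> i) (x i)) * leibniz_det k (\<lambda>i j. v (\<iota> i) (x j)) = 0"
    proof
      fix \<iota> assume "\<iota> \<in> (tuples k T) - inj_tuples k T"
      then have "\<not> inj_on \<iota> {..<k}" by (auto simp: inj_tuples_def)
      then obtain a b where "a < k" "b < k" "a \<noteq> b" "\<iota> a = \<iota> b" by (auto simp: inj_on_def)
      then have "leibniz_det k (\<lambda>i j. v (\<iota> i) (x j)) = 0"
        by (intro leibniz_det_identical_rows[of a _ b]) auto
      then show "(\<Prod>i<k. u (\<iota> i) (x i)) * leibniz_det k (\<lambda>i j. v (\<iota> i) (x j)) = 0" by simp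
    qed
  qed (auto simp: inj_tuples_def)
  also have "\<dots> = (\<Sum>\<iota>\<in>inj_tuples k T. \<Sum>\<pi> | \<pi> permutes {..<k}. of_int (sign \<pi>) * (\<Prod>i<k. u (\<iota> i) (x i) * v (\<iota> (\<pi> i)) (x i)))"
  proof (rule sum.cong[OF refl])
    fix \<iota>
    have "leibniz_det k (\<lambda>i j. v (\<iota> i) (x j)) = (\<Sum>\<pi> | \<pi> permutes {..<k}. of_int (sign (inv_into UNIV \<pi>)) * (\<Prod>i<k. v (\<iota> i) (x (inv_into UNIV \<pi> i))))"
      unfolding leibniz_det_def by (rule sum_permutations_inverse)
    also have "\<dots> = (\<Sum>\<pi> | \<pi> permutes {..<k}. of_int (sign \<pi>) * (\<Prod>i<k. v (\<iota> (\<pi> i)) (x i)))"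
    proof (intro sum.cong refl)
      fix \<pi> assume "\<pi> \<in> {\<pi>. \<pi> permutes {..<k}}"
      then have \<pi>: "\<pi> permutes {..<k}" by simp
      have "(\<Prod>i<k. v (\<iota> i) (x (inv_into UNIV \<pi> i))) = (\<Prod>i<k. v (\<iota> (\<pi> i)) (x i))"
        using prod.permute[OF \<pi>, of "\<lambda>i. v (\<iota> i) (x (inv_into UNIV \<pi> i))"] by (simp add: o_def permutes_inverses[OF \<pi>])
      moreover have "sign (inv_into UNIV \<pi>) = sign \<pi>"
        using \<pi> by (intro sign_inverse) (auto simp: permutation_permutes)
      ultimately show "of_int (sign (inv_into UNIV \<pi>)) * (\<Prod>i<k. v (\<iota> i) (x (inv_into UNIV \<pi> i))) =
        of_int (sign \<pi>) * (\<Prod>i<k. v (\<iota> (\<pi> i)) (x i))" by simp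
    qed
    finally show "(\<Prod>i<k. u (\<iota> i) (x i)) * leibniz_det k (\<lambda>i j. v (\<iota> i) (x j)) =
       (\<Sum>\<pi> | \<pi> permutes {..<k}. of_int (sign \<pi>) * (\<Prod>i<k. u (\<iota> i) (x i) * v (\<iota> (\<pi> i)) (x i)))"
      by (simp add: sum_distrib_left prod.distrib mult_ac)
  qed
  finally show ?thesis .
qed

text \<open>Orthogonality on \<open>A\<close> and on \<open>- A\<close> separately is what makes the
  conditioning tractable: whichever side each coordinate is assigned to, the cross terms
  vanish.\<close>

locale orthogonal_system =
  fixes \<psi> :: "nat \<Rightarrow> complex \<Rightarrow> complex" and A :: "complex set" and n :: nat
  assumes A_borel [measurable]: "A \<in> sets borel"
    and \<psi>_borel [measurable]: "\<And>j. \<psi> j \<in> borel_measurable borel"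
    and \<psi>_square_integrable: "\<And>j. j < n \<Longrightarrow> integrable lborel (\<lambda>z. (cmod (\<psi> j z))\<^sup>2)"
    and orthogonal_in: "\<And>i j. i < n \<Longrightarrow> j < n \<Longrightarrow> i \<noteq> j \<Longrightarrow>
      (LINT z|lborel. indicat_real A z *\<^sub>R (\<psi> i z * cnj (\<psi> j z))) = 0"
    and orthogonal_out: "\<And>i j. i < n \<Longrightarrow> j < n \<Longrightarrow> i \<noteq> j \<Longrightarrow>
      (LINT z|lborel. indicat_real (- A) z *\<^sub>R (\<psi> i z * cnj (\<psi> j z))) = 0"
begin

definition mass :: "complex set \<Rightarrow> nat \<Rightarrow> real" where
  "mass B j = (LINT z|lborel. indicat_real B z * (cmod (\<psi> j z))\<^sup>2)"

definition side :: "nat set \<Rightarrow> nat \<Rightarrow> complex set" where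
  "side T i = (if i \<in> T then A else - A)"

definition V :: "(nat \<Rightarrow> complex) \<Rightarrow> complex" where
  "V x = leibniz_det n (\<lambda>i j. \<psi> j (x i))"

lemma side_borel [measurable]: "side T i \<in> sets borel"
  by (simp add: side_def)

lemma integrable_pair:
  assumes "i < n" "j < n"
  shows "integrable lborel (\<lambda>z. \<psi> i z * cnj (\<psi> j z))"
proof (rule Bochner_Integration.integrable_bound)
  show "integrable lborel (\<lambda>z. (cmod (\<psi> i z))\<^sup>2 + (cmod (\<psi> j z))\<^sup>2)"
    using assms by (intro Bochner_Integration.integrable_add \<psi>_square_integrable)
  show "AE z in lborel. norm (\<psi> i z * cnj (\<psi> j z)) \<le> norm ((cmod (\<psi> i z))\<^sup>2 + (cmod (\<psi> j z))\<^sup>2)"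
  proof (intro AE_I2)
    fix z
    have "2 * (cmod (\<psi> i z) * cmod (\<psi> j z)) \<le> (cmod (\<psi> i z))\<^sup>2 + (cmod (\<psi> j z))\<^sup>2"
      using sum_squares_bound[of "cmod (\<psi> i z)" "cmod (\<psi> j z)"] by (simp add: mult_ac)
    moreover have "0 \<le> cmod (\<psi> i z) * cmod (\<psi> j z)" by simp
    ultimately have "cmod (\<psi> i z) * cmod (\<psi> j z) \<le> (cmod (\<psi> i z))\<^sup>2 + (cmod (\<psi> j z))\<^sup>2"
      by linarith
    then show "norm (\<psi> i z * cnj (\<psi> j z)) \<le> norm ((cmod (\<psi> i z))\<^sup>2 + (cmod (\<psi> j z))\<^sup>2)"
      by (simp add: norm_mult)
  qed
qed measurable

lemma integrable_pair_indicator: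
  assumes "i < n" "j < n" "B \<in> sets borel"
  shows "integrable lborel (\<lambda>z. indicat_real B z *\<^sub>R (\<psi> i z * cnj (\<psi> j z)))"
  using assms by (intro integrable_mult_indicator integrable_pair) auto

lemma integral_side:
  assumes "i < n" "j < n"
  shows "(LINT z|lborel. indicat_real (side T i) z *\<^sub>R (\<psi> i z * cnj (\<psi> j z))) =
    (if j = i then cplx (mass (side T i) i) else 0)"
proof (cases "j = i")
  case True
  have "(LINT z|lborel. indicat_real (side T i) z *\<^sub>R (\<psi> i z * cnj (\<psi> i z))) =
     (LINT z|lborel. cplx (indicat_real (side T i) z * (cmod (\<psi> i z))\<^sup>2))"
    by (intro Bochner_Integration.integral_cong refl)
      (simp only: of_real_mult complex_norm_square scaleR_conv_of_real)
  then show ?thesis using True by (simp only: mass_def integral_complex_of_real) simp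
next
  case False
  then show ?thesis
    using orthogonal_in[of i j] orthogonal_out[of i j] assms by (cases "i \<in> T") (auto simp: side_def)
qed

lemma V_permute:
  assumes p: "p permutes {..<n}"
  shows "V (\<lambda>i\<in>{..<n}. x (p i)) = of_int (sign p) * V x"
proof -
  have "V (\<lambda>i\<in>{..<n}. x (p i)) = leibniz_det n (\<lambda>i j. \<psi> j (x (p i)))"
    unfolding V_def by (rule leibniz_det_cong) auto
  then show ?thesis by (simp add: V_def leibniz_det_permute_rows[OF p, of "\<lambda>i j. \<psi> j (x i)"])
qed

end

locale orthogonal_system_statistic = orthogonal_system +
  fixes k m :: nat and F :: "(nat \<Rightarrow> complex) \<Rightarrow> complex" and C :: real
  assumes F_borel [measurable]: "F \<in> borel_measurable (lborels k)"
    and F_bounded: "\<And>x. x \<in> tuples k UNIV \<Longrightarrow> cmod (F x) \<le> C"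
    and F_support: "\<And>x i. x \<in> tuples k UNIV \<Longrightarrow> i < k \<Longrightarrow> x i \<notin> A \<Longrightarrow> F x = 0"
begin

definition tuple :: "(nat \<Rightarrow> nat) \<Rightarrow> (nat \<Rightarrow> complex) \<Rightarrow> (nat \<Rightarrow> complex)" where
  "tuple \<iota> x = (\<lambda>i\<in>{..<k}. x (\<iota> i))"

definition \<Phi> :: "(nat \<Rightarrow> complex) \<Rightarrow> complex" where
  "\<Phi> x = (if card {i \<in> {..<n}. x i \<in> A} = m then \<Sum>\<iota>\<in>inj_tuples k {..<n}. F (tuple \<iota> x) else 0)"

text \<open>One term of the expanded square. By symmetry the first determinant can be reduced to its
  diagonal product, so coordinate \<open>i\<close> carries mode \<open>i\<close> there and mode
  \<open>\<tau> i\<close> in the conjugate determinant, while \<open>T\<close> prescribes the side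
  on which it lies.\<close>

definition G :: "nat set \<Rightarrow> (nat \<Rightarrow> nat) \<Rightarrow> (nat \<Rightarrow> nat) \<Rightarrow> (nat \<Rightarrow> complex) \<Rightarrow> complex" where
  "G T \<iota> \<tau> x = F (tuple \<iota> x) *
     (\<Prod>i<n. indicat_real (side T i) (x i) *\<^sub>R (\<psi> i (x i) * cnj (\<psi> (\<tau> i) (x i))))"

lemma tuple_PiE: "tuple \<iota> x \<in> tuples k UNIV"
  by (auto simp: tuple_def)

lemma tuple_measurable:
  "\<iota> ` {..<k} \<subseteq> I \<Longrightarrow> tuple \<iota> \<in> measurable (lborel_on I) (lborels k)"
  unfolding tuple_def by (intro measurable_restrict measurable_component_singleton) auto

lemma F_tuple_measurable:
  "\<iota> ` {..<k} \<subseteq> I \<Longrightarrow> (\<lambda>x. F (tuple \<iota> x)) \<in> borel_measurable (lborel_on I)"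
  by (rule measurable_compose[OF tuple_measurable F_borel])

lemma G_integrable:
  assumes \<iota>: "\<iota> ` {..<k} \<subseteq> {..<n}" and \<tau>: "\<tau> permutes {..<n}"
  shows "integrable (lborels n) (G T \<iota> \<tau>)"
proof (rule Bochner_Integration.integrable_bound)
  let ?P = "\<lambda>x. \<Prod>i<n. indicat_real (side T i) (x i) *\<^sub>R (\<psi> i (x i) * cnj (\<psi> (\<tau> i) (x i)))"
  have P: "integrable (lborels n) ?P"
    using permutes_in_image[OF \<tau>] by (intro lborel_product.product_integrable_prod integrable_pair_indicator) auto
  then show "integrable (lborels n) (\<lambda>x. C *\<^sub>R ?P x)" by simp
  show "G T \<iota> \<tau> \<in> borel_measurable (lborels n)"
    unfolding G_def using P by (intro borel_measurable_times F_tuple_measurable \<iota>) auto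
  show "AE x in lborels n. norm (G T \<iota> \<tau> x) \<le> norm (C *\<^sub>R ?P x)"
  proof (intro AE_I2)
    fix x
    have "cmod (F (tuple \<iota> x)) \<le> \<bar>C\<bar>" using F_bounded[OF tuple_PiE, of \<iota> x] by linarith
    then show "norm (G T \<iota> \<tau> x) \<le> norm (C *\<^sub>R ?P x)"
      unfolding G_def norm_mult norm_scaleR by (intro mult_right_mono) auto
  qed
qed

lemma indicator_sides:
  assumes "T \<subseteq> {..<n}"
  shows "(\<Prod>i<n. indicat_real (side T i) (x i)) = (if T = {i \<in> {..<n}. x i \<in> A} then 1 else 0)"
proof (cases "T = {i \<in> {..<n}. x i \<in> A}")
  case True
  then have "indicat_real (side T i) (x i) = 1" if "i < n" for i
    using that by (auto simp: side_def indicator_def)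
  then show ?thesis using True by simp
next
  case False
  then obtain i where "i < n" "(i \<in> T) \<noteq> (x i \<in> A)" using assms by blast
  then have "\<exists>i\<in>{..<n}. indicat_real (side T i) (x i) = 0"
    by (intro bexI[of _ i]) (auto simp: side_def indicator_def)
  then show ?thesis using False by simp
qed

text \<open>For a given \<open>x\<close> the side indicators select the single set \<open>T\<close>
  of indices whose coordinates lie in \<open>A\<close>. Tuples that leave this set contribute
  nothing, because \<open>F\<close> is supported in \<open>A\<close>.\<close>

lemma \<Phi>_expand:
  "\<Phi> x * (\<Prod>i<n. \<psi> i (x i)) * (\<Prod>i<n. cnj (\<psi> (\<tau> i) (x i))) =
    (\<Sum>T | T \<subseteq> {..<n} \<and> card T = m. \<Sum>\<iota>\<in>inj_tuples k T. G T \<iota> \<tau> x)"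
proof -
  let ?q = "(\<Prod>i<n. \<psi> i (x i)) * (\<Prod>i<n. cnj (\<psi> (\<tau> i) (x i)))"
  let ?T = "{i \<in> {..<n}. x i \<in> A}"
  have fin: "finite {T. T \<subseteq> {..<n} \<and> card T = m}" by (rule finite_subset[of _ "Pow {..<n}"]) auto
  have G_eq: "G T \<iota> \<tau> x = (if T = ?T then F (tuple \<iota> x) * ?q else 0)" if "T \<subseteq> {..<n}" for T \<iota>
  proof -
    have "(\<Prod>i<n. indicat_real (side T i) (x i) *\<^sub>R (\<psi> i (x i) * cnj (\<psi> (\<tau> i) (x i)))) =
        cplx (\<Prod>i<n. indicat_real (side T i) (x i)) * ?q"
      by (simp add: scaleR_conv_of_real prod.distrib)
    then show ?thesis unfolding G_def indicator_sides[OF that] by simp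
  qed
  have "(\<Sum>T | T \<subseteq> {..<n} \<and> card T = m. \<Sum>\<iota>\<in>inj_tuples k T. G T \<iota> \<tau> x) =
     (\<Sum>T | T \<subseteq> {..<n} \<and> card T = m. if T = ?T then \<Sum>\<iota>\<in>inj_tuples k T. F (tuple \<iota> x) * ?q else 0)"
    by (intro sum.cong refl) (auto simp: G_eq)
  also have "\<dots> = (if card ?T = m then \<Sum>\<iota>\<in>inj_tuples k ?T. F (tuple \<iota> x) * ?q else 0)"
  proof -
    have "?T \<subseteq> {..<n}" by auto
    then show ?thesis using fin by (simp add: sum.delta')
  qed
  also have "(\<Sum>\<iota>\<in>inj_tuples k ?T. F (tuple \<iota> x) * ?q) = (\<Sum>\<iota>\<in>inj_tuples k {..<n}. F (tuple \<iota> x) * ?q)"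
  proof (rule sum.mono_neutral_left)
    show "finite (inj_tuples k {..<n})" by (rule finite_inj_tuples) simp
    show "inj_tuples k ?T \<subseteq> inj_tuples k {..<n}" by (auto simp: inj_tuples_def PiE_iff)
    show "\<forall>\<iota>\<in>inj_tuples k {..<n} - inj_tuples k ?T. F (tuple \<iota> x) * ?q = 0"
    proof
      fix \<iota> assume "\<iota> \<in> inj_tuples k {..<n} - inj_tuples k ?T"
      then obtain i where "i < k" "x (\<iota> i) \<notin> A" by (force simp: inj_tuples_def PiE_iff)
      then have "F (tuple \<iota> x) = 0" using tuple_PiE[of \<iota> x] by (intro F_support[of _ i]) (auto simp: tuple_def)
      then show "F (tuple \<iota> x) * ?q = 0" by simp
    qed
  qed
  also have "(if card ?T = m then \<Sum>\<iota>\<in>inj_tuples k {..<n}. F (tuple \<iota> x) * ?q else 0) = \<Phi> x * ?q"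
    by (simp add: \<Phi>_def sum_distrib_right)
  finally show ?thesis by (simp add: mult.assoc)
qed

lemma \<Phi>_permute:
  assumes p: "p permutes {..<n}"
  shows "\<Phi> (\<lambda>i\<in>{..<n}. x (p i)) = \<Phi> x"
proof -
  have img: "p ` {i \<in> {..<n}. x (p i) \<in> A} = {i \<in> {..<n}. x i \<in> A}"
  proof (intro equalityI subsetI)
    fix i assume i: "i \<in> {i \<in> {..<n}. x i \<in> A}"
    have pi: "p (inv_into UNIV p i) = i" by (rule permutes_inverses(1)[OF p])
    have "inv_into UNIV p i \<in> {i \<in> {..<n}. x (p i) \<in> A}"
      using i permutes_in_image[OF permutes_inv[OF p], of i] unfolding mem_Collect_eq pi by simp
    then show "i \<in> p ` {i \<in> {..<n}. x (p i) \<in> A}"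
      by (rule rev_image_eqI) (simp only: pi)
  next
    fix i assume "i \<in> p ` {i \<in> {..<n}. x (p i) \<in> A}"
    then show "i \<in> {i \<in> {..<n}. x i \<in> A}" using permutes_in_image[OF p] by auto
  qed
  have 1: "card {i \<in> {..<n}. x i \<in> A} = card {i \<in> {..<n}. (\<lambda>i\<in>{..<n}. x (p i)) i \<in> A}"
  proof -
    have "{i \<in> {..<n}. (\<lambda>i\<in>{..<n}. x (p i)) i \<in> A} = {i \<in> {..<n}. x (p i) \<in> A}" by auto
    then show ?thesis
      using card_image[OF permutes_inj_on[OF p], of "{i \<in> {..<n}. x (p i) \<in> A}"] by (simp only: img)
  qed
  have "(\<Sum>\<iota>\<in>inj_tuples k {..<n}. F (tuple \<iota> (\<lambda>i\<in>{..<n}. x (p i)))) = (\<Sum>\<iota>\<in>inj_tuples k {..<n}. F (tuple \<iota> x))"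
  proof (rule sum.reindex_bij_witness[where j="\<lambda>\<iota>. \<lambda>i\<in>{..<k}. p (\<iota> i)" and i="\<lambda>\<iota>. \<lambda>i\<in>{..<k}. inv_into UNIV p (\<iota> i)"])
    fix \<iota> assume \<iota>: "\<iota> \<in> inj_tuples k {..<n}"
    then have \<iota>': "\<iota> i < n" if "i < k" for i using that by (auto simp: inj_tuples_def)
    have e: "\<iota> \<in> extensional {..<k}" "inj_on \<iota> {..<k}" using \<iota> by (auto simp: inj_tuples_def PiE_iff)
    show "(\<lambda>i\<in>{..<k}. inv_into UNIV p ((\<lambda>i\<in>{..<k}. p (\<iota> i)) i)) = \<iota>"
      "(\<lambda>i\<in>{..<k}. p ((\<lambda>i\<in>{..<k}. inv_into UNIV p (\<iota> i)) i)) = \<iota>"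
      using e permutes_inverses[OF p] by (auto simp: extensional_def)
    have "inj_on (p \<circ> \<iota>) {..<k}" "inj_on (inv_into UNIV p \<circ> \<iota>) {..<k}"
      using e permutes_inj_on[OF p] permutes_inj_on[OF permutes_inv[OF p]] by (auto intro!: comp_inj_on)
    then show "(\<lambda>i\<in>{..<k}. p (\<iota> i)) \<in> inj_tuples k {..<n}" "(\<lambda>i\<in>{..<k}. inv_into UNIV p (\<iota> i)) \<in> inj_tuples k {..<n}"
      using \<iota>' permutes_in_image[OF p] permutes_in_image[OF permutes_inv[OF p]]
      by (auto simp: inj_tuples_def PiE_iff inj_on_def)
    show "F (tuple (\<lambda>i\<in>{..<k}. p (\<iota> i)) x) = F (tuple \<iota> (\<lambda>i\<in>{..<n}. x (p i)))"
      using \<iota>' by (intro arg_cong[where f=F]) (auto simp: tuple_def)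
  qed
  then show ?thesis unfolding \<Phi>_def 1 by simp
qed

text \<open>The coordinates outside the tuple split off as one-dimensional factors, and
  orthogonality forces \<open>\<tau>\<close> to fix each of them. Only permutations of the modes of
  the tuple itself survive. On its coordinates the side indicators equal 1 wherever \<open>F\<close>
  is nonzero.\<close>

lemma integral_G:
  assumes T: "T \<subseteq> {..<n}" and \<iota>: "\<iota> \<in> inj_tuples k T" and \<tau>: "\<tau> permutes {..<n}"
  shows "integral\<^sup>L (lborels n) (G T \<iota> \<tau>) =
    (if \<tau> permutes \<iota> ` {..<k} then
       (\<Prod>j\<in>{..<n} - \<iota> ` {..<k}. cplx (mass (side T j) j)) *
       (LINT y|lborels k. F y * (\<Prod>i<k. \<psi> (\<iota> i) (y i) * cnj (\<psi> (\<tau> (\<iota> i)) (y i))))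
     else 0)"
proof -
  let ?I = "\<iota> ` {..<k}" let ?J = "{..<n} - \<iota> ` {..<k}"
  have IT: "?I \<subseteq> T" and inj: "inj_on \<iota> {..<k}" using \<iota> by (auto simp: inj_tuples_def)
  have In: "?I \<subseteq> {..<n}" using IT T by auto
  have un: "?I \<union> ?J = {..<n}" using In by auto
  have \<tau>n: "\<tau> i < n" if "i < n" for i using permutes_in_image[OF \<tau>] that by auto
  let ?g = "\<lambda>i z. indicat_real (side T i) z *\<^sub>R (\<psi> i z * cnj (\<psi> (\<tau> i) z))"
  have "integral\<^sup>L (lborels n) (G T \<iota> \<tau>) =
    (LINT x|Pi\<^sub>M ?I (\<lambda>_. lborel). LINT y|Pi\<^sub>M ?J (\<lambda>_. lborel). G T \<iota> \<tau> (merge ?I ?J (x, y)))"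
    using lborel_product.product_integral_fold[of ?I ?J "G T \<iota> \<tau>"] G_integrable[OF In \<tau>] un by simp
  also have "\<dots> = (LINT x|Pi\<^sub>M ?I (\<lambda>_. lborel). LINT y|Pi\<^sub>M ?J (\<lambda>_. lborel).
      (F (tuple \<iota> x) * (\<Prod>i\<in>?I. ?g i (x i))) * (\<Prod>i\<in>?J. ?g i (y i)))"
  proof (intro Bochner_Integration.integral_cong refl)
    fix x y :: "nat \<Rightarrow> complex"
    have "tuple \<iota> (merge ?I ?J (x, y)) = tuple \<iota> x"
      by (auto simp: tuple_def merge_def)
    moreover have "(\<Prod>i<n. ?g i (merge ?I ?J (x, y) i)) = (\<Prod>i\<in>?I. ?g i (x i)) * (\<Prod>i\<in>?J. ?g i (y i))"
      by (subst un[symmetric], subst prod.union_disjoint) (auto simp: merge_def intro!: prod.cong)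
    ultimately show "G T \<iota> \<tau> (merge ?I ?J (x, y)) =
      (F (tuple \<iota> x) * (\<Prod>i\<in>?I. ?g i (x i))) * (\<Prod>i\<in>?J. ?g i (y i))"
      by (simp add: G_def)
  qed
  also have "\<dots> = (LINT x|Pi\<^sub>M ?I (\<lambda>_. lborel). F (tuple \<iota> x) * (\<Prod>i\<in>?I. ?g i (x i))) *
      (\<Prod>i\<in>?J. integral\<^sup>L lborel (?g i))"
  proof -
    have "(LINT y|Pi\<^sub>M ?J (\<lambda>_. lborel). (\<Prod>i\<in>?J. ?g i (y i))) = (\<Prod>i\<in>?J. integral\<^sup>L lborel (?g i))"
      using \<tau>n by (intro lborel_product.product_integral_prod integrable_pair_indicator) auto
    then show ?thesis by simp
  qed
  also have "(\<Prod>i\<in>?J. integral\<^sup>L lborel (?g i)) = (\<Prod>i\<in>?J. if \<tau> i = i then cplx (mass (side T i) i) else 0)"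
    using \<tau>n by (intro prod.cong refl integral_side) auto
  also have "\<dots> = (if \<tau> permutes ?I then (\<Prod>i\<in>?J. cplx (mass (side T i) i)) else 0)"
  proof (cases "\<tau> permutes ?I")
    case True
    then have "\<tau> i = i" if "i \<in> ?J" for i using that by (auto simp: permutes_def)
    then show ?thesis using True by simp
  next
    case False
    then have "\<not> (\<forall>i\<in>?J. \<tau> i = i)" using permutes_superset[OF \<tau>] by blast
    then have "\<exists>i\<in>?J. (if \<tau> i = i then cplx (mass (side T i) i) else 0) = 0" by auto
    then have "(\<Prod>i\<in>?J. if \<tau> i = i then cplx (mass (side T i) i) else 0) = 0"
      by (intro prod_zero) auto
    then show ?thesis using False by simp
  qed
  also have "(LINT x|Pi\<^sub>M ?I (\<lambda>_. lborel). F (tuple \<iota> x) * (\<Prod>i\<in>?I. ?g i (x i))) =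
     (LINT x|Pi\<^sub>M ?I (\<lambda>_. lborel). (\<lambda>y. F y * (\<Prod>i<k. \<psi> (\<iota> i) (y i) * cnj (\<psi> (\<tau> (\<iota> i)) (y i)))) (\<lambda>i\<in>{..<k}. x (\<iota> i)))"
  proof (intro Bochner_Integration.integral_cong refl)
    fix x :: "nat \<Rightarrow> complex"
    have "F (tuple \<iota> x) * (\<Prod>i\<in>?I. ?g i (x i)) = F (tuple \<iota> x) * (\<Prod>i<k. ?g (\<iota> i) (x (\<iota> i)))"
      by (simp add: prod.reindex[OF inj])
    also have "\<dots> = F (tuple \<iota> x) * (\<Prod>i<k. \<psi> (\<iota> i) (x (\<iota> i)) * cnj (\<psi> (\<tau> (\<iota> i)) (x (\<iota> i))))"
    proof (cases "F (tuple \<iota> x) = 0")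
      case False
      then have "x (\<iota> i) \<in> A" if "i < k" for i
        using F_support[OF tuple_PiE, of i \<iota> x] that by (auto simp: tuple_def)
      then have "(\<Prod>i<k. ?g (\<iota> i) (x (\<iota> i))) = (\<Prod>i<k. \<psi> (\<iota> i) (x (\<iota> i)) * cnj (\<psi> (\<tau> (\<iota> i)) (x (\<iota> i))))"
        using IT by (intro prod.cong) (auto simp: side_def)
      then show ?thesis by simp
    qed simp
    finally show "F (tuple \<iota> x) * (\<Prod>i\<in>?I. ?g i (x i)) =
      (\<lambda>y. F y * (\<Prod>i<k. \<psi> (\<iota> i) (y i) * cnj (\<psi> (\<tau> (\<iota> i)) (y i)))) (\<lambda>i\<in>{..<k}. x (\<iota> i))"
      by (simp add: tuple_def)
  qed
  also have "\<dots> = (LINT y|lborels k. F y * (\<Prod>i<k. \<psi> (\<iota> i) (y i) * cnj (\<psi> (\<tau> (\<iota> i)) (y i))))"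
  proof (rule PiM_lborel_integral_reindex)
    show "bij_betw \<iota> {..<k} ?I" using inj by (auto simp: bij_betw_def)
    show "(\<lambda>y. F y * (\<Prod>i<k. \<psi> (\<iota> i) (y i) * cnj (\<psi> (\<tau> (\<iota> i)) (y i)))) \<in> borel_measurable (lborels k)"
      by measurable
  qed simp
  finally show ?thesis by (simp add: mult.commute)
qed

lemma F_prod_integrable:
  assumes "\<And>i. i < k \<Longrightarrow> a i < n" "\<And>i. i < k \<Longrightarrow> b i < n"
  shows "integrable (lborels k) (\<lambda>y. F y * (\<Prod>i<k. \<psi> (a i) (y i) * cnj (\<psi> (b i) (y i))))"
proof (rule Bochner_Integration.integrable_bound)
  let ?P = "\<lambda>x. \<Prod>i<k. \<psi> (a i) (x i) * cnj (\<psi> (b i) (x i))"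
  have P: "integrable (lborels k) ?P"
    using assms by (intro lborel_product.product_integrable_prod integrable_pair) auto
  then show "integrable (lborels k) (\<lambda>x. C *\<^sub>R ?P x)" by simp
  show "(\<lambda>y. F y * ?P y) \<in> borel_measurable (lborels k)" by measurable
  show "AE x in lborels k. norm (F x * ?P x) \<le> norm (C *\<^sub>R ?P x)"
  proof (intro AE_I2)
    fix x assume "x \<in> space (lborels k)"
    then have "cmod (F x) \<le> C" by (intro F_bounded) (simp add: space_PiM)
    then have "cmod (F x) \<le> \<bar>C\<bar>" by linarith
    then show "norm (F x * ?P x) \<le> norm (C *\<^sub>R ?P x)"
      unfolding norm_mult norm_scaleR by (intro mult_right_mono) auto
  qed
qed

text \<open>A permutation of the modes used by the tuple is a permutation of its \<open>k\<close>
  positions, conjugated by \<open>\<iota>\<close>, with the same sign. This is how a determinant of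
  size \<open>k\<close> emerges from one of size \<open>n\<close>.\<close>

lemma sum_permutations_integral_G:
  assumes T: "T \<subseteq> {..<n}" and \<iota>: "\<iota> \<in> inj_tuples k T"
  shows "(\<Sum>\<tau> | \<tau> permutes {..<n}. of_int (sign \<tau>) * integral\<^sup>L (lborels n) (G T \<iota> \<tau>)) =
    (\<Prod>j\<in>{..<n} - \<iota> ` {..<k}. cplx (mass (side T j) j)) *
    (\<Sum>\<pi> | \<pi> permutes {..<k}. of_int (sign \<pi>) *
      (LINT y|lborels k. F y * (\<Prod>i<k. \<psi> (\<iota> i) (y i) * cnj (\<psi> (\<iota> (\<pi> i)) (y i)))))"
proof -
  let ?I = "\<iota> ` {..<k}"
  let ?c = "\<Prod>j\<in>{..<n} - ?I. cplx (mass (side T j) j)"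
  let ?h = "\<lambda>s. LINT y|lborels k. F y * (\<Prod>i<k. \<psi> (\<iota> i) (y i) * cnj (\<psi> (s i) (y i)))"
  have IT: "?I \<subseteq> T" and inj: "inj_on \<iota> {..<k}" using \<iota> by (auto simp: inj_tuples_def)
  have In: "?I \<subseteq> {..<n}" using IT T by auto
  have "(\<Sum>\<tau> | \<tau> permutes {..<n}. of_int (sign \<tau>) * integral\<^sup>L (lborels n) (G T \<iota> \<tau>)) =
     (\<Sum>\<tau> | \<tau> permutes {..<n}. if \<tau> permutes ?I then of_int (sign \<tau>) * (?c * ?h (\<lambda>i. \<tau> (\<iota> i))) else 0)"
    by (intro sum.cong refl) (simp add: integral_G[OF T \<iota>])
  also have "\<dots> = (\<Sum>\<tau> | \<tau> permutes ?I. of_int (sign \<tau>) * (?c * ?h (\<lambda>i. \<tau> (\<iota> i))))"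
    by (rule sum.mono_neutral_cong_right) (auto simp: finite_permutations permutes_subset[OF _ In])
  also have "\<dots> = (\<Sum>\<pi> | \<pi> permutes {..<k}. of_int (sign \<pi>) * (?c * ?h (\<lambda>i. \<iota> (\<pi> i))))"
  proof (rule sum.reindex_bij_witness[where j="map_permutation ?I (inv_into {..<k} \<iota>)" and i="map_permutation {..<k} \<iota>"])
    have inv_im: "inv_into {..<k} \<iota> ` ?I = {..<k}" using inj by (simp add: inv_into_image_cancel)
    have inv_bij: "bij_betw (inv_into {..<k} \<iota>) ?I {..<k}"
      using inj by (intro bij_betw_inv_into) (auto simp: bij_betw_def)
    fix \<tau> assume "\<tau> \<in> {\<tau>. \<tau> permutes ?I}"
    then have \<tau>: "\<tau> permutes ?I" by simp
    show "map_permutation {..<k} \<iota> (map_permutation ?I (inv_into {..<k} \<iota>) \<tau>) = \<tau>"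
      using inv_bij inj \<tau> by (intro map_permutation_compose_inv) (auto simp: f_inv_into_f)
    have mp: "map_permutation ?I (inv_into {..<k} \<iota>) \<tau> permutes {..<k}"
      using \<tau> inv_bij by (intro map_permutation_permutes)
    then show "map_permutation ?I (inv_into {..<k} \<iota>) \<tau> \<in> {\<pi>. \<pi> permutes {..<k}}" by simp
    have "\<iota> (map_permutation ?I (inv_into {..<k} \<iota>) \<tau> i) = \<tau> (\<iota> i)" if "i < k" for i
    proof -
      have "map_permutation ?I (inv_into {..<k} \<iota>) \<tau> (inv_into {..<k} \<iota> (\<iota> i)) = inv_into {..<k} \<iota> (\<tau> (\<iota> i))"
        using inv_bij that by (intro map_permutation_apply) (auto simp: bij_betw_def)
      moreover have "\<tau> (\<iota> i) \<in> ?I" using permutes_in_image[OF \<tau>] that by auto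
      ultimately show ?thesis using inj that by (simp add: f_inv_into_f)
    qed
    then have "?h (\<lambda>i. \<iota> (map_permutation ?I (inv_into {..<k} \<iota>) \<tau> i)) = ?h (\<lambda>i. \<tau> (\<iota> i))"
      by (intro Bochner_Integration.integral_cong refl arg_cong2[where f="(*)"] prod.cong) auto
    moreover have "sign (map_permutation ?I (inv_into {..<k} \<iota>) \<tau>) = sign \<tau>"
      using inv_bij \<tau> by (intro sign_map_permutation) (auto simp: bij_betw_def)
    ultimately show "of_int (sign (map_permutation ?I (inv_into {..<k} \<iota>) \<tau>)) *
        (?c * ?h (\<lambda>i. \<iota> (map_permutation ?I (inv_into {..<k} \<iota>) \<tau> i))) =
       of_int (sign \<tau>) * (?c * ?h (\<lambda>i. \<tau> (\<iota> i)))"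
      by simp
  next
    fix \<pi> assume "\<pi> \<in> {\<pi>. \<pi> permutes {..<k}}"
    then have \<pi>: "\<pi> permutes {..<k}" by simp
    show "map_permutation ?I (inv_into {..<k} \<iota>) (map_permutation {..<k} \<iota> \<pi>) = \<pi>"
      using inj \<pi> by (intro map_permutation_compose_inv) (auto simp: bij_betw_def inj_on_inv_into)
    show "map_permutation {..<k} \<iota> \<pi> \<in> {\<tau>. \<tau> permutes ?I}"
      using \<pi> inj by (auto intro!: map_permutation_permutes simp: bij_betw_def)
  qed
  finally show ?thesis by (simp add: sum_distrib_left mult_ac)
qed

text \<open>The statistic is symmetric and the signs of a relabelling cancel, so all
  \<open>n!\<close> terms of the first determinant contribute the same integral as its diagonal.
  What remains is a sum over \<open>T\<close> and injective tuples in \<open>T\<close>: the modes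
  outside the tuple contribute their masses, and the tuple itself reassembles, by
  \<open>leibniz_det_gram\<close>, to the kernel determinant of the modes in
  \<open>T\<close>.\<close>

lemma statistic_integral:
  assumes mass_nz: "\<And>j. j < n \<Longrightarrow> mass A j \<noteq> 0"
  shows "(LINT x|lborels n. \<Phi> x * (V x * cnj (V x))) =
    fact n * (\<Sum>T | T \<subseteq> {..<n} \<and> card T = m.
      cplx ((\<Prod>j\<in>T. mass A j) * (\<Prod>j\<in>{..<n} - T. mass (- A) j)) *
      (LINT y|lborels k. F y *
        leibniz_det k (\<lambda>i j. \<Sum>l\<in>T. \<psi> l (y i) * cnj (\<psi> l (y j)) / mass A l)))" (is ?eq)
    and "integrable (lborels n) (\<lambda>x. \<Phi> x * (V x * cnj (V x)))" (is ?int)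
proof -
  let ?M = "lborels n :: (nat \<Rightarrow> complex) measure"
  let ?TT = "{T. T \<subseteq> {..<n} \<and> card T = m}"
  have finTT: "finite ?TT" by (rule finite_subset[of _ "Pow {..<n}"]) auto
  define f where "f x = \<Phi> x * (\<Prod>i<n. \<psi> i (x i)) * cnj (V x)" for x
  have f_eq: "f x = (\<Sum>\<tau> | \<tau> permutes {..<n}. of_int (sign \<tau>) * (\<Sum>T\<in>?TT. \<Sum>\<iota>\<in>inj_tuples k T. G T \<iota> \<tau> x))" for x
    unfolding f_def V_def leibniz_det_def
    by (simp add: sum_distrib_left \<Phi>_expand[symmetric] mult_ac)
  have Gint: "integrable ?M (G T \<iota> \<tau>)" if "T \<in> ?TT" "\<iota> \<in> inj_tuples k T" "\<tau> permutes {..<n}" for T \<iota> \<tau>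
    using that by (intro G_integrable) (auto simp: inj_tuples_def)
  have f_int: "integrable ?M f"
    unfolding f_eq[abs_def] using Gint
    by (intro Bochner_Integration.integrable_sum integrable_mult_right) auto
  \<comment> \<open>The sign produced by relabelling the conjugate determinant is the very sign that
    the permutation carries in the first determinant.\<close>
  have perm_f: "f (\<lambda>i\<in>{..<n}. x (inv_into UNIV \<sigma> i)) =
      \<Phi> x * (of_int (sign \<sigma>) * (\<Prod>i<n. \<psi> (\<sigma> i) (x i))) * cnj (V x)" if \<sigma>: "\<sigma> permutes {..<n}" for \<sigma> x
  proof -
    have "(\<Prod>i<n. \<psi> i ((\<lambda>i\<in>{..<n}. x (inv_into UNIV \<sigma> i)) i)) = (\<Prod>i<n. \<psi> i (x (inv_into UNIV \<sigma> i)))"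
      by (intro prod.cong) auto
    also have "\<dots> = (\<Prod>i<n. \<psi> (\<sigma> i) (x i))"
      using prod.permute[OF \<sigma>, of "\<lambda>i. \<psi> i (x (inv_into UNIV \<sigma> i))"] by (simp add: o_def permutes_inverses[OF \<sigma>])
    moreover have "sign (inv_into UNIV \<sigma>) = sign \<sigma>"
      using \<sigma> by (intro sign_inverse) (auto simp: permutation_permutes)
    ultimately show ?thesis
      unfolding f_def \<Phi>_permute[OF permutes_inv[OF \<sigma>]] V_permute[OF permutes_inv[OF \<sigma>]] by simp
  qed
  have expand: "\<Phi> x * (V x * cnj (V x)) = (\<Sum>\<sigma> | \<sigma> permutes {..<n}. f (\<lambda>i\<in>{..<n}. x (inv_into UNIV \<sigma> i)))" for x
  proof -
    have "\<Phi> x * (V x * cnj (V x)) = (\<Sum>\<sigma> | \<sigma> permutes {..<n}. \<Phi> x * (of_int (sign \<sigma>) * (\<Prod>i<n. \<psi> (\<sigma> i) (x i))) * cnj (V x))"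
      by (subst (1) V_def) (simp add: leibniz_det_def sum_distrib_left sum_distrib_right mult_ac)
    then show ?thesis by (simp add: perm_f)
  qed
  have bij: "bij_betw (inv_into UNIV \<sigma>) {..<n} {..<n}" if "\<sigma> permutes {..<n}" for \<sigma>
    using permutes_inv[OF that] by (rule permutes_imp_bij)
  have f_perm_int: "integrable ?M (\<lambda>x. f (\<lambda>i\<in>{..<n}. x (inv_into UNIV \<sigma> i)))" if \<sigma>: "\<sigma> permutes {..<n}" for \<sigma>
  proof -
    have "(\<lambda>x. \<lambda>i\<in>{..<n}. x (inv_into UNIV \<sigma> i)) \<in> measurable ?M ?M"
      using bij[OF \<sigma>] by (intro measurable_restrict measurable_component_singleton) (auto simp: bij_betw_def)
    moreover have "integrable (distr ?M ?M (\<lambda>x. \<lambda>i\<in>{..<n}. x (inv_into UNIV \<sigma> i))) f"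
      using f_int by (simp add: PiM_lborel_reindex[OF bij[OF \<sigma>]])
    ultimately show ?thesis by (rule integrable_distr)
  qed
  show ?int unfolding expand by (intro Bochner_Integration.integrable_sum f_perm_int) simp
  have "(LINT x|?M. \<Phi> x * (V x * cnj (V x))) =
     (\<Sum>\<sigma> | \<sigma> permutes {..<n}. LINT x|?M. f (\<lambda>i\<in>{..<n}. x (inv_into UNIV \<sigma> i)))"
    unfolding expand by (intro Bochner_Integration.integral_sum f_perm_int) simp
  also have "\<dots> = (\<Sum>\<sigma> | \<sigma> permutes {..<n}. integral\<^sup>L ?M f)"
    using f_int by (intro sum.cong refl PiM_lborel_integral_reindex bij) auto
  also have "\<dots> = fact n * integral\<^sup>L ?M f"
    by (simp add: card_permutations)
  also have "integral\<^sup>L ?M f = (\<Sum>\<tau> | \<tau> permutes {..<n}. of_int (sign \<tau>) * (\<Sum>T\<in>?TT. \<Sum>\<iota>\<in>inj_tuples k T. integral\<^sup>L ?M (G T \<iota> \<tau>)))"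
    unfolding f_eq[abs_def]
    using Gint by (subst Bochner_Integration.integral_sum)
      (auto simp: Bochner_Integration.integral_sum intro!: Bochner_Integration.integrable_sum sum.cong)
  also have "\<dots> = (\<Sum>T\<in>?TT. \<Sum>\<iota>\<in>inj_tuples k T. \<Sum>\<tau> | \<tau> permutes {..<n}. of_int (sign \<tau>) * integral\<^sup>L ?M (G T \<iota> \<tau>))"
    by (simp add: sum_distrib_left sum.swap[of _ _ "{\<tau>. \<tau> permutes {..<n}}"])
  also have "\<dots> = (\<Sum>T\<in>?TT. cplx ((\<Prod>j\<in>T. mass A j) * (\<Prod>j\<in>{..<n} - T. mass (- A) j)) *
      (LINT y|lborels k. F y *
        leibniz_det k (\<lambda>i j. \<Sum>l\<in>T. \<psi> l (y i) * cnj (\<psi> l (y j)) / mass A l)))"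
  proof (intro sum.cong refl)
    fix T assume "T \<in> ?TT"
    then have T: "T \<subseteq> {..<n}" by simp
    then have finT: "finite T" by (rule finite_subset) simp
    let ?c = "cplx ((\<Prod>j\<in>T. mass A j) * (\<Prod>j\<in>{..<n} - T. mass (- A) j))"
    let ?h = "\<lambda>\<iota> \<pi> y. F y * (\<Prod>i<k. \<psi> (\<iota> i) (y i) * cnj (\<psi> (\<iota> (\<pi> i)) (y i)))"
    have hint: "integrable (lborels k) (?h \<iota> \<pi>)"
      if "\<iota> \<in> inj_tuples k T" "\<pi> permutes {..<k}" for \<iota> \<pi>
      using that T permutes_in_image[OF that(2)] by (intro F_prod_integrable) (auto simp: inj_tuples_def)
    \<comment> \<open>The masses of the tuple modes are missing from this product. Restoring them
      gives the full weight of \<open>T\<close>, at the price of the factors \<open>1 / mass\<close>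
      that normalise the kernel.\<close>
    have cprod: "(\<Prod>j\<in>{..<n} - \<iota> ` {..<k}. cplx (mass (side T j) j)) =
        ?c * (\<Prod>i<k. 1 / cplx (mass A (\<iota> i)))" if \<iota>: "\<iota> \<in> inj_tuples k T" for \<iota>
    proof -
      have IT: "\<iota> ` {..<k} \<subseteq> T" and inj: "inj_on \<iota> {..<k}" using \<iota> by (auto simp: inj_tuples_def)
      have "{..<n} - \<iota> ` {..<k} = (T - \<iota> ` {..<k}) \<union> ({..<n} - T)" using IT T by auto
      then have "(\<Prod>j\<in>{..<n} - \<iota> ` {..<k}. cplx (mass (side T j) j)) =
        (\<Prod>j\<in>T - \<iota> ` {..<k}. cplx (mass (side T j) j)) * (\<Prod>j\<in>{..<n} - T. cplx (mass (side T j) j))"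
        using finT by (subst prod.union_disjoint[symmetric]) auto
      also have "(\<Prod>j\<in>{..<n} - T. cplx (mass (side T j) j)) = (\<Prod>j\<in>{..<n} - T. cplx (mass (- A) j))"
        by (intro prod.cong) (auto simp: side_def)
      also have "(\<Prod>j\<in>T - \<iota> ` {..<k}. cplx (mass (side T j) j)) = (\<Prod>j\<in>T - \<iota> ` {..<k}. cplx (mass A j))"
        by (intro prod.cong) (auto simp: side_def)
      also have "(\<Prod>j\<in>T - \<iota> ` {..<k}. cplx (mass A j)) =
          (\<Prod>j\<in>T. cplx (mass A j)) * (\<Prod>i<k. 1 / cplx (mass A (\<iota> i)))"
      proof -
        have "(\<Prod>j\<in>T. cplx (mass A j)) =
           (\<Prod>j\<in>T - \<iota> ` {..<k}. cplx (mass A j)) * (\<Prod>j\<in>\<iota> ` {..<k}. cplx (mass A j))"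
          using IT finT by (rule prod.subset_diff)
        also have "(\<Prod>j\<in>\<iota> ` {..<k}. cplx (mass A j)) = (\<Prod>i<k. cplx (mass A (\<iota> i)))"
          by (simp add: prod.reindex[OF inj])
        finally have "(\<Prod>j\<in>T. cplx (mass A j)) * (\<Prod>i<k. 1 / cplx (mass A (\<iota> i))) =
           (\<Prod>j\<in>T - \<iota> ` {..<k}. cplx (mass A j)) *
           (\<Prod>i<k. cplx (mass A (\<iota> i)) * (1 / cplx (mass A (\<iota> i))))"
          by (simp only: prod.distrib mult.assoc)
        also have "(\<Prod>i<k. cplx (mass A (\<iota> i)) * (1 / cplx (mass A (\<iota> i)))) = 1"
          using IT T mass_nz by (intro prod.neutral) (auto simp: subset_iff)
        finally show ?thesis by simp
      qed
      finally show ?thesis by simp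
    qed
    have "(\<Sum>\<iota>\<in>inj_tuples k T. \<Sum>\<tau> | \<tau> permutes {..<n}. of_int (sign \<tau>) * integral\<^sup>L ?M (G T \<iota> \<tau>)) =
      (\<Sum>\<iota>\<in>inj_tuples k T. ?c * (\<Prod>i<k. 1 / cplx (mass A (\<iota> i))) *
        (\<Sum>\<pi> | \<pi> permutes {..<k}. of_int (sign \<pi>) * integral\<^sup>L (lborels k) (?h \<iota> \<pi>)))"
      by (intro sum.cong refl) (simp only: sum_permutations_integral_G[OF T] cprod)
    also have "\<dots> = ?c * (\<Sum>\<iota>\<in>inj_tuples k T. \<Sum>\<pi> | \<pi> permutes {..<k}. of_int (sign \<pi>) *
       ((\<Prod>i<k. 1 / cplx (mass A (\<iota> i))) * integral\<^sup>L (lborels k) (?h \<iota> \<pi>)))"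
      by (simp only: sum_distrib_left mult.assoc mult.left_commute)
    also have "(\<Sum>\<iota>\<in>inj_tuples k T. \<Sum>\<pi> | \<pi> permutes {..<k}. of_int (sign \<pi>) *
       ((\<Prod>i<k. 1 / cplx (mass A (\<iota> i))) * integral\<^sup>L (lborels k) (?h \<iota> \<pi>))) =
       (LINT y|lborels k. (\<Sum>\<iota>\<in>inj_tuples k T. \<Sum>\<pi> | \<pi> permutes {..<k}. of_int (sign \<pi>) *
       ((\<Prod>i<k. 1 / cplx (mass A (\<iota> i))) * ?h \<iota> \<pi> y)))"
      using hint by (subst Bochner_Integration.integral_sum)
        (auto simp: Bochner_Integration.integral_sum intro!: Bochner_Integration.integrable_sum integrable_mult_right sum.cong)
    also have "\<dots> = (LINT y|lborels k. F y *
        leibniz_det k (\<lambda>i j. \<Sum>l\<in>T. \<psi> l (y i) * cnj (\<psi> l (y j)) / mass A l))"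
    proof (intro Bochner_Integration.integral_cong refl)
      fix y
      have "leibniz_det k (\<lambda>i j. \<Sum>l\<in>T. \<psi> l (y i) * cnj (\<psi> l (y j)) / mass A l) =
        leibniz_det k (\<lambda>i j. \<Sum>l\<in>T. (\<psi> l (y i) / mass A l) * cnj (\<psi> l (y j)))"
        by (intro leibniz_det_cong sum.cong) auto
      also have "\<dots> = (\<Sum>\<iota>\<in>inj_tuples k T. \<Sum>\<pi> | \<pi> permutes {..<k}. of_int (sign \<pi>) *
          (\<Prod>i<k. \<psi> (\<iota> i) (y i) / mass A (\<iota> i) * cnj (\<psi> (\<iota> (\<pi> i)) (y i))))"
        using leibniz_det_gram[OF finT, of k "\<lambda>l z. \<psi> l z / mass A l" y "\<lambda>l z. cnj (\<psi> l z)"] by simp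
      finally show "(\<Sum>\<iota>\<in>inj_tuples k T. \<Sum>\<pi> | \<pi> permutes {..<k}. of_int (sign \<pi>) *
         ((\<Prod>i<k. 1 / cplx (mass A (\<iota> i))) * ?h \<iota> \<pi> y)) = F y *
        leibniz_det k (\<lambda>i j. \<Sum>l\<in>T. \<psi> l (y i) * cnj (\<psi> l (y j)) / mass A l)"
        by (simp add: sum_distrib_left prod.distrib prod_dividef mult_ac)
    qed
    finally show "(\<Sum>\<iota>\<in>inj_tuples k T. \<Sum>\<tau> | \<tau> permutes {..<n}. of_int (sign \<tau>) * integral\<^sup>L ?M (G T \<iota> \<tau>)) =
      ?c * (LINT y|lborels k. F y *
        leibniz_det k (\<lambda>i j. \<Sum>l\<in>T. \<psi> l (y i) * cnj (\<psi> l (y j)) / mass A l))" .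
  qed
  finally show ?eq .
qed

end

section \<open>Configuration spaces and tuple sums\<close>

lemma space_config_space [simp]: "space (config_space E) = configurations E"
  unfolding config_space_def by (rule space_measure_of) auto

lemma finite_configuration_Int:
  "X \<in> configurations E \<Longrightarrow> compact K \<Longrightarrow> K \<subseteq> E \<Longrightarrow> finite (X \<inter> K)"
  by (auto simp: configurations_def)

lemma finite_in_configurations: "finite X \<Longrightarrow> X \<subseteq> E \<Longrightarrow> X \<in> configurations E"
  by (auto simp: configurations_def)

lemma config_count_measurable:
  assumes "B \<in> sets borel" "compact K" "K \<subseteq> E" "B \<subseteq> K"
  shows "(\<lambda>X. card (X \<inter> B)) \<in> measurable (config_space E) (count_space UNIV)"
proof -
  have "(\<lambda>X. card (X \<inter> B)) -` {n} \<inter> space (config_space E) \<in> sets (config_space E)" for n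
  proof -
    have "(\<lambda>X. card (X \<inter> B)) -` {n} \<inter> space (config_space E) = {X \<in> configurations E. card (X \<inter> B) = n}"
      by auto
    moreover have "{X \<in> configurations E. card (X \<inter> B) = n} \<in> sets (config_space E)"
      unfolding config_space_def using assms by (intro in_measure_of) auto
    ultimately show ?thesis by simp
  qed
  then show ?thesis by (subst measurable_count_space_eq2_countable) auto
qed

lemma measurable_config_spaceI:
  assumes "\<And>x. x \<in> space M \<Longrightarrow> f x \<in> configurations E"
    and "\<And>B K n. B \<in> sets borel \<Longrightarrow> compact K \<Longrightarrow> K \<subseteq> E \<Longrightarrow> B \<subseteq> K \<Longrightarrow>
      {x \<in> space M. card (f x \<inter> B) = n} \<in> sets M"
  shows "f \<in> measurable M (config_space E)"
  unfolding config_space_def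
proof (rule measurable_measure_of)
  fix y assume "y \<in> {{X \<in> configurations E. card (X \<inter> B) = n} | B n.
        B \<in> sets borel \<and> (\<exists>K. compact K \<and> K \<subseteq> E \<and> B \<subseteq> K)}"
  then obtain B n K where "B \<in> sets borel" "compact K" "K \<subseteq> E" "B \<subseteq> K"
    and y: "y = {X \<in> configurations E. card (X \<inter> B) = n}" by auto
  then have "{x \<in> space M. card (f x \<inter> B) = n} \<in> sets M" using assms(2) by blast
  moreover have "f -` y \<inter> space M = {x \<in> space M. card (f x \<inter> B) = n}"
    using assms(1) by (auto simp: y)
  ultimately show "f -` y \<inter> space M \<in> sets M" by simp
qed (use assms(1) in auto)

lemma image_tuple_measurable:
  fixes n :: nat
  shows "(\<lambda>x. x ` {..<n}) \<in> measurable (lborels n) (config_space UNIV)"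
proof (rule measurable_config_spaceI)
  let ?M = "lborels n"
  fix B K :: "complex set" and c :: nat
  assume [measurable]: "B \<in> sets borel"
  \<comment> \<open>Equal coordinates collapse in the image, so a point is counted only at the first
    index where it occurs.\<close>
  have eq: "card (x ` {..<n} \<inter> B) = (\<Sum>i<n. if x i \<in> B \<and> (\<forall>j<i. x j - x i \<noteq> 0) then 1 else 0)" for x :: "nat \<Rightarrow> complex"
  proof -
    let ?I = "{i. i < n \<and> x i \<in> B \<and> (\<forall>j<i. x j \<noteq> x i)}"
    have "x ` {..<n} \<inter> B = x ` ?I"
    proof (intro equalityI subsetI)
      fix z assume "z \<in> x ` {..<n} \<inter> B"
      then have ex: "\<exists>i. i < n \<and> x i = z" and zB: "z \<in> B" by auto
      obtain i where i: "i < n" "x i = z" "\<And>j. j < i \<Longrightarrow> \<not> (j < n \<and> x j = z)"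
        using ex exists_least_iff[of "\<lambda>i. i < n \<and> x i = z"] by blast
      have "x j \<noteq> x i" if "j < i" for j
        using i(1,2) i(3)[OF that] that by simp
      then have "i \<in> ?I" using i(1,2) zB by simp
      then show "z \<in> x ` ?I" using i(2) by (rule rev_image_eqI[OF _ sym])
    qed auto
    moreover have "inj_on x ?I"
    proof (rule inj_onI)
      fix a b assume ab: "a \<in> ?I" "b \<in> ?I" "x a = x b"
      have "\<not> a < b" using ab(2,3) by blast
      moreover have "\<not> b < a" using ab(1) ab(3)[symmetric] by blast
      ultimately show "a = b" by simp
    qed
    ultimately have "card (x ` {..<n} \<inter> B) = card ?I" by (simp add: card_image)
    also have "\<dots> = card ({..<n} \<inter> {i. x i \<in> B \<and> (\<forall>j<i. x j \<noteq> x i)})" by (rule arg_cong[where f=card]) auto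
    also have "\<dots> = (\<Sum>i<n. if x i \<in> B \<and> (\<forall>j<i. x j - x i \<noteq> 0) then 1 else 0)"
      by (simp add: sum.If_cases)
    finally show ?thesis .
  qed
  have comp: "(\<lambda>x. x i) \<in> borel_measurable ?M" if "i < n" for i
    using that measurable_component_singleton[of i "{..<n}" "\<lambda>_. lborel :: complex measure"] by auto
  have neq: "{x \<in> space ?M. x j - x i \<noteq> 0} \<in> sets ?M" if "i < n" "j < i" for i j
  proof -
    have "(\<lambda>x. x j - x i) \<in> borel_measurable ?M" using that comp by (intro borel_measurable_diff) auto
    moreover have "- {0::complex} \<in> sets borel" by auto
    ultimately have "(\<lambda>x. x j - x i) -` (- {0}) \<inter> space ?M \<in> sets ?M" by (rule measurable_sets)
    moreover have "(\<lambda>x. x j - x i) -` (- {0}) \<inter> space ?M = {x \<in> space ?M. x j - x i \<noteq> 0}" by auto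
    ultimately show ?thesis by simp
  qed
  have "(\<lambda>x. card (x ` {..<n} \<inter> B)) \<in> measurable ?M (count_space UNIV)"
    unfolding eq
  proof (rule measurable_sum_nat)
    fix i assume "i \<in> {..<n}"
    then have i: "i < n" by simp
    have "(\<lambda>x. x i) -` B \<inter> space ?M \<inter> (\<Inter>j\<in>{..<i}. {x \<in> space ?M. x j - x i \<noteq> 0}) \<in> sets ?M" if "i \<noteq> 0"
      using neq i that by (intro sets.Int sets.finite_INT measurable_sets[OF comp[OF i]]) auto
    moreover have "(\<lambda>x. x i) -` B \<inter> space ?M \<in> sets ?M"
      by (intro measurable_sets[OF comp[OF i]]) auto
    moreover have "{x \<in> space ?M. x i \<in> B \<and> (\<forall>j<i. x j - x i \<noteq> 0)} =
       (if i = 0 then (\<lambda>x. x i) -` B \<inter> space ?M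
        else (\<lambda>x. x i) -` B \<inter> space ?M \<inter> (\<Inter>j\<in>{..<i}. {x \<in> space ?M. x j - x i \<noteq> 0}))"
      by auto
    ultimately have "{x \<in> space ?M. x i \<in> B \<and> (\<forall>j<i. x j - x i \<noteq> 0)} \<in> sets ?M" by (cases "i = 0") simp_all
    then show "(\<lambda>x. if x i \<in> B \<and> (\<forall>j<i. x j - x i \<noteq> 0) then 1 else 0) \<in> measurable ?M (count_space UNIV)"
      by (intro measurable_If) auto
  qed
  then show "{x \<in> space ?M. card (x ` {..<n} \<inter> B) = c} \<in> sets ?M"
    by (rule measurable_sets_Collect) auto
qed (auto intro: finite_in_configurations)

lemma map_config_measurable:
  fixes g h :: "complex \<Rightarrow> complex"
  assumes g: "continuous_on UNIV g" and h: "continuous_on UNIV h"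
    and gh: "\<And>z. g (h z) = z" and hg: "\<And>z. h (g z) = z"
  shows "(\<lambda>X. g ` X) \<in> measurable (config_space UNIV) (config_space UNIV)"
proof (rule measurable_config_spaceI)
  have inj: "inj_on g X" for X using hg by (metis inj_onI)
  have vim: "g -` K = h ` K" for K
  proof (intro equalityI subsetI)
    fix z assume "z \<in> g -` K"
    then show "z \<in> h ` K" using hg[of z] by (intro image_eqI[of _ _ "g z"]) auto
  qed (use gh in auto)
  have comp: "compact (g -` K)" if "compact K" for K
    unfolding vim using h that by (intro compact_continuous_image) (auto intro: continuous_on_subset)
  have int: "g ` X \<inter> B = g ` (X \<inter> g -` B)" for X B by auto
  show "g ` X \<in> configurations UNIV" if "X \<in> space (config_space UNIV)" for X
    using that comp by (auto simp: configurations_def int)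
  fix B K :: "complex set" and n
  assume B: "B \<in> sets borel" and K: "compact K" "B \<subseteq> K"
  have "g -` B \<in> sets borel"
    using measurable_sets[OF borel_measurable_continuous_onI[OF g] B] by simp
  then have "(\<lambda>X. card (X \<inter> g -` B)) \<in> measurable (config_space UNIV) (count_space UNIV)"
    using K comp by (intro config_count_measurable[of _ "g -` K"]) auto
  then have "{X \<in> space (config_space UNIV). card (X \<inter> g -` B) = n} \<in> sets (config_space UNIV)"
    by (rule measurable_sets_Collect) auto
  then show "{X \<in> space (config_space UNIV). card (g ` X \<inter> B) = n} \<in> sets (config_space UNIV)"
    by (simp add: int card_image[OF inj])
qed

text \<open>The generators of the sigma-algebra count only in relatively compact sets. Along an
  increasing exhaustion a finite total count \<open>m\<close> means that the counts are eventually
  equal to \<open>m\<close>, which is a countable combination of generators. Finiteness is stated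
  explicitly because \<open>card\<close> of an infinite set is 0.\<close>

lemma config_exhaustion_count:
  assumes B: "\<And>n. B n \<in> sets borel" "\<And>n. compact (K n)" "\<And>n. K n \<subseteq> E" "\<And>n. B n \<subseteq> K n"
    and inc: "incseq B"
  shows "{X \<in> configurations E. finite (X \<inter> (\<Union>n. B n)) \<and> card (X \<inter> (\<Union>n. B n)) = m} \<in> sets (config_space E)"
proof -
  have eq: "finite (X \<inter> (\<Union>n. B n)) \<and> card (X \<inter> (\<Union>n. B n)) = m \<longleftrightarrow> (\<exists>n0. \<forall>n\<ge>n0. card (X \<inter> B n) = m)"
    if X: "X \<in> configurations E" for X
  proof -
    have fin: "finite (X \<inter> B n)" for n
      by (rule finite_subset[OF Int_mono[OF order_refl B(4)] finite_configuration_Int[OF X B(2) B(3)]])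
    have mono: "X \<inter> B a \<subseteq> X \<inter> B b" if "a \<le> b" for a b
      using inc that by (auto simp: incseq_def)
    have stab: "\<exists>n0. \<forall>n\<ge>n0. card (X \<inter> B n) = card (X \<inter> (\<Union>n. B n))" if F: "finite (X \<inter> (\<Union>n. B n))"
    proof -
      have "\<exists>n0. S \<subseteq> X \<inter> B n0" if "finite S" "S \<subseteq> X \<inter> (\<Union>n. B n)" for S
        using that
      proof (induction S rule: finite_induct)
        case (insert a S)
        have "S \<subseteq> X \<inter> (\<Union>n. B n)" using insert.prems by (rule order.trans[OF subset_insertI])
        from insert.IH[OF this] obtain n1 where "S \<subseteq> X \<inter> B n1" by (rule exE)
        have "a \<in> X \<inter> (\<Union>n. B n)" using insert.prems by (rule subsetD) simp
        then obtain n2 where "a \<in> X \<inter> B n2" by (elim IntE UN_E) (rule that, rule IntI)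
        have "X \<inter> B n1 \<subseteq> X \<inter> B (max n1 n2)" "X \<inter> B n2 \<subseteq> X \<inter> B (max n1 n2)"
          by (rule mono, simp)+
        then have "insert a S \<subseteq> X \<inter> B (max n1 n2)"
          using \<open>S \<subseteq> X \<inter> B n1\<close> \<open>a \<in> X \<inter> B n2\<close> by blast
        then show ?case by (rule exI)
      qed simp
      from this[OF F order.refl] obtain n0 where n0: "X \<inter> (\<Union>n. B n) \<subseteq> X \<inter> B n0" by (rule exE)
      have "X \<inter> B n = X \<inter> (\<Union>n. B n)" if "n \<ge> n0" for n
      proof
        show "X \<inter> B n \<subseteq> X \<inter> (\<Union>n. B n)" by blast
        show "X \<inter> (\<Union>n. B n) \<subseteq> X \<inter> B n" using n0 mono[OF that] by (rule order.trans)
      qed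
      then show ?thesis by (intro exI[of _ n0]) simp
    qed
    show ?thesis
    proof
      assume *: "finite (X \<inter> (\<Union>n. B n)) \<and> card (X \<inter> (\<Union>n. B n)) = m"
      show "\<exists>n0. \<forall>n\<ge>n0. card (X \<inter> B n) = m" using stab[OF conjunct1[OF *]] unfolding conjunct2[OF *] .
    next
      assume "\<exists>n0. \<forall>n\<ge>n0. card (X \<inter> B n) = m"
      then obtain n0 where n0: "\<forall>n\<ge>n0. card (X \<inter> B n) = m" by (rule exE)
      have "X \<inter> B n \<subseteq> X \<inter> B n0" for n
      proof (cases "n \<ge> n0")
        case True
        have "X \<inter> B n0 = X \<inter> B n"
          by (rule card_subset_eq[OF fin mono[OF True]]) (simp only: n0[rule_format, OF True] n0[rule_format, OF order.refl])
        then show ?thesis by simp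
      next
        case False
        then show ?thesis by (intro mono) simp
      qed
      then have "(\<Union>n. X \<inter> B n) \<subseteq> X \<inter> B n0" by (rule UN_least)
      then have "X \<inter> (\<Union>n. B n) = X \<inter> B n0" by (intro equalityI) (simp_all only: Int_UN_distrib, auto)
      then show "finite (X \<inter> (\<Union>n. B n)) \<and> card (X \<inter> (\<Union>n. B n)) = m"
        using fin[of n0] n0[rule_format, of n0] by simp
    qed
  qed
  have [measurable]: "(\<lambda>X. card (X \<inter> B n)) \<in> measurable (config_space E) (count_space UNIV)" for n
    by (rule config_count_measurable[of _ "K n"]) (rule B)+
  have "{X \<in> configurations E. finite (X \<inter> (\<Union>n. B n)) \<and> card (X \<inter> (\<Union>n. B n)) = m} =
      {X \<in> space (config_space E). \<exists>n0. \<forall>n\<ge>n0. card (X \<inter> B n) = m}"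
    unfolding space_config_space by (intro Collect_cong conj_cong refl eq)
  also have "\<dots> \<in> sets (config_space E)" by measurable
  finally show ?thesis .
qed

lemma config_exhaustion_card_measurable:
  assumes B: "\<And>n. B n \<in> sets borel" "\<And>n. compact (K n)" "\<And>n. K n \<subseteq> E" "\<And>n. B n \<subseteq> K n"
    and inc: "incseq B"
  shows "(\<lambda>X. card (X \<inter> (\<Union>n. B n))) \<in> measurable (config_space E) (count_space UNIV)"
proof -
  let ?B = "\<Union>n. B n"
  let ?S = "\<lambda>m. {X \<in> configurations E. finite (X \<inter> ?B) \<and> card (X \<inter> ?B) = m}"
  have S: "?S m \<in> sets (config_space E)" for m by (rule config_exhaustion_count) (fact assms)+
  have "(\<lambda>X. card (X \<inter> ?B)) -` {m} \<inter> space (config_space E) \<in> sets (config_space E)" for m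
  proof -
    \<comment> \<open>The value 0 also collects the configurations with infinitely many points in
      \<open>?B\<close>, so it is obtained as the complement of all positive finite counts.\<close>
    have "(\<lambda>X. card (X \<inter> ?B)) -` {m} \<inter> space (config_space E) =
      (if m = 0 then space (config_space E) - (\<Union>m\<in>{1..}. ?S m) else ?S m)"
      by (cases m) (auto, (use card.infinite in force)+)
    moreover have "space (config_space E) - (\<Union>m\<in>{1..}. ?S m) \<in> sets (config_space E)"
      using S by (intro sets.compl_sets sets.countable_UN') auto
    ultimately show ?thesis using S by (simp only: split: if_split) simp
  qed
  then show ?thesis by (subst measurable_count_space_eq2_countable) auto
qed

lemma config_finite_annulus_sets:
  "{X \<in> configurations UNIV. finite X \<and> card {z \<in> X. R < cmod z} = m} \<in> sets (config_space UNIV)"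
proof -
  let ?A = "\<lambda>n. cball (0::complex) (real n)" and ?B = "\<lambda>n. cball (0::complex) (real n) \<inter> {z. R < cmod z}"
  have UA: "(\<Union>n. ?A n) = UNIV" using real_arch_simple by auto
  have UB: "(\<Union>n. ?B n) = {z. R < cmod z}" using real_arch_simple by auto
  have [measurable]: "{z::complex. R < cmod z} \<in> sets borel" by measurable
  have 1: "{X \<in> configurations UNIV. finite (X \<inter> (\<Union>n. ?A n)) \<and> card (X \<inter> (\<Union>n. ?A n)) = p} \<in> sets (config_space UNIV)" for p
    by (rule config_exhaustion_count[where K="?A"]) (auto simp: incseq_def)
  have 2: "{X \<in> configurations UNIV. finite (X \<inter> (\<Union>n. ?B n)) \<and> card (X \<inter> (\<Union>n. ?B n)) = m} \<in> sets (config_space UNIV)"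
    by (rule config_exhaustion_count[where K="?A"]) (auto simp: incseq_def)
  have "{X \<in> configurations UNIV. finite X \<and> card {z \<in> X. R < cmod z} = m} =
    (\<Union>p. {X \<in> configurations UNIV. finite (X \<inter> (\<Union>n. ?A n)) \<and> card (X \<inter> (\<Union>n. ?A n)) = p}) \<inter>
    {X \<in> configurations UNIV. finite (X \<inter> (\<Union>n. ?B n)) \<and> card (X \<inter> (\<Union>n. ?B n)) = m}"
    unfolding UA UB by (auto simp: Int_def)
  also have "\<dots> \<in> sets (config_space UNIV)" using 1 2 by (intro sets.Int sets.countable_UN) auto
  finally show ?thesis .
qed

section \<open>Test functions and the measurability of tuple sums\<close>

lemma distinct_tuples_eq: "distinct_tuples k X = inj_tuples k X"
  by (simp add: distinct_tuples_def inj_tuples_def)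

text \<open>The union of the coordinate projections of the support is one compact set for all
  coordinates. It reduces every tuple sum to the finitely many points of a configuration in
  \<open>K\<close>.\<close>

lemma test_function_support:
  assumes "test_function k U f"
  obtains K where "compact K" "K \<subseteq> U"
    "\<And>x i. x \<in> tuples k UNIV \<Longrightarrow> f x \<noteq> 0 \<Longrightarrow> i < k \<Longrightarrow> x i \<in> K"
proof
  let ?T = "product_topology (\<lambda>_. euclidean :: complex topology) {..<k}"
  let ?S = "tuple_support k f"
  let ?K = "\<Union>i<k. (\<lambda>x. x i) ` ?S"
  have S: "compactin ?T ?S" "?S \<subseteq> tuples k U" using assms by (auto simp: test_function_def)
  show "compact ?K"
  proof (intro compact_UN)
    fix i assume "i \<in> {..<k}"
    have "continuous_map ?T euclidean (\<lambda>x. x i)"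
      using \<open>i \<in> {..<k}\<close> by (rule continuous_map_product_projection)
    then have "compactin euclidean ((\<lambda>x. x i) ` ?S)" by (rule image_compactin[OF S(1)])
    then show "compact ((\<lambda>x. x i) ` ?S)" by simp
  qed simp
  show "?K \<subseteq> U" using S(2) by (auto simp: PiE_iff)
  fix x i assume "x \<in> tuples k UNIV" "f x \<noteq> 0" "i < k"
  moreover have "x \<in> ?S"
    unfolding tuple_support_def using calculation
    by (intro subsetD[OF closure_of_subset]) (auto simp: topspace_product_topology)
  ultimately show "x i \<in> ?K" by auto
qed

lemma lipschitz_tuplesE:
  assumes "lipschitz_tuples k f"
  obtains L where "L \<ge> 0" "\<And>x y. x \<in> tuples k UNIV \<Longrightarrow> y \<in> tuples k UNIV \<Longrightarrow>
    cmod (f x - f y) \<le> L * (\<Sum>i<k. dist (x i) (y i))"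
proof -
  obtain L where L: "\<And>x y. x \<in> tuples k UNIV \<Longrightarrow> y \<in> tuples k UNIV \<Longrightarrow>
    cmod (f x - f y) \<le> L * L2_set (\<lambda>i. dist (x i) (y i)) {..<k}"
    using assms unfolding lipschitz_tuples_def by blast
  show ?thesis
  proof (rule that[of "\<bar>L\<bar>"])
    fix x y :: "nat \<Rightarrow> complex" assume "x \<in> tuples k UNIV" "y \<in> tuples k UNIV"
    then have "cmod (f x - f y) \<le> L * L2_set (\<lambda>i. dist (x i) (y i)) {..<k}" by (rule L)
    also have "\<dots> \<le> \<bar>L\<bar> * (\<Sum>i<k. dist (x i) (y i))"
      by (intro mult_mono L2_set_le_sum) auto
    finally show "cmod (f x - f y) \<le> \<bar>L\<bar> * (\<Sum>i<k. dist (x i) (y i))" .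
  qed simp
qed

text \<open>Continuity yields measurability on the whole space
  \<open>nat \<Rightarrow> complex\<close>, whose product sigma-algebra is the Borel one. So
  \<open>f\<close> is extended by ignoring the coordinates from \<open>k\<close> on, and then pulled
  back along padding with zeros.\<close>

lemma lipschitz_tuples_measurable:
  assumes "lipschitz_tuples k f"
  shows "f \<in> borel_measurable (lborels k)"
proof -
  obtain L where L: "L \<ge> 0" "\<And>x y. x \<in> tuples k UNIV \<Longrightarrow> y \<in> tuples k UNIV \<Longrightarrow>
    cmod (f x - f y) \<le> L * (\<Sum>i<k. dist (x i) (y i))"
    by (rule lipschitz_tuplesE[OF assms]) blast
  define f' where "f' x = f (restrict x {..<k})" for x :: "nat \<Rightarrow> complex"
  have "continuous_on UNIV f'"
    unfolding continuous_on_def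
  proof (intro ballI)
    fix y :: "nat \<Rightarrow> complex"
    have "((\<lambda>x. L * (\<Sum>i<k. dist (x i) (y i))) \<longlongrightarrow> L * (\<Sum>i<k. dist (y i) (y i))) (at y within UNIV)"
    proof (intro tendsto_intros)
      fix i
      have "continuous_on UNIV (\<lambda>x::nat\<Rightarrow>complex. x i)" by (rule continuous_on_product_coordinates)
      then show "((\<lambda>x. x i) \<longlongrightarrow> y i) (at y within UNIV)" by (auto simp: continuous_on_def)
    qed
    then have lim: "((\<lambda>x. L * (\<Sum>i<k. dist (x i) (y i))) \<longlongrightarrow> 0) (at y within UNIV)" by simp
    have "((\<lambda>x. f' x - f' y) \<longlongrightarrow> 0) (at y within UNIV)"
    proof (rule Lim_null_comparison[OF always_eventually lim], rule allI)
      fix x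
      have "cmod (f' x - f' y) \<le> L * (\<Sum>i<k. dist (restrict x {..<k} i) (restrict y {..<k} i))"
        unfolding f'_def by (intro L(2)) auto
      then show "norm (f' x - f' y) \<le> L * (\<Sum>i<k. dist (x i) (y i))" by simp
    qed
    then show "(f' \<longlongrightarrow> f' y) (at y within UNIV)" by (simp add: LIM_zero_iff)
  qed
  then have "f' \<in> borel_measurable borel" by (rule borel_measurable_continuous_onI)
  then have f': "f' \<in> borel_measurable (Pi\<^sub>M UNIV (\<lambda>_. borel))"
    by (simp add: measurable_cong_sets[OF sets_PiM_equal_borel refl])
  have ext: "(\<lambda>x i. if i < k then x i else 0) \<in> measurable (lborels k) (Pi\<^sub>M UNIV (\<lambda>_. borel :: complex measure))"
  proof (rule measurable_PiM_single')
    fix i :: nat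
    show "(\<lambda>x. if i < k then x i else 0) \<in> measurable (lborels k) (borel :: complex measure)"
      by (cases "i < k") auto
  qed auto
  have "(\<lambda>x. f' (\<lambda>i. if i < k then x i else 0)) \<in> borel_measurable (lborels k)"
    by (rule measurable_compose[OF ext f'])
  moreover have "f' (\<lambda>i. if i < k then x i else 0) = f x" if "x \<in> space (lborels k)" for x
    unfolding f'_def using that
    by (intro arg_cong[where f=f]) (auto simp: space_PiM PiE_iff extensional_def)
  ultimately show ?thesis by (subst (asm) measurable_cong) auto
qed

lemma tuple_sum_eq_finite:
  assumes X: "finite (X \<inter> K)"
    and supp: "\<And>x i. x \<in> tuples k UNIV \<Longrightarrow> f x \<noteq> 0 \<Longrightarrow> i < k \<Longrightarrow> x i \<in> K"
  shows "(\<Sum>\<^sub>\<infinity>x\<in>distinct_tuples k X. f x) = (\<Sum>x\<in>inj_tuples k (X \<inter> K). (f x :: complex))"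
proof -
  have "(\<Sum>\<^sub>\<infinity>x\<in>distinct_tuples k X. f x) = (\<Sum>\<^sub>\<infinity>x\<in>inj_tuples k (X \<inter> K). f x)"
  proof (rule infsum_cong_neutral)
    fix x assume "x \<in> distinct_tuples k X - inj_tuples k (X \<inter> K)"
    then obtain i where x: "x \<in> tuples k UNIV" "i < k" "x i \<notin> K"
      by (force simp: distinct_tuples_def inj_tuples_def PiE_iff)
    then show "f x = 0" using supp by blast
  qed (auto simp: distinct_tuples_eq inj_tuples_def PiE_iff)
  also have "\<dots> = (\<Sum>x\<in>inj_tuples k (X \<inter> K). f x)"
    by (rule infsum_finite) (intro finite_inj_tuples X)
  finally show ?thesis .
qed

text \<open>The grid map \<open>grid n\<close> separates the points of a finite set for large \<open>n\<close>; then every cell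
  contains at most one of them and tuple sums become polynomials in the cell counts.\<close>

definition grid :: "nat \<Rightarrow> complex \<Rightarrow> complex" where
  "grid n z = Complex (of_int \<lfloor>real (Suc n) * Re z\<rfloor> / real (Suc n)) (of_int \<lfloor>real (Suc n) * Im z\<rfloor> / real (Suc n))"

lemma grid_tendsto: "(\<lambda>n. grid n z) \<longlonglongrightarrow> z"
proof -
  have r: "(\<lambda>n. of_int \<lfloor>real (Suc n) * t\<rfloor> / real (Suc n)) \<longlonglongrightarrow> t" for t :: real
  proof (rule real_tendsto_sandwich)
    show "(\<lambda>n. t - 1 / real (Suc n)) \<longlonglongrightarrow> t"
      using tendsto_diff[OF tendsto_const[of t] LIMSEQ_inverse_real_of_nat] by (simp add: inverse_eq_divide)
    show "\<forall>\<^sub>F n in sequentially. t - 1 / real (Suc n) \<le> of_int \<lfloor>real (Suc n) * t\<rfloor> / real (Suc n)"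
    proof (intro always_eventually allI)
      fix n
      have "real (Suc n) * t - 1 \<le> of_int \<lfloor>real (Suc n) * t\<rfloor>" by linarith
      then have "(real (Suc n) * t - 1) / real (Suc n) \<le> of_int \<lfloor>real (Suc n) * t\<rfloor> / real (Suc n)"
        by (rule divide_right_mono) simp
      then show "t - 1 / real (Suc n) \<le> of_int \<lfloor>real (Suc n) * t\<rfloor> / real (Suc n)"
        by (simp add: diff_divide_distrib)
    qed
    show "\<forall>\<^sub>F n in sequentially. of_int \<lfloor>real (Suc n) * t\<rfloor> / real (Suc n) \<le> t"
    proof (intro always_eventually allI)
      fix n
      have "of_int \<lfloor>real (Suc n) * t\<rfloor> \<le> t * real (Suc n)" by (simp add: mult.commute)
      then show "of_int \<lfloor>real (Suc n) * t\<rfloor> / real (Suc n) \<le> t" by (simp add: pos_divide_le_eq del: of_nat_Suc)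
    qed
  qed auto
  have "(\<lambda>n. Complex (of_int \<lfloor>real (Suc n) * Re z\<rfloor> / real (Suc n)) (of_int \<lfloor>real (Suc n) * Im z\<rfloor> / real (Suc n))) \<longlonglongrightarrow> Complex (Re z) (Im z)"
    by (rule tendsto_Complex[OF r r])
  then show ?thesis by (simp add: grid_def[abs_def])
qed

lemma grid_measurable [measurable]: "grid n \<in> borel_measurable borel"
proof -
  have "grid n = (\<lambda>z. cplx (of_int \<lfloor>real (Suc n) * Re z\<rfloor> / real (Suc n)) +
      \<i> * cplx (of_int \<lfloor>real (Suc n) * Im z\<rfloor> / real (Suc n)))"
    by (auto simp: grid_def Complex_eq)
  also have "\<dots> \<in> borel_measurable borel" by measurable
  finally show ?thesis .
qed

lemma grid_finite_range:
  assumes "compact K"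
  shows "finite (grid n ` K)"
proof -
  obtain b where b: "\<And>z. z \<in> K \<Longrightarrow> cmod z \<le> b" using compact_imp_bounded[OF assms] by (auto simp: bounded_iff)
  let ?m = "\<lceil>real (Suc n) * b\<rceil> + 1"
  have "grid n ` K \<subseteq> (\<lambda>(p, q). Complex (of_int p / real (Suc n)) (of_int q / real (Suc n))) ` ({-?m..?m} \<times> {-?m..?m})"
  proof
    fix w assume "w \<in> grid n ` K"
    then obtain z where z: "z \<in> K" "w = grid n z" by auto
    have fl: "\<lfloor>real (Suc n) * t\<rfloor> \<in> {-?m..?m}" if "\<bar>t\<bar> \<le> b" for t
    proof -
      have "\<bar>real (Suc n) * t\<bar> \<le> real (Suc n) * b" using that by (simp add: abs_mult mult_left_mono)
      then show ?thesis unfolding atLeastAtMost_iff by linarith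
    qed
    have "\<bar>Re z\<bar> \<le> b" "\<bar>Im z\<bar> \<le> b" using b[OF z(1)] abs_Re_le_cmod[of z] abs_Im_le_cmod[of z] by linarith+
    then show "w \<in> (\<lambda>(p, q). Complex (of_int p / real (Suc n)) (of_int q / real (Suc n))) ` ({-?m..?m} \<times> {-?m..?m})"
      unfolding z(2) grid_def using fl by (intro image_eqI[of _ _ "(\<lfloor>real (Suc n) * Re z\<rfloor>, \<lfloor>real (Suc n) * Im z\<rfloor>)"]) auto
  qed
  then show ?thesis by (rule finite_subset) auto
qed

lemma tuple_sum_measurable:
  assumes lip: "lipschitz_tuples k f" and K: "compact K" "K \<subseteq> E"
    and supp: "\<And>x i. x \<in> tuples k UNIV \<Longrightarrow> f x \<noteq> 0 \<Longrightarrow> i < k \<Longrightarrow> x i \<in> K"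
  shows "(\<lambda>X. \<Sum>\<^sub>\<infinity>x\<in>distinct_tuples k X. f x) \<in> borel_measurable (config_space E)"
proof -
  obtain L where L: "L \<ge> 0" "\<And>x y. x \<in> tuples k UNIV \<Longrightarrow> y \<in> tuples k UNIV \<Longrightarrow>
    cmod (f x - f y) \<le> L * (\<Sum>i<k. dist (x i) (y i))"
    by (rule lipschitz_tuplesE[OF lip]) blast
  \<comment> \<open>Intersecting with \<open>K\<close> keeps the cells relatively compact in
    \<open>E\<close>, as the generators of the sigma-algebra require.\<close>
  define cell where "cell n w = K \<inter> grid n -` {w}" for n w
  define H where "H n X = (\<Sum>c\<in>inj_tuples k (grid n ` K). f c * (\<Prod>i<k. of_nat (card (X \<inter> cell n (c i)))))" for n X
  have cell_borel: "cell n w \<in> sets borel" for n w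
  proof -
    have "grid n -` {w} \<inter> space borel \<in> sets borel" by (rule measurable_sets[OF grid_measurable]) simp
    then show ?thesis unfolding cell_def using borel_compact[OF K(1)] by auto
  qed
  have cnt: "(\<lambda>X. card (X \<inter> cell n w)) \<in> measurable (config_space E) (count_space UNIV)" for n w
    using K cell_borel by (intro config_count_measurable[of _ K]) (auto simp: cell_def)
  have cnt': "(\<lambda>X. of_nat (card (X \<inter> cell n w)) :: complex) \<in> borel_measurable (config_space E)" for n w
    by (rule measurable_compose[OF cnt]) simp
  show ?thesis
  proof (rule borel_measurable_LIMSEQ_metric)
    show "H n \<in> borel_measurable (config_space E)" for n
      unfolding H_def by (intro borel_measurable_sum borel_measurable_times borel_measurable_const borel_measurable_prod cnt')
    fix X assume "X \<in> space (config_space E)"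
    then have XK: "finite (X \<inter> K)" using K by (intro finite_configuration_Int[of _ E]) auto
    have sep: "\<forall>\<^sub>F n in sequentially. inj_on (grid n) (X \<inter> K)"
    proof -
      have "\<forall>\<^sub>F n in sequentially. \<forall>p\<in>(X \<inter> K) \<times> (X \<inter> K). fst p \<noteq> snd p \<longrightarrow> grid n (fst p) \<noteq> grid n (snd p)"
      proof (intro eventually_ball_finite ballI)
        fix p assume "p \<in> (X \<inter> K) \<times> (X \<inter> K)"
        show "\<forall>\<^sub>F n in sequentially. fst p \<noteq> snd p \<longrightarrow> grid n (fst p) \<noteq> grid n (snd p)"
        proof (cases "fst p = snd p")
          case False
          have "(\<lambda>n. grid n (fst p) - grid n (snd p)) \<longlonglongrightarrow> fst p - snd p"
            by (intro tendsto_diff grid_tendsto)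
          then have "\<forall>\<^sub>F n in sequentially. grid n (fst p) - grid n (snd p) \<noteq> 0"
            using False by (intro tendsto_imp_eventually_ne) auto
          then show ?thesis by eventually_elim auto
        qed simp
      qed (use XK in auto)
      then show ?thesis by eventually_elim (auto simp: inj_on_def)
    qed
    have H_eq: "\<forall>\<^sub>F n in sequentially. (\<Sum>x\<in>inj_tuples k (X \<inter> K). f (\<lambda>i\<in>{..<k}. grid n (x i))) = H n X"
      using sep
    proof eventually_elim
      case (elim n)
      define \<phi> where "\<phi> x = (\<lambda>i\<in>{..<k}. grid n (x i))" for x :: "nat \<Rightarrow> complex"
      have inj: "inj_on \<phi> (inj_tuples k (X \<inter> K))"
      proof (rule inj_onI)
        fix x y assume x: "x \<in> inj_tuples k (X \<inter> K)" and y: "y \<in> inj_tuples k (X \<inter> K)" and e: "\<phi> x = \<phi> y"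
        show "x = y"
        proof (rule extensionalityI[of _ "{..<k}"])
          fix i assume i: "i \<in> {..<k}"
          have "grid n (x i) = grid n (y i)" using fun_cong[OF e, of i] i by (simp add: \<phi>_def)
          moreover have "x i \<in> X \<inter> K" "y i \<in> X \<inter> K" using x y i by (auto simp: inj_tuples_def PiE_iff)
          ultimately show "x i = y i" using elim by (auto dest: inj_onD)
        qed (use x y in \<open>auto simp: inj_tuples_def PiE_iff\<close>)
      qed
      have sub: "\<phi> ` inj_tuples k (X \<inter> K) \<subseteq> inj_tuples k (grid n ` K)"
      proof
        fix c assume "c \<in> \<phi> ` inj_tuples k (X \<inter> K)"
        then obtain x where x: "x \<in> tuples k (X \<inter> K)" "inj_on x {..<k}" "c = \<phi> x" by (auto simp: inj_tuples_def)
        have "inj_on (grid n \<circ> x) {..<k}"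
          using x elim by (intro comp_inj_on) (auto intro: inj_on_subset simp: PiE_iff)
        then show "c \<in> inj_tuples k (grid n ` K)"
          using x by (auto simp: inj_tuples_def \<phi>_def inj_on_def PiE_iff)
      qed
      have card1: "(\<Prod>i<k. of_nat (card (X \<inter> cell n (c i)))) = (1::complex)" if c: "c \<in> \<phi> ` inj_tuples k (X \<inter> K)" for c
      proof (intro prod.neutral ballI)
        fix i assume i: "i \<in> {..<k}"
        obtain x where x: "x \<in> tuples k (X \<inter> K)" "c = \<phi> x" using c by (auto simp: inj_tuples_def)
        have xi: "x i \<in> X \<inter> K" and ci: "c i = grid n (x i)" using x i by (auto simp: \<phi>_def PiE_iff)
        have "X \<inter> cell n (c i) = {x i}"
        proof (intro equalityI subsetI)
          fix z assume "z \<in> X \<inter> cell n (c i)"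
          then have "z \<in> X \<inter> K" "grid n z = grid n (x i)" by (auto simp: cell_def ci)
          then show "z \<in> {x i}" using inj_onD[OF elim _ _ xi] by blast
        qed (use xi in \<open>auto simp: cell_def ci\<close>)
        then show "of_nat (card (X \<inter> cell n (c i))) = (1::complex)" by simp
      qed
      \<comment> \<open>A grid tuple that does not come from a tuple of points has an empty cell
        among its entries: otherwise a point could be picked in each cell, and distinct cells would
        make these points distinct.\<close>
      have card0: "(\<Prod>i<k. of_nat (card (X \<inter> cell n (c i)))) = (0::complex)"
        if c: "c \<in> inj_tuples k (grid n ` K) - \<phi> ` inj_tuples k (X \<inter> K)" for c
      proof (rule ccontr)
        assume "(\<Prod>i<k. of_nat (card (X \<inter> cell n (c i)))) \<noteq> (0::complex)"
        then have "\<forall>i\<in>{..<k}. X \<inter> cell n (c i) \<noteq> {}" by (auto simp: card_gt_0_iff)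
        then have "\<forall>i\<in>{..<k}. \<exists>z. z \<in> X \<inter> K \<and> grid n z = c i" by (auto simp: cell_def)
        then obtain x where "\<forall>i\<in>{..<k}. x i \<in> X \<inter> K \<and> grid n (x i) = c i" unfolding bchoice_iff by blast
        then have x: "x i \<in> X \<inter> K \<and> grid n (x i) = c i" if "i < k" for i using that by simp
        have c': "c \<in> extensional {..<k}" "inj_on c {..<k}" using c by (auto simp: inj_tuples_def PiE_iff)
        have "inj_on x {..<k}"
        proof (rule inj_onI)
          fix a b assume "a \<in> {..<k}" "b \<in> {..<k}" "x a = x b"
          then show "a = b" using x[of a] x[of b] c'(2) by (auto dest!: inj_onD)
        qed
        then have "restrict x {..<k} \<in> inj_tuples k (X \<inter> K)"
          using x by (auto simp: inj_tuples_def inj_on_def)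
        moreover have "\<phi> (restrict x {..<k}) = c"
          using x c'(1) by (auto simp: \<phi>_def extensional_def)
        ultimately show False using c by blast
      qed
      have "H n X = (\<Sum>c\<in>\<phi> ` inj_tuples k (X \<inter> K). f c * (\<Prod>i<k. of_nat (card (X \<inter> cell n (c i)))))"
        unfolding H_def using card0 sub
        by (intro sum.mono_neutral_right finite_inj_tuples grid_finite_range K) auto
      also have "\<dots> = (\<Sum>c\<in>\<phi> ` inj_tuples k (X \<inter> K). f c)"
        by (intro sum.cong refl) (simp add: card1)
      also have "\<dots> = (\<Sum>x\<in>inj_tuples k (X \<inter> K). f (\<phi> x))"
        by (simp add: sum.reindex[OF inj])
      finally show ?case by (simp add: \<phi>_def)
    qed
    have lim: "(\<lambda>n. \<Sum>x\<in>inj_tuples k (X \<inter> K). f (\<lambda>i\<in>{..<k}. grid n (x i))) \<longlonglongrightarrow> (\<Sum>x\<in>inj_tuples k (X \<inter> K). f x)"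
    proof (rule tendsto_sum)
      fix x assume "x \<in> inj_tuples k (X \<inter> K)"
      then have x: "x \<in> tuples k UNIV" by (auto simp: inj_tuples_def PiE_iff)
      have "(\<lambda>n. L * (\<Sum>i<k. dist (grid n (x i)) (x i))) \<longlonglongrightarrow> L * (\<Sum>i<k. dist (x i) (x i))"
        by (intro tendsto_intros grid_tendsto)
      then have lim: "(\<lambda>n. L * (\<Sum>i<k. dist (grid n (x i)) (x i))) \<longlonglongrightarrow> 0" by simp
      have "(\<lambda>n. f (\<lambda>i\<in>{..<k}. grid n (x i)) - f x) \<longlonglongrightarrow> 0"
      proof (rule Lim_null_comparison[OF always_eventually lim], rule allI)
        fix n
        show "norm (f (\<lambda>i\<in>{..<k}. grid n (x i)) - f x) \<le> L * (\<Sum>i<k. dist (grid n (x i)) (x i))"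
          using L(2)[of "\<lambda>i\<in>{..<k}. grid n (x i)" x] x by simp
      qed
      then show "(\<lambda>n. f (\<lambda>i\<in>{..<k}. grid n (x i))) \<longlonglongrightarrow> f x" by (simp add: LIM_zero_iff)
    qed
    have "(\<Sum>\<^sub>\<infinity>x\<in>distinct_tuples k X. f x) = (\<Sum>x\<in>inj_tuples k (X \<inter> K). f x)"
      by (rule tuple_sum_eq_finite[OF XK]) (rule supp)
    then show "(\<lambda>n. H n X) \<longlonglongrightarrow> (\<Sum>\<^sub>\<infinity>x\<in>distinct_tuples k X. f x)"
      using Lim_transform_eventually[OF lim H_eq] by simp
  qed
qed

section \<open>The Ginibre ensemble and its modes\<close>

definition pois :: "real \<Rightarrow> nat \<Rightarrow> real" where
  "pois l j = l ^ j / fact j * exp (- l)"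

definition pois_cdf :: "real \<Rightarrow> nat \<Rightarrow> real" where
  "pois_cdf l j = (\<Sum>i\<le>j. pois l i)"

definition ginibre_fun :: "nat \<Rightarrow> nat \<Rightarrow> complex \<Rightarrow> complex" where
  "ginibre_fun N j z = z ^ j * cplx (exp (- real N * (cmod z)\<^sup>2 / 2))"

text \<open>The squared norm of \<open>ginibre_fun N j\<close> over the whole plane.\<close>

definition ginibre_norm :: "nat \<Rightarrow> nat \<Rightarrow> real" where
  "ginibre_norm N j = pi * fact j / real N ^ Suc j"

lemma ginibre_norm_pos: "N > 0 \<Longrightarrow> ginibre_norm N j > 0"
  by (simp add: ginibre_norm_def)

lemma ginibre_norm_nonneg: "0 \<le> ginibre_norm N j"
  by (simp add: ginibre_norm_def)

lemma ginibre_fun_measurable [measurable]: "ginibre_fun N j \<in> borel_measurable borel"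
  unfolding ginibre_fun_def by measurable

lemma cmod_ginibre_fun_power2:
  "(cmod (ginibre_fun N j z))\<^sup>2 = ((cmod z)\<^sup>2) ^ j * exp (- real N * (cmod z)\<^sup>2)"
proof -
  have "(exp (- real N * (cmod z)\<^sup>2 / 2))\<^sup>2 = exp (- real N * (cmod z)\<^sup>2)"
    by (simp add: power2_eq_square flip: exp_add)
  then show ?thesis
    by (simp add: ginibre_fun_def norm_mult norm_power power_mult_distrib power_mult[symmetric] mult.commute)
qed

lemma erlang_density_ginibre:
  assumes "N > 0"
  shows "ennreal pi * (ennreal (t ^ j * exp (- real N * t)) * indicator {0..} t) =
    ennreal (ginibre_norm N j) * ennreal (erlang_density j (real N) t)"
proof (cases "t \<ge> 0")
  case True
  have "ennreal pi * ennreal (t ^ j * exp (- real N * t)) = ennreal (pi * (t ^ j * exp (- real N * t)))"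
    using True by (simp add: ennreal_mult)
  also have "pi * (t ^ j * exp (- real N * t)) = ginibre_norm N j * erlang_density j (real N) t"
    using True assms by (simp add: ginibre_norm_def erlang_density_def field_simps)
  also have "ennreal \<dots> = ennreal (ginibre_norm N j) * ennreal (erlang_density j (real N) t)"
    by (rule ennreal_mult'[OF ginibre_norm_nonneg])
  finally show ?thesis using True by simp
qed (simp add: erlang_density_def)

lemma nn_integral_ginibre_fun:
  assumes "N > 0"
  shows "(\<integral>\<^sup>+z. ennreal ((cmod (ginibre_fun N j z))\<^sup>2) \<partial>lborel) = ennreal (ginibre_norm N j)"
proof -
  have "(\<integral>\<^sup>+z. ennreal ((cmod (ginibre_fun N j z))\<^sup>2) \<partial>lborel) =
     ennreal pi * (\<integral>\<^sup>+t. ennreal (t ^ j * exp (- real N * t)) * indicator {0..} t \<partial>lborel)"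
    unfolding cmod_ginibre_fun_power2 by (rule nn_integral_radial) measurable
  also have "\<dots> = (\<integral>\<^sup>+t. ennreal (ginibre_norm N j) * ennreal (erlang_density j (real N) t) \<partial>lborel)"
    unfolding erlang_density_ginibre[OF assms, symmetric] by (rule nn_integral_cmult[symmetric]) measurable
  also have "\<dots> = ennreal (ginibre_norm N j) * (\<integral>\<^sup>+t. ennreal (erlang_density j (real N) t) \<partial>lborel)"
    by (rule nn_integral_cmult) measurable
  also have "(\<integral>\<^sup>+t. ennreal (erlang_density j (real N) t) \<partial>lborel) = 1"
  proof -
    interpret prob_space "density lborel (erlang_density j (real N))"
      using assms by (intro prob_space_erlang_density) simp
    show ?thesis using emeasure_space_1 by (simp add: emeasure_density)
  qed
  finally show ?thesis by simp
qed

text \<open>In the variable \<open>t = |z|^2\<close> the normalised mode is an Erlang law, the time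
  of arrival number \<open>j + 1\<close> in a Poisson process of rate \<open>N\<close>. It exceeds
  \<open>R\<^sup>2\<close> exactly if at most \<open>j\<close> arrivals occur before that time; this
  is where the Poisson distribution function comes from.\<close>

lemma nn_integral_ginibre_fun_disc:
  assumes "N > 0" "R \<ge> 0"
  shows "(\<integral>\<^sup>+z. ennreal (indicat_real {z. cmod z \<le> R} z * (cmod (ginibre_fun N j z))\<^sup>2) \<partial>lborel) =
    ennreal (ginibre_norm N j * (1 - pois_cdf (real N * R\<^sup>2) j))"
proof -
  have "(\<integral>\<^sup>+z. ennreal (indicat_real {z. cmod z \<le> R} z * (cmod (ginibre_fun N j z))\<^sup>2) \<partial>lborel) =
     (\<integral>\<^sup>+z. (\<lambda>t. ennreal (t ^ j * exp (- real N * t)) * indicator {..R\<^sup>2} t) ((cmod z)\<^sup>2) \<partial>lborel)"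
  proof (intro nn_integral_cong)
    fix z :: complex
    have "cmod z \<le> R \<longleftrightarrow> (cmod z)\<^sup>2 \<le> R\<^sup>2" using assms by (simp add: power2_le_iff_abs_le)
    then show "ennreal (indicat_real {z. cmod z \<le> R} z * (cmod (ginibre_fun N j z))\<^sup>2) =
       (\<lambda>t. ennreal (t ^ j * exp (- real N * t)) * indicator {..R\<^sup>2} t) ((cmod z)\<^sup>2)"
      unfolding cmod_ginibre_fun_power2 by (auto simp: indicator_def)
  qed
  also have "\<dots> = ennreal pi * (\<integral>\<^sup>+t. ennreal (t ^ j * exp (- real N * t)) * indicator {..R\<^sup>2} t * indicator {0..} t \<partial>lborel)"
    by (rule nn_integral_radial) measurable
  also have "\<dots> = (\<integral>\<^sup>+t. ennreal (ginibre_norm N j) * (ennreal (erlang_density j (real N) t) * indicator {..R\<^sup>2} t) \<partial>lborel)"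
  proof (subst nn_integral_cmult[symmetric])
    show "(\<integral>\<^sup>+t. ennreal pi * (ennreal (t ^ j * exp (- real N * t)) * indicator {..R\<^sup>2} t * indicator {0..} t) \<partial>lborel) =
       (\<integral>\<^sup>+t. ennreal (ginibre_norm N j) * (ennreal (erlang_density j (real N) t) * indicator {..R\<^sup>2} t) \<partial>lborel)"
    proof (intro nn_integral_cong)
      fix t
      show "ennreal pi * (ennreal (t ^ j * exp (- real N * t)) * indicator {..R\<^sup>2} t * indicator {0..} t) =
         ennreal (ginibre_norm N j) * (ennreal (erlang_density j (real N) t) * indicator {..R\<^sup>2} t)"
        using erlang_density_ginibre[OF assms(1), of t j] by (simp add: mult_ac indicator_def)
    qed
  qed measurable
  also have "\<dots> = ennreal (ginibre_norm N j) * (\<integral>\<^sup>+t. ennreal (erlang_density j (real N) t) * indicator {..R\<^sup>2} t \<partial>lborel)"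
    by (rule nn_integral_cmult) measurable
  also have "\<dots> = ennreal (ginibre_norm N j) * ennreal (erlang_CDF j (real N) (R\<^sup>2))"
    using assms by (subst nn_integral_erlang_density) auto
  also have "erlang_CDF j (real N) (R\<^sup>2) = 1 - pois_cdf (real N * R\<^sup>2) j"
    by (simp add: erlang_CDF_def pois_cdf_def pois_def)
  also have "ennreal (ginibre_norm N j) * ennreal (1 - pois_cdf (real N * R\<^sup>2) j) = ennreal (ginibre_norm N j * (1 - pois_cdf (real N * R\<^sup>2) j))"
    by (rule ennreal_mult'[OF ginibre_norm_nonneg, symmetric])
  finally show ?thesis .
qed

lemma integrable_ginibre_fun: "N > 0 \<Longrightarrow> integrable lborel (\<lambda>z. (cmod (ginibre_fun N j z))\<^sup>2)"
  by (rule integrableI_nonneg) (auto simp: nn_integral_ginibre_fun)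

text \<open>The rotation by the angle \<open>pi / (i - j)\<close> preserves Lebesgue measure and the
  radial set but multiplies the integrand by -1.\<close>

lemma ginibre_fun_orthogonal:
  assumes A: "A \<in> sets borel" "\<And>u z. cmod u = 1 \<Longrightarrow> u * z \<in> A \<longleftrightarrow> z \<in> A" and ij: "i \<noteq> j"
  shows "(LINT z|lborel. indicat_real A z *\<^sub>R (ginibre_fun N i z * cnj (ginibre_fun N j z))) = 0"
proof -
  let ?f = "\<lambda>z. indicat_real A z *\<^sub>R (ginibre_fun N i z * cnj (ginibre_fun N j z))"
  define u where "u = cis (pi / (real i - real j))"
  have u: "cmod u = 1" by (simp add: u_def)
  have uu: "u ^ i * cnj u ^ j = -1"
  proof -
    have "u ^ i * cnj u ^ j = cis (real i * (pi / (real i - real j))) * cis (- (real j * (pi / (real i - real j))))"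
      by (simp add: u_def Complex.DeMoivre cis_cnj)
    also have "\<dots> = cis ((real i - real j) * (pi / (real i - real j)))"
      by (simp add: cis_mult algebra_simps diff_divide_distrib)
    also have "(real i - real j) * (pi / (real i - real j)) = pi" using ij by simp
    finally show ?thesis by simp
  qed
  have [measurable]: "?f \<in> borel_measurable borel" using A(1) by measurable
  have "(LINT z|lborel. ?f (u * z)) = (LINT z|lborel. ?f z)"
    by (rule lborel_integral_rotation[OF u]) measurable
  moreover have "?f (u * z) = - ?f z" for z
  proof -
    have "ginibre_fun N i (u * z) * cnj (ginibre_fun N j (u * z)) = (u ^ i * cnj u ^ j) * (ginibre_fun N i z * cnj (ginibre_fun N j z))"
      using u by (simp add: ginibre_fun_def norm_mult power_mult_distrib mult_ac)
    moreover have "indicat_real A (u * z) = indicat_real A z" using A(2)[OF u] by (simp add: indicator_def)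
    ultimately show ?thesis by (simp add: uu)
  qed
  ultimately show ?thesis by simp
qed

lemma orthogonal_system_ginibre:
  assumes "N > 0" and A: "A \<in> sets borel" "\<And>u z. cmod u = 1 \<Longrightarrow> u * z \<in> A \<longleftrightarrow> z \<in> A"
  shows "orthogonal_system (ginibre_fun N) A n"
proof
  show "(LINT z|lborel. indicat_real A z *\<^sub>R (ginibre_fun N i z * cnj (ginibre_fun N j z))) = 0"
    if "i \<noteq> j" for i j using assms that by (intro ginibre_fun_orthogonal)
  show "(LINT z|lborel. indicat_real (- A) z *\<^sub>R (ginibre_fun N i z * cnj (ginibre_fun N j z))) = 0"
    if "i \<noteq> j" for i j using assms that by (intro ginibre_fun_orthogonal) auto
qed (use assms integrable_ginibre_fun in auto)

abbreviation ginibre_mass :: "nat \<Rightarrow> complex set \<Rightarrow> nat \<Rightarrow> real" where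
  "ginibre_mass N \<equiv> orthogonal_system.mass (ginibre_fun N)"

lemma ginibre_mass_eq:
  assumes "N > 0"
  shows "ginibre_mass N B j = (LINT z|lborel. indicat_real B z * (cmod (ginibre_fun N j z))\<^sup>2)"
  by (rule orthogonal_system.mass_def[OF orthogonal_system_ginibre[of N UNIV 0]]) (use assms in auto)

lemma pois_cdf_le_1:
  assumes "l \<ge> 0" shows "pois_cdf l j \<le> 1"
proof -
  have "(\<Sum>i\<le>j. l ^ i / fact i) \<le> (\<Sum>i. l ^ i / fact i)"
    using summable_exp_generic[of l] assms
    by (intro sum_le_suminf) (auto simp: divide_inverse scaleR_conv_of_real mult.commute)
  also have "\<dots> = exp l"
    unfolding exp_def by (intro suminf_cong) (simp add: divide_inverse mult.commute)
  finally have "(\<Sum>i\<le>j. l ^ i / fact i) * exp (- l) \<le> exp l * exp (- l)"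
    by (intro mult_right_mono) auto
  then show ?thesis by (simp add: pois_cdf_def pois_def sum_distrib_right flip: exp_add)
qed

lemma ginibre_mass_UNIV:
  assumes "N > 0"
  shows "ginibre_mass N UNIV j = ginibre_norm N j"
  unfolding ginibre_mass_eq[OF assms]
  by (subst integral_eq_nn_integral) (auto simp: nn_integral_ginibre_fun[OF assms] ginibre_norm_def)

lemma ginibre_mass_disc:
  assumes "N > 0" "R \<ge> 0"
  shows "ginibre_mass N {z. cmod z \<le> R} j = ginibre_norm N j * (1 - pois_cdf (real N * R\<^sup>2) j)"
  unfolding ginibre_mass_eq[OF assms(1)]
  using pois_cdf_le_1[of "real N * R\<^sup>2" j] nn_integral_ginibre_fun_disc[OF assms, of j]
  by (subst integral_eq_nn_integral) (auto simp: ginibre_norm_def intro!: mult_nonneg_nonneg)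

lemma ginibre_mass_outside:
  assumes "N > 0" "R \<ge> 0"
  shows "ginibre_mass N {z. R < cmod z} j = ginibre_norm N j * pois_cdf (real N * R\<^sup>2) j"
proof -
  have [measurable]: "{z::complex. cmod z \<le> R} \<in> sets borel" by measurable
  have i: "integrable lborel (\<lambda>z. indicat_real {z. cmod z \<le> R} z * (cmod (ginibre_fun N j z))\<^sup>2)"
    using integrable_mult_indicator[OF _ integrable_ginibre_fun[OF assms(1), of j], of "{z. cmod z \<le> R}"] by simp
  have "ginibre_mass N {z. R < cmod z} j = (LINT z|lborel. (cmod (ginibre_fun N j z))\<^sup>2 - indicat_real {z. cmod z \<le> R} z * (cmod (ginibre_fun N j z))\<^sup>2)"
    unfolding ginibre_mass_eq[OF assms(1)] by (intro Bochner_Integration.integral_cong refl) (auto simp: indicator_def)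
  also have "\<dots> = ginibre_mass N UNIV j - ginibre_mass N {z. cmod z \<le> R} j"
    using i integrable_ginibre_fun[OF assms(1), of j] by (simp add: ginibre_mass_eq[OF assms(1)])
  finally show ?thesis
    by (simp add: ginibre_mass_UNIV[OF assms(1)] ginibre_mass_disc[OF assms] algebra_simps)
qed

lemma pois_pos: "l > 0 \<Longrightarrow> pois l j > 0"
  by (simp add: pois_def)

lemma pois_nonneg: "l \<ge> 0 \<Longrightarrow> pois l j \<ge> 0"
  by (simp add: pois_def)

lemma pois_cdf_pos: "l > 0 \<Longrightarrow> pois_cdf l j > 0"
  unfolding pois_cdf_def by (intro sum_pos) (auto simp: pois_pos)

lemma pois_cdf_less_1:
  assumes "l > 0" shows "pois_cdf l j < 1"
proof -
  have "pois_cdf l j < pois_cdf l (Suc j)" using pois_pos[OF assms, of "Suc j"] by (simp add: pois_cdf_def)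
  also have "\<dots> \<le> 1" using assms by (intro pois_cdf_le_1) simp
  finally show ?thesis .
qed

definition ginibre_det :: "nat \<Rightarrow> (nat \<Rightarrow> complex) \<Rightarrow> complex" where
  "ginibre_det N x = leibniz_det N (\<lambda>i j. ginibre_fun N j (x i))"

lemma ginibre_weight_eq:
  "cplx (ginibre_weight N x) = ginibre_det N x * cnj (ginibre_det N x)"
proof -
  let ?e = "\<lambda>i. cplx (exp (- real N * (cmod (x i))\<^sup>2 / 2))"
  have "ginibre_det N x = (\<Prod>i<N. ?e i) * leibniz_det N (\<lambda>i j. x i ^ j)"
    by (simp add: ginibre_det_def leibniz_det_def ginibre_fun_def prod.distrib sum_distrib_left sum_distrib_right mult_ac)
  then have V: "ginibre_det N x = (\<Prod>i<N. ?e i) * (\<Prod>k<N. \<Prod>j<k. (x k - x j))"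
    by (simp only: leibniz_det_vandermonde)
  have e: "?e i * cnj (?e i) = cplx (exp (- real N * (cmod (x i))\<^sup>2))" for i
  proof -
    have "?e i * cnj (?e i) = cplx (exp (- real N * (cmod (x i))\<^sup>2 / 2) * exp (- real N * (cmod (x i))\<^sup>2 / 2))"
      by (simp only: complex_cnj_complex_of_real of_real_mult)
    also have "exp (- real N * (cmod (x i))\<^sup>2 / 2) * exp (- real N * (cmod (x i))\<^sup>2 / 2) = exp (- real N * (cmod (x i))\<^sup>2)"
      by (simp flip: exp_add)
    finally show ?thesis .
  qed
  have "ginibre_det N x * cnj (ginibre_det N x) =
     (\<Prod>i<N. ?e i * cnj (?e i)) * (\<Prod>k<N. \<Prod>j<k. (x k - x j) * cnj (x k - x j))"
    unfolding V by (simp only: complex_cnj_mult cnj_prod prod.distrib mult_ac)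
  also have "\<dots> = cplx (ginibre_weight N x)"
    unfolding e by (simp only: complex_norm_square[symmetric] ginibre_weight_def of_real_mult of_real_prod mult.commute)
  finally show ?thesis ..
qed

lemma ginibre_weight_nonneg: "0 \<le> ginibre_weight N x"
  unfolding ginibre_weight_def by (intro mult_nonneg_nonneg prod_nonneg) auto

lemma ginibre_weight_measurable [measurable]:
  "ginibre_weight N \<in> borel_measurable (lborels N)"
proof -
  have [measurable]: "(\<lambda>x. x i) \<in> borel_measurable (lborels N)" if "i < N" for i
    using that measurable_component_singleton[of i "{..<N}" "\<lambda>_. lborel :: complex measure"] by auto
  show ?thesis unfolding ginibre_weight_def
    by (intro borel_measurable_times borel_measurable_prod borel_measurable_power borel_measurable_norm
      borel_measurable_diff borel_measurable_exp) (auto intro!: borel_measurable_times borel_measurable_power borel_measurable_norm)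
qed

text \<open>Tuples with coinciding coordinates, whose image has fewer points than indices, carry no
  weight. They can therefore be discarded pointwise instead of almost everywhere.\<close>

lemma ginibre_weight_eq_0:
  assumes "\<not> inj_on x {..<N}"
  shows "ginibre_weight N x = 0"
proof -
  obtain a b where ab: "a < N" "b < N" "a \<noteq> b" "x a = x b" using assms by (auto simp: inj_on_def)
  then obtain k j where "k < N" "j < k" "x k = x j" by (metis linorder_neqE_nat)
  then have "(\<Prod>j<k. (cmod (x k - x j))\<^sup>2) = 0"
    by (intro prod_zero) auto
  with \<open>k < N\<close> have "(\<Prod>k<N. \<Prod>j<k. (cmod (x k - x j))\<^sup>2) = 0"
    by (intro prod_zero) auto
  then show ?thesis by (simp add: ginibre_weight_def)
qed

section \<open>Weights of mode sets, normalisation and conditional expectations\<close>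

definition bernoulli_weight :: "nat \<Rightarrow> (nat \<Rightarrow> real) \<Rightarrow> (nat \<Rightarrow> real) \<Rightarrow> nat set \<Rightarrow> real" where
  "bernoulli_weight N a b T = (\<Prod>j\<in>T. a j) * (\<Prod>j\<in>{..<N} - T. b j)"

definition size_subsets :: "nat \<Rightarrow> nat \<Rightarrow> nat set set" where
  "size_subsets N m = {T. T \<subseteq> {..<N} \<and> card T = m}"

lemma finite_size_subsets [simp]: "finite (size_subsets N m)"
  unfolding size_subsets_def by (rule finite_subset[of _ "Pow {..<N}"]) auto

lemma size_subsets_nonempty: "m \<le> N \<Longrightarrow> size_subsets N m \<noteq> {}"
  using obtain_subset_with_card_n[of m "{..<N}"] by (auto simp: size_subsets_def)

lemma size_subsets_full: "size_subsets N N = {{..<N}}"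
proof -
  have "T = {..<N}" if "T \<subseteq> {..<N}" "card T = N" for T
    using that by (intro card_subset_eq) auto
  then show ?thesis by (auto simp: size_subsets_def)
qed

definition statistic ::
  "nat \<Rightarrow> nat \<Rightarrow> nat \<Rightarrow> complex set \<Rightarrow> ((nat \<Rightarrow> complex) \<Rightarrow> complex) \<Rightarrow> (nat \<Rightarrow> complex) \<Rightarrow> complex" where
  "statistic N k m A F x = (if card {i \<in> {..<N}. x i \<in> A} = m
     then \<Sum>\<iota>\<in>inj_tuples k {..<N}. F (\<lambda>i\<in>{..<k}. x (\<iota> i)) else 0)"

locale radial_statistic =
  fixes N :: nat and A :: "complex set" and k m :: nat and F :: "(nat \<Rightarrow> complex) \<Rightarrow> complex" and C :: real
  assumes N_pos: "N > 0"
    and A_borel: "A \<in> sets borel"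
    and A_radial: "\<And>u z. cmod u = 1 \<Longrightarrow> u * z \<in> A \<longleftrightarrow> z \<in> A"
    and F_borel: "F \<in> borel_measurable (lborels k)"
    and F_bounded: "\<And>x. x \<in> tuples k UNIV \<Longrightarrow> cmod (F x) \<le> C"
    and F_support: "\<And>x i. x \<in> tuples k UNIV \<Longrightarrow> i < k \<Longrightarrow> x i \<notin> A \<Longrightarrow> F x = 0"
    and mass_nz: "\<And>j. j < N \<Longrightarrow> ginibre_mass N A j \<noteq> 0"
begin

lemma ginibre_statistic:
  shows "(LINT x|lborels N. ginibre_weight N x *\<^sub>R statistic N k m A F x) =
      fact N * (\<Sum>T\<in>size_subsets N m.
        cplx (bernoulli_weight N (ginibre_mass N A) (ginibre_mass N (- A)) T) *
        (LINT y|lborels k. F y * leibniz_det k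
          (\<lambda>i j. \<Sum>l\<in>T. ginibre_fun N l (y i) * cnj (ginibre_fun N l (y j)) / ginibre_mass N A l)))"
    and "integrable (lborels N) (\<lambda>x. ginibre_weight N x *\<^sub>R statistic N k m A F x)"
proof -
  interpret orthogonal_system "ginibre_fun N" A N
    by (intro orthogonal_system_ginibre N_pos A_borel A_radial)
  interpret orthogonal_system_statistic "ginibre_fun N" A N k m F C
    by standard (use F_borel F_bounded F_support in auto)
  have eq: "ginibre_weight N x *\<^sub>R statistic N k m A F x = \<Phi> x * (V x * cnj (V x))" for x
  proof -
    have "V x = ginibre_det N x" by (simp add: V_def ginibre_det_def)
    then show ?thesis
      by (simp add: scaleR_conv_of_real ginibre_weight_eq statistic_def \<Phi>_def tuple_def mult.commute)
  qed
  show "(LINT x|lborels N. ginibre_weight N x *\<^sub>R statistic N k m A F x) =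
      fact N * (\<Sum>T\<in>size_subsets N m.
        cplx (bernoulli_weight N (ginibre_mass N A) (ginibre_mass N (- A)) T) *
        (LINT y|lborels k. F y * leibniz_det k
          (\<lambda>i j. \<Sum>l\<in>T. ginibre_fun N l (y i) * cnj (ginibre_fun N l (y j)) / ginibre_mass N A l)))"
    unfolding eq size_subsets_def bernoulli_weight_def by (rule statistic_integral(1)[OF mass_nz])
  show "integrable (lborels N) (\<lambda>x. ginibre_weight N x *\<^sub>R statistic N k m A F x)"
    unfolding eq by (rule statistic_integral(2)[OF mass_nz])
qed

end

lemma measure_PiM_empty_space:
  "measure (Pi\<^sub>M {} (\<lambda>_. lborel)) (space (Pi\<^sub>M {} (\<lambda>_. lborel :: complex measure))) = 1"
  by (simp add: measure_def space_PiM_empty)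

text \<open>This is the mode expansion for \<open>k = 0\<close> and \<open>F = 1\<close>: there is
  one empty tuple, and a determinant of size 0 is 1.\<close>

lemma ginibre_partition:
  assumes N: "N > 0" and A: "A \<in> sets borel" "\<And>u z. cmod u = 1 \<Longrightarrow> u * z \<in> A \<longleftrightarrow> z \<in> A"
    and nz: "\<And>j. j < N \<Longrightarrow> ginibre_mass N A j \<noteq> 0"
  shows "(LINT x|lborels N. ginibre_weight N x * (if card {i \<in> {..<N}. x i \<in> A} = m then 1 else 0)) =
      fact N * (\<Sum>T\<in>size_subsets N m. bernoulli_weight N (ginibre_mass N A) (ginibre_mass N (- A)) T)" (is "?L = ?R")
    and "integrable (lborels N) (\<lambda>x. ginibre_weight N x * (if card {i \<in> {..<N}. x i \<in> A} = m then 1 else 0))"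
proof -
  interpret radial_statistic N A 0 m "\<lambda>_. 1" 1
    by standard (use assms in auto)
  have tup: "inj_tuples 0 S = {\<lambda>_. undefined}" for S :: "nat set" by (auto simp: inj_tuples_def)
  have eq: "ginibre_weight N x *\<^sub>R statistic N 0 m A (\<lambda>_. 1) x =
      cplx (ginibre_weight N x * (if card {i \<in> {..<N}. x i \<in> A} = m then 1 else 0))" for x
    by (simp add: statistic_def tup scaleR_conv_of_real)
  have "cplx ?L = (LINT x|lborels N. ginibre_weight N x *\<^sub>R statistic N 0 m A (\<lambda>_. 1) x)"
    unfolding eq by (rule integral_complex_of_real[symmetric])
  also have "\<dots> = cplx ?R"
    unfolding ginibre_statistic(1) by (simp add: leibniz_det_def measure_PiM_empty_space)
  finally show "?L = ?R" by (simp only: of_real_eq_iff)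
  have "integrable (lborels N) (\<lambda>x. Re (ginibre_weight N x *\<^sub>R statistic N 0 m A (\<lambda>_. 1) x))"
    by (intro integrable_Re ginibre_statistic(2))
  then show "integrable (lborels N) (\<lambda>x. ginibre_weight N x * (if card {i \<in> {..<N}. x i \<in> A} = m then 1 else 0))"
    unfolding eq by simp
qed

text \<open>The choice \<open>A = UNIV\<close>, \<open>m = N\<close> leaves a single set of modes
  and turns the normalising constant into \<open>N!\<close> times a product of masses.\<close>

lemma ginibre_weight_integral:
  assumes N: "N > 0"
  shows "integrable (lborels N) (ginibre_weight N)" and "0 < (LINT x|lborels N. ginibre_weight N x)"
proof -
  have c: "card {i. i < N} = N" by simp
  have nz: "ginibre_mass N UNIV j > 0" for j using N by (simp add: ginibre_mass_UNIV ginibre_norm_pos)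
  have eq: "ginibre_weight N x * (if card {i \<in> {..<N}. x i \<in> UNIV} = N then 1 else 0) = ginibre_weight N x" for x
    by simp
  note * = ginibre_partition[of N UNIV N, unfolded eq]
  show "integrable (lborels N) (ginibre_weight N)"
    using N nz by (intro *(2)) (auto simp: less_imp_neq[symmetric])
  have "(LINT x|lborels N. ginibre_weight N x) =
    fact N * (\<Sum>T\<in>size_subsets N N. bernoulli_weight N (ginibre_mass N UNIV) (ginibre_mass N (- UNIV)) T)"
    using N nz by (intro *(1)) (auto simp: less_imp_neq[symmetric])
  also have "\<dots> = fact N * (\<Prod>j<N. ginibre_mass N UNIV j)"
    by (simp add: size_subsets_full bernoulli_weight_def)
  also have "\<dots> > 0" using nz by (intro mult_pos_pos prod_pos) auto
  finally show "0 < (LINT x|lborels N. ginibre_weight N x)" .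
qed

abbreviation ginibre_Z :: "nat \<Rightarrow> real" where
  "ginibre_Z N \<equiv> (LINT x|lborels N. ginibre_weight N x)"

lemma prob_space_ginibre_law:
  assumes N: "N > 0"
  shows "prob_space (ginibre_law N)"
proof
  have nn: "0 \<le> ginibre_weight N x / ginibre_Z N" for x
    using ginibre_weight_nonneg[of N x] ginibre_weight_integral(2)[OF N] by simp
  have "emeasure (ginibre_law N) (space (ginibre_law N)) = (\<integral>\<^sup>+x. ennreal (ginibre_weight N x / ginibre_Z N) \<partial>lborels N)"
    unfolding ginibre_law_def by (subst emeasure_density) (auto intro!: nn_integral_cong)
  also have "\<dots> = ennreal (LINT x|lborels N. ginibre_weight N x / ginibre_Z N)"
    using ginibre_weight_integral(1)[OF N] nn by (intro nn_integral_eq_integral) auto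
  also have "(LINT x|lborels N. ginibre_weight N x / ginibre_Z N) = 1"
    using ginibre_weight_integral(2)[OF N] by simp
  finally show "emeasure (ginibre_law N) (space (ginibre_law N)) = 1" by simp
qed

lemma sets_ginibre_law [simp, measurable_cong]: "sets (ginibre_law N) = sets (lborels N)"
  by (simp add: ginibre_law_def)

lemma sets_ginibre [simp, measurable_cong]: "sets (ginibre N) = sets (config_space UNIV)"
  and space_ginibre [simp]: "space (ginibre N) = configurations UNIV"
  by (simp_all add: ginibre_def)

lemma image_tuple_measurable_law: "(\<lambda>x. x ` {..<N}) \<in> measurable (ginibre_law N) (config_space UNIV)"
  using image_tuple_measurable by (simp cong: measurable_cong_sets)

lemma prob_space_ginibre: "N > 0 \<Longrightarrow> prob_space (ginibre N)"
  unfolding ginibre_def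
  by (intro prob_space.prob_space_distr prob_space_ginibre_law image_tuple_measurable_law)

lemma ginibre_integral:
  fixes H :: "complex set \<Rightarrow> 'b::{banach, second_countable_topology}"
  assumes N: "N > 0" and H: "H \<in> borel_measurable (config_space UNIV)"
  shows "(LINT X|ginibre N. H X) = (LINT x|lborels N. ginibre_weight N x *\<^sub>R H (x ` {..<N})) /\<^sub>R ginibre_Z N"
proof -
  have Hx: "(\<lambda>x. H (x ` {..<N})) \<in> borel_measurable (lborels N)"
    by (rule measurable_compose[OF image_tuple_measurable H])
  have "(LINT X|ginibre N. H X) = (LINT x|ginibre_law N. H (x ` {..<N}))"
    unfolding ginibre_def using H image_tuple_measurable_law by (intro integral_distr)
  also have "\<dots> = (LINT x|lborels N. (ginibre_weight N x / ginibre_Z N) *\<^sub>R H (x ` {..<N}))"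
    unfolding ginibre_law_def
    using ginibre_weight_integral(2)[OF N] Hx by (intro integral_density) (auto simp: ginibre_weight_nonneg)
  also have "\<dots> = (LINT x|lborels N. inverse (ginibre_Z N) *\<^sub>R (ginibre_weight N x *\<^sub>R H (x ` {..<N})))"
    by (simp add: divide_inverse mult.commute)
  also have "\<dots> = (LINT x|lborels N. ginibre_weight N x *\<^sub>R H (x ` {..<N})) /\<^sub>R ginibre_Z N"
    by (rule integral_scaleR_right)
  finally show ?thesis .
qed

lemma integral_uniform_measure:
  fixes f :: "'a \<Rightarrow> 'b::{banach, second_countable_topology}"
  assumes "prob_space M" and S: "S \<in> sets M" "measure M S > 0" and f: "f \<in> borel_measurable M"
  shows "integral\<^sup>L (uniform_measure M S) f = (LINT x|M. indicat_real S x *\<^sub>R f x) /\<^sub>R measure M S"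
proof -
  interpret prob_space M by fact
  have "uniform_measure M S = density M (\<lambda>x. ennreal (indicat_real S x / measure M S))"
    unfolding uniform_measure_def using S
    by (intro arg_cong[where f="density M"]) (auto simp: fun_eq_iff indicator_def emeasure_eq_measure divide_ennreal simp flip: ennreal_1)
  then have "integral\<^sup>L (uniform_measure M S) f = (LINT x|M. (indicat_real S x / measure M S) *\<^sub>R f x)"
    using S f by (simp add: integral_density)
  also have "\<dots> = (LINT x|M. inverse (measure M S) *\<^sub>R (indicat_real S x *\<^sub>R f x))"
    by (simp add: divide_inverse mult.commute)
  also have "\<dots> = (LINT x|M. indicat_real S x *\<^sub>R f x) /\<^sub>R measure M S"
    by (rule integral_scaleR_right)
  finally show ?thesis .
qed

text \<open>The weights \<open>a j\<close>, \<open>b j\<close> are those of a Bernoulli variable deciding on which side of the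
  circle the \<open>j\<close>-th mode lies; \<open>cond_avg\<close> conditions on exactly \<open>m\<close> successes.\<close>

definition cond_avg :: "nat \<Rightarrow> nat \<Rightarrow> (nat \<Rightarrow> real) \<Rightarrow> (nat \<Rightarrow> real) \<Rightarrow> (nat set \<Rightarrow> complex) \<Rightarrow> complex" where
  "cond_avg N m a b G = (\<Sum>T\<in>size_subsets N m. cplx (bernoulli_weight N a b T) * G T) /
     cplx (\<Sum>T\<in>size_subsets N m. bernoulli_weight N a b T)"

lemma bernoulli_weight_scale:
  assumes "T \<subseteq> {..<N}"
  shows "bernoulli_weight N (\<lambda>j. h j * a j) (\<lambda>j. h j * b j) T = (\<Prod>j<N. h j) * bernoulli_weight N a b T"
proof -
  have "(\<Prod>j<N. h j) = (\<Prod>j\<in>{..<N} - T. h j) * (\<Prod>j\<in>T. h j)"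
    using assms by (intro prod.subset_diff) auto
  then show ?thesis by (simp add: bernoulli_weight_def prod.distrib mult_ac)
qed

text \<open>Every mode contributes exactly one factor to each weight, so a common factor per mode
  cancels. This removes the norms of the modes and leaves Poisson probabilities.\<close>

lemma cond_avg_scale:
  assumes "\<And>j. j < N \<Longrightarrow> h j > (0::real)"
  shows "cond_avg N m (\<lambda>j. h j * a j) (\<lambda>j. h j * b j) G = cond_avg N m a b G"
proof -
  let ?h = "\<Prod>j<N. h j"
  have h: "?h \<noteq> 0" using assms by (auto simp: less_imp_neq[symmetric])
  have "bernoulli_weight N (\<lambda>j. h j * a j) (\<lambda>j. h j * b j) T = ?h * bernoulli_weight N a b T"
    if "T \<in> size_subsets N m" for T using that by (intro bernoulli_weight_scale) (auto simp: size_subsets_def)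
  then have "cond_avg N m (\<lambda>j. h j * a j) (\<lambda>j. h j * b j) G =
     (cplx ?h * (\<Sum>T\<in>size_subsets N m. cplx (bernoulli_weight N a b T) * G T)) /
     (cplx ?h * cplx (\<Sum>T\<in>size_subsets N m. bernoulli_weight N a b T))"
    unfolding cond_avg_def by (simp add: sum_distrib_left mult.assoc)
  also have "\<dots> = cond_avg N m a b G" unfolding cond_avg_def using h by (intro mult_divide_mult_cancel_left) simp
  finally show ?thesis .
qed

lemma cond_avg_cong:
  assumes "\<And>j. j < N \<Longrightarrow> a j = a' j" "\<And>j. j < N \<Longrightarrow> b j = b' j"
    "\<And>T. T \<subseteq> {..<N} \<Longrightarrow> card T = m \<Longrightarrow> G T = G' T"
  shows "cond_avg N m a b G = cond_avg N m a' b' G'"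
proof -
  have "bernoulli_weight N a b T = bernoulli_weight N a' b' T" if "T \<in> size_subsets N m" for T
    using that assms unfolding bernoulli_weight_def size_subsets_def
    by (intro arg_cong2[where f="(*)"] prod.cong) auto
  then show ?thesis using assms(3) unfolding cond_avg_def
    by (intro arg_cong2[where f="(/)"] sum.cong arg_cong[where f=cplx]) (auto simp: size_subsets_def)
qed

lemma cond_avg_full:
  assumes "\<And>j. j < N \<Longrightarrow> a j > 0"
  shows "cond_avg N N a b G = G {..<N}"
proof -
  have "(\<Prod>j<N. a j) \<noteq> 0" using assms by (auto simp: less_imp_neq[symmetric])
  then show ?thesis by (simp add: cond_avg_def size_subsets_full bernoulli_weight_def)
qed

text \<open>For the disc, a success means lying inside. Passing to complements expresses both
  regions through the same random set of outer modes, so that one concentration estimate serves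
  both.\<close>

lemma cond_avg_complement:
  assumes m: "m \<le> N"
  shows "cond_avg N (N - m) b a G = cond_avg N m a b (\<lambda>T. G ({..<N} - T))"
proof -
  have bij: "T \<in> size_subsets N m \<Longrightarrow> {..<N} - T \<in> size_subsets N (N - m)"
    "T \<in> size_subsets N (N - m) \<Longrightarrow> {..<N} - T \<in> size_subsets N m" for T
    using m by (auto simp: size_subsets_def card_Diff_subset finite_subset)
  have dd: "T \<subseteq> {..<N} \<Longrightarrow> {..<N} - ({..<N} - T) = T" for T by auto
  have w: "bernoulli_weight N b a ({..<N} - T) = bernoulli_weight N a b T" if "T \<in> size_subsets N m" for T
    using that by (simp add: bernoulli_weight_def dd size_subsets_def)
  have "(\<Sum>T\<in>size_subsets N (N - m). cplx (bernoulli_weight N b a T) * G T) =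
     (\<Sum>T\<in>size_subsets N m. cplx (bernoulli_weight N a b T) * G ({..<N} - T))"
    by (rule sum.reindex_bij_witness[of _ "\<lambda>T. {..<N} - T" "\<lambda>T. {..<N} - T"])
      (use bij dd w in \<open>auto simp: size_subsets_def bernoulli_weight_def\<close>)
  moreover have "(\<Sum>T\<in>size_subsets N (N - m). bernoulli_weight N b a T) = (\<Sum>T\<in>size_subsets N m. bernoulli_weight N a b T)"
    by (rule sum.reindex_bij_witness[of _ "\<lambda>T. {..<N} - T" "\<lambda>T. {..<N} - T"])
      (use bij dd w in \<open>auto simp: size_subsets_def bernoulli_weight_def\<close>)
  ultimately show ?thesis by (simp add: cond_avg_def)
qed

text \<open>The numerator is the mode expansion for \<open>F\<close>, the probability of the event
  is the same expansion for the empty tuple, and the common factors \<open>N!\<close> and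
  \<open>1 / ginibre_Z N\<close> cancel.\<close>

lemma (in radial_statistic) conditional_expectation:
  assumes S: "S \<in> sets (config_space UNIV)"
    and S_iff: "\<And>x. inj_on x {..<N} \<Longrightarrow> x ` {..<N} \<in> S \<longleftrightarrow> card {i \<in> {..<N}. x i \<in> A} = m"
    and H: "H \<in> borel_measurable (config_space UNIV)"
    and H_eq: "\<And>x. inj_on x {..<N} \<Longrightarrow> H (x ` {..<N}) = (\<Sum>\<iota>\<in>inj_tuples k {..<N}. F (\<lambda>i\<in>{..<k}. x (\<iota> i)))"
    and weight_pos: "0 < (\<Sum>T\<in>size_subsets N m. bernoulli_weight N (ginibre_mass N A) (ginibre_mass N (- A)) T)"
  shows "(LINT X|uniform_measure (ginibre N) S. H X) =
    cond_avg N m (ginibre_mass N A) (ginibre_mass N (- A)) (\<lambda>T.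
        (LINT y|lborels k. F y * leibniz_det k
          (\<lambda>i j. \<Sum>l\<in>T. ginibre_fun N l (y i) * cnj (ginibre_fun N l (y j)) / ginibre_mass N A l)))"
proof -
  let ?W = "\<Sum>T\<in>size_subsets N m. bernoulli_weight N (ginibre_mass N A) (ginibre_mass N (- A)) T"
  interpret G: prob_space "ginibre N" by (rule prob_space_ginibre[OF N_pos])
  have Z: "ginibre_Z N > 0" by (rule ginibre_weight_integral(2)[OF N_pos])
  have "measure (ginibre N) S = (LINT X|ginibre N. indicat_real S X)"
    using S sets.sets_into_space[OF S] by (simp add: Int_absorb2)
  also have "\<dots> = (LINT x|lborels N. ginibre_weight N x *\<^sub>R indicat_real S (x ` {..<N})) /\<^sub>R ginibre_Z N"
    using S by (intro ginibre_integral N_pos) auto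
  also have "(\<lambda>x. ginibre_weight N x *\<^sub>R indicat_real S (x ` {..<N})) =
      (\<lambda>x. ginibre_weight N x * (if card {i \<in> {..<N}. x i \<in> A} = m then 1 else 0))"
  proof
    fix x show "ginibre_weight N x *\<^sub>R indicat_real S (x ` {..<N}) =
      ginibre_weight N x * (if card {i \<in> {..<N}. x i \<in> A} = m then 1 else 0)"
      using S_iff[of x] ginibre_weight_eq_0[of x N] by (cases "inj_on x {..<N}") (auto simp: indicator_def)
  qed
  also have "(LINT x|lborels N. ginibre_weight N x * (if card {i \<in> {..<N}. x i \<in> A} = m then 1 else 0)) = fact N * ?W"
    by (intro ginibre_partition N_pos A_borel A_radial mass_nz)
  finally have meas: "measure (ginibre N) S = (fact N * ?W) / ginibre_Z N" by (simp add: divide_inverse mult.commute)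
  have meas_pos: "measure (ginibre N) S > 0" unfolding meas using Z weight_pos by simp
  have "(LINT X|uniform_measure (ginibre N) S. H X) = (LINT X|ginibre N. indicat_real S X *\<^sub>R H X) /\<^sub>R measure (ginibre N) S"
    using S H meas_pos by (intro integral_uniform_measure G.prob_space_axioms) (auto cong: measurable_cong_sets)
  also have "(LINT X|ginibre N. indicat_real S X *\<^sub>R H X) =
      (LINT x|lborels N. ginibre_weight N x *\<^sub>R (indicat_real S (x ` {..<N}) *\<^sub>R H (x ` {..<N}))) /\<^sub>R ginibre_Z N"
    using S H by (intro ginibre_integral N_pos) auto
  also have "(\<lambda>x. ginibre_weight N x *\<^sub>R (indicat_real S (x ` {..<N}) *\<^sub>R H (x ` {..<N}))) =
      (\<lambda>x. ginibre_weight N x *\<^sub>R statistic N k m A F x)"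
  proof
    fix x show "ginibre_weight N x *\<^sub>R (indicat_real S (x ` {..<N}) *\<^sub>R H (x ` {..<N})) =
      ginibre_weight N x *\<^sub>R statistic N k m A F x"
    proof (cases "inj_on x {..<N}")
      case True
      then show ?thesis using S_iff[OF True] H_eq[OF True] by (auto simp: indicator_def statistic_def)
    qed (simp add: ginibre_weight_eq_0)
  qed
  also note ginibre_statistic(1)
  finally show ?thesis
    using Z weight_pos unfolding cond_avg_def meas by (simp add: scaleR_conv_of_real field_simps)
qed

lemma restrict_PiE_UNIV: "restrict x I \<in> I \<rightarrow>\<^sub>E UNIV"
  by simp

text \<open>The contribution of mode \<open>l\<close> to the Ginibre kernel, without the factor
  \<open>N / pi\<close>. On the diagonal it is a Poisson probability.\<close>

definition mode :: "nat \<Rightarrow> nat \<Rightarrow> complex \<Rightarrow> complex \<Rightarrow> complex" where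
  "mode N l x y = (of_nat N * x * cnj y) ^ l / fact l *
     cplx (exp (- real N * ((cmod x)\<^sup>2 + (cmod y)\<^sup>2) / 2))"

text \<open>Here \<open>\<gamma> l\<close> is the fraction of the norm of mode \<open>l\<close> that
  lies in the region under consideration; dividing by it renormalises the mode there.\<close>

definition mode_kernel :: "nat \<Rightarrow> (nat \<Rightarrow> real) \<Rightarrow> nat set \<Rightarrow> complex \<Rightarrow> complex \<Rightarrow> complex" where
  "mode_kernel N \<gamma> T x y = cplx (real N / pi) * (\<Sum>l\<in>T. mode N l x y / cplx (\<gamma> l))"

lemma ginibre_fun_mode:
  assumes N: "N > 0"
  shows "ginibre_fun N l x * cnj (ginibre_fun N l y) / cplx (ginibre_norm N l * \<gamma> l) =
    cplx (real N / pi) * (mode N l x y / cplx (\<gamma> l))"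
proof -
  have e: "exp (- real N * (cmod x)\<^sup>2 / 2) * exp (- real N * (cmod y)\<^sup>2 / 2) =
     exp (- real N * ((cmod x)\<^sup>2 + (cmod y)\<^sup>2) / 2)"
    unfolding exp_add[symmetric] by (rule arg_cong[where f=exp]) (simp add: field_simps)
  have "ginibre_fun N l x * cnj (ginibre_fun N l y) =
     (x * cnj y) ^ l * cplx (exp (- real N * (cmod x)\<^sup>2 / 2) * exp (- real N * (cmod y)\<^sup>2 / 2))"
    by (simp add: ginibre_fun_def power_mult_distrib mult_ac)
  also have "\<dots> = (x * cnj y) ^ l * cplx (exp (- real N * ((cmod x)\<^sup>2 + (cmod y)\<^sup>2) / 2))"
    unfolding e ..
  finally have *: "ginibre_fun N l x * cnj (ginibre_fun N l y) =
    (x * cnj y) ^ l * cplx (exp (- real N * ((cmod x)\<^sup>2 + (cmod y)\<^sup>2) / 2))" .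
  have n: "cplx (ginibre_norm N l) = cplx pi * fact l / (of_nat N * of_nat N ^ l)"
    by (simp add: ginibre_norm_def)
  have p: "(of_nat N * x * cnj y) ^ l = of_nat N ^ l * (x * cnj y) ^ l"
    by (simp only: power_mult_distrib mult.assoc)
  have alg: "X * E / (P * f / (n * q) * c) = n / P * (q * X / f * E / c)" if "n \<noteq> 0" "q \<noteq> 0"
    for X E P f n q c :: complex
    using that by (simp add: divide_simps)
  show ?thesis
    unfolding * mode_def of_real_mult n p of_real_divide of_real_of_nat_eq using N by (intro alg) simp_all
qed

lemma ginibre_kernel_mode:
  assumes N: "N > 0" and mass: "\<And>l. l \<in> T \<Longrightarrow> ginibre_mass N A l = ginibre_norm N l * \<gamma> l"
  shows "(\<Sum>l\<in>T. ginibre_fun N l x * cnj (ginibre_fun N l y) / ginibre_mass N A l) = mode_kernel N \<gamma> T x y"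
  unfolding mode_kernel_def sum_distrib_left
  by (intro sum.cong refl) (simp only: mass ginibre_fun_mode[OF N])

lemma test_function_bounded:
  assumes "test_function k U f"
  obtains C where "\<And>x. x \<in> tuples k UNIV \<Longrightarrow> cmod (f x) \<le> C"
proof -
  obtain K where K: "compact K" "K \<subseteq> U"
    and supp: "\<And>x i. x \<in> tuples k UNIV \<Longrightarrow> f x \<noteq> 0 \<Longrightarrow> i < k \<Longrightarrow> x i \<in> K"
    by (rule test_function_support[OF assms]) blast
  obtain L where L: "L \<ge> 0" "\<And>x y. x \<in> tuples k UNIV \<Longrightarrow> y \<in> tuples k UNIV \<Longrightarrow>
    cmod (f x - f y) \<le> L * (\<Sum>i<k. dist (x i) (y i))"
    using assms by (auto simp: test_function_def elim!: lipschitz_tuplesE)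
  obtain B where B: "\<And>z. z \<in> K \<Longrightarrow> cmod z \<le> B" using compact_imp_bounded[OF K(1)] by (auto simp: bounded_iff)
  define o' :: "nat \<Rightarrow> complex" where "o' = (\<lambda>i\<in>{..<k}. 0)"
  show ?thesis
  proof (rule that[of "cmod (f o') + \<bar>L * (\<Sum>i<k. B)\<bar>"])
    fix x :: "nat \<Rightarrow> complex" assume x: "x \<in> tuples k UNIV"
    show "cmod (f x) \<le> cmod (f o') + \<bar>L * (\<Sum>i<k. B)\<bar>"
    proof (cases "f x = 0")
      case False
      have "cmod (f x - f o') \<le> L * (\<Sum>i<k. dist (x i) (o' i))"
        using x by (intro L(2)) (auto simp: o'_def)
      also have "\<dots> \<le> L * (\<Sum>i<k. B)"
        using supp[OF x False] B L(1) by (intro mult_left_mono sum_mono) (auto simp: o'_def)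
      finally show ?thesis using norm_triangle_ineq2[of "f x" "f o'"] by linarith
    qed simp
  qed
qed

lemma tuple_sum_image:
  fixes x :: "nat \<Rightarrow> complex" and N :: nat
  assumes x: "inj_on x {..<N}" and g: "inj g"
  shows "(\<Sum>\<^sub>\<infinity>y\<in>distinct_tuples k (g ` x ` {..<N}). f y) =
    (\<Sum>\<iota>\<in>inj_tuples k {..<N}. (f (\<lambda>i\<in>{..<k}. g (x (\<iota> i))) :: complex))"
proof -
  let ?\<phi> = "\<lambda>\<iota>. \<lambda>i\<in>{..<k}. g (x (\<iota> i))"
  have gx: "inj_on (\<lambda>i. g (x i)) {..<N}" using x g by (auto simp: inj_on_def)
  have bij: "bij_betw ?\<phi> (inj_tuples k {..<N}) (inj_tuples k (g ` x ` {..<N}))"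
  proof (rule bij_betwI[where g="\<lambda>y. \<lambda>i\<in>{..<k}. the_inv_into {..<N} (\<lambda>i. g (x i)) (y i)"])
    show "?\<phi> \<in> inj_tuples k {..<N} \<rightarrow> inj_tuples k (g ` x ` {..<N})"
    proof
      fix \<iota> assume "\<iota> \<in> inj_tuples k {..<N}"
      then have i: "\<iota> ` {..<k} \<subseteq> {..<N}" "inj_on \<iota> {..<k}" by (auto simp: inj_tuples_def PiE_iff)
      have "inj_on ((\<lambda>i. g (x i)) \<circ> \<iota>) {..<k}" using i gx by (intro comp_inj_on) (auto intro: inj_on_subset)
      then have "inj_on (?\<phi> \<iota>) {..<k}" by (simp add: inj_on_def)
      then show "?\<phi> \<iota> \<in> inj_tuples k (g ` x ` {..<N})" using i(1) by (auto simp: inj_tuples_def)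
    qed
    show "(\<lambda>y. \<lambda>i\<in>{..<k}. the_inv_into {..<N} (\<lambda>i. g (x i)) (y i)) \<in> inj_tuples k (g ` x ` {..<N}) \<rightarrow> inj_tuples k {..<N}"
    proof
      fix y assume "y \<in> inj_tuples k (g ` x ` {..<N})"
      then have y: "y ` {..<k} \<subseteq> (\<lambda>i. g (x i)) ` {..<N}" "inj_on y {..<k}" by (auto simp: inj_tuples_def PiE_iff image_image)
      have "the_inv_into {..<N} (\<lambda>i. g (x i)) (y i) < N" if "i < k" for i
        using the_inv_into_into[OF gx, of "y i" "{..<N}"] y(1) that by auto
      moreover have "inj_on (the_inv_into {..<N} (\<lambda>i. g (x i)) \<circ> y) {..<k}"
        using y gx by (intro comp_inj_on) (auto intro: inj_on_subset inj_on_the_inv_into)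
      then have "inj_on (\<lambda>i\<in>{..<k}. the_inv_into {..<N} (\<lambda>i. g (x i)) (y i)) {..<k}" by (simp add: inj_on_def)
      ultimately show "(\<lambda>i\<in>{..<k}. the_inv_into {..<N} (\<lambda>i. g (x i)) (y i)) \<in> inj_tuples k {..<N}"
        by (auto simp: inj_tuples_def)
    qed
    show "(\<lambda>i\<in>{..<k}. the_inv_into {..<N} (\<lambda>i. g (x i)) (?\<phi> \<iota> i)) = \<iota>" if "\<iota> \<in> inj_tuples k {..<N}" for \<iota>
    proof (rule extensionalityI[of _ "{..<k}"])
      fix i assume "i \<in> {..<k}"
      then have "\<iota> i \<in> {..<N}" using that by (auto simp: inj_tuples_def PiE_iff)
      then show "(\<lambda>i\<in>{..<k}. the_inv_into {..<N} (\<lambda>i. g (x i)) (?\<phi> \<iota> i)) i = \<iota> i"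
        using \<open>i \<in> {..<k}\<close> the_inv_into_f_f[OF gx] by simp
    qed (use that in \<open>auto simp: inj_tuples_def PiE_iff\<close>)
    show "?\<phi> (\<lambda>i\<in>{..<k}. the_inv_into {..<N} (\<lambda>i. g (x i)) (y i)) = y" if "y \<in> inj_tuples k (g ` x ` {..<N})" for y
    proof (rule extensionalityI[of _ "{..<k}"])
      fix i assume "i \<in> {..<k}"
      then have "y i \<in> (\<lambda>i. g (x i)) ` {..<N}" using that by (auto simp: inj_tuples_def PiE_iff image_image)
      then show "?\<phi> (\<lambda>i\<in>{..<k}. the_inv_into {..<N} (\<lambda>i. g (x i)) (y i)) i = y i"
        using \<open>i \<in> {..<k}\<close> f_the_inv_into_f[OF gx] by simp
    qed (use that in \<open>auto simp: inj_tuples_def PiE_iff\<close>)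
  qed
  have "(\<Sum>\<^sub>\<infinity>y\<in>distinct_tuples k (g ` x ` {..<N}). f y) = (\<Sum>y\<in>inj_tuples k (g ` x ` {..<N}). f y)"
    unfolding distinct_tuples_eq by (intro infsum_finite finite_inj_tuples) simp
  also have "\<dots> = (\<Sum>\<iota>\<in>inj_tuples k {..<N}. f (?\<phi> \<iota>))"
    by (rule sum.reindex_bij_betw[OF bij, symmetric])
  finally show ?thesis .
qed

lemma sets_conditioned_ginibre [simp, measurable_cong]:
  "sets (conditioned_ginibre N m R) = sets (config_space UNIV)"
  by (simp add: conditioned_ginibre_def)

lemma map_process_id: "sets P = sets (config_space UNIV) \<Longrightarrow> map_process (\<lambda>z. z) P = P"
  by (simp add: map_process_def distr_id2)

text \<open>A common frame for all regions: \<open>g\<close> is the identity, a nonzero dilation or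
  the rescaling at the edge, and the tuple sum of the image process becomes the tuple sum of
  \<open>F\<close> over the original one. The continuous inverse \<open>h\<close> makes preimages of
  compact sets compact, on which the measurability of the image map rests.\<close>

locale mapped_test_function =
  fixes g h :: "complex \<Rightarrow> complex" and k :: nat and U :: "complex set" and f :: "(nat \<Rightarrow> complex) \<Rightarrow> complex"
  assumes g_cont: "continuous_on UNIV g" and h_cont: "continuous_on UNIV h"
    and gh: "\<And>z. g (h z) = z" and hg: "\<And>z. h (g z) = z"
    and f_test: "test_function k U f"
begin

definition F :: "(nat \<Rightarrow> complex) \<Rightarrow> complex" where
  "F y = f (\<lambda>i\<in>{..<k}. g (y i))"

lemma inj_g: "inj g"
  by (rule inj_on_inverseI[of _ h]) (rule hg)

lemma f_borel: "f \<in> borel_measurable (lborels k)"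
  using f_test by (auto simp: test_function_def intro: lipschitz_tuples_measurable)

lemma F_borel: "F \<in> borel_measurable (lborels k)"
proof -
  have "(\<lambda>y. \<lambda>i\<in>{..<k}. g (y i)) \<in> measurable (lborels k) (lborels k)"
  proof (rule measurable_restrict)
    fix i assume i: "i \<in> {..<k}"
    have "g \<in> borel_measurable borel" by (rule borel_measurable_continuous_onI[OF g_cont])
    then show "(\<lambda>y. g (y i)) \<in> measurable (lborels k) lborel"
      using measurable_compose[OF measurable_component_singleton[OF i, of "\<lambda>_. lborel :: complex measure"], of g lborel] by simp
  qed
  then show ?thesis unfolding F_def by (rule measurable_compose[OF _ f_borel])
qed

definition H :: "complex set \<Rightarrow> complex" where
  "H X = (\<Sum>\<^sub>\<infinity>y\<in>distinct_tuples k (g ` X). f y)"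

lemma map_measurable: "(\<lambda>X. g ` X) \<in> measurable (config_space UNIV) (config_space UNIV)"
  by (rule map_config_measurable[OF g_cont h_cont gh hg])

lemma tuple_sum_borel: "(\<lambda>X. \<Sum>\<^sub>\<infinity>y\<in>distinct_tuples k X. f y) \<in> borel_measurable (config_space UNIV)"
proof -
  obtain K where "compact K" "\<And>x i. x \<in> tuples k UNIV \<Longrightarrow> f x \<noteq> 0 \<Longrightarrow> i < k \<Longrightarrow> x i \<in> K"
    by (rule test_function_support[OF f_test]) blast
  then show ?thesis using f_test by (intro tuple_sum_measurable[of k f K]) (auto simp: test_function_def)
qed

lemma H_borel: "H \<in> borel_measurable (config_space UNIV)"
  unfolding H_def by (rule measurable_compose[OF map_measurable tuple_sum_borel])

lemma H_eq:
  fixes x :: "nat \<Rightarrow> complex" and N :: nat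
  shows "inj_on x {..<N} \<Longrightarrow> H (x ` {..<N}) = (\<Sum>\<iota>\<in>inj_tuples k {..<N}. F (\<lambda>i\<in>{..<k}. x (\<iota> i)))"
  unfolding H_def by (subst tuple_sum_image[OF _ inj_g]) (auto simp: F_def intro!: sum.cong arg_cong[where f=f])

lemma expected_map_process:
  assumes "sets P = sets (config_space UNIV)"
  shows "expected_tuple_sum (map_process g P) k f = (LINT X|P. H X)"
  unfolding expected_tuple_sum_def map_process_def H_def
  using map_measurable assms by (intro integral_distr tuple_sum_borel) (simp cong: measurable_cong_sets)

lemma F_zero:
  assumes "x \<in> tuples k UNIV" "i < k" "g (x i) \<notin> U"
  shows "F x = 0"
proof (rule ccontr)
  obtain K where K: "K \<subseteq> U" "\<And>x i. x \<in> tuples k UNIV \<Longrightarrow> f x \<noteq> 0 \<Longrightarrow> i < k \<Longrightarrow> x i \<in> K"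
    by (rule test_function_support[OF f_test]) blast
  assume "F x \<noteq> 0"
  then have "(\<lambda>i\<in>{..<k}. g (x i)) i \<in> K" unfolding F_def by (rule K(2)[OF _ _ assms(2), rotated]) (rule restrict_PiE_UNIV)
  then show False using assms K(1) by auto
qed

lemma F_bounded: obtains C where "\<And>x. x \<in> tuples k UNIV \<Longrightarrow> cmod (F x) \<le> C"
proof -
  obtain C where C: "\<And>x. x \<in> tuples k UNIV \<Longrightarrow> cmod (f x) \<le> C"
    by (rule test_function_bounded[OF f_test]) blast
  show ?thesis by (rule that[of C]) (unfold F_def, rule C, rule restrict_PiE_UNIV)
qed

text \<open>\<open>A\<close> is the side that contains the region and \<open>m'\<close> the number
  of points that the event puts into \<open>A\<close>. Thus \<open>m' = m\<close> for the exterior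
  and \<open>m' = N - m\<close> for the disc.\<close>

lemma expected_conditioned:
  assumes N: "N > 0" and m': "m' \<le> N" and A: "A \<in> sets borel" "\<And>u z. cmod u = 1 \<Longrightarrow> u * z \<in> A \<longleftrightarrow> z \<in> A"
    and U: "\<And>z. g z \<in> U \<Longrightarrow> z \<in> A"
    and mA: "\<And>j. ginibre_mass N A j = ginibre_norm N j * a j" and mB: "\<And>j. ginibre_mass N (- A) j = ginibre_norm N j * b j"
    and ab: "\<And>j. a j > 0" "\<And>j. b j > 0"
    and event: "\<And>x :: nat \<Rightarrow> complex. card {i \<in> {..<N}. R < cmod (x i)} = m \<longleftrightarrow> card {i \<in> {..<N}. x i \<in> A} = m'"
  shows "expected_tuple_sum (map_process g (conditioned_ginibre N m R)) k f =
    cond_avg N m' a b (\<lambda>T. kernel_integral k F (mode_kernel N a T))"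
proof -
  obtain C where C: "\<And>x. x \<in> tuples k UNIV \<Longrightarrow> cmod (F x) \<le> C" by (rule F_bounded) blast
  have pos: "ginibre_mass N A j > 0" "ginibre_mass N (- A) j > 0" for j
    using ab ginibre_norm_pos[OF N] by (auto simp: mA mB)
  interpret radial_statistic N A k m' F C
  proof
    show "F x = 0" if "x \<in> tuples k UNIV" "i < k" "x i \<notin> A" for x i
      using that U by (intro F_zero[of x i]) auto
    show "ginibre_mass N A j \<noteq> 0" for j using pos(1)[of j] by simp
  qed (use N C F_borel A in auto)
  have "expected_tuple_sum (map_process g (conditioned_ginibre N m R)) k f = (LINT X|conditioned_ginibre N m R. H X)"
    by (intro expected_map_process) simp
  also have "\<dots> = cond_avg N m' (ginibre_mass N A) (ginibre_mass N (- A)) (\<lambda>T.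
        (LINT y|lborels k. F y * leibniz_det k
          (\<lambda>i j. \<Sum>l\<in>T. ginibre_fun N l (y i) * cnj (ginibre_fun N l (y j)) / ginibre_mass N A l)))"
    unfolding conditioned_ginibre_def
  proof (rule conditional_expectation)
    show "{X \<in> space (ginibre N). finite X \<and> card {z \<in> X. R < cmod z} = m} \<in> sets (config_space UNIV)"
      using config_finite_annulus_sets by simp
    fix x :: "nat \<Rightarrow> complex" assume x: "inj_on x {..<N}"
    have "{z \<in> x ` {..<N}. R < cmod z} = x ` {i \<in> {..<N}. R < cmod (x i)}" by auto
    moreover have "card (x ` {i \<in> {..<N}. R < cmod (x i)}) = card {i \<in> {..<N}. R < cmod (x i)}"
      by (rule card_image[OF inj_on_subset[OF x]]) auto
    ultimately have "card {z \<in> x ` {..<N}. R < cmod z} = m \<longleftrightarrow> card {i \<in> {..<N}. x i \<in> A} = m'"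
      by (simp only: event)
    then show "x ` {..<N} \<in> {X \<in> space (ginibre N). finite X \<and> card {z \<in> X. R < cmod z} = m} \<longleftrightarrow>
      card {i \<in> {..<N}. x i \<in> A} = m'" by (auto intro: finite_in_configurations)
  next
    show "0 < (\<Sum>T\<in>size_subsets N m'. bernoulli_weight N (ginibre_mass N A) (ginibre_mass N (- A)) T)"
      using pos size_subsets_nonempty[OF m'] unfolding bernoulli_weight_def
      by (intro sum_pos mult_pos_pos prod_pos) auto
  qed (use H_borel H_eq in auto)
  also have "\<dots> = cond_avg N m' (\<lambda>j. ginibre_norm N j * a j) (\<lambda>j. ginibre_norm N j * b j) (\<lambda>T. kernel_integral k F (mode_kernel N a T))"
    by (intro cond_avg_cong mA mB) (simp only: ginibre_kernel_mode[OF N mA])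
  also have "\<dots> = cond_avg N m' a b (\<lambda>T. kernel_integral k F (mode_kernel N a T))"
    by (intro cond_avg_scale ginibre_norm_pos N)
  finally show ?thesis .
qed

lemma expected_conditioned_outside:
  assumes N: "N > 0" and R: "R > 0" and m: "m \<le> N" and U: "\<And>z. g z \<in> U \<Longrightarrow> R < cmod z"
  shows "expected_tuple_sum (map_process g (conditioned_ginibre N m R)) k f =
    cond_avg N m (pois_cdf (real N * R\<^sup>2)) (\<lambda>j. 1 - pois_cdf (real N * R\<^sup>2) j) (\<lambda>T.
      kernel_integral k F (mode_kernel N (pois_cdf (real N * R\<^sup>2)) T))"
proof (rule expected_conditioned[where A="{z. R < cmod z}", OF N m])
  have l: "real N * R\<^sup>2 > 0" using N R by simp
  show "ginibre_mass N {z. R < cmod z} j = ginibre_norm N j * pois_cdf (real N * R\<^sup>2) j" for j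
    using N R by (intro ginibre_mass_outside) auto
  have "- {z. R < cmod z} = {z. cmod z \<le> R}" by auto
  then show "ginibre_mass N (- {z. R < cmod z}) j = ginibre_norm N j * (1 - pois_cdf (real N * R\<^sup>2) j)" for j
    using N R ginibre_mass_disc[of N R j] by simp
  show "0 < pois_cdf (real N * R\<^sup>2) j" "0 < 1 - pois_cdf (real N * R\<^sup>2) j" for j
    using pois_cdf_pos[OF l] pois_cdf_less_1[OF l] by auto
qed (use U in \<open>auto simp: norm_mult\<close>)

lemma expected_conditioned_inside:
  assumes N: "N > 0" and R: "R > 0" and m: "m \<le> N" and U: "\<And>z. g z \<in> U \<Longrightarrow> cmod z \<le> R"
  shows "expected_tuple_sum (map_process g (conditioned_ginibre N m R)) k f =
    cond_avg N m (pois_cdf (real N * R\<^sup>2)) (\<lambda>j. 1 - pois_cdf (real N * R\<^sup>2) j) (\<lambda>T.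
      kernel_integral k F (mode_kernel N (\<lambda>j. 1 - pois_cdf (real N * R\<^sup>2) j) ({..<N} - T)))"
proof (rule trans[OF expected_conditioned[where A="{z. cmod z \<le> R}" and m'="N - m", OF N] cond_avg_complement[OF m]])
  have l: "real N * R\<^sup>2 > 0" using N R by simp
  show "ginibre_mass N {z. cmod z \<le> R} j = ginibre_norm N j * (1 - pois_cdf (real N * R\<^sup>2) j)" for j
    using N R by (intro ginibre_mass_disc) auto
  have "- {z. cmod z \<le> R} = {z. R < cmod z}" by auto
  then show "ginibre_mass N (- {z. cmod z \<le> R}) j = ginibre_norm N j * pois_cdf (real N * R\<^sup>2) j" for j
    using N R ginibre_mass_outside[of N R j] by simp
  show "0 < pois_cdf (real N * R\<^sup>2) j" "0 < 1 - pois_cdf (real N * R\<^sup>2) j" for j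
    using pois_cdf_pos[OF l] pois_cdf_less_1[OF l] by auto
  fix x :: "nat \<Rightarrow> complex"
  have "card ({i \<in> {..<N}. R < cmod (x i)} \<union> {i \<in> {..<N}. x i \<in> {z. cmod z \<le> R}}) =
    card {i \<in> {..<N}. R < cmod (x i)} + card {i \<in> {..<N}. x i \<in> {z. cmod z \<le> R}}"
    by (rule card_Un_disjoint) auto
  moreover have "{i \<in> {..<N}. R < cmod (x i)} \<union> {i \<in> {..<N}. x i \<in> {z. cmod z \<le> R}} = {..<N}" by auto
  ultimately have "N = card {i \<in> {..<N}. R < cmod (x i)} + card {i \<in> {..<N}. x i \<in> {z. cmod z \<le> R}}"
    by (simp only: card_lessThan)
  then show "card {i \<in> {..<N}. R < cmod (x i)} = m \<longleftrightarrow> card {i \<in> {..<N}. x i \<in> {z. cmod z \<le> R}} = N - m"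
    using m by linarith
qed (use U in \<open>auto simp: norm_mult\<close>)

end

lemma uniform_measure_space:
  assumes "prob_space M" shows "uniform_measure M (space M) = M"
proof -
  interpret prob_space M by fact
  have "uniform_measure M (space M) = density M (\<lambda>_. 1)"
    unfolding uniform_measure_def by (rule density_cong) (auto simp: emeasure_space_1)
  then show ?thesis by (simp add: density_1)
qed

text \<open>The unconditioned ensemble is the ensemble conditioned on the sure event that all
  \<open>N\<close> points lie in the plane; the full set of modes is then the only possible
  one.\<close>

lemma ginibre_expectation:
  assumes N: "N > 0"
    and F: "F \<in> borel_measurable (lborels k)" "\<And>x. x \<in> tuples k UNIV \<Longrightarrow> cmod (F x) \<le> C"
    and H: "H \<in> borel_measurable (config_space UNIV)"
      "\<And>x. inj_on x {..<N} \<Longrightarrow> H (x ` {..<N}) = (\<Sum>\<iota>\<in>inj_tuples k {..<N}. F (\<lambda>i\<in>{..<k}. x (\<iota> i)))"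
  shows "(LINT X|ginibre N. H X) =
    kernel_integral k F (mode_kernel N (\<lambda>_. 1) {..<N})"
proof -
  have mA: "ginibre_mass N UNIV j = ginibre_norm N j * 1" for j using N by (simp add: ginibre_mass_UNIV)
  have pos: "ginibre_mass N UNIV j > 0" for j using ginibre_norm_pos[OF N, of j] by (simp add: mA)
  interpret radial_statistic N UNIV k N F C
    by standard (use N F pos in \<open>auto simp: less_imp_neq[symmetric]\<close>)
  have "(LINT X|ginibre N. H X) = (LINT X|uniform_measure (ginibre N) (space (ginibre N)). H X)"
    by (simp only: uniform_measure_space[OF prob_space_ginibre[OF N]])
  also have "\<dots> = cond_avg N N (ginibre_mass N UNIV) (ginibre_mass N (- UNIV)) (\<lambda>T.
        (LINT y|lborels k. F y * leibniz_det k
          (\<lambda>i j. \<Sum>l\<in>T. ginibre_fun N l (y i) * cnj (ginibre_fun N l (y j)) / ginibre_mass N UNIV l)))"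
  proof (rule conditional_expectation)
    show "space (ginibre N) \<in> sets (config_space UNIV)"
      using sets.top[of "config_space UNIV"] by simp
    show "0 < (\<Sum>T\<in>size_subsets N N. bernoulli_weight N (ginibre_mass N UNIV) (ginibre_mass N (- UNIV)) T)"
      using pos by (simp add: size_subsets_full bernoulli_weight_def prod_pos)
    fix x :: "nat \<Rightarrow> complex"
    show "x ` {..<N} \<in> space (ginibre N) \<longleftrightarrow> card {i \<in> {..<N}. x i \<in> UNIV} = N"
      by (auto intro: finite_in_configurations)
  qed (use H in auto)
  also have "\<dots> = kernel_integral k F (mode_kernel N (\<lambda>_. 1) {..<N})"
    using pos by (simp only: cond_avg_full ginibre_kernel_mode[OF N mA])
  finally show ?thesis .
qed

lemma (in mapped_test_function) expected_ginibre:
  assumes N: "N > 0"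
  shows "expected_tuple_sum (map_process g (ginibre N)) k f =
    kernel_integral k F (mode_kernel N (\<lambda>_. 1) {..<N})"
proof -
  obtain C where C: "\<And>x. x \<in> tuples k UNIV \<Longrightarrow> cmod (F x) \<le> C" by (rule F_bounded) blast
  have "expected_tuple_sum (map_process g (ginibre N)) k f = (LINT X|ginibre N. H X)"
    by (intro expected_map_process) simp
  also have "\<dots> = kernel_integral k F (mode_kernel N (\<lambda>_. 1) {..<N})"
    by (rule ginibre_expectation[OF N F_borel C H_borel H_eq])
  finally show ?thesis .
qed

text \<open>A count is a tuple sum for \<open>k = 1\<close>, but the indicator of the disc is not
  Lipschitz. The proof therefore goes through \<open>ginibre_expectation\<close>, which asks only
  for a bounded measurable function.\<close>

lemma expected_count_ginibre:
  assumes g: "continuous_on UNIV g" "continuous_on UNIV h" "\<And>z. g (h z) = z" "\<And>z. h (g z) = z"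
    and N: "N > 0"
  shows "cplx (expected_count (map_process g (ginibre N)) (ball 0 1)) =
    (LINT y|lborels 1. indicator (ball 0 1) (g (y 0)) *
      kernel_det 1 (mode_kernel N (\<lambda>_. 1) {..<N}) y)"
proof -
  have cnt: "(\<lambda>X. card (X \<inter> ball 0 1)) \<in> measurable (config_space UNIV) (count_space UNIV)"
    by (rule config_count_measurable[of _ "cball 0 1"]) auto
  have map: "(\<lambda>X. g ` X) \<in> measurable (config_space UNIV) (config_space UNIV)"
    by (rule map_config_measurable[OF g])
  have "expected_count (map_process g (ginibre N)) (ball 0 1) = (LINT X|ginibre N. real (card (g ` X \<inter> ball 0 1)))"
    unfolding expected_count_def map_process_def
    using map cnt by (intro integral_distr) (auto cong: measurable_cong_sets intro: measurable_compose)
  then have "cplx (expected_count (map_process g (ginibre N)) (ball 0 1)) =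
     (LINT X|ginibre N. cplx (real (card (g ` X \<inter> ball 0 1))))"
    by (simp only: integral_complex_of_real)
  also have "\<dots> = (LINT y|lborels 1. indicator (ball 0 1) (g (y 0)) *
      kernel_det 1 (mode_kernel N (\<lambda>_. 1) {..<N}) y)"
  proof (rule ginibre_expectation[OF N])
    have "g \<in> borel_measurable borel" by (rule borel_measurable_continuous_onI[OF g(1)])
    then have "(\<lambda>y. g (y 0)) \<in> borel_measurable (lborels 1)"
      by (intro measurable_compose[OF measurable_component_singleton[of 0 "{..<1}" "\<lambda>_. lborel"]]) auto
    from measurable_compose[OF this, of "indicator (ball 0 1) :: complex \<Rightarrow> complex" borel]
    show "(\<lambda>y. indicator (ball 0 1) (g (y 0)) :: complex) \<in> borel_measurable (lborels 1)"
      by (simp add: borel_measurable_indicator)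
    show "cmod (indicator (ball 0 1) (g (x 0))) \<le> 1" for x by (simp add: indicator_def)
    show "(\<lambda>X. cplx (real (card (g ` X \<inter> ball 0 1)))) \<in> borel_measurable (config_space UNIV)"
      using measurable_compose[OF map cnt] by (rule measurable_compose) simp
    fix x :: "nat \<Rightarrow> complex" assume x: "inj_on x {..<N}"
    have gx: "inj_on (\<lambda>i. g (x i)) {..<N}"
    proof (rule inj_onI)
      fix a b assume "a \<in> {..<N}" "b \<in> {..<N}" "g (x a) = g (x b)"
      have "x a = h (g (x a))" by (rule g(4)[symmetric])
      also have "\<dots> = x b" unfolding \<open>g (x a) = g (x b)\<close> by (rule g(4))
      finally show "a = b" using x \<open>a \<in> {..<N}\<close> \<open>b \<in> {..<N}\<close> by (simp add: inj_on_eq_iff)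
    qed
    have "g ` x ` {..<N} \<inter> ball 0 1 = (\<lambda>i. g (x i)) ` {i \<in> {..<N}. g (x i) \<in> ball 0 1}" by auto
    moreover have "card ((\<lambda>i. g (x i)) ` {i \<in> {..<N}. g (x i) \<in> ball 0 1}) = card {i \<in> {..<N}. g (x i) \<in> ball 0 1}"
      by (rule card_image[OF inj_on_subset[OF gx]]) auto
    ultimately have "card (g ` x ` {..<N} \<inter> ball 0 1) = card {i \<in> {..<N}. g (x i) \<in> ball 0 1}" by simp
    also have "cplx (real \<dots>) = (\<Sum>i<N. indicator (ball 0 1) (g (x i)))"
    proof -
      have "(\<Sum>i<N. indicator (ball 0 1) (g (x i)) :: complex) = (\<Sum>i\<in>{i \<in> {..<N}. g (x i) \<in> ball 0 1}. 1)"
        by (rule sum.mono_neutral_cong_right) (auto simp: indicator_def)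
      then show ?thesis by simp
    qed
    also have "\<dots> = (\<Sum>\<iota>\<in>inj_tuples 1 {..<N}. indicator (ball 0 1) (g ((\<lambda>i\<in>{..<1}. x (\<iota> i)) 0)))"
    proof (rule sum.reindex_bij_witness[of _ "\<lambda>\<iota>. \<iota> 0" "\<lambda>i. \<lambda>_\<in>{..<1}. i"])
      fix \<iota> assume "\<iota> \<in> inj_tuples 1 {..<N}"
      then have \<iota>: "\<iota> \<in> {..<1::nat} \<rightarrow>\<^sub>E {..<N}" by (simp add: inj_tuples_def)
      show "(\<lambda>_\<in>{..<1}. \<iota> 0) = \<iota>"
      proof (rule extensionalityI[of _ "{..<1}"])
        show "\<iota> \<in> extensional {..<1}" using \<iota> unfolding PiE_iff by blast
      qed auto
      show "\<iota> 0 \<in> {..<N}" using \<iota> by (rule PiE_mem) simp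
    next
      fix i assume "i \<in> {..<N}"
      then show "(\<lambda>_\<in>{..<1}. i) \<in> inj_tuples 1 {..<N}" by (simp add: inj_tuples_def inj_on_def)
    qed simp_all
    finally show "cplx (real (card (g ` x ` {..<N} \<inter> ball 0 1))) =
      (\<Sum>\<iota>\<in>inj_tuples 1 {..<N}. indicator (ball 0 1) (g ((\<lambda>i\<in>{..<1}. x (\<iota> i)) 0)))" .
  qed
  finally show ?thesis .
qed

section \<open>Limits of mixtures of determinantal processes\<close>

text \<open>Dividing all factors by \<open>C\<close> reduces the claim to factors of modulus at most
  1.\<close>

lemma norm_prod_diff_le:
  fixes z w :: "nat \<Rightarrow> complex"
  assumes "C \<ge> 1" "\<And>i. i < k \<Longrightarrow> cmod (z i) \<le> C" "\<And>i. i < k \<Longrightarrow> cmod (w i) \<le> C"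
  shows "cmod ((\<Prod>i<k. z i) - (\<Prod>i<k. w i)) \<le> C ^ k * (\<Sum>i<k. cmod (z i - w i))"
proof -
  have C: "C > 0" using assms(1) by linarith
  let ?z = "\<lambda>i. z i / cplx C" and ?w = "\<lambda>i. w i / cplx C"
  have p: "(\<Prod>i<k. u i) = cplx C ^ k * (\<Prod>i<k. u i / cplx C)" for u :: "nat \<Rightarrow> complex"
    using C by (simp add: prod_dividef)
  have "cmod ((\<Prod>i<k. z i) - (\<Prod>i<k. w i)) = C ^ k * cmod ((\<Prod>i<k. ?z i) - (\<Prod>i<k. ?w i))"
    unfolding p[of z] p[of w] right_diff_distrib[symmetric] using C by (simp add: norm_mult norm_power)
  also have "\<dots> \<le> C ^ k * (\<Sum>i<k. cmod (?z i - ?w i))"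
    using C assms by (intro mult_left_mono norm_prod_diff) (auto simp: norm_divide)
  also have "\<dots> \<le> C ^ k * (\<Sum>i<k. cmod (z i - w i))"
  proof (intro mult_left_mono sum_mono)
    fix i
    have "cmod (?z i - ?w i) = cmod (z i - w i) / C" using C by (simp add: norm_divide flip: diff_divide_distrib)
    also have "\<dots> \<le> cmod (z i - w i) / 1" using assms(1) by (intro divide_left_mono) auto
    finally show "cmod (?z i - ?w i) \<le> cmod (z i - w i)" by simp
  qed (use C in auto)
  finally show ?thesis .
qed

lemma leibniz_det_bound:
  fixes M :: "nat \<Rightarrow> nat \<Rightarrow> complex"
  assumes "\<And>i j. i < k \<Longrightarrow> j < k \<Longrightarrow> cmod (M i j) \<le> C"
  shows "cmod (leibniz_det k M) \<le> fact k * C ^ k"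
proof -
  have "cmod (leibniz_det k M) \<le> (\<Sum>\<pi> | \<pi> permutes {..<k}. C ^ k)"
    unfolding leibniz_det_def
  proof (rule sum_norm_le)
    fix \<pi> assume "\<pi> \<in> {\<pi>. \<pi> permutes {..<k}}"
    then have \<pi>: "\<pi> permutes {..<k}" by simp
    have "cmod (of_int (sign \<pi>) * (\<Prod>i<k. M i (\<pi> i))) = (\<Prod>i<k. cmod (M i (\<pi> i)))"
      by (simp add: norm_mult prod_norm sign_def)
    also have "\<dots> \<le> (\<Prod>i<k. C)"
      using permutes_in_image[OF \<pi>] assms by (intro prod_mono) auto
    finally show "cmod (of_int (sign \<pi>) * (\<Prod>i<k. M i (\<pi> i))) \<le> C ^ k" by simp
  qed
  then show ?thesis by (simp add: card_permutations)
qed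

lemma leibniz_det_diff:
  fixes M M' :: "nat \<Rightarrow> nat \<Rightarrow> complex"
  assumes "C \<ge> 1" "\<And>i j. i < k \<Longrightarrow> j < k \<Longrightarrow> cmod (M i j) \<le> C" "\<And>i j. i < k \<Longrightarrow> j < k \<Longrightarrow> cmod (M' i j) \<le> C"
  shows "cmod (leibniz_det k M - leibniz_det k M') \<le> fact k * C ^ k * (\<Sum>i<k. \<Sum>j<k. cmod (M i j - M' i j))"
proof -
  let ?S = "\<Sum>i<k. \<Sum>j<k. cmod (M i j - M' i j)"
  have "cmod (leibniz_det k M - leibniz_det k M') =
    cmod (\<Sum>\<pi> | \<pi> permutes {..<k}. of_int (sign \<pi>) * ((\<Prod>i<k. M i (\<pi> i)) - (\<Prod>i<k. M' i (\<pi> i))))"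
    by (simp add: leibniz_det_def sum_subtractf right_diff_distrib)
  also have "\<dots> \<le> (\<Sum>\<pi> | \<pi> permutes {..<k}. C ^ k * ?S)"
  proof (rule sum_norm_le)
    fix \<pi> assume "\<pi> \<in> {\<pi>. \<pi> permutes {..<k}}"
    then have \<pi>: "\<pi> permutes {..<k}" by simp
    have \<pi>k: "\<pi> i < k" if "i < k" for i using permutes_in_image[OF \<pi>] that by auto
    have "cmod (of_int (sign \<pi>) * ((\<Prod>i<k. M i (\<pi> i)) - (\<Prod>i<k. M' i (\<pi> i)))) =
      cmod ((\<Prod>i<k. M i (\<pi> i)) - (\<Prod>i<k. M' i (\<pi> i)))"
      by (simp add: norm_mult sign_def)
    also have "\<dots> \<le> C ^ k * (\<Sum>i<k. cmod (M i (\<pi> i) - M' i (\<pi> i)))"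
      using assms \<pi>k by (intro norm_prod_diff_le) auto
    also have "\<dots> \<le> C ^ k * ?S"
    proof (intro mult_left_mono sum_mono)
      fix i assume "i \<in> {..<k}"
      then show "cmod (M i (\<pi> i) - M' i (\<pi> i)) \<le> (\<Sum>j<k. cmod (M i j - M' i j))"
        using \<pi>k by (intro member_le_sum[of "\<pi> i" "{..<k}" "\<lambda>j. cmod (M i j - M' i j)"]) auto
    qed (use assms(1) in auto)
    finally show "cmod (of_int (sign \<pi>) * ((\<Prod>i<k. M i (\<pi> i)) - (\<Prod>i<k. M' i (\<pi> i)))) \<le> C ^ k * ?S" .
  qed
  finally show ?thesis by (simp add: card_permutations mult.assoc)
qed

lemma leibniz_det_measurable:
  assumes "\<And>i j. i < k \<Longrightarrow> j < k \<Longrightarrow> (\<lambda>y. M y i j) \<in> borel_measurable P"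
  shows "(\<lambda>y. leibniz_det k (M y) :: complex) \<in> borel_measurable P"
  unfolding leibniz_det_def
proof (intro borel_measurable_sum borel_measurable_times borel_measurable_const borel_measurable_prod)
  fix \<pi> i assume "\<pi> \<in> {\<pi>. \<pi> permutes {..<k}}" "i \<in> {..<k}"
  then show "(\<lambda>y. M y i (\<pi> i)) \<in> borel_measurable P"
    using permutes_in_image[of \<pi> "{..<k}" i] by (intro assms) auto
qed

lemma integrable_bounded_support:
  fixes f :: "(nat \<Rightarrow> complex) \<Rightarrow> complex"
  assumes f: "f \<in> borel_measurable (lborels k)" and Q: "Q \<in> sets borel" "emeasure lborel Q < \<infinity>"
    and supp: "\<And>y i. y \<in> tuples k UNIV \<Longrightarrow> f y \<noteq> 0 \<Longrightarrow> i < k \<Longrightarrow> y i \<in> Q"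
    and bound: "\<And>y. y \<in> tuples k Q \<Longrightarrow> cmod (f y) \<le> C"
  shows "integrable (lborels k) f"
    and "integrable (lborels k) (\<lambda>y. C * indicat_real (tuples k Q) y)"
    and "\<And>y. y \<in> tuples k UNIV \<Longrightarrow> cmod (f y) \<le> C * indicat_real (tuples k Q) y"
proof -
  let ?M = "lborels k"
  have "emeasure ?M (tuples k Q) = (\<Prod>i<k. emeasure lborel Q)"
    using Q by (intro lborel_product.emeasure_PiM) auto
  also have "\<dots> < \<infinity>" using Q(2) by (simp add: power_less_top_ennreal)
  finally have fin: "emeasure ?M (tuples k Q) < \<infinity>" .
  have QM: "(tuples k Q) \<in> sets ?M" using Q by (intro sets_PiM_I_finite) auto
  show i: "integrable ?M (\<lambda>y. C * indicat_real (tuples k Q) y)"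
    using fin QM by (intro integrable_mult_right integrable_real_indicator) auto
  show b: "cmod (f y) \<le> C * indicat_real (tuples k Q) y" if y: "y \<in> tuples k UNIV" for y
  proof (cases "y \<in> tuples k Q")
    case False
    then have "f y = 0" using supp[OF y] y by (auto simp: PiE_iff)
    then show ?thesis using False by simp
  qed (use bound in simp)
  show "integrable ?M f"
  proof (rule Bochner_Integration.integrable_bound[OF i f AE_I2])
    fix y assume "y \<in> space ?M"
    then have "cmod (f y) \<le> C * indicat_real (tuples k Q) y" by (intro b) (simp add: space_PiM)
    then show "norm (f y) \<le> norm (C * indicat_real (tuples k Q) y)" by simp
  qed
qed

text \<open>Convergence of the kernels in probability suffices for mixtures of determinantal processes,
  because uniformly bounded kernels have uniformly bounded correlation functions.\<close>

lemma mixture_correlations_tendsto: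
  fixes K :: "nat \<Rightarrow> 'a \<Rightarrow> complex \<Rightarrow> complex \<Rightarrow> complex"
  assumes F: "F \<in> borel_measurable (lborels k)" "\<And>y. y \<in> tuples k UNIV \<Longrightarrow> cmod (F y) \<le> C0"
    and Q: "Q \<in> sets borel" "emeasure lborel Q < \<infinity>"
    and supp: "\<And>y i. y \<in> tuples k UNIV \<Longrightarrow> F y \<noteq> 0 \<Longrightarrow> i < k \<Longrightarrow> y i \<in> Q"
    and w: "\<forall>\<^sub>F n in sequentially. finite (\<T> n) \<and> (\<forall>T\<in>\<T> n. w n T \<ge> 0) \<and> (\<Sum>T\<in>\<T> n. w n T) = (1::real)"
    and K_meas: "\<And>n T i j. i < k \<Longrightarrow> j < k \<Longrightarrow> (\<lambda>y. K n T (y i) (y j)) \<in> borel_measurable (lborels k)"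
    and Kl_meas: "\<And>i j. i < k \<Longrightarrow> j < k \<Longrightarrow> (\<lambda>y. Kl (y i) (y j)) \<in> borel_measurable (lborels k)"
    and K_bound: "\<forall>\<^sub>F n in sequentially. \<forall>T\<in>\<T> n. \<forall>x\<in>Q. \<forall>y\<in>Q. cmod (K n T x y) \<le> C"
    and Kl_bound: "\<And>x y. x \<in> Q \<Longrightarrow> y \<in> Q \<Longrightarrow> cmod (Kl x y) \<le> C"
    and conv: "AE y in lborels k. y \<in> tuples k Q \<longrightarrow> (\<forall>i<k. \<forall>j<k.
      (\<lambda>n. \<Sum>T\<in>\<T> n. w n T * cmod (K n T (y i) (y j) - Kl (y i) (y j))) \<longlonglongrightarrow> 0)"
  shows "(\<lambda>n. \<Sum>T\<in>\<T> n. cplx (w n T) *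
      kernel_integral k F (K n T))
    \<longlonglongrightarrow> (kernel_integral k F Kl)"
proof -
  let ?M = "lborels k"
  \<comment> \<open>The perturbation bound \<open>leibniz_det_diff\<close> asks for a bound of at
    least 1.\<close>
  define D where "D = max C 1"
  have D: "D \<ge> 1" "C \<le> D" by (auto simp: D_def)
  obtain n1 where n1: "\<forall>n\<ge>n1. finite (\<T> n) \<and> (\<forall>T\<in>\<T> n. w n T \<ge> 0) \<and> (\<Sum>T\<in>\<T> n. w n T) = 1"
    using w unfolding eventually_sequentially by (rule exE)
  obtain n2 where n2: "\<forall>n\<ge>n2. \<forall>T\<in>\<T> n. \<forall>x\<in>Q. \<forall>y\<in>Q. cmod (K n T x y) \<le> C"
    using K_bound unfolding eventually_sequentially by (rule exE)
  define n0 where "n0 = max n1 n2"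
  have n0: "finite (\<T> n)" "T \<in> \<T> n \<Longrightarrow> w n T \<ge> 0" "(\<Sum>T\<in>\<T> n. w n T) = 1"
      "T \<in> \<T> n \<Longrightarrow> x \<in> Q \<Longrightarrow> y \<in> Q \<Longrightarrow> cmod (K n T x y) \<le> D" if n: "n \<ge> n0" for n T x y
  proof -
    have "n \<ge> n1" "n \<ge> n2" using n by (simp_all add: n0_def)
    from n1[rule_format, OF this(1)] n2[rule_format, OF this(2)] D(2)
    show "finite (\<T> n)" "T \<in> \<T> n \<Longrightarrow> w n T \<ge> 0" "(\<Sum>T\<in>\<T> n. w n T) = 1"
      "T \<in> \<T> n \<Longrightarrow> x \<in> Q \<Longrightarrow> y \<in> Q \<Longrightarrow> cmod (K n T x y) \<le> D"
      by (simp_all, fastforce)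
  qed
  have C0: "0 \<le> C0" using F(2)[OF restrict_PiE_UNIV] norm_ge_zero by (rule order.trans[rotated])
  have CD: "0 \<le> fact k * D ^ k" using D(1) by simp
  have Kl_D: "cmod (Kl x y) \<le> D" if "x \<in> Q" "y \<in> Q" for x y
    using Kl_bound[OF that] D(2) by (rule order.trans)
  define d where "d n T y = kernel_det k (K n T) y" for n T and y :: "nat \<Rightarrow> complex"
  define dl where "dl y = kernel_det k Kl y" for y :: "nat \<Rightarrow> complex"
  have d_meas: "(\<lambda>y. F y * d n T y) \<in> borel_measurable ?M" for n T
    unfolding d_def by (intro borel_measurable_times F(1) leibniz_det_measurable K_meas)
  have dl_meas: "(\<lambda>y. F y * dl y) \<in> borel_measurable ?M"
    unfolding dl_def by (intro borel_measurable_times F(1) leibniz_det_measurable Kl_meas)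
  have d_bound: "cmod (d n T y) \<le> fact k * D ^ k" if "n \<ge> n0" "T \<in> \<T> n" "y \<in> tuples k Q" for n T y
    unfolding d_def using that n0(4) by (intro leibniz_det_bound) (auto simp: PiE_iff)
  have Fd_bound: "cmod (F y * d n T y) \<le> C0 * (fact k * D ^ k)" if "n \<ge> n0" "T \<in> \<T> n" "y \<in> tuples k Q" for n T y
  proof -
    have "cmod (F y) \<le> C0" using that(3) by (intro F(2)) (auto simp: PiE_iff)
    then show ?thesis
      unfolding norm_mult using d_bound[OF that] C0 by (intro mult_mono) auto
  qed
  have int: "integrable ?M (\<lambda>y. F y * d n T y)" if "n \<ge> n0" "T \<in> \<T> n" for n T
    using integrable_bounded_support(1)[OF d_meas Q, of n T "C0 * (fact k * D ^ k)"] supp Fd_bound[OF that] by auto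
  define s where "s n y = (\<Sum>T\<in>\<T> n. cplx (w n T) * (F y * d n T y))" for n y
  have s_eq: "integral\<^sup>L ?M (s n) = (\<Sum>T\<in>\<T> n. cplx (w n T) * (LINT y|?M. F y * d n T y))" if "n \<ge> n0" for n
    unfolding s_def using int[OF that] by (subst Bochner_Integration.integral_sum) auto
  have s_supp: "s n y = 0" if "y \<in> tuples k UNIV" "y \<notin> tuples k Q" for n y
  proof -
    have "F y = 0" using supp[OF that(1)] that by (auto simp: PiE_iff)
    then show ?thesis by (simp add: s_def)
  qed
  have s_bound: "cmod (s n y) \<le> C0 * (fact k * D ^ k) * indicat_real (tuples k Q) y"
    if n: "n \<ge> n0" and y: "y \<in> tuples k UNIV" for n y
  proof (cases "y \<in> tuples k Q")
    case True
    have "cmod (s n y) \<le> (\<Sum>T\<in>\<T> n. w n T * (C0 * (fact k * D ^ k)))"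
      unfolding s_def
    proof (rule sum_norm_le)
      fix T assume T: "T \<in> \<T> n"
      show "cmod (cplx (w n T) * (F y * d n T y)) \<le> w n T * (C0 * (fact k * D ^ k))"
        unfolding norm_mult[of "cplx (w n T)"]
        using n0(2)[OF n T] Fd_bound[OF n T True] by (simp add: mult_left_mono)
    qed
    also have "\<dots> = C0 * (fact k * D ^ k)" using n0(3)[OF n] by (simp only: sum_distrib_right[symmetric] mult_1)
    finally show ?thesis using True by simp
  qed (use s_supp[OF y] in simp)
  \<comment> \<open>The bounds on weights and kernels hold only from \<open>n0\<close> on, whereas
    dominated convergence wants them for every index; hence the shift.\<close>
  have "(\<lambda>n. integral\<^sup>L ?M (s (n + n0))) \<longlonglongrightarrow> (LINT y|?M. F y * dl y)"
  proof (rule integral_dominated_convergence[where w="\<lambda>y. C0 * (fact k * D ^ k) * indicat_real (tuples k Q) y"])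
    show "(\<lambda>y. F y * dl y) \<in> borel_measurable ?M" by (rule dl_meas)
    show "s (n + n0) \<in> borel_measurable ?M" for n
      unfolding s_def by (intro borel_measurable_sum borel_measurable_times borel_measurable_const d_meas[unfolded])
    show "integrable ?M (\<lambda>y. C0 * (fact k * D ^ k) * indicat_real (tuples k Q) y)"
      by (rule integrable_bounded_support(2)[of "\<lambda>_. 0" k Q "C0 * (fact k * D ^ k)"])
        (use Q mult_nonneg_nonneg[OF C0 CD] in simp_all)
    show "AE y in ?M. norm (s (n + n0) y) \<le> C0 * (fact k * D ^ k) * indicat_real (tuples k Q) y" for n
    proof (rule AE_I2)
      fix y assume "y \<in> space ?M"
      then show "norm (s (n + n0) y) \<le> C0 * (fact k * D ^ k) * indicat_real (tuples k Q) y"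
        by (intro s_bound) (simp_all add: space_PiM)
    qed
    show "AE y in ?M. (\<lambda>n. s (n + n0) y) \<longlonglongrightarrow> F y * dl y"
      using conv
    proof (rule AE_mp, intro AE_I2 impI)
      fix y assume "y \<in> space ?M" and cv: "y \<in> tuples k Q \<longrightarrow> (\<forall>i<k. \<forall>j<k.
        (\<lambda>n. \<Sum>T\<in>\<T> n. w n T * cmod (K n T (y i) (y j) - Kl (y i) (y j))) \<longlonglongrightarrow> 0)"
      then have y: "y \<in> tuples k UNIV" by (simp add: space_PiM)
      show "(\<lambda>n. s (n + n0) y) \<longlonglongrightarrow> F y * dl y"
      proof (cases "y \<in> tuples k Q")
        case False
        then have "F y = 0" using supp[OF y] y by (auto simp: PiE_iff)
        then show ?thesis by (simp add: s_def)
      next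
        case True
        let ?e = "\<lambda>n. \<Sum>i<k. \<Sum>j<k. \<Sum>T\<in>\<T> n. w n T * cmod (K n T (y i) (y j) - Kl (y i) (y j))"
        have e0: "?e \<longlonglongrightarrow> (\<Sum>i<k. \<Sum>j<k. 0)"
          using cv True by (intro tendsto_sum) auto
        then have e1: "(\<lambda>n. cmod (F y) * (fact k * D ^ k * ?e (n + n0))) \<longlonglongrightarrow> 0"
          using LIMSEQ_ignore_initial_segment[OF e0, of n0]
          by (auto intro!: tendsto_mult_right_zero)
        have "(\<lambda>n. s (n + n0) y - F y * dl y) \<longlonglongrightarrow> 0"
        proof (rule Lim_null_comparison[OF always_eventually e1], rule allI)
          fix n
          let ?n = "n + n0"
          have n: "?n \<ge> n0" by simp
          have "F y * dl y = (\<Sum>T\<in>\<T> ?n. cplx (w ?n T) * (F y * dl y))"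
            using n0(3)[OF n] by (simp only: sum_distrib_right[symmetric] of_real_sum[symmetric] of_real_1 mult_1)
          then have "s ?n y - F y * dl y = F y * (\<Sum>T\<in>\<T> ?n. cplx (w ?n T) * (d ?n T y - dl y))"
            by (simp add: s_def sum_subtractf sum_distrib_left algebra_simps)
          then have "norm (s ?n y - F y * dl y) = cmod (F y) * cmod (\<Sum>T\<in>\<T> ?n. cplx (w ?n T) * (d ?n T y - dl y))"
            by (simp add: norm_mult)
          also have "\<dots> \<le> cmod (F y) * (\<Sum>T\<in>\<T> ?n. w ?n T * (fact k * D ^ k * (\<Sum>i<k. \<Sum>j<k. cmod (K ?n T (y i) (y j) - Kl (y i) (y j)))))"
          proof (intro mult_left_mono sum_norm_le)
            fix T assume T: "T \<in> \<T> ?n"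
            have "cmod (d ?n T y - dl y) \<le> fact k * D ^ k * (\<Sum>i<k. \<Sum>j<k. cmod (K ?n T (y i) (y j) - Kl (y i) (y j)))"
              unfolding d_def dl_def
              using D True by (intro leibniz_det_diff n0(4)[OF n T] Kl_D) (auto simp: PiE_iff)
            then show "cmod (cplx (w ?n T) * (d ?n T y - dl y)) \<le>
              w ?n T * (fact k * D ^ k * (\<Sum>i<k. \<Sum>j<k. cmod (K ?n T (y i) (y j) - Kl (y i) (y j))))"
              using n0(2)[OF n T] by (simp add: norm_mult mult_left_mono)
          qed auto
          also have "(\<Sum>T\<in>\<T> ?n. w ?n T * (fact k * D ^ k * (\<Sum>i<k. \<Sum>j<k. cmod (K ?n T (y i) (y j) - Kl (y i) (y j))))) =
              fact k * D ^ k * ?e ?n"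
          proof -
            have "?e ?n = (\<Sum>i<k. \<Sum>T\<in>\<T> ?n. \<Sum>j<k. w ?n T * cmod (K ?n T (y i) (y j) - Kl (y i) (y j)))"
              by (intro sum.cong refl sum.swap)
            also have "\<dots> = (\<Sum>T\<in>\<T> ?n. \<Sum>i<k. \<Sum>j<k. w ?n T * cmod (K ?n T (y i) (y j) - Kl (y i) (y j)))"
              by (rule sum.swap)
            finally show ?thesis by (simp add: sum_distrib_left mult_ac)
          qed
          finally show "norm (s ?n y - F y * dl y) \<le> cmod (F y) * (fact k * D ^ k * ?e ?n)" .
        qed
        then show ?thesis by (simp add: LIM_zero_iff)
      qed
    qed
  qed
  then have "(\<lambda>n. integral\<^sup>L ?M (s n)) \<longlonglongrightarrow> (LINT y|?M. F y * dl y)"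
    by (rule LIMSEQ_offset)
  moreover have "\<forall>\<^sub>F n in sequentially. integral\<^sup>L ?M (s n) = (\<Sum>T\<in>\<T> n. cplx (w n T) * (LINT y|?M. F y * d n T y))"
    using s_eq by (auto simp: eventually_sequentially)
  ultimately have "(\<lambda>n. \<Sum>T\<in>\<T> n. cplx (w n T) * (LINT y|?M. F y * d n T y)) \<longlonglongrightarrow> (LINT y|?M. F y * dl y)"
    by (rule Lim_transform_eventually)
  then show ?thesis unfolding d_def dl_def .
qed

section \<open>Conditioned Bernoulli choices and Poisson estimates\<close>

definition bernoulli_prob :: "nat \<Rightarrow> nat \<Rightarrow> (nat \<Rightarrow> real) \<Rightarrow> (nat \<Rightarrow> real) \<Rightarrow> nat set \<Rightarrow> real" where
  "bernoulli_prob N m a b T = bernoulli_weight N a b T / (\<Sum>T\<in>size_subsets N m. bernoulli_weight N a b T)"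

lemma bernoulli_weight_pos:
  assumes "\<And>j. j < N \<Longrightarrow> a j > 0" "\<And>j. j < N \<Longrightarrow> b j > 0" "T \<in> size_subsets N m"
  shows "bernoulli_weight N a b T > 0"
  using assms unfolding bernoulli_weight_def by (intro mult_pos_pos prod_pos) (auto simp: size_subsets_def)

lemma bernoulli_prob_space:
  assumes "\<And>j. j < N \<Longrightarrow> a j > 0" "\<And>j. j < N \<Longrightarrow> b j > 0" "m \<le> N"
  shows "T \<in> size_subsets N m \<Longrightarrow> bernoulli_prob N m a b T \<ge> 0"
    and "(\<Sum>T\<in>size_subsets N m. bernoulli_prob N m a b T) = 1"
proof -
  have pos: "(\<Sum>T\<in>size_subsets N m. bernoulli_weight N a b T) > 0"
    using size_subsets_nonempty[OF assms(3)] bernoulli_weight_pos[of N a b _ m] assms by (intro sum_pos) auto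
  show "T \<in> size_subsets N m \<Longrightarrow> bernoulli_prob N m a b T \<ge> 0"
    using bernoulli_weight_pos[of N a b T m] assms pos by (simp add: bernoulli_prob_def less_imp_le)
  show "(\<Sum>T\<in>size_subsets N m. bernoulli_prob N m a b T) = 1"
    using pos by (simp add: bernoulli_prob_def flip: sum_divide_distrib)
qed

lemma cond_avg_eq_prob:
  "cond_avg N m a b G = (\<Sum>T\<in>size_subsets N m. cplx (bernoulli_prob N m a b T) * G T)"
  by (simp add: cond_avg_def bernoulli_prob_def sum_divide_distrib)

lemma bernoulli_weight_swap:
  assumes T: "T \<in> size_subsets N m" and ij: "i \<in> T" "j \<notin> T" "i < N" "j < N"
  shows "a j * b i * bernoulli_weight N a b T = a i * b j * bernoulli_weight N a b (insert j (T - {i}))"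
    and "insert j (T - {i}) \<in> size_subsets N m"
proof -
  have fin: "finite T" and Tn: "T \<subseteq> {..<N}" and card: "card T = m"
    using T by (auto simp: size_subsets_def intro: finite_subset)
  have 1: "(\<Prod>l\<in>T. a l) = a i * (\<Prod>l\<in>T - {i}. a l)" using fin ij by (intro prod.remove)
  have 2: "(\<Prod>l\<in>{..<N} - T. b l) = b j * (\<Prod>l\<in>{..<N} - T - {j}. b l)" using ij by (intro prod.remove) auto
  have 3: "(\<Prod>l\<in>insert j (T - {i}). a l) = a j * (\<Prod>l\<in>T - {i}. a l)" using fin ij by (intro prod.insert) auto
  have "{..<N} - insert j (T - {i}) = insert i ({..<N} - T - {j})" using ij Tn by auto
  then have 4: "(\<Prod>l\<in>{..<N} - insert j (T - {i}). b l) = b i * (\<Prod>l\<in>{..<N} - T - {j}. b l)"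
    using ij by simp
  show "a j * b i * bernoulli_weight N a b T = a i * b j * bernoulli_weight N a b (insert j (T - {i}))"
    unfolding bernoulli_weight_def 1 2 3 4 by (simp add: mult_ac)
  have "card (T - {i}) = m - 1" "m > 0" using fin ij card card_gt_0_iff[of T] by auto
  moreover have "card (insert j (T - {i})) = Suc (card (T - {i}))" using fin ij by (intro card_insert_disjoint) auto
  ultimately show "insert j (T - {i}) \<in> size_subsets N m" using Tn ij by (auto simp: size_subsets_def)
qed

text \<open>Replacing \<open>i\<close> by \<open>j\<close> maps these sets injectively to sets of
  the same size, and the weight is at most \<open>q\<close> times that of the image. Summing, the
  images have total probability at most 1.\<close>

lemma bernoulli_prob_swap:
  assumes pos: "\<And>j. j < N \<Longrightarrow> a j > 0" "\<And>j. j < N \<Longrightarrow> b j > 0" and m: "m \<le> N"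
    and ij: "i < N" "j < N" and q: "a i * b j \<le> q * (a j * b i)" "q \<ge> 0"
  shows "(\<Sum>T\<in>{T \<in> size_subsets N m. i \<in> T \<and> j \<notin> T}. bernoulli_prob N m a b T) \<le> q"
proof -
  let ?W = "\<Sum>T\<in>size_subsets N m. bernoulli_weight N a b T"
  let ?S = "{T \<in> size_subsets N m. i \<in> T \<and> j \<notin> T}"
  let ?\<phi> = "\<lambda>T. insert j (T - {i})"
  have W: "?W > 0"
    using size_subsets_nonempty[OF m] bernoulli_weight_pos[of N a b _ m] pos by (intro sum_pos) auto
  have inj: "inj_on ?\<phi> ?S"
  proof (rule inj_onI)
    fix S T assume S: "S \<in> ?S" and T: "T \<in> ?S" and eq: "?\<phi> S = ?\<phi> T"
    have "S = insert i (?\<phi> S - {j})" using S by auto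
    also have "\<dots> = insert i (?\<phi> T - {j})" by (simp only: eq)
    also have "\<dots> = T" using T by auto
    finally show "S = T" .
  qed
  have "(\<Sum>T\<in>?S. bernoulli_weight N a b T) \<le> (\<Sum>T\<in>?S. q * bernoulli_weight N a b (?\<phi> T))"
  proof (rule sum_mono)
    fix T assume T: "T \<in> ?S"
    then have sw: "a j * b i * bernoulli_weight N a b T = a i * b j * bernoulli_weight N a b (?\<phi> T)"
      and mem: "?\<phi> T \<in> size_subsets N m"
      using bernoulli_weight_swap(1)[of T N m i j a b] bernoulli_weight_swap(2)[of T N m i j] ij by auto
    have "0 < bernoulli_weight N a b (?\<phi> T)" using pos mem by (intro bernoulli_weight_pos) auto
    then have "a i * b j * bernoulli_weight N a b (?\<phi> T) \<le> q * (a j * b i) * bernoulli_weight N a b (?\<phi> T)"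
      using q by (intro mult_right_mono) auto
    then have "a j * b i * bernoulli_weight N a b T \<le> a j * b i * (q * bernoulli_weight N a b (?\<phi> T))"
      unfolding sw by (simp add: mult_ac)
    then show "bernoulli_weight N a b T \<le> q * bernoulli_weight N a b (?\<phi> T)"
      using pos ij by (simp add: mult_le_cancel_left_pos)
  qed
  also have "\<dots> = q * (\<Sum>T\<in>?\<phi> ` ?S. bernoulli_weight N a b T)"
    by (simp add: sum.reindex[OF inj] sum_distrib_left)
  also have "\<dots> \<le> q * ?W"
  proof (intro mult_left_mono sum_mono2)
    show "?\<phi> ` ?S \<subseteq> size_subsets N m" using bernoulli_weight_swap(2) ij by auto
    show "0 \<le> bernoulli_weight N a b T" if "T \<in> size_subsets N m - ?\<phi> ` ?S" for T
      using that pos bernoulli_weight_pos[of N a b T m] by (auto intro: less_imp_le)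
  qed (use q in auto)
  finally have "(\<Sum>T\<in>?S. bernoulli_weight N a b T) / ?W \<le> q" using W by (simp add: pos_divide_le_eq)
  then show ?thesis by (simp add: bernoulli_prob_def sum_divide_distrib)
qed

text \<open>With strongly increasing odds \<open>a j / b j\<close> the conditioned set is close to the top segment
  \<open>{N - m..<N}\<close>: a hole above \<open>N - m\<close> forces a particle below it.\<close>

lemma bernoulli_prob_concentration:
  assumes pos: "\<And>j. j < N \<Longrightarrow> a j > 0" "\<And>j. j < N \<Longrightarrow> b j > 0" and m: "m \<le> N" and q0: "q \<ge> 0" and d: "d > 0"
    and q: "\<And>i j. i < N - m \<Longrightarrow> N - m \<le> j \<Longrightarrow> j < N \<Longrightarrow> i + d \<le> j \<Longrightarrow> a i * b j \<le> q * (a j * b i)"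
    and l: "l < N" "l + d \<le> N - m \<or> N - m + d \<le> l"
  shows "(\<Sum>T\<in>{T \<in> size_subsets N m. (l \<in> T) \<noteq> (N - m \<le> l)}. bernoulli_prob N m a b T) \<le> real N * q"
proof -
  let ?p = "bernoulli_prob N m a b" and ?M = "N - m"
  have p0: "?p T \<ge> 0" if "T \<in> size_subsets N m" for T
    using that pos m by (intro bernoulli_prob_space(1)) auto
  have union: "(\<Sum>T\<in>S. ?p T) \<le> real N * q"
    if J: "J \<subseteq> {..<N}" and S: "S \<subseteq> (\<Union>j\<in>J. S' j)" and S': "\<And>j. j \<in> J \<Longrightarrow> S' j \<subseteq> size_subsets N m"
      and b: "\<And>j. j \<in> J \<Longrightarrow> (\<Sum>T\<in>S' j. ?p T) \<le> q" for S S' and J :: "nat set"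
  proof -
    have finJ: "finite J" using J by (rule finite_subset) simp
    have fin: "finite (S' j)" if "j \<in> J" for j using S'[OF that] by (rule finite_subset) simp
    have "(\<Sum>T\<in>S. ?p T) \<le> (\<Sum>T\<in>(\<Union>j\<in>J. S' j). ?p T)"
    proof (rule sum_mono2)
      show "finite (\<Union>j\<in>J. S' j)" using finJ fin by auto
      show "0 \<le> ?p T" if "T \<in> (\<Union>j\<in>J. S' j) - S" for T using that S' p0 by blast
    qed (rule S)
    also have "\<dots> \<le> (\<Sum>j\<in>J. \<Sum>T\<in>S' j. ?p T)"
      using finJ fin S' p0
    proof (induction J rule: finite_induct)
      case (insert j J)
      have "(\<Sum>T\<in>S' j \<union> (\<Union>j\<in>J. S' j). ?p T) \<le> (\<Sum>T\<in>S' j. ?p T) + (\<Sum>T\<in>(\<Union>j\<in>J. S' j). ?p T)"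
      proof -
        have "(\<Sum>T\<in>S' j \<inter> (\<Union>j\<in>J. S' j). ?p T) \<ge> 0"
          using insert.prems by (intro sum_nonneg) auto
        then show ?thesis using insert.hyps insert.prems by (subst sum_Un) auto
      qed
      moreover have "(\<Sum>T\<in>(\<Union>j\<in>J. S' j). ?p T) \<le> (\<Sum>j\<in>J. \<Sum>T\<in>S' j. ?p T)"
        using insert.prems by (intro insert.IH) auto
      ultimately show ?case using insert.hyps by simp
    qed simp
    also have "\<dots> \<le> (\<Sum>j\<in>J. q)" using b by (intro sum_mono)
    also have "\<dots> \<le> real N * q"
      using card_mono[OF finite_lessThan J] q0 by (simp add: mult_right_mono)
    finally show ?thesis .
  qed
  show ?thesis
  proof (cases "l < ?M")
    case True
    show ?thesis
    proof (rule union[where S'="\<lambda>j. {T \<in> size_subsets N m. l \<in> T \<and> j \<notin> T}" and J="{?M..<N}"])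
      show "{T \<in> size_subsets N m. (l \<in> T) \<noteq> (?M \<le> l)} \<subseteq> (\<Union>j\<in>{?M..<N}. {T \<in> size_subsets N m. l \<in> T \<and> j \<notin> T})"
      proof
        fix T assume "T \<in> {T \<in> size_subsets N m. (l \<in> T) \<noteq> (?M \<le> l)}"
        then have T: "T \<in> size_subsets N m" "l \<in> T" using True by auto
        have "\<not> {?M..<N} \<subseteq> T"
        proof
          assume sub: "{?M..<N} \<subseteq> T"
          have "finite T" "card T = m" using T by (auto simp: size_subsets_def intro: finite_subset)
          moreover have "insert l {?M..<N} \<subseteq> T" using T sub by auto
          ultimately have "card (insert l {?M..<N}) \<le> m" using card_mono[of T "insert l {?M..<N}"] by simp
          then show False using True m by simp
        qed
        then show "T \<in> (\<Union>j\<in>{?M..<N}. {T \<in> size_subsets N m. l \<in> T \<and> j \<notin> T})" using T by auto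
      qed
      show "(\<Sum>T\<in>{T \<in> size_subsets N m. l \<in> T \<and> j \<notin> T}. ?p T) \<le> q" if "j \<in> {?M..<N}" for j
        using that l True pos m q0 by (intro bernoulli_prob_swap q) auto
    qed auto
  next
    case False
    show ?thesis
    proof (rule union[where S'="\<lambda>i. {T \<in> size_subsets N m. i \<in> T \<and> l \<notin> T}" and J="{..<?M}"])
      show "{T \<in> size_subsets N m. (l \<in> T) \<noteq> (?M \<le> l)} \<subseteq> (\<Union>i\<in>{..<?M}. {T \<in> size_subsets N m. i \<in> T \<and> l \<notin> T})"
      proof
        fix T assume "T \<in> {T \<in> size_subsets N m. (l \<in> T) \<noteq> (?M \<le> l)}"
        then have T: "T \<in> size_subsets N m" "l \<notin> T" using False by auto
        have "\<not> T \<subseteq> {?M..<N} - {l}"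
        proof
          assume sub: "T \<subseteq> {?M..<N} - {l}"
          have "card T \<le> card ({?M..<N} - {l})" using sub by (intro card_mono) auto
          also have "\<dots> < m" using False l m by simp
          finally show False using T by (simp add: size_subsets_def)
        qed
        then obtain i where "i \<in> T" "i \<notin> {?M..<N} - {l}" unfolding subset_iff by blast
        moreover have "i \<noteq> l" using calculation(1) T(2) by blast
        ultimately have i: "i \<in> T" "\<not> (?M \<le> i \<and> i < N)" by auto
        moreover have "i < N" using i(1) T(1) by (auto simp: size_subsets_def)
        ultimately have "i < ?M" by linarith
        then show "T \<in> (\<Union>i\<in>{..<?M}. {T \<in> size_subsets N m. i \<in> T \<and> l \<notin> T})" using T \<open>i \<in> T\<close> by auto
      qed
      show "(\<Sum>T\<in>{T \<in> size_subsets N m. i \<in> T \<and> l \<notin> T}. ?p T) \<le> q" if "i \<in> {..<?M}" for i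
        using that l False pos m q0 d by (intro bernoulli_prob_swap q) auto
    qed auto
  qed
qed

section \<open>Poisson probabilities: tails, growth of the distribution function, comparison of
  parameters, windows\<close>

lemma pois_Suc: "real (Suc j) * pois l (Suc j) = l * pois l j"
  by (simp add: pois_def fact_Suc del: of_nat_Suc)

lemma pois_cdf_Suc: "pois_cdf l (Suc j) = pois_cdf l j + pois l (Suc j)"
  by (simp add: pois_cdf_def)

lemma pois_cdf_mono: "l \<ge> 0 \<Longrightarrow> i \<le> j \<Longrightarrow> pois_cdf l i \<le> pois_cdf l j"
  unfolding pois_cdf_def by (intro sum_mono2) (auto simp: pois_nonneg)

lemma pois_sum_le_1:
  assumes "l \<ge> 0" "finite J"
  shows "(\<Sum>j\<in>J. pois l j) \<le> 1"
proof (cases "J = {}")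
  case False
  have "(\<Sum>j\<in>J. pois l j) \<le> pois_cdf l (Max J)"
    unfolding pois_cdf_def using assms by (intro sum_mono2) (auto simp: pois_nonneg)
  also have "\<dots> \<le> 1" using assms(1) by (rule pois_cdf_le_1)
  finally show ?thesis .
qed simp

text \<open>The truncated second central moment in closed form. For \<open>l\<close> at most
  \<open>n + 1\<close> the boundary term is nonpositive, which leaves the variance \<open>l\<close>
  as an upper bound for Chebyshev.\<close>

lemma pois_variance: "(\<Sum>j\<le>n. (real j - l)\<^sup>2 * pois l j) = l * pois_cdf l n + l * (l - real n - 1) * pois l n"
proof (induction n)
  case 0
  show ?case by (simp add: pois_cdf_def power2_eq_square algebra_simps)
next
  case (Suc n)
  have e: "l * (l - real n - 1) * pois l n = (l - real n - 1) * (real (Suc n) * pois l (Suc n))"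
    unfolding pois_Suc by simp
  show ?case
    unfolding sum.atMost_Suc Suc.IH pois_cdf_Suc e by (simp add: power2_eq_square algebra_simps)
qed

lemma pois_chebyshev:
  assumes l: "l \<ge> 0" and J: "finite J" and \<delta>: "\<delta> > 0" "\<And>j. j \<in> J \<Longrightarrow> \<delta> \<le> \<bar>real j - l\<bar>"
  shows "(\<Sum>j\<in>J. pois l j) \<le> l / \<delta>\<^sup>2"
proof -
  \<comment> \<open>The truncation point is taken beyond \<open>l\<close>, so that the boundary term
    of \<open>pois_variance\<close> has the favourable sign.\<close>
  obtain n where n: "J \<subseteq> {..n}" "l \<le> real n"
  proof -
    obtain n1 where "J \<subseteq> {..n1}" using J by (auto simp: finite_nat_iff_bounded_le)
    moreover obtain n2 where "l \<le> real n2" using real_arch_simple by auto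
    ultimately show ?thesis by (intro that[of "max n1 n2"]) auto
  qed
  have "\<delta>\<^sup>2 * (\<Sum>j\<in>J. pois l j) = (\<Sum>j\<in>J. \<delta>\<^sup>2 * pois l j)" by (rule sum_distrib_left)
  also have "\<dots> \<le> (\<Sum>j\<in>J. (real j - l)\<^sup>2 * pois l j)"
  proof (intro sum_mono mult_right_mono)
    fix j assume "j \<in> J"
    then have "\<delta>\<^sup>2 \<le> \<bar>real j - l\<bar>\<^sup>2" using \<delta> by (intro power_mono) auto
    then show "\<delta>\<^sup>2 \<le> (real j - l)\<^sup>2" by simp
  qed (use l pois_nonneg in auto)
  also have "\<dots> \<le> (\<Sum>j\<le>n. (real j - l)\<^sup>2 * pois l j)"
    using n l by (intro sum_mono2) (auto simp: pois_nonneg)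
  also have "\<dots> = l * pois_cdf l n + l * (l - real n - 1) * pois l n" by (rule pois_variance)
  also have "\<dots> \<le> l * 1 + 0"
    using l n pois_cdf_le_1[OF l, of n] pois_nonneg[OF l, of n]
    by (intro add_mono mult_left_mono mult_nonpos_nonneg mult_nonneg_nonpos) auto
  finally show ?thesis using \<delta>(1) by (simp add: pos_le_divide_eq mult.commute)
qed

lemma pois_cdf_tendsto: "pois_cdf l \<longlonglongrightarrow> 1"
proof -
  have "(\<lambda>i. l ^ i / fact i) sums exp l"
    using exp_converges[of l] by (simp add: divide_inverse scaleR_conv_of_real mult.commute)
  then have "(\<lambda>n. \<Sum>i\<le>n. l ^ i / fact i) \<longlonglongrightarrow> exp l" by (simp add: sums_def_le)
  then have "(\<lambda>n. (\<Sum>i\<le>n. l ^ i / fact i) * exp (- l)) \<longlonglongrightarrow> exp l * exp (- l)" by (intro tendsto_intros)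
  then show ?thesis by (simp add: pois_cdf_def[abs_def] pois_def sum_distrib_right flip: exp_add)
qed

lemma pois_upper_tail:
  assumes l: "l \<ge> 0" and \<delta>: "\<delta> > 0" "l + \<delta> \<le> real (Suc j)"
  shows "1 - pois_cdf l j \<le> l / \<delta>\<^sup>2"
proof (rule LIMSEQ_le_const2)
  show "(\<lambda>n. pois_cdf l n - pois_cdf l j) \<longlonglongrightarrow> 1 - pois_cdf l j"
    by (intro tendsto_diff pois_cdf_tendsto tendsto_const)
  have "pois_cdf l n - pois_cdf l j \<le> l / \<delta>\<^sup>2" if "n \<ge> j" for n
  proof -
    have "pois_cdf l n = pois_cdf l j + (\<Sum>i\<in>{j<..n}. pois l i)"
      unfolding pois_cdf_def using that
      by (subst sum.union_disjoint[symmetric]) (auto intro!: sum.cong)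
    moreover have "(\<Sum>i\<in>{j<..n}. pois l i) \<le> l / \<delta>\<^sup>2"
      using \<delta> by (intro pois_chebyshev l) auto
    ultimately show ?thesis by simp
  qed
  then show "\<exists>N. \<forall>n\<ge>N. pois_cdf l n - pois_cdf l j \<le> l / \<delta>\<^sup>2" by blast
qed

lemma pois_lower_tail:
  assumes l: "l \<ge> 0" and \<delta>: "\<delta> > 0" "real j \<le> l - \<delta>"
  shows "pois_cdf l j \<le> l / \<delta>\<^sup>2"
  unfolding pois_cdf_def using \<delta> by (intro pois_chebyshev l) auto

text \<open>Sum \<open>pois_Suc\<close> over the indices up to \<open>i\<close> and bound each
  factor \<open>j + 1\<close> by \<open>i + 1\<close>. Below \<open>l\<close> the distribution
  function thus grows at least geometrically, and no Stirling estimate is involved.\<close>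

lemma pois_cdf_ratio_Suc:
  assumes l: "l > 0"
  shows "l * pois_cdf l i \<le> real (Suc i) * pois_cdf l (Suc i)"
proof -
  have "l * pois_cdf l i = (\<Sum>j\<le>i. real (Suc j) * pois l (Suc j))"
    by (simp only: pois_cdf_def sum_distrib_left pois_Suc)
  also have "\<dots> \<le> (\<Sum>j\<le>i. real (Suc i) * pois l (Suc j))"
    using l by (intro sum_mono mult_right_mono) (auto simp: pois_nonneg)
  also have "\<dots> = real (Suc i) * (\<Sum>j\<in>Suc ` {..i}. pois l j)"
    by (simp add: sum_distrib_left sum.reindex)
  also have "\<dots> \<le> real (Suc i) * pois_cdf l (Suc i)"
    unfolding pois_cdf_def using l by (intro mult_left_mono sum_mono2) (auto simp: pois_nonneg)
  finally show ?thesis .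
qed

lemma pois_cdf_ratio:
  assumes l: "l > 0" and s: "real (i + s) \<le> \<rho> * l"
  shows "pois_cdf l i \<le> \<rho> ^ s * pois_cdf l (i + s)"
  using s
proof (induction s)
  case (Suc s)
  have "0 \<le> \<rho> * l" using Suc.prems by (rule order.trans[OF of_nat_0_le_iff])
  then have \<rho>: "0 \<le> \<rho>" using l by (simp add: zero_le_mult_iff)
  have IH: "pois_cdf l i \<le> \<rho> ^ s * pois_cdf l (i + s)" using Suc.prems by (intro Suc.IH) simp
  have "l * pois_cdf l (i + s) \<le> real (Suc (i + s)) * pois_cdf l (Suc (i + s))" by (rule pois_cdf_ratio_Suc[OF l])
  also have "\<dots> \<le> \<rho> * l * pois_cdf l (Suc (i + s))"
    using Suc.prems pois_cdf_pos[OF l] by (intro mult_right_mono) (auto intro: less_imp_le)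
  finally have "pois_cdf l (i + s) \<le> \<rho> * pois_cdf l (i + Suc s)" using l by (simp add: mult.assoc mult.left_commute)
  then have "\<rho> ^ s * pois_cdf l (i + s) \<le> \<rho> ^ s * (\<rho> * pois_cdf l (i + Suc s))" using \<rho> by (intro mult_left_mono) auto
  then show ?case using IH by (simp add: mult_ac)
qed simp

text \<open>The factor \<open>\<rho> ^ d\<close> comes from the distribution functions alone; the
  complementary probabilities only improve the ratio, by monotonicity.\<close>

lemma pois_odds_ratio:
  assumes l: "l > 0" and ij: "i + d \<le> j" and s: "real (i + d) \<le> \<rho> * l"
  shows "pois_cdf l i * (1 - pois_cdf l j) \<le> \<rho> ^ d * (pois_cdf l j * (1 - pois_cdf l i))"
proof -
  have "0 \<le> \<rho> * l" using s by (rule order.trans[OF of_nat_0_le_iff])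
  then have \<rho>: "0 \<le> \<rho>" using l by (simp add: zero_le_mult_iff)
  have "pois_cdf l i \<le> \<rho> ^ d * pois_cdf l (i + d)" by (rule pois_cdf_ratio[OF l s])
  also have "\<dots> \<le> \<rho> ^ d * pois_cdf l j" using l ij \<rho> by (intro mult_left_mono pois_cdf_mono) auto
  finally have "pois_cdf l i * (1 - pois_cdf l j) \<le> \<rho> ^ d * pois_cdf l j * (1 - pois_cdf l i)"
    using l ij pois_cdf_mono[of l i j] pois_cdf_le_1[of l j] pois_cdf_pos[OF l, of j] \<rho>
    by (intro mult_mono) (auto intro: less_imp_le)
  then show ?thesis by (simp add: mult_ac)
qed

text \<open>On the modes in question the ratio of the two weights is \<open>exp (j ln (t / s) - N (t - s))\<close>,
  and the exponent is bounded by its tangent at \<open>t1\<close>.\<close>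

lemma pois_compare_above:
  assumes s: "0 < s" "s < t1"
  obtains \<delta> \<kappa> where "\<delta> > 0" "\<kappa> > 0" "s + \<delta> \<le> t1"
    "\<And>N j t. t1 \<le> t \<Longrightarrow> real j \<le> real N * (s + \<delta>) \<Longrightarrow>
      pois (real N * t) j \<le> exp (- \<kappa> * real N) * pois (real N * s) j"
proof -
  define u1 where "u1 = t1 / s"
  have u1: "u1 > 1" using s by (simp add: u1_def)
  have "ln u1 \<noteq> u1 - 1" using ln_eq_minus_one[of u1] u1 by auto
  then have lnu1: "ln u1 > 0" "ln u1 < u1 - 1"
    using u1 ln_le_minus_one[of u1] by (auto simp: ln_gt_zero)
  define g where "g = u1 - 1 - ln u1"
  have g: "g > 0" using lnu1 by (simp add: g_def)
  \<comment> \<open>At \<open>j = N * s\<close>, \<open>t = t1\<close> the exponent is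
    \<open>- N * s * g\<close>. The second bound on \<delta> lets a displacement of \<open>j\<close>
    by \<open>N * \<delta>\<close> spend at most half of this rate; the first keeps the exponent
    nonincreasing in \<open>t\<close> beyond \<open>t1\<close>.\<close>
  define \<delta> where "\<delta> = min (t1 - s) (s * g / (2 * ln u1))"
  define \<kappa> where "\<kappa> = s * g / 2"
  show ?thesis
  proof (rule that[of \<delta> \<kappa>])
    show \<delta>: "\<delta> > 0" "\<kappa> > 0" "s + \<delta> \<le> t1" using s g lnu1 by (auto simp: \<delta>_def \<kappa>_def)
    fix N j :: nat and t assume t: "t1 \<le> t" and j: "real j \<le> real N * (s + \<delta>)"
    define u where "u = t / s"
    have u: "u1 \<le> u" using t s by (simp add: u_def u1_def divide_right_mono)
    have u0: "u > 1" using u u1 by linarith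
    have tu: "t = s * u" using s by (simp add: u_def)
    have "ln u \<le> ln u1 + (u - u1) / u1"
    proof -
      have "ln (u / u1) \<le> u / u1 - 1" using u0 u1 by (intro ln_le_minus_one) auto
      moreover have "u / u1 - 1 = (u - u1) / u1" using u1 by (simp add: field_simps)
      ultimately show ?thesis using u0 u1 by (simp add: ln_div)
    qed
    then have "(s + \<delta>) * ln u - s * (u - 1) \<le> (s + \<delta>) * (ln u1 + (u - u1) / u1) - s * (u - 1)"
      using s \<delta> by (intro diff_right_mono mult_left_mono) auto
    also have "\<dots> = (s + \<delta>) * ln u1 - s * (u1 - 1) + (u - u1) * ((s + \<delta>) / u1 - s)"
      using u1 by (simp add: field_simps)
    also have "\<dots> \<le> (s + \<delta>) * ln u1 - s * (u1 - 1) + 0"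
    proof (intro add_left_mono mult_nonneg_nonpos)
      have "(s + \<delta>) \<le> s * u1" using \<delta>(3) s by (simp add: u1_def)
      then show "(s + \<delta>) / u1 - s \<le> 0" using u1 by (simp add: pos_divide_le_eq)
    qed (use u in simp)
    also have "\<dots> = \<delta> * ln u1 - s * g" by (simp add: g_def algebra_simps)
    also have "\<dots> \<le> - \<kappa>"
    proof -
      have "\<delta> * ln u1 \<le> s * g / (2 * ln u1) * ln u1" using lnu1 by (intro mult_right_mono) (auto simp: \<delta>_def)
      also have "\<dots> = s * g / 2" using lnu1 by simp
      finally show ?thesis by (simp add: \<kappa>_def)
    qed
    finally have \<phi>: "(s + \<delta>) * ln u - s * (u - 1) \<le> - \<kappa>" .
    have "pois (real N * t) j = u ^ j * exp (- real N * (s * (u - 1))) * pois (real N * s) j"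
      using s by (simp add: pois_def tu power_mult_distrib algebra_simps flip: exp_add)
    also have "u ^ j = exp (real j * ln u)" using u0 by (simp add: exp_of_nat_mult)
    also have "exp (real j * ln u) * exp (- real N * (s * (u - 1))) = exp (real j * ln u - real N * (s * (u - 1)))"
      by (simp flip: exp_add)
    also have "\<dots> * pois (real N * s) j \<le> exp (- \<kappa> * real N) * pois (real N * s) j"
    proof (intro mult_right_mono pois_nonneg)
      have "real j * ln u - real N * (s * (u - 1)) \<le> real N * (s + \<delta>) * ln u - real N * (s * (u - 1))"
        using j u0 by (intro diff_right_mono mult_right_mono) auto
      also have "\<dots> = real N * ((s + \<delta>) * ln u - s * (u - 1))" by (simp add: algebra_simps)
      also have "\<dots> \<le> real N * (- \<kappa>)" using \<phi> by (intro mult_left_mono) auto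
      finally show "exp (real j * ln u - real N * (s * (u - 1))) \<le> exp (- \<kappa> * real N)" by (simp add: mult.commute)
    qed (use s in simp)
    finally show "pois (real N * t) j \<le> exp (- \<kappa> * real N) * pois (real N * s) j" .
  qed
qed

text \<open>The mirror image of \<open>pois_compare_above\<close>: the modes lie above
  \<open>N * (s - \<delta>)\<close>, the parameter below the mean, and both logarithms are negative.
  At \<open>t = 0\<close> there is no logarithm to take, but then \<open>j > 0\<close> and the left
  side vanishes.\<close>

lemma pois_compare_below:
  assumes s: "0 < t1" "t1 < s"
  obtains \<delta> \<kappa> where "\<delta> > 0" "\<kappa> > 0" "t1 \<le> s - \<delta>"
    "\<And>N j t. 0 \<le> t \<Longrightarrow> t \<le> t1 \<Longrightarrow> N > 0 \<Longrightarrow> real N * (s - \<delta>) \<le> real j \<Longrightarrow>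
      pois (real N * t) j \<le> exp (- \<kappa> * real N) * pois (real N * s) j"
proof -
  define u1 where "u1 = t1 / s"
  have u1: "u1 < 1" "u1 > 0" using s by (auto simp: u1_def)
  have "ln u1 \<noteq> u1 - 1" using ln_eq_minus_one[of u1] u1 by auto
  then have lnu1: "ln u1 < 0" "ln u1 < u1 - 1"
    using u1 ln_le_minus_one[of u1] by (auto simp: ln_less_zero)
  define g where "g = u1 - 1 - ln u1"
  have g: "g > 0" using lnu1 by (simp add: g_def)
  define \<delta> where "\<delta> = min (s - t1) (s * g / (2 * (- ln u1)))"
  define \<kappa> where "\<kappa> = s * g / 2"
  show ?thesis
  proof (rule that[of \<delta> \<kappa>])
    have "s * g / (2 * (- ln u1)) > 0" using s g lnu1 by (intro divide_pos_pos mult_pos_pos) auto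
    then show \<delta>: "\<delta> > 0" "\<kappa> > 0" "t1 \<le> s - \<delta>" using s g by (auto simp: \<delta>_def \<kappa>_def)
    fix N j :: nat and t assume t: "0 \<le> t" "t \<le> t1" and N: "N > 0" and j: "real N * (s - \<delta>) \<le> real j"
    show "pois (real N * t) j \<le> exp (- \<kappa> * real N) * pois (real N * s) j"
    proof (cases "t = 0")
      case True
      have "real N * (s - \<delta>) > 0" using N s \<delta> by (intro mult_pos_pos) auto
      then have "j > 0" using j by linarith
      then have "pois (real N * t) j = 0" using True by (simp add: pois_def)
      then show ?thesis using s pois_nonneg[of "real N * s" j] by simp
    next
      case False
      define u where "u = t / s"
      have u: "u \<le> u1" "u > 0" using t s False by (auto simp: u_def u1_def divide_right_mono)
      have u0: "u < 1" "ln u < 0" using u u1 by (auto intro: ln_less_zero)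
      have tu: "t = s * u" using s by (simp add: u_def)
      have "ln u \<le> ln u1 + (u - u1) / u1"
      proof -
        have "ln (u / u1) \<le> u / u1 - 1" using u u1 by (intro ln_le_minus_one) auto
        moreover have "u / u1 - 1 = (u - u1) / u1" using u1 by (simp add: field_simps)
        ultimately show ?thesis using u u1 by (simp add: ln_div)
      qed
      then have "(s - \<delta>) * ln u - s * (u - 1) \<le> (s - \<delta>) * (ln u1 + (u - u1) / u1) - s * (u - 1)"
        using s \<delta> by (intro diff_right_mono mult_left_mono) auto
      also have "\<dots> = (s - \<delta>) * ln u1 - s * (u1 - 1) + (u - u1) * ((s - \<delta>) / u1 - s)"
        using u1 by (simp add: field_simps)
      also have "\<dots> \<le> (s - \<delta>) * ln u1 - s * (u1 - 1) + 0"
      proof (intro add_left_mono mult_nonpos_nonneg)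
        have "s * u1 \<le> s - \<delta>" using \<delta>(3) s by (simp add: u1_def)
        then show "0 \<le> (s - \<delta>) / u1 - s" using u1 by (simp add: pos_le_divide_eq)
      qed (use u in simp)
      also have "\<dots> = \<delta> * (- ln u1) - s * g" by (simp add: g_def algebra_simps)
      also have "\<dots> \<le> - \<kappa>"
      proof -
        have "\<delta> * (- ln u1) \<le> s * g / (2 * (- ln u1)) * (- ln u1)" using lnu1 by (intro mult_right_mono) (auto simp: \<delta>_def)
        also have "\<dots> = s * g / 2" using lnu1 by simp
        finally show ?thesis by (simp add: \<kappa>_def)
      qed
      finally have \<phi>: "(s - \<delta>) * ln u - s * (u - 1) \<le> - \<kappa>" .
      have "pois (real N * t) j = u ^ j * exp (- real N * (s * (u - 1))) * pois (real N * s) j"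
        using s by (simp add: pois_def tu power_mult_distrib algebra_simps flip: exp_add)
      also have "u ^ j = exp (real j * ln u)" using u by (simp add: exp_of_nat_mult)
      also have "exp (real j * ln u) * exp (- real N * (s * (u - 1))) = exp (real j * ln u - real N * (s * (u - 1)))"
        by (simp flip: exp_add)
      also have "\<dots> * pois (real N * s) j \<le> exp (- \<kappa> * real N) * pois (real N * s) j"
      proof (intro mult_right_mono pois_nonneg)
        have "real j * ln u - real N * (s * (u - 1)) \<le> real N * (s - \<delta>) * ln u - real N * (s * (u - 1))"
          using j u0 by (intro diff_right_mono mult_right_mono_neg) auto
        also have "\<dots> = real N * ((s - \<delta>) * ln u - s * (u - 1))" by (simp add: algebra_simps)
        also have "\<dots> \<le> real N * (- \<kappa>)" using \<phi> by (intro mult_left_mono) auto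
        finally show "exp (real j * ln u - real N * (s * (u - 1))) \<le> exp (- \<kappa> * real N)" by (simp add: mult.commute)
      qed (use s in simp)
      finally show ?thesis .
    qed
  qed
qed

text \<open>A law of large numbers: the mean \<open>n * t\<close> keeps a distance of order
  \<open>n\<close> from both ends of the window, so Chebyshev bounds the error by a multiple of
  \<open>1 / n\<close>. At the ends themselves fluctuations of order \<open>sqrt n\<close> would
  matter.\<close>

lemma pois_window_tendsto:
  fixes A B :: "nat \<Rightarrow> nat"
  assumes A: "(\<lambda>n. real (A n) / real n) \<longlonglongrightarrow> a" and B: "(\<lambda>n. real (B n) / real n) \<longlonglongrightarrow> b"
    and t: "t \<ge> 0" "t \<noteq> a" "t \<noteq> b"
  shows "(\<lambda>n. \<Sum>j\<in>{A n..<B n}. pois (real n * t) j) \<longlonglongrightarrow> (if a < t \<and> t < b then 1 else 0)"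
proof -
  have small: "(\<lambda>n. c * (t / (\<delta>\<^sup>2 * real n))) \<longlonglongrightarrow> 0" for c \<delta>
  proof -
    have "(\<lambda>n. c * t / \<delta>\<^sup>2 * (1 / real n)) \<longlonglongrightarrow> 0" by (intro tendsto_mult_right_zero lim_1_over_n)
    then show ?thesis by (simp add: mult_ac)
  qed
  have cheb: "(\<Sum>j\<in>J. pois (real n * t) j) \<le> t / (\<delta>\<^sup>2 * real n)"
    if "n > 0" "\<delta> > 0" "finite J" "\<And>j. j \<in> J \<Longrightarrow> \<delta> * real n \<le> \<bar>real j - real n * t\<bar>" for n \<delta> J
  proof -
    have "(\<Sum>j\<in>J. pois (real n * t) j) \<le> real n * t / (\<delta> * real n)\<^sup>2"
      using that t by (intro pois_chebyshev) auto
    also have "\<dots> = t / (\<delta>\<^sup>2 * real n)" using that by (simp add: power2_eq_square)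
    finally show ?thesis .
  qed
  have nonneg: "0 \<le> (\<Sum>j\<in>J. pois (real n * t) j)" for J n using t by (intro sum_nonneg pois_nonneg) auto
  consider "a < t" "t < b" | "t < a" | "b < t" using t by linarith
  then show ?thesis
  proof cases
    case 1
    obtain \<delta> where \<delta>: "\<delta> > 0" "a < t - \<delta>" "t + \<delta> < b"
      using 1 by (intro that[of "min (t - a) (b - t) / 2"]) (auto simp: min_def field_simps)
    have "\<forall>\<^sub>F n in sequentially. real (A n) / real n < t - \<delta>" using A \<delta> by (intro order_tendstoD)
    moreover have "\<forall>\<^sub>F n in sequentially. t + \<delta> < real (B n) / real n" using B \<delta> by (intro order_tendstoD)
    ultimately have lower: "\<forall>\<^sub>F n in sequentially. 1 - 2 * (t / (\<delta>\<^sup>2 * real n)) \<le> (\<Sum>j\<in>{A n..<B n}. pois (real n * t) j)"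
      using eventually_gt_at_top[of 0]
    proof eventually_elim
      case (elim n)
      have An: "real (A n) < real n * (t - \<delta>)" and Bn: "real n * (t + \<delta>) < real (B n)"
        using elim by (simp_all add: pos_divide_less_eq pos_less_divide_eq mult.commute)
      have "real n * (t + \<delta>) > 0" using elim t \<delta> by (intro mult_pos_pos) auto
      then obtain B' where B': "B n = Suc B'" using Bn by (cases "B n") auto
      have "1 - pois_cdf (real n * t) B' \<le> real n * t / (\<delta> * real n)\<^sup>2"
        using elim t \<delta> Bn unfolding B' by (intro pois_upper_tail) (auto simp: algebra_simps)
      also have "\<dots> = t / (\<delta>\<^sup>2 * real n)" using elim by (simp add: power2_eq_square)
      finally have up: "1 - pois_cdf (real n * t) B' \<le> t / (\<delta>\<^sup>2 * real n)" .
      have low: "(\<Sum>j<A n. pois (real n * t) j) \<le> t / (\<delta>\<^sup>2 * real n)"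
        using elim \<delta> An by (intro cheb) (auto simp: algebra_simps)
      have "real n * (t - \<delta>) \<le> real n * (t + \<delta>)" using \<delta> by (intro mult_left_mono) auto
      then have "A n \<le> B n" using An Bn by linarith
      have "pois_cdf (real n * t) B' = (\<Sum>j<B n. pois (real n * t) j)"
        by (simp add: pois_cdf_def B' lessThan_Suc_atMost)
      also have "\<dots> = (\<Sum>j<A n. pois (real n * t) j) + (\<Sum>j\<in>{A n..<B n}. pois (real n * t) j)"
        using \<open>A n \<le> B n\<close> by (simp add: sum.atLeastLessThan_concat lessThan_atLeast0)
      finally show ?case using up low by linarith
    qed
    have upper: "\<forall>\<^sub>F n in sequentially. (\<Sum>j\<in>{A n..<B n}. pois (real n * t) j) \<le> 1"
      using t by (intro always_eventually allI pois_sum_le_1) auto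
    have lim: "(\<lambda>n. 1 - 2 * (t / (\<delta>\<^sup>2 * real n))) \<longlonglongrightarrow> 1"
      using tendsto_diff[OF tendsto_const[of 1] small[of 2 \<delta>]] by simp
    have "(\<lambda>n. \<Sum>j\<in>{A n..<B n}. pois (real n * t) j) \<longlonglongrightarrow> 1"
      by (rule real_tendsto_sandwich[OF lower upper lim tendsto_const])
    then show ?thesis using 1 by simp
  next
    case 2
    define \<delta> where "\<delta> = (a - t) / 2"
    have \<delta>: "\<delta> > 0" "t + \<delta> < a" using 2 by (auto simp: \<delta>_def field_simps)
    have "\<forall>\<^sub>F n in sequentially. t + \<delta> < real (A n) / real n" using A \<delta> by (intro order_tendstoD)
    then have "\<forall>\<^sub>F n in sequentially. (\<Sum>j\<in>{A n..<B n}. pois (real n * t) j) \<le> 1 * (t / (\<delta>\<^sup>2 * real n))"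
      using eventually_gt_at_top[of 0]
    proof eventually_elim
      case (elim n)
      have An: "real n * t + \<delta> * real n < real (A n)" using elim by (simp add: pos_less_divide_eq algebra_simps)
      show ?case using elim \<delta> An unfolding mult_1 by (intro cheb) auto
    qed
    then have "(\<lambda>n. \<Sum>j\<in>{A n..<B n}. pois (real n * t) j) \<longlonglongrightarrow> 0"
      using nonneg by (intro real_tendsto_sandwich[OF _ _ tendsto_const small[of 1 \<delta>]]) auto
    then show ?thesis using 2 by simp
  next
    case 3
    define \<delta> where "\<delta> = (t - b) / 2"
    have \<delta>: "\<delta> > 0" "b < t - \<delta>" using 3 by (auto simp: \<delta>_def field_simps)
    have "\<forall>\<^sub>F n in sequentially. real (B n) / real n < t - \<delta>" using B \<delta> by (intro order_tendstoD)
    then have "\<forall>\<^sub>F n in sequentially. (\<Sum>j\<in>{A n..<B n}. pois (real n * t) j) \<le> 1 * (t / (\<delta>\<^sup>2 * real n))"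
      using eventually_gt_at_top[of 0]
    proof eventually_elim
      case (elim n)
      have Bn: "real (B n) < real n * t - \<delta> * real n"
      proof -
        have "real (B n) < (t - \<delta>) * real n" using elim by (simp only: pos_divide_less_eq of_nat_0_less_iff)
        then show ?thesis by (simp add: algebra_simps)
      qed
      show ?case using elim \<delta> Bn unfolding mult_1 by (intro cheb) auto
    qed
    then have "(\<lambda>n. \<Sum>j\<in>{A n..<B n}. pois (real n * t) j) \<longlonglongrightarrow> 0"
      using nonneg by (intro real_tendsto_sandwich[OF _ _ tendsto_const small[of 1 \<delta>]]) auto
    then show ?thesis using 3 by simp
  qed
qed

section \<open>Size of the modes and the limit of mode kernels in the bulk\<close>

lemma cmod_mode:
  "cmod (mode N l x y) = (real N * (cmod x * cmod y)) ^ l / fact l * exp (- real N * ((cmod x)\<^sup>2 + (cmod y)\<^sup>2) / 2)"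
  by (simp add: mode_def norm_mult norm_divide norm_power mult.assoc)

lemma mode_diag: "mode N l x x = cplx (pois (real N * (cmod x)\<^sup>2) l)"
proof -
  have "of_nat N * x * cnj x = cplx (real N * (cmod x)\<^sup>2)"
    by (simp add: complex_norm_square mult.assoc del: of_real_power)
  moreover have "exp (- real N * ((cmod x)\<^sup>2 + (cmod x)\<^sup>2) / 2) = exp (- (real N * (cmod x)\<^sup>2))"
    by (rule arg_cong[where f=exp]) (simp add: field_simps)
  ultimately show ?thesis unfolding mode_def pois_def by (simp only: of_real_mult of_real_divide of_real_power of_real_fact)
qed

text \<open>The modulus is the geometric mean of the two diagonal values. The arithmetic mean
  separates \<open>x\<close> from \<open>y\<close>, so that later estimates concern one point at a
  time.\<close>

lemma cmod_mode_le:
  "cmod (mode N l x y) \<le> (pois (real N * (cmod x)\<^sup>2) l + pois (real N * (cmod y)\<^sup>2) l) / 2"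
proof -
  define u where "u z = sqrt (pois (real N * (cmod z)\<^sup>2) l)" for z :: complex
  have u: "(u z)\<^sup>2 = pois (real N * (cmod z)\<^sup>2) l" for z
    by (simp add: u_def pois_nonneg)
  have "(cmod (mode N l x y))\<^sup>2 = (u x * u y)\<^sup>2"
  proof -
    have "(exp (- real N * ((cmod x)\<^sup>2 + (cmod y)\<^sup>2) / 2))\<^sup>2 = exp (- (real N * (cmod x)\<^sup>2)) * exp (- (real N * (cmod y)\<^sup>2))"
      by (simp add: power2_eq_square field_simps flip: exp_add)
    moreover have "((real N * (cmod x * cmod y)) ^ l)\<^sup>2 = (real N * (cmod x)\<^sup>2) ^ l * (real N * (cmod y)\<^sup>2) ^ l"
      by (simp add: power2_eq_square power_mult_distrib mult_ac)
    ultimately show ?thesis unfolding cmod_mode power_mult_distrib[of "_ / _"] power_mult_distrib[of "u x"] power_divide u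
      by (simp add: pois_def power2_eq_square)
  qed
  then have "cmod (mode N l x y) = u x * u y"
    by (rule power2_eq_imp_eq) (auto simp: u_def pois_nonneg)
  also have "\<dots> \<le> ((u x)\<^sup>2 + (u y)\<^sup>2) / 2" using sum_squares_bound[of "u x" "u y"] by simp
  finally show ?thesis by (simp only: u)
qed

text \<open>Completing the square writes \<open>cmod (mode N l x y)\<close> as a Gaussian in
  \<open>cmod x - cmod y\<close> times a Poisson probability of parameter
  \<open>N * cmod x * cmod y\<close>. Hence kernel entries at points of different modulus decay
  exponentially, for every set of modes.\<close>

lemma sum_cmod_mode_le:
  assumes J: "finite J"
  shows "(\<Sum>l\<in>J. cmod (mode N l x y)) \<le> exp (- real N * (cmod x - cmod y)\<^sup>2 / 2)"
proof -
  let ?l = "real N * (cmod x * cmod y)"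
  have "cmod (mode N l x y) = exp (- real N * (cmod x - cmod y)\<^sup>2 / 2) * pois ?l l" for l
  proof -
    have "exp (- real N * ((cmod x)\<^sup>2 + (cmod y)\<^sup>2) / 2) = exp (- real N * (cmod x - cmod y)\<^sup>2 / 2) * exp (- ?l)"
      unfolding exp_add[symmetric] by (rule arg_cong[where f=exp]) (simp add: power2_eq_square field_simps)
    then show ?thesis unfolding cmod_mode pois_def by simp
  qed
  then have "(\<Sum>l\<in>J. cmod (mode N l x y)) = exp (- real N * (cmod x - cmod y)\<^sup>2 / 2) * (\<Sum>l\<in>J. pois ?l l)"
    by (simp add: sum_distrib_left)
  also have "\<dots> \<le> exp (- real N * (cmod x - cmod y)\<^sup>2 / 2) * 1"
    by (intro mult_left_mono pois_sum_le_1 J) auto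
  finally show ?thesis by simp
qed

lemma null_sphere: "emeasure lborel {z::complex. cmod z = r} = 0"
proof -
  have "{z::complex. cmod z = r} = sphere 0 r" by (auto simp: dist_norm)
  moreover have "sphere (0::complex) r \<in> null_sets lebesgue"
    using negligible_sphere[of "0::complex" r] by (simp add: negligible_iff_null_sets)
  then have "sphere (0::complex) r \<in> null_sets lborel"
    by (subst (asm) null_sets_completion_iff) auto
  ultimately show ?thesis by auto
qed

lemma component_measurable:
  fixes i k :: nat
  shows "i < k \<Longrightarrow> (\<lambda>y. y i) \<in> borel_measurable (lborels k)"
  using measurable_component_singleton[of i "{..<k}" "\<lambda>_. lborel :: complex measure"] by auto

lemma AE_component_cmod_neq:
  fixes i k :: nat
  assumes i: "i < k"
  shows "AE y in lborels k. cmod (y i) \<noteq> r"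
proof (rule AE_I)
  let ?B = "\<lambda>j. if j = i then {z::complex. cmod z = r} else UNIV"
  have m: "{z::complex. cmod z = r} \<in> sets borel" by measurable
  show "{y \<in> space (lborels k). \<not> cmod (y i) \<noteq> r} \<subseteq> Pi\<^sub>E {..<k} ?B"
    by (auto simp: space_PiM PiE_iff extensional_def)
  have "emeasure (lborels k) (Pi\<^sub>E {..<k} ?B) = (\<Prod>j<k. emeasure lborel (?B j))"
    using m by (intro lborel_product.emeasure_PiM) auto
  also have "\<dots> = 0" using i by (intro prod_zero) (auto simp: null_sphere intro!: bexI[of _ i])
  finally show "emeasure (lborels k) (Pi\<^sub>E {..<k} ?B) = 0" .
  show "Pi\<^sub>E {..<k} ?B \<in> sets (lborels k)" using m by (intro sets_PiM_I_finite) auto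
qed

text \<open>At equal moduli the Gaussian factor of \<open>sum_cmod_mode_le\<close> gives no decay.
  Such pairs are negligible: once one point is fixed, the other is confined to a circle.\<close>

lemma AE_pair_cmod_neq:
  fixes i j k :: nat
  assumes ij: "i < k" "j < k" "i \<noteq> j"
  shows "AE y in lborels k. cmod (y i) \<noteq> cmod (y j)"
proof (rule AE_I)
  let ?M = "lborels k"
  let ?S = "{y \<in> space ?M. cmod (y i) = cmod (y j)}"
  show "{y \<in> space ?M. \<not> cmod (y i) \<noteq> cmod (y j)} \<subseteq> ?S" by auto
  have comp: "(\<lambda>y. cmod (y l)) \<in> borel_measurable ?M" if "l < k" for l
    by (rule measurable_compose[OF component_measurable[OF that] borel_measurable_norm])
  show S: "?S \<in> sets ?M" using comp ij by (intro borel_measurable_eq) auto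
  let ?I = "{..<k} - {i}"
  have ins: "insert i ?I = {..<k}" using ij by auto
  have "emeasure ?M ?S = (\<integral>\<^sup>+y. indicator ?S y \<partial>?M)" using S by simp
  also have "\<dots> = (\<integral>\<^sup>+x. (\<integral>\<^sup>+z. indicator ?S (x(i := z)) \<partial>lborel) \<partial>Pi\<^sub>M ?I (\<lambda>_. lborel))"
    using lborel_product.product_nn_integral_insert[of ?I i "indicator ?S"] S unfolding ins by simp
  also have "\<dots> = (\<integral>\<^sup>+x. 0 \<partial>Pi\<^sub>M ?I (\<lambda>_. lborel :: complex measure))"
  proof (intro nn_integral_cong)
    fix x assume "x \<in> space (Pi\<^sub>M ?I (\<lambda>_. lborel :: complex measure))"
    have "(\<integral>\<^sup>+z. indicator ?S (x(i := z)) \<partial>lborel) \<le> (\<integral>\<^sup>+z. indicator {z. cmod z = cmod (x j)} z \<partial>lborel)"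
      using ij by (intro nn_integral_mono) (auto simp: indicator_def)
    also have "\<dots> = emeasure lborel {z. cmod z = cmod (x j)}"
      by (rule nn_integral_indicator) measurable
    finally show "(\<integral>\<^sup>+z. indicator ?S (x(i := z)) \<partial>lborel) = 0" by (simp add: null_sphere)
  qed
  finally show "emeasure ?M ?S = 0" by simp
qed

text \<open>The pointwise limit of \<open>1 / N\<close> times the kernel. It vanishes off the
  diagonal, so at distinct points its determinant is a product of intensities \<open>1 / pi\<close>;
  \<open>W\<close> is the set of squared moduli filled by the selected modes.\<close>

definition bulk_kernel :: "real set \<Rightarrow> complex \<Rightarrow> complex \<Rightarrow> complex" where
  "bulk_kernel W x y = (if x = y \<and> (cmod x)\<^sup>2 \<in> W then cplx (1 / pi) else 0)"

lemma mode_kernel_measurable: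
  fixes i j k :: nat
  assumes "i < k" "j < k"
  shows "(\<lambda>y. mode_kernel N \<gamma> T (y i) (y j)) \<in> borel_measurable (lborels k)"
proof -
  note [measurable] = component_measurable[OF assms(1)] component_measurable[OF assms(2)]
  show ?thesis unfolding mode_kernel_def mode_def by measurable
qed

lemma bulk_kernel_measurable:
  fixes i j k :: nat
  assumes ij: "i < k" "j < k" and W: "W \<in> sets borel"
  shows "(\<lambda>y. bulk_kernel W (y i) (y j)) \<in> borel_measurable (lborels k)"
proof -
  let ?M = "lborels k"
  have m: "(\<lambda>y. y i) \<in> borel_measurable ?M" "(\<lambda>y. y j) \<in> borel_measurable ?M"
    using ij by (auto intro: component_measurable)
  have "{y \<in> space ?M. y i = y j} \<in> sets ?M"
  proof -
    have "{y \<in> space ?M. cmod (y i - y j) = 0} \<in> sets ?M"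
      using measurable_compose[OF borel_measurable_diff[OF m] borel_measurable_norm] by (intro borel_measurable_eq) auto
    then show ?thesis by simp
  qed
  moreover have "{y \<in> space ?M. (cmod (y i))\<^sup>2 \<in> W} \<in> sets ?M"
  proof -
    have "(\<lambda>y. (cmod (y i))\<^sup>2) \<in> borel_measurable ?M" using measurable_compose[OF m(1) borel_measurable_norm] by (intro borel_measurable_power)
    then have "(\<lambda>y. (cmod (y i))\<^sup>2) -` W \<inter> space ?M \<in> sets ?M" using W by (rule measurable_sets)
    moreover have "(\<lambda>y. (cmod (y i))\<^sup>2) -` W \<inter> space ?M = {y \<in> space ?M. (cmod (y i))\<^sup>2 \<in> W}" by auto
    ultimately show ?thesis by simp
  qed
  ultimately have "{y \<in> space ?M. y i = y j} \<inter> {y \<in> space ?M. (cmod (y i))\<^sup>2 \<in> W} \<in> sets ?M" by (rule sets.Int)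
  moreover have "{y \<in> space ?M. y i = y j} \<inter> {y \<in> space ?M. (cmod (y i))\<^sup>2 \<in> W} = {y \<in> space ?M. y i = y j \<and> (cmod (y i))\<^sup>2 \<in> W}" by auto
  ultimately have "{y \<in> space ?M. y i = y j \<and> (cmod (y i))\<^sup>2 \<in> W} \<in> sets ?M" by simp
  then show ?thesis unfolding bulk_kernel_def by (intro measurable_If) auto
qed

lemma leibniz_det_scale: "leibniz_det k (\<lambda>i j. c * M i j) = c ^ k * leibniz_det k M"
  by (simp add: leibniz_det_def prod.distrib sum_distrib_left mult_ac)

text \<open>Three errors have to vanish. The renormalisation by \<gamma> is uniformly small by
  \<open>err\<close>. Entries at distinct moduli decay exponentially. On the diagonal the kernel is
  the Poisson mass of the random set of modes, which converges in mean by \<open>conv\<close>. The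
  set \<open>X\<close> collects the exceptional radii, whose circles are null sets.\<close>

lemma bulk_limit:
  fixes w :: "nat \<Rightarrow> 'a \<Rightarrow> real" and D :: "nat \<Rightarrow> 'a \<Rightarrow> nat set"
  assumes F: "F \<in> borel_measurable (lborels k)" "\<And>y. y \<in> tuples k UNIV \<Longrightarrow> cmod (F y) \<le> C0"
    and Q: "Q \<in> sets borel" "emeasure lborel Q < \<infinity>"
    and supp: "\<And>y i. y \<in> tuples k UNIV \<Longrightarrow> F y \<noteq> 0 \<Longrightarrow> i < k \<Longrightarrow> y i \<in> Q"
    and w: "\<forall>\<^sub>F n in sequentially. finite (\<T> n) \<and> (\<forall>T\<in>\<T> n. w n T \<ge> 0) \<and> (\<Sum>T\<in>\<T> n. w n T) = 1"
    and D: "\<And>n T. T \<in> \<T> n \<Longrightarrow> D n T \<subseteq> {..<n}"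
    and err: "err \<longlonglongrightarrow> 0" "\<forall>\<^sub>F n in sequentially. \<forall>J\<subseteq>{..<n}. \<forall>x\<in>Q. \<forall>y\<in>Q.
      (\<Sum>l\<in>J. cmod (mode n l x y) * \<bar>1 / \<gamma> n l - 1\<bar>) \<le> err n"
    and X: "finite X" and W: "W \<in> sets borel"
    and conv: "\<And>z. z \<in> Q \<Longrightarrow> cmod z \<notin> X \<Longrightarrow> (\<lambda>n. \<Sum>T\<in>\<T> n. w n T *
      \<bar>(\<Sum>l\<in>D n T. pois (real n * (cmod z)\<^sup>2) l) - indicat_real W ((cmod z)\<^sup>2)\<bar>) \<longlonglongrightarrow> 0"
  shows "(\<lambda>n. (\<Sum>T\<in>\<T> n. cplx (w n T) *
      kernel_integral k F (mode_kernel n (\<gamma> n) (D n T))) / of_nat n ^ k)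
    \<longlonglongrightarrow> kernel_integral k F (bulk_kernel W)"
proof -
  define K where "K n T x y = cplx (1 / real n) * mode_kernel n (\<gamma> n) (D n T) x y" for n T x y
  have K_eq: "K n T x y = cplx (1 / pi) * (\<Sum>l\<in>D n T. mode n l x y / cplx (\<gamma> n l))" if "n > 0" for n T x y
    using that by (simp add: K_def mode_kernel_def)
  have close: "\<forall>\<^sub>F n in sequentially. n > 0 \<and> (\<forall>T\<in>\<T> n. \<forall>x\<in>Q. \<forall>y\<in>Q.
      cmod (K n T x y - cplx (1 / pi) * (\<Sum>l\<in>D n T. mode n l x y)) \<le> err n / pi)"
    using err(2) eventually_gt_at_top[of 0]
  proof eventually_elim
    case (elim n)
    have "cmod (K n T x y - cplx (1 / pi) * (\<Sum>l\<in>D n T. mode n l x y)) \<le> err n / pi"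
      if T: "T \<in> \<T> n" and xy: "x \<in> Q" "y \<in> Q" for T x y
    proof -
      have "K n T x y - cplx (1 / pi) * (\<Sum>l\<in>D n T. mode n l x y) =
         cplx (1 / pi) * (\<Sum>l\<in>D n T. mode n l x y * cplx (1 / \<gamma> n l - 1))"
        unfolding K_eq[OF elim(2)] by (simp add: right_diff_distrib sum_subtractf)
      then have "cmod (K n T x y - cplx (1 / pi) * (\<Sum>l\<in>D n T. mode n l x y)) =
         1 / pi * cmod (\<Sum>l\<in>D n T. mode n l x y * cplx (1 / \<gamma> n l - 1))"
        by (simp only: norm_mult norm_of_real) simp
      also have "\<dots> \<le> 1 / pi * (\<Sum>l\<in>D n T. cmod (mode n l x y) * \<bar>1 / \<gamma> n l - 1\<bar>)"
        by (intro mult_left_mono order.trans[OF norm_sum] sum_mono) (simp_all only: norm_mult norm_of_real order_refl, simp)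
      also have "\<dots> \<le> 1 / pi * err n"
        using elim(1) D[OF T] xy by (intro mult_left_mono) simp_all
      finally show ?thesis by simp
    qed
    then show ?case using elim by auto
  qed
  have plain: "cmod (\<Sum>l\<in>J. mode n l x y) \<le> exp (- real n * (cmod x - cmod y)\<^sup>2 / 2)" if "finite J" for J n x y
    using norm_sum sum_cmod_mode_le[OF that] by (rule order.trans)
  have plain1: "cmod (\<Sum>l\<in>J. mode n l x y) \<le> 1" if "finite J" for J n x y
    using plain[OF that] by (rule order.trans) simp
  have finD: "finite (D n T)" if "T \<in> \<T> n" for n T using D[OF that] by (rule finite_subset) simp
  have "\<forall>\<^sub>F n in sequentially. err n < 1" using err(1) by (rule order_tendstoD) simp
  with close have Kbound: "\<forall>\<^sub>F n in sequentially. \<forall>T\<in>\<T> n. \<forall>x\<in>Q. \<forall>y\<in>Q. cmod (K n T x y) \<le> 2"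
  proof eventually_elim
    case (elim n)
    show ?case
    proof (intro ballI)
      fix T x y assume T: "T \<in> \<T> n" and xy: "x \<in> Q" "y \<in> Q"
      have pi1: "1 / pi \<le> 1" using pi_gt3 by simp
      have "cmod (cplx (1 / pi) * (\<Sum>l\<in>D n T. mode n l x y)) \<le> 1 * 1"
        unfolding norm_mult norm_of_real using pi1 plain1[OF finD[OF T]] by (intro mult_mono) simp_all
      moreover have "err n / pi \<le> 1"
      proof -
        have "err n / pi \<le> 1 / pi" using elim(2) by (intro divide_right_mono) auto
        then show ?thesis using pi1 by linarith
      qed
      moreover have "cmod (K n T x y - cplx (1 / pi) * (\<Sum>l\<in>D n T. mode n l x y)) \<le> err n / pi"
        using elim(1) T xy by blast
      ultimately show "cmod (K n T x y) \<le> 2"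
        using norm_triangle_sub[of "K n T x y" "cplx (1 / pi) * (\<Sum>l\<in>D n T. mode n l x y)"] by linarith
    qed
  qed
  have lim: "(\<lambda>n. \<Sum>T\<in>\<T> n. cplx (w n T) *
      kernel_integral k F (K n T))
    \<longlonglongrightarrow> kernel_integral k F (bulk_kernel W)"
  proof (rule mixture_correlations_tendsto[where F=F and Q=Q and C=2 and ?C0.0=C0])
    show "F y \<noteq> 0 \<Longrightarrow> y \<in> tuples k UNIV \<Longrightarrow> i < k \<Longrightarrow> y i \<in> Q" for y i by (rule supp)
    show "(\<lambda>y. bulk_kernel W (y i) (y j)) \<in> borel_measurable (lborels k)" if "i < k" "j < k" for i j
      using that W by (rule bulk_kernel_measurable)
    show "\<forall>\<^sub>F n in sequentially. \<forall>T\<in>\<T> n. \<forall>x\<in>Q. \<forall>y\<in>Q. cmod (K n T x y) \<le> 2" by (rule Kbound)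
    show "(\<lambda>y. K n T (y i) (y j)) \<in> borel_measurable (lborels k)" if "i < k" "j < k" for n T i j
      unfolding K_def using mode_kernel_measurable[OF that] by (intro borel_measurable_times borel_measurable_const)
    show "cmod (bulk_kernel W x y) \<le> 2" for x y
    proof -
      have "1 / pi \<le> 2" using pi_gt3 by (simp add: pos_divide_le_eq)
      then show ?thesis by (simp add: bulk_kernel_def norm_divide)
    qed
    have "AE y in lborels k. (\<forall>i\<in>{..<k}. \<forall>r\<in>X. cmod (y i) \<noteq> r) \<and>
       (\<forall>i\<in>{..<k}. \<forall>j\<in>{..<k} - {i}. cmod (y i) \<noteq> cmod (y j))"
      using X by (intro AE_conjI AE_finite_allI AE_component_cmod_neq AE_pair_cmod_neq) auto
    then show "AE y in lborels k. y \<in> tuples k Q \<longrightarrow> (\<forall>i<k. \<forall>j<k.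
      (\<lambda>n. \<Sum>T\<in>\<T> n. w n T * cmod (K n T (y i) (y j) - bulk_kernel W (y i) (y j))) \<longlonglongrightarrow> 0)"
    proof (rule AE_mp, intro AE_I2 impI allI)
      fix y :: "nat \<Rightarrow> complex" and i j
      assume ae: "(\<forall>i\<in>{..<k}. \<forall>r\<in>X. cmod (y i) \<noteq> r) \<and> (\<forall>i\<in>{..<k}. \<forall>j\<in>{..<k} - {i}. cmod (y i) \<noteq> cmod (y j))"
        and yQ: "y \<in> tuples k Q" and ij: "i < k" "j < k"
      have yi: "y i \<in> Q" "y j \<in> Q" using yQ ij by (auto simp: PiE_iff)
      let ?b = "bulk_kernel W (y i) (y j)"
      define r where "r n T = cmod (cplx (1 / pi) * (\<Sum>l\<in>D n T. mode n l (y i) (y j)) - ?b)" for n T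
      have r0: "(\<lambda>n. \<Sum>T\<in>\<T> n. w n T * r n T) \<longlonglongrightarrow> 0"
      proof (cases "i = j")
        case True
        let ?t = "(cmod (y i))\<^sup>2"
        have "r n T = 1 / pi * \<bar>(\<Sum>l\<in>D n T. pois (real n * ?t) l) - indicat_real W ?t\<bar>" for n T
        proof -
          have "cplx (1 / pi) * (\<Sum>l\<in>D n T. mode n l (y i) (y j)) - ?b =
            cplx (1 / pi * ((\<Sum>l\<in>D n T. pois (real n * ?t) l) - indicat_real W ?t))"
            using True by (simp add: mode_diag bulk_kernel_def indicator_def right_diff_distrib)
          then show ?thesis unfolding r_def by (simp only: norm_of_real abs_mult) simp
        qed
        then have "(\<lambda>n. \<Sum>T\<in>\<T> n. w n T * r n T) =
          (\<lambda>n. 1 / pi * (\<Sum>T\<in>\<T> n. w n T * \<bar>(\<Sum>l\<in>D n T. pois (real n * ?t) l) - indicat_real W ?t\<bar>))"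
          by (simp add: sum_distrib_left sum_divide_distrib)
        moreover have "(\<lambda>n. \<Sum>T\<in>\<T> n. w n T * \<bar>(\<Sum>l\<in>D n T. pois (real n * ?t) l) - indicat_real W ?t\<bar>) \<longlonglongrightarrow> 0"
          using ae ij by (intro conv yi) auto
        ultimately show ?thesis by (simp only: tendsto_mult_right_zero)
      next
        case False
        then have ne: "cmod (y i) \<noteq> cmod (y j)" using ae ij by auto
        then have "y i \<noteq> y j" by auto
        then have b0: "?b = 0" by (simp add: bulk_kernel_def)
        define q where "q = exp (- (cmod (y i) - cmod (y j))\<^sup>2 / 2)"
        have q: "0 < q" "q < 1" using ne by (auto simp: q_def)
        have qn: "(\<lambda>n. q ^ n) \<longlonglongrightarrow> 0" using q by (intro LIMSEQ_realpow_zero) auto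
        have nn: "\<forall>\<^sub>F n in sequentially. 0 \<le> (\<Sum>T\<in>\<T> n. w n T * r n T)"
          using w by eventually_elim (auto intro!: sum_nonneg simp: r_def)
        have up: "\<forall>\<^sub>F n in sequentially. (\<Sum>T\<in>\<T> n. w n T * r n T) \<le> q ^ n"
          using w
        proof eventually_elim
          case (elim n)
          have "r n T \<le> q ^ n" if T: "T \<in> \<T> n" for T
          proof -
            have "r n T = 1 / pi * cmod (\<Sum>l\<in>D n T. mode n l (y i) (y j))"
              unfolding r_def b0 diff_0_right norm_mult norm_of_real by simp
            also have "\<dots> \<le> 1 * exp (- real n * (cmod (y i) - cmod (y j))\<^sup>2 / 2)"
              using pi_gt3 by (intro mult_mono plain finD[OF T]) auto
            also have "\<dots> = q ^ n" by (simp add: q_def mult.commute flip: exp_of_nat_mult)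
            finally show ?thesis .
          qed
          then have "(\<Sum>T\<in>\<T> n. w n T * r n T) \<le> (\<Sum>T\<in>\<T> n. w n T * q ^ n)"
            using elim by (intro sum_mono mult_left_mono) auto
          also have "\<dots> = q ^ n" using elim by (simp only: sum_distrib_right[symmetric] mult_1)
          finally show ?case .
        qed
        show ?thesis by (rule real_tendsto_sandwich[OF nn up tendsto_const qn])
      qed
      have e0: "(\<lambda>n. err n / pi + (\<Sum>T\<in>\<T> n. w n T * r n T)) \<longlonglongrightarrow> 0"
        using tendsto_add[OF tendsto_divide[OF err(1) tendsto_const[of pi]] r0] by simp
      have nn: "\<forall>\<^sub>F n in sequentially. 0 \<le> (\<Sum>T\<in>\<T> n. w n T * cmod (K n T (y i) (y j) - ?b))"
        using w by eventually_elim (auto intro!: sum_nonneg)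
      have up: "\<forall>\<^sub>F n in sequentially. (\<Sum>T\<in>\<T> n. w n T * cmod (K n T (y i) (y j) - ?b)) \<le> err n / pi + (\<Sum>T\<in>\<T> n. w n T * r n T)"
        using w close
      proof eventually_elim
        case (elim n)
        have "(\<Sum>T\<in>\<T> n. w n T * cmod (K n T (y i) (y j) - ?b)) \<le> (\<Sum>T\<in>\<T> n. w n T * (err n / pi + r n T))"
        proof (intro sum_mono mult_left_mono)
          fix T assume T: "T \<in> \<T> n"
          have "cmod (K n T (y i) (y j) - cplx (1 / pi) * (\<Sum>l\<in>D n T. mode n l (y i) (y j))) \<le> err n / pi"
            using elim(2) T yi by blast
          then show "cmod (K n T (y i) (y j) - ?b) \<le> err n / pi + r n T"
            unfolding r_def
            using norm_triangle_ineq[of "K n T (y i) (y j) - cplx (1 / pi) * (\<Sum>l\<in>D n T. mode n l (y i) (y j))"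
                "cplx (1 / pi) * (\<Sum>l\<in>D n T. mode n l (y i) (y j)) - ?b"] by simp
          show "0 \<le> w n T" using elim(1) T by blast
        qed
        also have "\<dots> = (\<Sum>T\<in>\<T> n. w n T) * (err n / pi) + (\<Sum>T\<in>\<T> n. w n T * r n T)"
          by (simp only: distrib_left sum.distrib sum_distrib_right)
        finally show ?case using elim(1) by simp
      qed
      show "(\<lambda>n. \<Sum>T\<in>\<T> n. w n T * cmod (K n T (y i) (y j) - ?b)) \<longlonglongrightarrow> 0"
        by (rule real_tendsto_sandwich[OF nn up tendsto_const e0])
    qed
  qed (use F Q w in auto)
  have "(\<Sum>T\<in>\<T> n. cplx (w n T) *
      kernel_integral k F (K n T)) =
     (\<Sum>T\<in>\<T> n. cplx (w n T) *
      kernel_integral k F (mode_kernel n (\<gamma> n) (D n T))) / of_nat n ^ k" for n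
  proof -
    have "kernel_integral k F (K n T) =
      cplx (1 / real n) ^ k * kernel_integral k F (mode_kernel n (\<gamma> n) (D n T))" for T
    proof -
      have "kernel_integral k F (K n T) =
        (LINT y|lborels k. cplx (1 / real n) ^ k *
          (F y * kernel_det k (mode_kernel n (\<gamma> n) (D n T)) y))"
        unfolding K_def leibniz_det_scale by (intro Bochner_Integration.integral_cong refl) (simp only: mult_ac)
      then show ?thesis by simp
    qed
    then show ?thesis by (simp add: sum_divide_distrib power_divide mult_ac)
  qed
  then show ?thesis using lim by simp
qed

section \<open>The bulk\<close>

lemma le_nat_floor_mult:
  assumes "0 \<le> c" "c \<le> 1" shows "nat \<lfloor>c * real n\<rfloor> \<le> n"
proof -
  have "c * real n \<le> 1 * real n" using assms by (intro mult_right_mono) auto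
  then show ?thesis by linarith
qed

section \<open>The random set of outer modes and its deviation from the top segment\<close>

locale conditioned_setting =
  fixes R c :: real
  assumes R: "0 < R" "R < 1" and c: "1 - R\<^sup>2 < c" "c \<le> 1"
begin

definition Nc :: "nat \<Rightarrow> nat" where "Nc n = nat \<lfloor>c * real n\<rfloor>"
definition M :: "nat \<Rightarrow> nat" where "M n = n - Nc n"
text \<open>The fraction of the norm of a mode that lies outside the circle of radius
  \<open>R\<close>, by \<open>ginibre_mass_outside\<close>.\<close>

definition \<alpha> :: "nat \<Rightarrow> nat \<Rightarrow> real" where "\<alpha> n = pois_cdf (real n * R\<^sup>2)"
abbreviation (input) G :: "nat \<Rightarrow> complex set measure" where "G n \<equiv> conditioned_ginibre n (Nc n) R"
definition prob :: "nat \<Rightarrow> nat set \<Rightarrow> real" where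
  "prob n = bernoulli_prob n (Nc n) (\<alpha> n) (\<lambda>j. 1 - \<alpha> n j)"
abbreviation TT :: "nat \<Rightarrow> nat set set" where "TT n \<equiv> size_subsets n (Nc n)"
text \<open>The mismatch probability of a single mode. These marginals are all that is ever used of
  the law of \<open>T\<close>.\<close>

definition mis :: "nat \<Rightarrow> nat \<Rightarrow> real" where
  "mis n l = (\<Sum>T\<in>{T \<in> TT n. (l \<in> T) \<noteq> (M n \<le> l)}. prob n T)"

lemma c_pos: "c > 0"
proof -
  have "R\<^sup>2 < 1" using R by (simp add: power_less_one_iff abs_square_less_1)
  then show ?thesis using c by linarith
qed

lemma Nc_le: "Nc n \<le> n"
  unfolding Nc_def using c_pos c by (intro le_nat_floor_mult) auto

lemma M_le: "M n \<le> n" by (simp add: M_def)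

lemma real_M: "real (M n) = real n - real (Nc n)"
  using Nc_le[of n] by (simp add: M_def of_nat_diff)

lemma M_bounds: "(1 - c) * real n \<le> real (M n)" "real (M n) \<le> (1 - c) * real n + 1"
proof -
  have "0 \<le> c * real n" using c_pos by simp
  then have "real (Nc n) \<le> c * real n" "c * real n \<le> real (Nc n) + 1"
    unfolding Nc_def by linarith+
  then show "(1 - c) * real n \<le> real (M n)" "real (M n) \<le> (1 - c) * real n + 1"
    unfolding real_M by (auto simp: algebra_simps)
qed

lemma M_ratio: "(\<lambda>n. real (M n) / real n) \<longlonglongrightarrow> 1 - c"
proof (rule real_tendsto_sandwich)
  show "\<forall>\<^sub>F n in sequentially. 1 - c \<le> real (M n) / real n"
    using eventually_gt_at_top[of 0] by eventually_elim (use M_bounds(1) in \<open>simp add: pos_le_divide_eq\<close>)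
  show "\<forall>\<^sub>F n in sequentially. real (M n) / real n \<le> (1 - c) + 1 / real n"
    using eventually_gt_at_top[of 0]
  proof eventually_elim
    case (elim n)
    have "real (M n) / real n \<le> ((1 - c) * real n + 1) / real n"
      using M_bounds(2)[of n] by (intro divide_right_mono) auto
    then show ?case using elim by (simp add: add_divide_distrib)
  qed
  show "(\<lambda>n. (1 - c) + 1 / real n) \<longlonglongrightarrow> 1 - c"
    using tendsto_add[OF tendsto_const[of "1 - c"] lim_1_over_n[where 'a=real]] by simp
qed auto

lemma \<alpha>_pos: "n > 0 \<Longrightarrow> 0 < \<alpha> n j" and \<alpha>_less_1: "n > 0 \<Longrightarrow> \<alpha> n j < 1"
  using R by (auto simp: \<alpha>_def pois_cdf_pos pois_cdf_less_1)

lemma prob_nonneg: "n > 0 \<Longrightarrow> T \<in> TT n \<Longrightarrow> prob n T \<ge> 0"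
  unfolding prob_def using \<alpha>_pos \<alpha>_less_1 Nc_le by (intro bernoulli_prob_space(1)) auto

lemma prob_sum: "n > 0 \<Longrightarrow> (\<Sum>T\<in>TT n. prob n T) = 1"
  unfolding prob_def using \<alpha>_pos \<alpha>_less_1 Nc_le by (intro bernoulli_prob_space(2)) auto

lemma prob_space_eventually:
  "\<forall>\<^sub>F n in sequentially. finite (TT n) \<and> (\<forall>T\<in>TT n. prob n T \<ge> 0) \<and> (\<Sum>T\<in>TT n. prob n T) = 1"
  using eventually_gt_at_top[of 0] by eventually_elim (simp add: prob_nonneg prob_sum)

lemma mis_nonneg: "n > 0 \<Longrightarrow> 0 \<le> mis n l"
  unfolding mis_def by (intro sum_nonneg prob_nonneg) auto

lemma mis_le_1: "n > 0 \<Longrightarrow> mis n l \<le> 1"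
  unfolding mis_def by (subst prob_sum[symmetric], assumption, intro sum_mono2) (auto intro: prob_nonneg)

text \<open>Because \<open>1 - c < R\<^sup>2\<close>, the modes near \<open>M n\<close> lie below
  the Poisson mean, where the odds grow by at least \<open>1 / \<rho>\<close> per mode. Over a
  distance of order \<open>n\<close> this exponential gain beats the factor \<open>n\<close> lost in
  the union bound.\<close>

lemma mis_far:
  assumes \<eta>: "0 < \<eta>" "\<eta> < (R\<^sup>2 - (1 - c)) / 4"
  obtains \<epsilon> where "\<epsilon> \<longlonglongrightarrow> 0"
    "\<forall>\<^sub>F n in sequentially. \<forall>l<n. \<eta> * real n \<le> \<bar>real l - real (M n)\<bar> \<longrightarrow> mis n l \<le> \<epsilon> n"
proof -
  \<comment> \<open>A lower partner \<open>i\<close> is below \<open>M n\<close>, about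
    \<open>(1 - c) * n\<close>, and \<open>d\<close> is about \<open>\<eta> * n\<close>; the second
    multiple of \<eta> absorbs the roundings. The bound on \<eta> makes the ratio to the mean
    \<open>n * R\<^sup>2\<close> smaller than 1.\<close>
  define \<rho> where "\<rho> = (1 - c + 2 * \<eta>) / R\<^sup>2"
  have R2: "R\<^sup>2 > 0" using R by simp
  have "1 - c + 2 * \<eta> < R\<^sup>2" using \<eta> by (simp add: field_simps)
  then have \<rho>: "0 < \<rho>" "\<rho> < 1" using \<eta> c R2 by (auto simp: \<rho>_def pos_divide_less_eq)
  define x where "x = \<rho> powr \<eta>"
  have x: "0 < x" "x < 1" using \<rho> \<eta> powr_less_mono2[of \<eta> \<rho> 1] by (auto simp: x_def)
  show ?thesis
  proof (rule that[of "\<lambda>n. real n * x ^ n"])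
    show "(\<lambda>n. real n * x ^ n) \<longlonglongrightarrow> 0" using x by (intro powser_times_n_limit_0) auto
    have "\<forall>\<^sub>F n in sequentially. real n > 2 / \<eta>"
      using filterlim_real_sequentially by (simp add: filterlim_at_top_dense)
    then show "\<forall>\<^sub>F n in sequentially. \<forall>l<n. \<eta> * real n \<le> \<bar>real l - real (M n)\<bar> \<longrightarrow> mis n l \<le> real n * x ^ n"
    proof eventually_elim
      case (elim n)
      have n: "n > 0" using elim \<eta> by (metis divide_pos_pos of_nat_0_less_iff order.strict_trans zero_less_numeral)
      have big: "\<eta> * real n > 2" using elim \<eta> by (simp add: pos_divide_less_eq mult.commute)
      define d where "d = nat \<lceil>\<eta> * real n\<rceil>"
      have d: "d > 0" "\<eta> * real n \<le> real d" "real d < \<eta> * real n + 1"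
        using big unfolding d_def by linarith+
      show ?case
      proof (intro allI impI)
        fix l assume l: "l < n" "\<eta> * real n \<le> \<bar>real l - real (M n)\<bar>"
        have "\<eta> * real n \<le> real_of_int \<bar>int l - int (M n)\<bar>" using l(2) by simp
        then have "\<lceil>\<eta> * real n\<rceil> \<le> \<bar>int l - int (M n)\<bar>" by (simp only: ceiling_le_iff)
        then have ld: "l + d \<le> M n \<or> M n + d \<le> l" unfolding d_def using big by linarith
        have "mis n l \<le> real n * \<rho> ^ d"
          unfolding mis_def prob_def M_def
        proof (rule bernoulli_prob_concentration)
          fix i j assume ij: "i < n - Nc n" "n - Nc n \<le> j" "j < n" "i + d \<le> j"
          have "real (i + d) \<le> real (M n) + real d - 1" using ij(1) unfolding M_def by linarith
          also have "\<dots> \<le> (1 - c) * real n + 1 + \<eta> * real n" using M_bounds(2)[of n] d(3) by linarith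
          also have "\<dots> \<le> (1 - c + 2 * \<eta>) * real n" using big by (simp add: algebra_simps)
          also have "\<dots> = \<rho> * (real n * R\<^sup>2)" using R2 by (simp add: \<rho>_def)
          finally show "\<alpha> n i * (1 - \<alpha> n j) \<le> \<rho> ^ d * (\<alpha> n j * (1 - \<alpha> n i))"
            unfolding \<alpha>_def using R2 n ij(4) by (intro pois_odds_ratio) auto
        qed (use n \<alpha>_pos \<alpha>_less_1 Nc_le \<rho> d l ld in \<open>auto simp: M_def\<close>)
        also have "\<rho> ^ d \<le> x ^ n"
        proof -
          have "\<rho> ^ d = \<rho> powr real d" using \<rho> by (simp add: powr_realpow)
          also have "\<dots> \<le> \<rho> powr (\<eta> * real n)" using \<rho> d by (intro powr_mono') auto
          also have "\<dots> = x ^ n" using x by (simp add: x_def powr_powr[symmetric] powr_realpow)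
          finally show ?thesis .
        qed
        finally show "mis n l \<le> real n * x ^ n" by (simp add: mult_left_mono)
      qed
    qed
  qed
qed

text \<open>Exchanging the two sums turns the expected discrepancy of a linear statistic into a sum
  over modes, so no joint law of several memberships is involved.\<close>

lemma expected_mismatch:
  assumes n: "n > 0" and v: "\<And>l. l < n \<Longrightarrow> v l \<ge> (0::real)"
    and b: "\<And>T. T \<in> TT n \<Longrightarrow> b T \<le> (\<Sum>l\<in>{l \<in> {..<n}. (l \<in> T) \<noteq> (M n \<le> l)}. v l)"
  shows "(\<Sum>T\<in>TT n. prob n T * b T) \<le> (\<Sum>l<n. mis n l * v l)"
proof -
  have "(\<Sum>T\<in>TT n. prob n T * b T) \<le> (\<Sum>T\<in>TT n. prob n T * (\<Sum>l\<in>{l \<in> {..<n}. (l \<in> T) \<noteq> (M n \<le> l)}. v l))"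
    using prob_nonneg[OF n] b by (intro sum_mono mult_left_mono)
  also have "\<dots> = (\<Sum>T\<in>TT n. \<Sum>l<n. if (l \<in> T) \<noteq> (M n \<le> l) then prob n T * v l else 0)"
    by (intro sum.cong refl) (simp add: sum_distrib_left sum.inter_filter[symmetric] if_distrib)
  also have "\<dots> = (\<Sum>l<n. \<Sum>T\<in>TT n. if (l \<in> T) \<noteq> (M n \<le> l) then prob n T * v l else 0)"
    by (rule sum.swap)
  also have "\<dots> = (\<Sum>l<n. mis n l * v l)"
    by (intro sum.cong refl) (simp add: mis_def sum_distrib_right sum.inter_filter[symmetric])
  finally show ?thesis .
qed

text \<open>Far from \<open>M n\<close> the mismatch probabilities are uniformly small. Near
  \<open>M n\<close> nothing is known about them, but there the Poisson law of mean
  \<open>n * t\<close> has little mass, since \<open>t\<close> differs from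
  \<open>1 - c\<close>.\<close>

lemma mis_pois_tendsto:
  assumes t: "t \<ge> 0" "t \<noteq> 1 - c"
  shows "(\<lambda>n. \<Sum>l<n. mis n l * pois (real n * t) l) \<longlonglongrightarrow> 0"
proof -
  let ?x = "1 - c"
  define \<eta> where "\<eta> = min ((R\<^sup>2 - ?x) / 8) (\<bar>t - ?x\<bar> / 2)"
  \<comment> \<open>The distance from \<open>t\<close> to \<open>1 - c\<close> is
    \<open>4 * \<delta>\<close>, and \<eta> is at most \<open>2 * \<delta>\<close>. A mode within
    \<open>\<eta> * n\<close> of \<open>M n\<close>, itself within \<open>\<delta> * n\<close> of
    its asymptotic place, stays at distance \<open>\<delta> * n\<close> from the mean.\<close>
  define \<delta> where "\<delta> = \<bar>t - ?x\<bar> / 4"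
  have \<delta>: "\<delta> > 0" using t by (simp add: \<delta>_def)
  have "R\<^sup>2 - ?x > 0" using c by simp
  then have \<eta>: "0 < \<eta>" "\<eta> < (R\<^sup>2 - ?x) / 4" using t by (auto simp: \<eta>_def min_def)
  obtain \<epsilon> where \<epsilon>: "\<epsilon> \<longlonglongrightarrow> 0"
    "\<forall>\<^sub>F n in sequentially. \<forall>l<n. \<eta> * real n \<le> \<bar>real l - real (M n)\<bar> \<longrightarrow> mis n l \<le> \<epsilon> n"
    by (rule mis_far[OF \<eta>]) blast
  have "\<forall>\<^sub>F n in sequentially. dist (real (M n) / real n) ?x < \<delta>"
    using M_ratio \<delta> by (rule tendstoD)
  then have up: "\<forall>\<^sub>F n in sequentially. (\<Sum>l<n. mis n l * pois (real n * t) l) \<le> \<bar>\<epsilon> n\<bar> + t / \<delta>\<^sup>2 * (1 / real n)"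
    using \<epsilon>(2) eventually_gt_at_top[of 0]
  proof eventually_elim
    case (elim n)
    have n: "n > 0" by fact
    let ?near = "{l \<in> {..<n}. \<bar>real l - real (M n)\<bar> < \<eta> * real n}"
    let ?far = "{l \<in> {..<n}. \<not> \<bar>real l - real (M n)\<bar> < \<eta> * real n}"
    have p0: "pois (real n * t) l \<ge> 0" for l using t by (intro pois_nonneg) auto
    have "(\<Sum>l<n. mis n l * pois (real n * t) l) = (\<Sum>l\<in>?far. mis n l * pois (real n * t) l) + (\<Sum>l\<in>?near. mis n l * pois (real n * t) l)"
      by (subst sum.union_disjoint[symmetric]) (auto intro!: sum.cong)
    also have "(\<Sum>l\<in>?far. mis n l * pois (real n * t) l) \<le> (\<Sum>l\<in>?far. \<bar>\<epsilon> n\<bar> * pois (real n * t) l)"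
    proof (intro sum_mono mult_right_mono p0)
      fix l assume "l \<in> ?far"
      then have "mis n l \<le> \<epsilon> n" using elim(2) by auto
      then show "mis n l \<le> \<bar>\<epsilon> n\<bar>" by linarith
    qed
    also have "\<dots> \<le> \<bar>\<epsilon> n\<bar> * 1"
      unfolding sum_distrib_left[symmetric] using t by (intro mult_left_mono pois_sum_le_1) auto
    also have "(\<Sum>l\<in>?near. mis n l * pois (real n * t) l) \<le> (\<Sum>l\<in>?near. 1 * pois (real n * t) l)"
      using mis_le_1[OF n] p0 by (intro sum_mono mult_right_mono) auto
    also have "\<dots> \<le> real n * t / (\<delta> * real n)\<^sup>2"
      unfolding mult_1
    proof (rule pois_chebyshev)
      fix l assume "l \<in> ?near"
      then have l: "\<bar>real l - real (M n)\<bar> < \<eta> * real n" by simp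
      have "\<bar>real (M n) / real n - ?x\<bar> < \<delta>" using elim(1) by (simp add: dist_real_def)
      then have "\<bar>real (M n) - ?x * real n\<bar> < \<delta> * real n"
        using n by (simp add: abs_less_iff field_simps)
      moreover have "\<eta> * real n \<le> 2 * \<delta> * real n"
      proof (intro mult_right_mono)
        have "\<eta> \<le> \<bar>t - ?x\<bar> / 2" unfolding \<eta>_def by (rule min.cobounded2)
        then show "\<eta> \<le> 2 * \<delta>" by (simp add: \<delta>_def)
      qed simp
      moreover have "\<bar>real n * t - ?x * real n\<bar> = 4 * \<delta> * real n"
      proof -
        have "real n * t - ?x * real n = real n * (t - ?x)" by (simp add: algebra_simps)
        then show ?thesis by (simp add: abs_mult \<delta>_def)
      qed
      ultimately show "\<delta> * real n \<le> \<bar>real l - real n * t\<bar>" using l by linarith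
    qed (use t n \<delta> in auto)
    also have "\<dots> = t / \<delta>\<^sup>2 * (1 / real n)" using n by (simp add: power2_eq_square)
    finally show ?case by simp
  qed
  have lim: "(\<lambda>n. \<bar>\<epsilon> n\<bar> + t / \<delta>\<^sup>2 * (1 / real n)) \<longlonglongrightarrow> 0"
    using tendsto_add[OF tendsto_rabs_zero[OF \<epsilon>(1)] tendsto_mult_right_zero[OF lim_1_over_n[where 'a=real], of "t / \<delta>\<^sup>2"]] by simp
  have nn: "\<forall>\<^sub>F n in sequentially. 0 \<le> (\<Sum>l<n. mis n l * pois (real n * t) l)"
    using eventually_gt_at_top[of 0]
    by eventually_elim (use t in \<open>auto intro!: sum_nonneg mult_nonneg_nonneg mis_nonneg pois_nonneg\<close>)
  show ?thesis by (rule real_tendsto_sandwich[OF nn up tendsto_const lim])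
qed

text \<open>Through the arithmetic mean in \<open>cmod_mode_le\<close>, a bound for diagonal entries
  is inherited by all entries.\<close>

lemma symmetric_mode_bound:
  assumes "\<And>t. t \<in> P \<Longrightarrow> (\<Sum>l<n. pois (real n * t) l * \<bar>1 / \<gamma> l - 1\<bar>) \<le> e"
    and "J \<subseteq> {..<n}" "(cmod x)\<^sup>2 \<in> P" "(cmod y)\<^sup>2 \<in> P"
  shows "(\<Sum>l\<in>J. cmod (mode n l x y) * \<bar>1 / \<gamma> l - 1\<bar>) \<le> e"
proof -
  have "(\<Sum>l\<in>J. cmod (mode n l x y) * \<bar>1 / \<gamma> l - 1\<bar>) \<le> (\<Sum>l<n. cmod (mode n l x y) * \<bar>1 / \<gamma> l - 1\<bar>)"
    using assms(2) by (intro sum_mono2) auto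
  also have "\<dots> \<le> (\<Sum>l<n. (pois (real n * (cmod x)\<^sup>2) l + pois (real n * (cmod y)\<^sup>2) l) / 2 * \<bar>1 / \<gamma> l - 1\<bar>)"
    by (intro sum_mono mult_right_mono cmod_mode_le) auto
  also have "\<dots> = ((\<Sum>l<n. pois (real n * (cmod x)\<^sup>2) l * \<bar>1 / \<gamma> l - 1\<bar>) + (\<Sum>l<n. pois (real n * (cmod y)\<^sup>2) l * \<bar>1 / \<gamma> l - 1\<bar>)) / 2"
    by (simp add: sum.distrib sum_divide_distrib field_simps flip: sum.distrib)
  also have "\<dots> \<le> (e + e) / 2"
    by (intro divide_right_mono add_mono assms(1)[OF assms(3)] assms(1)[OF assms(4)]) simp
  also have "\<dots> = e" by simp
  finally show ?thesis .
qed

lemma exp_decay: "\<kappa> > 0 \<Longrightarrow> (\<lambda>n. real n * exp (- \<kappa> * real n)) \<longlonglongrightarrow> 0"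
proof -
  assume "\<kappa> > 0"
  then have "norm (exp (- \<kappa>)) < 1" by simp
  then have "(\<lambda>n. real n * exp (- \<kappa>) ^ n) \<longlonglongrightarrow> 0" by (rule powser_times_n_limit_0)
  then show ?thesis by (simp add: exp_of_nat_mult[symmetric] mult.commute)
qed

text \<open>Modes split into \<open>bad\<close> ones, exponentially small on the region, and the others, whose
  normalisation is within \<open>C / n\<close> of 1.\<close>

lemma normalisation_error:
  assumes \<kappa>: "\<kappa> > 0" and C: "C \<ge> 0" and C': "C' \<ge> 0" and P: "\<And>t. t \<in> P \<Longrightarrow> t \<ge> 0"
    and \<gamma>: "\<And>n l. n > 0 \<Longrightarrow> l < n \<Longrightarrow> 0 < \<gamma> n l \<and> \<gamma> n l \<le> 1"
    and bad: "\<And>n l t. n > 0 \<Longrightarrow> l < n \<Longrightarrow> bad n l \<Longrightarrow> t \<in> P \<Longrightarrow> pois (real n * t) l \<le> C' * exp (- \<kappa> * real n) * \<gamma> n l"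
    and good: "\<And>n l. n > 0 \<Longrightarrow> l < n \<Longrightarrow> \<not> bad n l \<Longrightarrow> 1 - \<gamma> n l \<le> C / real n"
  obtains err where "err \<longlonglongrightarrow> 0" "\<forall>\<^sub>F n in sequentially. \<forall>J\<subseteq>{..<n}. \<forall>x y. (cmod x)\<^sup>2 \<in> P \<longrightarrow> (cmod y)\<^sup>2 \<in> P \<longrightarrow>
      (\<Sum>l\<in>J. cmod (mode n l x y) * \<bar>1 / \<gamma> n l - 1\<bar>) \<le> err n"
proof (rule that)
  let ?err = "\<lambda>n. C' * (real n * exp (- \<kappa> * real n)) + 2 * C * (1 / real n)"
  show "?err \<longlonglongrightarrow> 0"
    using tendsto_add[OF tendsto_mult_right_zero[OF exp_decay[OF \<kappa>], of C'] tendsto_mult_right_zero[OF lim_1_over_n[where 'a=real], of "2 * C"]]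
    by simp
  have "\<forall>\<^sub>F n in sequentially. real n > 2 * C"
    using filterlim_real_sequentially by (simp add: filterlim_at_top_dense)
  then show "\<forall>\<^sub>F n in sequentially. \<forall>J\<subseteq>{..<n}. \<forall>x y. (cmod x)\<^sup>2 \<in> P \<longrightarrow> (cmod y)\<^sup>2 \<in> P \<longrightarrow>
      (\<Sum>l\<in>J. cmod (mode n l x y) * \<bar>1 / \<gamma> n l - 1\<bar>) \<le> ?err n"
    using eventually_gt_at_top[of 0]
  proof eventually_elim
    case (elim n)
    have n: "n > 0" by fact
    have half: "C / real n \<le> 1 / 2" using elim by (simp add: pos_divide_le_eq)
    have key: "(\<Sum>l<n. pois (real n * t) l * \<bar>1 / \<gamma> n l - 1\<bar>) \<le> ?err n" if t: "t \<in> P" for t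
    proof -
      have p0: "pois (real n * t) l \<ge> 0" for l using P[OF t] by (intro pois_nonneg) auto
      have "pois (real n * t) l * \<bar>1 / \<gamma> n l - 1\<bar> \<le> C' * exp (- \<kappa> * real n) + pois (real n * t) l * (2 * C * (1 / real n))"
        if l: "l < n" for l
      proof -
        have g: "0 < \<gamma> n l" "\<gamma> n l \<le> 1" using \<gamma>[OF n l] by auto
        have ab: "\<bar>1 / \<gamma> n l - 1\<bar> = (1 - \<gamma> n l) / \<gamma> n l" using g by (simp add: field_simps)
        show ?thesis
        proof (cases "bad n l")
          case True
          have "pois (real n * t) l * \<bar>1 / \<gamma> n l - 1\<bar> \<le> pois (real n * t) l * (1 / \<gamma> n l)"
            unfolding ab using g p0 by (intro mult_left_mono divide_right_mono) auto
          also have "\<dots> \<le> C' * exp (- \<kappa> * real n)"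
            using bad[OF n l True t] g by (simp add: pos_divide_le_eq)
          finally have "pois (real n * t) l * \<bar>1 / \<gamma> n l - 1\<bar> \<le> C' * exp (- \<kappa> * real n)" .
          moreover have "0 \<le> pois (real n * t) l * (2 * C * (1 / real n))" using p0 C by (intro mult_nonneg_nonneg) auto
          ultimately show ?thesis by linarith
        next
          case False
          have g1: "1 - \<gamma> n l \<le> C / real n" using good[OF n l False] .
          then have g2: "\<gamma> n l \<ge> 1 / 2" using half by linarith
          have "(1 - \<gamma> n l) / \<gamma> n l \<le> (1 - \<gamma> n l) / (1 / 2)" using g g2 by (intro divide_left_mono) auto
          also have "\<dots> \<le> 2 * C * (1 / real n)" using g1 by simp
          finally have "pois (real n * t) l * \<bar>1 / \<gamma> n l - 1\<bar> \<le> pois (real n * t) l * (2 * C * (1 / real n))"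
            unfolding ab using p0 by (intro mult_left_mono) auto
          moreover have "0 \<le> C' * exp (- \<kappa> * real n)" using C' by simp
          ultimately show ?thesis by linarith
        qed
      qed
      then have "(\<Sum>l<n. pois (real n * t) l * \<bar>1 / \<gamma> n l - 1\<bar>) \<le>
         (\<Sum>l<n. C' * exp (- \<kappa> * real n) + pois (real n * t) l * (2 * C * (1 / real n)))"
        by (intro sum_mono) auto
      also have "\<dots> = C' * (real n * exp (- \<kappa> * real n)) + (\<Sum>l<n. pois (real n * t) l) * (2 * C * (1 / real n))"
        by (simp only: sum.distrib sum_distrib_right sum_constant card_lessThan) simp
      also have "\<dots> \<le> C' * (real n * exp (- \<kappa> * real n)) + 1 * (2 * C * (1 / real n))"
        using P[OF t] C by (intro add_left_mono mult_right_mono pois_sum_le_1) auto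
      finally show ?thesis by simp
    qed
    show ?case using symmetric_mode_bound[of P n "\<gamma> n" "?err n", OF key] by blast
  qed
qed

text \<open>For modes up to \<open>n * (R\<^sup>2 + \<delta>)\<close> the factor \<alpha> may be
  tiny, but beyond radius \<open>r\<close> such a mode is smaller than its value at radius
  \<open>R\<close> by an exponential factor, and that value is a single summand of \<alpha>. For the
  higher modes \<alpha> is close to 1 by Chebyshev.\<close>

lemma error_outside:
  assumes r: "R < r"
  obtains err where "err \<longlonglongrightarrow> 0" "\<forall>\<^sub>F n in sequentially. \<forall>J\<subseteq>{..<n}. \<forall>x y. (cmod x)\<^sup>2 \<in> {r\<^sup>2..} \<longrightarrow> (cmod y)\<^sup>2 \<in> {r\<^sup>2..} \<longrightarrow>
      (\<Sum>l\<in>J. cmod (mode n l x y) * \<bar>1 / \<alpha> n l - 1\<bar>) \<le> err n"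
proof -
  have s: "0 < R\<^sup>2" "R\<^sup>2 < r\<^sup>2" using R r by (auto intro: power_strict_mono)
  obtain \<delta> \<kappa> where \<delta>: "\<delta> > 0" "\<kappa> > 0" "R\<^sup>2 + \<delta> \<le> r\<^sup>2"
    and cmp: "\<And>N j t. r\<^sup>2 \<le> t \<Longrightarrow> real j \<le> real N * (R\<^sup>2 + \<delta>) \<Longrightarrow>
      pois (real N * t) j \<le> exp (- \<kappa> * real N) * pois (real N * R\<^sup>2) j"
    by (rule pois_compare_above[OF s]) blast
  show ?thesis
  proof (rule normalisation_error[where \<kappa>=\<kappa> and C="R\<^sup>2 / \<delta>\<^sup>2" and C'=1 and P="{r\<^sup>2..}" and \<gamma>=\<alpha>
        and bad="\<lambda>n l. real l \<le> real n * (R\<^sup>2 + \<delta>)", OF _ _ _ _ _ _ _ that])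
    show "0 < \<alpha> n l \<and> \<alpha> n l \<le> 1" if "n > 0" for n l using \<alpha>_pos[OF that] \<alpha>_less_1[OF that] by (simp add: less_imp_le)
    show "pois (real n * t) l \<le> 1 * exp (- \<kappa> * real n) * \<alpha> n l"
      if "n > 0" "real l \<le> real n * (R\<^sup>2 + \<delta>)" "t \<in> {r\<^sup>2..}" for n l t
    proof -
      have "pois (real n * R\<^sup>2) l \<le> \<alpha> n l"
        unfolding \<alpha>_def pois_cdf_def using s by (intro member_le_sum) (auto intro!: pois_nonneg)
      then have "exp (- \<kappa> * real n) * pois (real n * R\<^sup>2) l \<le> exp (- \<kappa> * real n) * \<alpha> n l" by (intro mult_left_mono) auto
      with cmp[of t l n] that have "pois (real n * t) l \<le> exp (- \<kappa> * real n) * \<alpha> n l"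
        by (intro order.trans[OF cmp]) auto
      then show ?thesis by simp
    qed
    show "1 - \<alpha> n l \<le> R\<^sup>2 / \<delta>\<^sup>2 / real n" if "n > 0" "\<not> real l \<le> real n * (R\<^sup>2 + \<delta>)" for n l
    proof -
      have "1 - \<alpha> n l \<le> real n * R\<^sup>2 / (\<delta> * real n)\<^sup>2"
        unfolding \<alpha>_def using that \<delta> by (intro pois_upper_tail) (auto simp: algebra_simps)
      also have "\<dots> = R\<^sup>2 / \<delta>\<^sup>2 / real n" using that by (simp add: power2_eq_square)
      finally show ?thesis .
    qed
    show "0 \<le> t" if "t \<in> {r\<^sup>2..}" for t using that by (auto intro: order.trans[OF zero_le_power2])
  qed (use \<delta> in auto)
qed

text \<open>The counterpart of \<open>error_outside\<close>, with one difference: the summand at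
  \<open>l\<close> belongs to \<alpha>, not to \<open>1 - \<alpha>\<close>, so the comparison uses
  the next one. By \<open>pois_Suc\<close> and \<open>l + 1 \<le> n\<close> that summand is at least
  \<open>R\<^sup>2\<close> times the one at \<open>l\<close>, whence the constant
  \<open>1 / R\<^sup>2\<close>.\<close>

lemma error_inside:
  assumes r: "0 < r" "r < R"
  obtains err where "err \<longlonglongrightarrow> 0" "\<forall>\<^sub>F n in sequentially. \<forall>J\<subseteq>{..<n}. \<forall>x y. (cmod x)\<^sup>2 \<in> {0..r\<^sup>2} \<longrightarrow> (cmod y)\<^sup>2 \<in> {0..r\<^sup>2} \<longrightarrow>
      (\<Sum>l\<in>J. cmod (mode n l x y) * \<bar>1 / (1 - \<alpha> n l) - 1\<bar>) \<le> err n"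
proof -
  have s: "0 < r\<^sup>2" "r\<^sup>2 < R\<^sup>2" using r by (auto intro: power_strict_mono)
  obtain \<delta> \<kappa> where \<delta>: "\<delta> > 0" "\<kappa> > 0" "r\<^sup>2 \<le> R\<^sup>2 - \<delta>"
    and cmp: "\<And>N j t. 0 \<le> t \<Longrightarrow> t \<le> r\<^sup>2 \<Longrightarrow> N > 0 \<Longrightarrow> real N * (R\<^sup>2 - \<delta>) \<le> real j \<Longrightarrow>
      pois (real N * t) j \<le> exp (- \<kappa> * real N) * pois (real N * R\<^sup>2) j"
    by (rule pois_compare_below[OF s]) blast
  show ?thesis
  proof (rule normalisation_error[where \<kappa>=\<kappa> and C="R\<^sup>2 / \<delta>\<^sup>2" and C'="1 / R\<^sup>2" and P="{0..r\<^sup>2}" and \<gamma>="\<lambda>n l. 1 - \<alpha> n l"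
        and bad="\<lambda>n l. real n * (R\<^sup>2 - \<delta>) \<le> real l", OF _ _ _ _ _ _ _ that])
    show "0 < 1 - \<alpha> n l \<and> 1 - \<alpha> n l \<le> 1" if "n > 0" for n l using \<alpha>_pos[OF that] \<alpha>_less_1[OF that] by (simp add: less_imp_le)
    show "pois (real n * t) l \<le> 1 / R\<^sup>2 * exp (- \<kappa> * real n) * (1 - \<alpha> n l)"
      if n: "n > 0" and l: "l < n" and b: "real n * (R\<^sup>2 - \<delta>) \<le> real l" and t: "t \<in> {0..r\<^sup>2}" for n l t
    proof -
      have p: "0 \<le> pois (real n * R\<^sup>2) l" by (intro pois_nonneg) simp
      have "R\<^sup>2 * pois (real n * R\<^sup>2) l \<le> pois (real n * R\<^sup>2) (Suc l)"
      proof -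
        have "real (Suc l) * (R\<^sup>2 * pois (real n * R\<^sup>2) l) \<le> real n * (R\<^sup>2 * pois (real n * R\<^sup>2) l)"
          using l p by (intro mult_right_mono) auto
        also have "\<dots> = real (Suc l) * pois (real n * R\<^sup>2) (Suc l)" by (simp only: pois_Suc mult.assoc)
        finally show ?thesis by (simp only: mult_le_cancel_left_pos of_nat_0_less_iff zero_less_Suc)
      qed
      also have "\<dots> \<le> 1 - \<alpha> n l"
        using pois_cdf_le_1[of "real n * R\<^sup>2" "Suc l"] by (simp add: \<alpha>_def pois_cdf_Suc)
      finally have "pois (real n * R\<^sup>2) l \<le> 1 / R\<^sup>2 * (1 - \<alpha> n l)" using R by (simp add: pos_le_divide_eq mult.commute)
      then have "exp (- \<kappa> * real n) * pois (real n * R\<^sup>2) l \<le> exp (- \<kappa> * real n) * (1 / R\<^sup>2 * (1 - \<alpha> n l))"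
        by (intro mult_left_mono) auto
      moreover have "pois (real n * t) l \<le> exp (- \<kappa> * real n) * pois (real n * R\<^sup>2) l"
        using n b t by (intro cmp) auto
      ultimately have "pois (real n * t) l \<le> exp (- \<kappa> * real n) * (1 / R\<^sup>2 * (1 - \<alpha> n l))" by linarith
      then show ?thesis by (simp add: mult_ac)
    qed
    show "1 - (1 - \<alpha> n l) \<le> R\<^sup>2 / \<delta>\<^sup>2 / real n" if "n > 0" "\<not> real n * (R\<^sup>2 - \<delta>) \<le> real l" for n l
    proof -
      have "\<alpha> n l \<le> real n * R\<^sup>2 / (\<delta> * real n)\<^sup>2"
        unfolding \<alpha>_def using that \<delta> by (intro pois_lower_tail) (auto simp: algebra_simps)
      also have "\<dots> = R\<^sup>2 / \<delta>\<^sup>2 / real n" using that by (simp add: power2_eq_square)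
      finally show ?thesis by simp
    qed
  qed (use \<delta> in auto)
qed

end

section \<open>Convergence in the bulk, outside and inside the circle\<close>

lemma norm_sum_diff_le_mismatch:
  fixes v :: "nat \<Rightarrow> 'a::real_normed_vector"
  assumes "X \<subseteq> {..<n}" "Y \<subseteq> {..<n}"
  shows "norm ((\<Sum>l\<in>X. v l) - (\<Sum>l\<in>Y. v l)) \<le> (\<Sum>l\<in>{l \<in> {..<n}. (l \<in> X) \<noteq> (l \<in> Y)}. norm (v l))"
proof -
  have e: "(\<Sum>l\<in>Z. v l) = (\<Sum>l<n. if l \<in> Z then v l else 0)" if "Z \<subseteq> {..<n}" for Z
    using that by (simp add: sum.If_cases Int_absorb1)
  have "(\<Sum>l\<in>X. v l) - (\<Sum>l\<in>Y. v l) = (\<Sum>l<n. (if l \<in> X then v l else 0) - (if l \<in> Y then v l else 0))"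
    unfolding e[OF assms(1)] e[OF assms(2)] by (rule sum_subtractf[symmetric])
  also have "norm \<dots> \<le> (\<Sum>l<n. norm ((if l \<in> X then v l else 0) - (if l \<in> Y then v l else 0)))" by (rule norm_sum)
  also have "\<dots> = (\<Sum>l<n. if (l \<in> X) \<noteq> (l \<in> Y) then norm (v l) else 0)"
    by (intro sum.cong) auto
  also have "\<dots> = (\<Sum>l\<in>{l \<in> {..<n}. (l \<in> X) \<noteq> (l \<in> Y)}. norm (v l))" by (simp add: sum.inter_filter[symmetric])
  finally show ?thesis .
qed

lemma mismatch_pois:
  assumes "X \<subseteq> {..<n}" "Y \<subseteq> {..<n}" "L \<ge> 0"
  shows "\<bar>(\<Sum>l\<in>X. pois L l) - (\<Sum>l\<in>Y. pois L l)\<bar> \<le> (\<Sum>l\<in>{l \<in> {..<n}. (l \<in> X) \<noteq> (l \<in> Y)}. pois L l)"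
  using norm_sum_diff_le_mismatch[OF assms(1,2), of "pois L"] assms(3) by (simp add: pois_nonneg)

lemma mean_abs_tendsto:
  fixes w :: "nat \<Rightarrow> 'a \<Rightarrow> real"
  assumes w: "\<forall>\<^sub>F n in sequentially. finite (\<T> n) \<and> (\<forall>T\<in>\<T> n. w n T \<ge> 0) \<and> (\<Sum>T\<in>\<T> n. w n T) = 1"
    and X: "(\<lambda>n. \<Sum>T\<in>\<T> n. w n T * \<bar>X n T - Y n\<bar>) \<longlonglongrightarrow> 0" and Y: "Y \<longlonglongrightarrow> L"
  shows "(\<lambda>n. \<Sum>T\<in>\<T> n. w n T * \<bar>X n T - L\<bar>) \<longlonglongrightarrow> 0"
proof -
  have nn: "\<forall>\<^sub>F n in sequentially. 0 \<le> (\<Sum>T\<in>\<T> n. w n T * \<bar>X n T - L\<bar>)"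
    using w by eventually_elim (auto intro!: sum_nonneg)
  have up: "\<forall>\<^sub>F n in sequentially. (\<Sum>T\<in>\<T> n. w n T * \<bar>X n T - L\<bar>) \<le> (\<Sum>T\<in>\<T> n. w n T * \<bar>X n T - Y n\<bar>) + \<bar>Y n - L\<bar>"
    using w
  proof eventually_elim
    case (elim n)
    have "(\<Sum>T\<in>\<T> n. w n T * \<bar>X n T - L\<bar>) \<le> (\<Sum>T\<in>\<T> n. w n T * (\<bar>X n T - Y n\<bar> + \<bar>Y n - L\<bar>))"
      using elim by (intro sum_mono mult_left_mono) auto
    also have "\<dots> = (\<Sum>T\<in>\<T> n. w n T * \<bar>X n T - Y n\<bar>) + (\<Sum>T\<in>\<T> n. w n T) * \<bar>Y n - L\<bar>"
      by (simp only: distrib_left sum.distrib sum_distrib_right)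
    finally show ?case using elim by simp
  qed
  have "(\<lambda>n. Y n - L) \<longlonglongrightarrow> 0" using Y by (simp add: LIM_zero)
  then have lim: "(\<lambda>n. (\<Sum>T\<in>\<T> n. w n T * \<bar>X n T - Y n\<bar>) + \<bar>Y n - L\<bar>) \<longlonglongrightarrow> 0"
    using tendsto_add[OF X tendsto_rabs_zero] by simp
  show ?thesis by (rule real_tendsto_sandwich[OF nn up tendsto_const lim])
qed

lemma ratio_self_tendsto: "(\<lambda>n. real n / real n) \<longlonglongrightarrow> 1"
  by (rule tendsto_eventually) (auto simp: eventually_sequentially intro!: exI[of _ 1])

text \<open>Replacing \<open>T\<close> by the top segment costs at most the mismatch sum, and the
  segment is a Poisson window. Since \<open>t > 1 - c\<close>, the lower end of that window is
  invisible, so the limit is the one of the unconditioned ensemble.\<close>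

lemma (in conditioned_setting) window_outside:
  assumes t: "t > 1 - c" "t \<noteq> 1"
  shows "(\<lambda>n. \<Sum>T\<in>TT n. prob n T * \<bar>(\<Sum>l\<in>T. pois (real n * t) l) - indicat_real {0<..<1} t\<bar>) \<longlonglongrightarrow> 0"
proof (rule mean_abs_tendsto[OF prob_space_eventually])
  have t0: "t \<ge> 0" using t c by linarith
  have "(\<lambda>n. \<Sum>l\<in>{M n..<n}. pois (real n * t) l) \<longlonglongrightarrow> (if 1 - c < t \<and> t < 1 then 1 else 0)"
    using t t0 by (intro pois_window_tendsto M_ratio ratio_self_tendsto) auto
  also have "(if 1 - c < t \<and> t < 1 then 1 else 0) = indicat_real {0<..<1} t" using t c by (auto simp: indicator_def)
  finally show "(\<lambda>n. \<Sum>l\<in>{M n..<n}. pois (real n * t) l) \<longlonglongrightarrow> indicat_real {0<..<1} t" .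
  have nn: "\<forall>\<^sub>F n in sequentially. 0 \<le> (\<Sum>T\<in>TT n. prob n T * \<bar>(\<Sum>l\<in>T. pois (real n * t) l) - (\<Sum>l\<in>{M n..<n}. pois (real n * t) l)\<bar>)"
    using prob_space_eventually by eventually_elim (auto intro!: sum_nonneg)
  have up: "\<forall>\<^sub>F n in sequentially. (\<Sum>T\<in>TT n. prob n T * \<bar>(\<Sum>l\<in>T. pois (real n * t) l) - (\<Sum>l\<in>{M n..<n}. pois (real n * t) l)\<bar>)
      \<le> (\<Sum>l<n. mis n l * pois (real n * t) l)"
    using eventually_gt_at_top[of 0]
  proof eventually_elim
    case (elim n)
    show ?case
    proof (rule expected_mismatch[OF elim])
      fix T assume "T \<in> TT n"
      then have T: "T \<subseteq> {..<n}" by (simp add: size_subsets_def)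
      have "\<bar>(\<Sum>l\<in>T. pois (real n * t) l) - (\<Sum>l\<in>{M n..<n}. pois (real n * t) l)\<bar> \<le>
        (\<Sum>l\<in>{l \<in> {..<n}. (l \<in> T) \<noteq> (l \<in> {M n..<n})}. pois (real n * t) l)"
        using T t0 by (intro mismatch_pois) auto
      also have "{l \<in> {..<n}. (l \<in> T) \<noteq> (l \<in> {M n..<n})} = {l \<in> {..<n}. (l \<in> T) \<noteq> (M n \<le> l)}" by auto
      finally show "\<bar>(\<Sum>l\<in>T. pois (real n * t) l) - (\<Sum>l\<in>{M n..<n}. pois (real n * t) l)\<bar> \<le>
        (\<Sum>l\<in>{l \<in> {..<n}. (l \<in> T) \<noteq> (M n \<le> l)}. pois (real n * t) l)" .
    qed (use t0 in \<open>auto intro: pois_nonneg\<close>)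
  qed
  show "(\<lambda>n. \<Sum>T\<in>TT n. prob n T * \<bar>(\<Sum>l\<in>T. pois (real n * t) l) - (\<Sum>l\<in>{M n..<n}. pois (real n * t) l)\<bar>) \<longlonglongrightarrow> 0"
    using t t0 by (intro real_tendsto_sandwich[OF nn up tendsto_const mis_pois_tendsto]) auto
qed

lemma (in conditioned_setting) window_inside:
  assumes t: "t > 0" "t \<noteq> 1 - c"
  shows "(\<lambda>n. \<Sum>T\<in>TT n. prob n T * \<bar>(\<Sum>l\<in>{..<n} - T. pois (real n * t) l) - indicat_real {0<..<1 - c} t\<bar>) \<longlonglongrightarrow> 0"
proof (rule mean_abs_tendsto[OF prob_space_eventually])
  have "(\<lambda>n. \<Sum>l\<in>{0..<M n}. pois (real n * t) l) \<longlonglongrightarrow> (if 0 < t \<and> t < 1 - c then 1 else 0)"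
    using t by (intro pois_window_tendsto M_ratio) auto
  also have "(if 0 < t \<and> t < 1 - c then 1 else 0) = indicat_real {0<..<1 - c} t" by (auto simp: indicator_def)
  finally show "(\<lambda>n. \<Sum>l\<in>{0..<M n}. pois (real n * t) l) \<longlonglongrightarrow> indicat_real {0<..<1 - c} t" .
  have nn: "\<forall>\<^sub>F n in sequentially. 0 \<le> (\<Sum>T\<in>TT n. prob n T * \<bar>(\<Sum>l\<in>{..<n} - T. pois (real n * t) l) - (\<Sum>l\<in>{0..<M n}. pois (real n * t) l)\<bar>)"
    using prob_space_eventually by eventually_elim (auto intro!: sum_nonneg)
  have up: "\<forall>\<^sub>F n in sequentially. (\<Sum>T\<in>TT n. prob n T * \<bar>(\<Sum>l\<in>{..<n} - T. pois (real n * t) l) - (\<Sum>l\<in>{0..<M n}. pois (real n * t) l)\<bar>)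
      \<le> (\<Sum>l<n. mis n l * pois (real n * t) l)"
    using eventually_gt_at_top[of 0]
  proof eventually_elim
    case (elim n)
    show ?case
    proof (rule expected_mismatch[OF elim])
      fix T assume "T \<in> TT n"
      have "\<bar>(\<Sum>l\<in>{..<n} - T. pois (real n * t) l) - (\<Sum>l\<in>{0..<M n}. pois (real n * t) l)\<bar> \<le>
        (\<Sum>l\<in>{l \<in> {..<n}. (l \<in> {..<n} - T) \<noteq> (l \<in> {0..<M n})}. pois (real n * t) l)"
        using t M_le[of n] by (intro mismatch_pois) auto
      also have "{l \<in> {..<n}. (l \<in> {..<n} - T) \<noteq> (l \<in> {0..<M n})} = {l \<in> {..<n}. (l \<in> T) \<noteq> (M n \<le> l)}" by auto
      finally show "\<bar>(\<Sum>l\<in>{..<n} - T. pois (real n * t) l) - (\<Sum>l\<in>{0..<M n}. pois (real n * t) l)\<bar> \<le>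
        (\<Sum>l\<in>{l \<in> {..<n}. (l \<in> T) \<noteq> (M n \<le> l)}. pois (real n * t) l)" .
    qed (use t in \<open>auto intro: pois_nonneg\<close>)
  qed
  show "(\<lambda>n. \<Sum>T\<in>TT n. prob n T * \<bar>(\<Sum>l\<in>{..<n} - T. pois (real n * t) l) - (\<Sum>l\<in>{0..<M n}. pois (real n * t) l)\<bar>) \<longlonglongrightarrow> 0"
    using t by (intro real_tendsto_sandwich[OF nn up tendsto_const mis_pois_tendsto]) auto
qed

text \<open>A mixture with a single component. With \<open>B n = n\<close> it describes the Ginibre
  ensemble of size \<open>n\<close>, with \<open>B n = M n\<close> the dilated smaller one, by
  \<open>scaled_ginibre_integral\<close>.\<close>

lemma plain_bulk_limit:
  fixes B :: "nat \<Rightarrow> nat"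
  assumes F: "F \<in> borel_measurable (lborels k)" "\<And>y. y \<in> tuples k UNIV \<Longrightarrow> cmod (F y) \<le> C0"
    and Q: "Q \<in> sets borel" "emeasure lborel Q < \<infinity>"
    and supp: "\<And>y i. y \<in> tuples k UNIV \<Longrightarrow> F y \<noteq> 0 \<Longrightarrow> i < k \<Longrightarrow> y i \<in> Q"
    and B: "\<And>n. B n \<le> n" "(\<lambda>n. real (B n) / real n) \<longlonglongrightarrow> b" and b: "b \<ge> 0"
  shows "(\<lambda>n. kernel_integral k F (mode_kernel n (\<lambda>_. 1) {..<B n}) / of_nat n ^ k)
    \<longlonglongrightarrow> kernel_integral k F (bulk_kernel {0<..<b})"
proof -
  have "(\<lambda>n. (\<Sum>T\<in>{()}. cplx 1 *
      kernel_integral k F (mode_kernel n (\<lambda>_. 1) {..<B n})) / of_nat n ^ k)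
    \<longlonglongrightarrow> kernel_integral k F (bulk_kernel {0<..<b})"
  proof (rule bulk_limit[where Q=Q and ?C0.0=C0 and err="\<lambda>_. 0" and X="{0, sqrt b}" and \<gamma>="\<lambda>_ _. 1" and w="\<lambda>_ _. 1"
        and \<T>="\<lambda>_. {()}" and D="\<lambda>n _. {..<B n}"])
    show "F y \<noteq> 0 \<Longrightarrow> y \<in> tuples k UNIV \<Longrightarrow> i < k \<Longrightarrow> y i \<in> Q" for y i by (rule supp)
    show "{..<B n} \<subseteq> {..<n}" for n using B(1)[of n] by auto
    fix z :: complex assume "cmod z \<notin> {0, sqrt b}"
    then have "(cmod z)\<^sup>2 \<noteq> 0" "(cmod z)\<^sup>2 \<noteq> b" using b by auto
    then have "(\<lambda>n. \<Sum>l\<in>{0..<B n}. pois (real n * (cmod z)\<^sup>2) l) \<longlonglongrightarrow> (if 0 < (cmod z)\<^sup>2 \<and> (cmod z)\<^sup>2 < b then 1 else 0)"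
      using B by (intro pois_window_tendsto) auto
    also have "(if 0 < (cmod z)\<^sup>2 \<and> (cmod z)\<^sup>2 < b then 1 else 0) = indicat_real {0<..<b} ((cmod z)\<^sup>2)" by (auto simp: indicator_def)
    finally have "(\<lambda>n. (\<Sum>l\<in>{..<B n}. pois (real n * (cmod z)\<^sup>2) l) - indicat_real {0<..<b} ((cmod z)\<^sup>2)) \<longlonglongrightarrow> 0"
      by (simp add: LIM_zero atLeast0LessThan)
    then show "(\<lambda>n. \<Sum>T\<in>{()}. 1 * \<bar>(\<Sum>l\<in>{..<B n}. pois (real n * (cmod z)\<^sup>2) l) - indicat_real {0<..<b} ((cmod z)\<^sup>2)\<bar>) \<longlonglongrightarrow> 0"
      by (simp add: tendsto_rabs_zero)
  qed (use F Q in auto)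
  then show ?thesis by simp
qed

lemma leibniz_det_1: "leibniz_det 1 M = M 0 0"
proof -
  have "{\<pi>. \<pi> permutes {..<1::nat}} = {id}"
    by (simp add: lessThan_Suc)
  then show ?thesis by (simp add: leibniz_det_def)
qed

text \<open>The filled disc of squared radius \<open>b\<close>, cut down to the unit disc, has area
  \<open>pi * min 1 b\<close>, and the intensity is \<open>1 / pi\<close>.\<close>

lemma bulk_intensity_ball:
  assumes b: "b \<ge> 0"
  shows "kernel_integral 1 ball_test (bulk_kernel {0<..<b})
    = cplx (min 1 b)"
proof -
  let ?S = "{z::complex. (cmod z)\<^sup>2 \<in> {0<..<min 1 b}}"
  have S: "?S \<in> sets borel" by measurable
  have "emeasure lborel ?S = (\<integral>\<^sup>+z. indicator {0<..<min 1 b} ((cmod z)\<^sup>2) \<partial>lborel)"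
  proof -
    have "emeasure lborel ?S = (\<integral>\<^sup>+z. indicator ?S z \<partial>lborel)" using S by (intro nn_integral_indicator[symmetric]) simp
    also have "\<dots> = (\<integral>\<^sup>+z. indicator {0<..<min 1 b} ((cmod z)\<^sup>2) \<partial>lborel)"
      by (rule nn_integral_cong) (simp only: indicator_def mem_Collect_eq)
    finally show ?thesis .
  qed
  also have "\<dots> = ennreal pi * (\<integral>\<^sup>+t. indicator {0<..<min 1 b} t * indicator {0..} t \<partial>lborel)"
    by (rule nn_integral_radial) simp
  also have "(\<integral>\<^sup>+t. indicator {0<..<min 1 b} t * indicator {0..} t \<partial>lborel) = (\<integral>\<^sup>+t. indicator {0<..<min 1 b} t \<partial>lborel)"
    by (intro nn_integral_cong) (auto simp: indicator_def)
  also have "\<dots> = ennreal (min 1 b)" using b by simp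
  finally have meas: "measure lborel ?S = pi * min 1 b" and fin: "emeasure lborel ?S < \<infinity>"
    using b by (auto simp: measure_def ennreal_mult'[symmetric] ennreal_mult_less_top)
  have e: "{..<1::nat} = {0}" by auto
  have k: "indicator (ball 0 1) z * bulk_kernel {0<..<b} z z = cplx (1 / pi * indicat_real ?S z)" for z
    by (auto simp: bulk_kernel_def indicator_def abs_square_less_1)
  have "kernel_integral 1 ball_test (bulk_kernel {0<..<b})
    = (LINT y|Pi\<^sub>M {0::nat} (\<lambda>_. lborel). (\<lambda>z. cplx (1 / pi * indicat_real ?S z)) (y 0))"
    by (simp only: e leibniz_det_1 k)
  also have "\<dots> = (LINT z|lborel. cplx (1 / pi * indicat_real ?S z))"
    using S by (intro lborel_product.product_integral_singleton) measurable
  also have "\<dots> = cplx (LINT z|lborel. 1 / pi * indicat_real ?S z)"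
    by (rule integral_complex_of_real)
  also have "(LINT z|lborel. 1 / pi * indicat_real ?S z) = min 1 b"
    using S fin meas by simp
  finally show ?thesis .
qed

lemma ball_test_measurable: "ball_test \<in> borel_measurable (lborels 1)"
proof -
  have comp: "(\<lambda>y. y (0::nat)) \<in> borel_measurable (lborels 1)"
    by (rule component_measurable) simp
  show ?thesis
  proof (rule measurable_compose[OF comp])
    show "(indicator (ball 0 1) :: complex \<Rightarrow> complex) \<in> borel_measurable borel"
      by (intro borel_measurable_indicator) simp
  qed
qed

lemma plain_count_limit:
  fixes B :: "nat \<Rightarrow> nat"
  assumes B: "\<And>n. B n \<le> n" "(\<lambda>n. real (B n) / real n) \<longlonglongrightarrow> b" and b: "b \<ge> 0"
  shows "(\<lambda>n. kernel_integral 1 ball_test (mode_kernel n (\<lambda>_. 1) {..<B n}) / of_nat n)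
    \<longlonglongrightarrow> cplx (min 1 b)"
proof -
  have "(\<lambda>n. kernel_integral 1 ball_test (mode_kernel n (\<lambda>_. 1) {..<B n}) / of_nat n ^ 1)
    \<longlonglongrightarrow> kernel_integral 1 ball_test (bulk_kernel {0<..<b})"
  proof (rule plain_bulk_limit[where Q="ball 0 1" and ?C0.0=1])
    show "emeasure lborel (ball (0::complex) 1) < \<infinity>" by (simp add: emeasure_ball unit_ball_vol_2)
  qed (use ball_test_measurable B b in \<open>auto simp: indicator_def split: if_splits\<close>)
  then show ?thesis using bulk_intensity_ball[OF b] by simp
qed

text \<open>A mode depends on size and points only through \<open>n * x * cnj y\<close> and the
  squared moduli times \<open>n\<close>, so the dilation by \<open>sqrt (m / n)\<close> converts
  size \<open>m\<close> into size \<open>n\<close>. The dilated small ensemble is thus given by the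
  size-\<open>n\<close> kernel with fewer modes, directly comparable with the conditioned
  ensemble.\<close>

lemma scaled_ginibre_integral:
  assumes m: "m > 0" and n: "n > 0" and F: "F \<in> borel_measurable (lborels k)"
  shows "(LINT y|lborels k. F (\<lambda>i\<in>{..<k}. cplx (sqrt (real m / real n)) * y i) *
      kernel_det k (mode_kernel m (\<lambda>_. 1) T) y) =
    kernel_integral k F (mode_kernel n (\<lambda>_. 1) T)"
proof -
  define s where "s = sqrt (real m / real n)"
  have s: "s > 0" "s\<^sup>2 = real m / real n" using m n by (auto simp: s_def)
  have ns: "real n * s\<^sup>2 = real m" using n by (simp add: s(2))
  have mode: "mode n l (s *\<^sub>R x) (s *\<^sub>R y) = mode m l x y" for l x y
  proof -
    have "of_nat n * (s *\<^sub>R x) * cnj (s *\<^sub>R y) = cplx (real n * s\<^sup>2) * x * cnj y"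
      by (simp add: scaleR_conv_of_real power2_eq_square mult_ac)
    then have 1: "of_nat n * (s *\<^sub>R x) * cnj (s *\<^sub>R y) = of_nat m * x * cnj y"
      unfolding ns by simp
    have c: "(cmod (s *\<^sub>R z))\<^sup>2 = s\<^sup>2 * (cmod z)\<^sup>2" for z by (simp only: norm_scaleR power_mult_distrib power2_abs)
    have "- real n * ((cmod (s *\<^sub>R x))\<^sup>2 + (cmod (s *\<^sub>R y))\<^sup>2) / 2 = - (real n * s\<^sup>2) * ((cmod x)\<^sup>2 + (cmod y)\<^sup>2) / 2"
      unfolding c by (simp add: algebra_simps del: s)
    then have 2: "- real n * ((cmod (s *\<^sub>R x))\<^sup>2 + (cmod (s *\<^sub>R y))\<^sup>2) / 2 = - real m * ((cmod x)\<^sup>2 + (cmod y)\<^sup>2) / 2"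
      unfolding ns .
    show ?thesis unfolding mode_def 1 2 ..
  qed
  have kern: "mode_kernel n (\<lambda>_. 1) T (s *\<^sub>R x) (s *\<^sub>R y) = cplx (1 / s\<^sup>2) * mode_kernel m (\<lambda>_. 1) T x y" for x y
    using m n s by (simp add: mode_kernel_def mode)
  have "kernel_integral k F (mode_kernel n (\<lambda>_. 1) T) =
    (s\<^sup>2) ^ card {..<k} *\<^sub>R (LINT y|lborels k. F (\<lambda>i\<in>{..<k}. 0 + s *\<^sub>R y i) *
      leibniz_det k (\<lambda>i j. mode_kernel n (\<lambda>_. 1) T ((\<lambda>i\<in>{..<k}. 0 + s *\<^sub>R y i) i) ((\<lambda>i\<in>{..<k}. 0 + s *\<^sub>R y i) j)))"
    using s by (intro PiM_lborel_integral_affine borel_measurable_times F leibniz_det_measurable mode_kernel_measurable) auto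
  also have "\<dots> = (s\<^sup>2) ^ k *\<^sub>R (LINT y|lborels k. cplx (1 / s\<^sup>2) ^ k *
      (F (\<lambda>i\<in>{..<k}. cplx s * y i) * kernel_det k (mode_kernel m (\<lambda>_. 1) T) y))"
  proof -
    have "leibniz_det k (\<lambda>i j. mode_kernel n (\<lambda>_. 1) T ((\<lambda>i\<in>{..<k}. 0 + s *\<^sub>R y i) i) ((\<lambda>i\<in>{..<k}. 0 + s *\<^sub>R y i) j)) =
      cplx (1 / s\<^sup>2) ^ k * kernel_det k (mode_kernel m (\<lambda>_. 1) T) y" for y
      unfolding leibniz_det_scale[symmetric] by (rule leibniz_det_cong) (simp add: kern)
    then show ?thesis by (simp add: scaleR_conv_of_real mult_ac)
  qed
  also have "\<dots> = (LINT y|lborels k. F (\<lambda>i\<in>{..<k}. cplx s * y i) *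
      kernel_det k (mode_kernel m (\<lambda>_. 1) T) y)"
    using s(1) by (simp add: scaleR_conv_of_real power_divide)
  finally show ?thesis by (simp only: s_def)
qed

text \<open>\<open>e\<close> is the expected number of points in the unit disc. Its exact order
  \<open>n\<close> makes a difference of order \<open>o(n ^ k)\<close> small relative to
  \<open>e ^ k\<close>.\<close>

lemma smallo_of_common_limit:
  fixes A B :: "nat \<Rightarrow> complex" and e :: "nat \<Rightarrow> real"
  assumes A: "(\<lambda>n. A n / of_nat n ^ k) \<longlonglongrightarrow> L" and B: "(\<lambda>n. B n / of_nat n ^ k) \<longlonglongrightarrow> L"
    and e: "(\<lambda>n. cplx (e n) / of_nat n) \<longlonglongrightarrow> cplx e0" and e0: "e0 > 0"
  shows "(\<lambda>n. A n - B n) \<in> o(\<lambda>n. cplx (e n ^ k))"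
proof (rule smalloI_tendsto)
  have "(\<lambda>n. Re (cplx (e n) / of_nat n)) \<longlonglongrightarrow> Re (cplx e0)" using e by (rule tendsto_Re)
  then have er: "(\<lambda>n. e n / real n) \<longlonglongrightarrow> e0" by (simp add: Re_divide_of_nat)
  then have "\<forall>\<^sub>F n in sequentially. e n / real n > 0" using e0 by (rule order_tendstoD)
  then have pos: "\<forall>\<^sub>F n in sequentially. n > 0 \<and> e n \<noteq> 0"
    by eventually_elim (auto intro: Nat.gr0I)
  then show "\<forall>\<^sub>F n in sequentially. cplx (e n ^ k) \<noteq> 0" by eventually_elim simp
  have "(\<lambda>n. (A n / of_nat n ^ k - B n / of_nat n ^ k) / (cplx (e n) / of_nat n) ^ k) \<longlonglongrightarrow> (L - L) / cplx e0 ^ k"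
    using e0 by (intro tendsto_intros A B e) auto
  then have "(\<lambda>n. (A n / of_nat n ^ k - B n / of_nat n ^ k) / (cplx (e n) / of_nat n) ^ k) \<longlonglongrightarrow> 0" by simp
  moreover have "\<forall>\<^sub>F n in sequentially. (A n / of_nat n ^ k - B n / of_nat n ^ k) / (cplx (e n) / of_nat n) ^ k =
      (A n - B n) / cplx (e n ^ k)"
    using pos by eventually_elim (simp add: power_divide diff_divide_distrib[symmetric])
  ultimately show "(\<lambda>n. (A n - B n) / cplx (e n ^ k)) \<longlonglongrightarrow> 0"
    by (rule Lim_transform_eventually)
qed

lemma compact_borel_finite:
  fixes K :: "complex set" assumes "compact K"
  shows "K \<in> sets borel" "emeasure lborel K < \<infinity>"
  using assms emeasure_compact_finite[OF assms] by (auto intro: borel_compact)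

lemma (in conditioned_setting) part_outside:
  assumes \<epsilon>: "\<epsilon> > 0"
  shows "behaves_asymptotically_as (\<lambda>n. G n) ginibre {z. cmod z > R + \<epsilon>}"
  unfolding behaves_asymptotically_as_def
proof (intro allI impI)
  fix k :: nat and f assume f: "test_function k {z. cmod z > R + \<epsilon>} f"
  interpret mapped_test_function "\<lambda>z. z" "\<lambda>z. z" k "{z. cmod z > R + \<epsilon>}" f
    by standard (use f in auto)
  obtain C0 where C0: "\<And>x. x \<in> tuples k UNIV \<Longrightarrow> cmod (F x) \<le> C0" by (rule F_bounded) blast
  obtain Q where Q: "compact Q" "Q \<subseteq> {z. cmod z > R + \<epsilon>}"
    and supp: "\<And>x i. x \<in> tuples k UNIV \<Longrightarrow> f x \<noteq> 0 \<Longrightarrow> i < k \<Longrightarrow> x i \<in> Q"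
    by (rule test_function_support[OF f]) blast
  have F_supp: "x i \<in> Q" if "x \<in> tuples k UNIV" "F x \<noteq> 0" "i < k" for x i
    using supp[of "\<lambda>i\<in>{..<k}. x i" i] that by (auto simp: F_def)
  note Qm = compact_borel_finite[OF Q(1)]
  let ?L = "kernel_integral k F (bulk_kernel {0<..<1})"
  obtain err where err: "err \<longlonglongrightarrow> 0" "\<forall>\<^sub>F n in sequentially. \<forall>J\<subseteq>{..<n}. \<forall>x y. (cmod x)\<^sup>2 \<in> {(R + \<epsilon>)\<^sup>2..} \<longrightarrow> (cmod y)\<^sup>2 \<in> {(R + \<epsilon>)\<^sup>2..} \<longrightarrow>
      (\<Sum>l\<in>J. cmod (mode n l x y) * \<bar>1 / \<alpha> n l - 1\<bar>) \<le> err n"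
    by (rule error_outside[of "R + \<epsilon>"]) (use \<epsilon> in simp, assumption)
  have Q2: "(cmod z)\<^sup>2 \<in> {(R + \<epsilon>)\<^sup>2..}" if "z \<in> Q" for z
  proof -
    have "R + \<epsilon> \<le> cmod z" using that Q(2) by auto
    then have "(R + \<epsilon>)\<^sup>2 \<le> (cmod z)\<^sup>2" using R \<epsilon> by (intro power_mono) auto
    then show ?thesis by simp
  qed
  have A_lim: "(\<lambda>n. (\<Sum>T\<in>TT n. cplx (prob n T) *
      kernel_integral k F (mode_kernel n (\<alpha> n) T)) / of_nat n ^ k) \<longlonglongrightarrow> ?L"
  proof (rule bulk_limit[where Q=Q and ?C0.0=C0 and err=err and X="{1}"])
    show "F y \<noteq> 0 \<Longrightarrow> y \<in> tuples k UNIV \<Longrightarrow> i < k \<Longrightarrow> y i \<in> Q" for y i by (rule F_supp)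
    show "T \<subseteq> {..<n}" if "T \<in> TT n" for n T using that by (simp add: size_subsets_def)
    show "\<forall>\<^sub>F n in sequentially. \<forall>J\<subseteq>{..<n}. \<forall>x\<in>Q. \<forall>y\<in>Q. (\<Sum>l\<in>J. cmod (mode n l x y) * \<bar>1 / \<alpha> n l - 1\<bar>) \<le> err n"
      using err(2) by eventually_elim (use Q2 in blast)
    fix z assume z: "z \<in> Q" "cmod z \<notin> {1}"
    have "(cmod z)\<^sup>2 > 1 - c"
    proof -
      have "R\<^sup>2 \<le> (R + \<epsilon>)\<^sup>2" using R \<epsilon> by (intro power_mono) auto
      then show ?thesis using Q2[OF z(1)] c by auto
    qed
    moreover have "(cmod z)\<^sup>2 \<noteq> 1" using z(2) power2_eq_iff_nonneg[of "cmod z" 1] by auto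
    ultimately show "(\<lambda>n. \<Sum>T\<in>TT n. prob n T * \<bar>(\<Sum>l\<in>T. pois (real n * (cmod z)\<^sup>2) l) - indicat_real {0<..<1} ((cmod z)\<^sup>2)\<bar>) \<longlonglongrightarrow> 0"
      by (rule window_outside)
  qed (use F_borel C0 Qm prob_space_eventually err(1) in auto)
  have A_eq: "\<forall>\<^sub>F n in sequentially. (\<Sum>T\<in>TT n. cplx (prob n T) *
      kernel_integral k F (mode_kernel n (\<alpha> n) T)) / of_nat n ^ k =
      expected_tuple_sum (G n) k f / of_nat n ^ k"
    using eventually_gt_at_top[of 0]
  proof eventually_elim
    case (elim n)
    have "expected_tuple_sum (G n) k f =
      expected_tuple_sum (map_process (\<lambda>z. z) (G n)) k f"
      by (simp add: map_process_id)
    also have "\<dots> = (\<Sum>T\<in>TT n. cplx (prob n T) *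
      kernel_integral k F (mode_kernel n (\<alpha> n) T))"
      using elim R \<epsilon> Nc_le unfolding prob_def \<alpha>_def
      by (subst expected_conditioned_outside) (auto simp: cond_avg_eq_prob)
    finally show ?case by simp
  qed
  have A: "(\<lambda>n. expected_tuple_sum (G n) k f / of_nat n ^ k) \<longlonglongrightarrow> ?L"
    by (rule Lim_transform_eventually[OF A_lim A_eq])
  have B_lim: "(\<lambda>n. kernel_integral k F (mode_kernel n (\<lambda>_. 1) {..<n}) / of_nat n ^ k) \<longlonglongrightarrow> ?L"
    by (rule plain_bulk_limit[OF F_borel, where ?C0.0=C0 and Q=Q and B="\<lambda>n. n" and b=1])
      (use C0 Qm F_supp ratio_self_tendsto in auto)
  have B_eq: "\<forall>\<^sub>F n in sequentially. kernel_integral k F (mode_kernel n (\<lambda>_. 1) {..<n}) / of_nat n ^ k =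
      expected_tuple_sum (ginibre n) k f / of_nat n ^ k"
    using eventually_gt_at_top[of 0]
  proof eventually_elim
    case (elim n)
    then show ?case using expected_ginibre[OF elim] by (simp add: map_process_id)
  qed
  have B: "(\<lambda>n. expected_tuple_sum (ginibre n) k f / of_nat n ^ k) \<longlonglongrightarrow> ?L"
    by (rule Lim_transform_eventually[OF B_lim B_eq])
  have e_eq: "\<forall>\<^sub>F n in sequentially. kernel_integral 1 ball_test (mode_kernel n (\<lambda>_. 1) {..<n}) / of_nat n =
      cplx (expected_count (ginibre n) (ball 0 1)) / of_nat n"
    using eventually_gt_at_top[of 0]
  proof eventually_elim
    case (elim n)
    then show ?case using expected_count_ginibre[of "\<lambda>z. z" "\<lambda>z. z" n] by (simp add: map_process_id)
  qed
  have "(\<lambda>n. kernel_integral 1 ball_test (mode_kernel n (\<lambda>_. 1) {..<n}) / of_nat n) \<longlonglongrightarrow> cplx (min 1 1)"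
    by (rule plain_count_limit[OF _ ratio_self_tendsto]) auto
  then have e: "(\<lambda>n. cplx (expected_count (ginibre n) (ball 0 1)) / of_nat n) \<longlonglongrightarrow> cplx (min 1 1)"
    by (rule Lim_transform_eventually[OF _ e_eq])
  show "(\<lambda>N. expected_tuple_sum (conditioned_ginibre N (Nc N) R) k f - expected_tuple_sum (ginibre N) k f)
    \<in> o(\<lambda>N. cplx (expected_count (ginibre N) (ball 0 1) ^ k))"
    by (rule smallo_of_common_limit[OF A B e]) simp
qed

section \<open>The empty disc for \<open>c = 1\<close>, and the comparison inside the circle\<close>

lemma ginibre_0: "ginibre 0 = distr (ginibre_law 0) (config_space UNIV) (\<lambda>_. {})"
  by (simp add: ginibre_def)

text \<open>For \<open>c = 1\<close> the dilation factor is \<open>sqrt 0 = 0\<close>, so the map is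
  not invertible and \<open>map_config_measurable\<close> does not apply. Its measurability still
  has to be known before the image law can be integrated; it rests on the event of the empty
  configuration.\<close>

lemma collapse_measurable:
  "(\<lambda>X. (\<lambda>_. 0) ` X :: complex set) \<in> measurable (config_space UNIV) (config_space UNIV)"
proof (rule measurable_config_spaceI)
  fix X :: "complex set" show "(\<lambda>_. 0) ` X \<in> configurations UNIV"
    by (rule finite_in_configurations) (auto intro: finite_subset[of _ "{0}"])
next
  fix B :: "complex set" and n :: nat assume B: "B \<in> sets borel"
  have "UNIV = (\<Union>n. cball (0::complex) (real n))"
  proof (rule UNIV_eq_I)
    fix z :: complex
    obtain n :: nat where "cmod z \<le> real n" using real_arch_simple by blast
    then show "z \<in> (\<Union>n. cball 0 (real n))" by auto
  qed
  moreover have "{X \<in> configurations UNIV. finite (X \<inter> (\<Union>n. cball (0::complex) (real n))) \<and> card (X \<inter> (\<Union>n. cball (0::complex) (real n))) = 0} \<in> sets (config_space UNIV)"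
    by (rule config_exhaustion_count[where K="\<lambda>n. cball 0 (real n)"]) (auto simp: incseq_def)
  ultimately have "{X \<in> configurations UNIV. finite X \<and> card X = 0} \<in> sets (config_space UNIV)" by (simp flip: \<open>UNIV = _\<close>)
  moreover have "{X \<in> configurations UNIV. finite X \<and> card X = 0} = {{} :: complex set}"
    using finite_in_configurations[of "{}" UNIV] by auto
  ultimately have e: "{{}} \<in> sets (config_space UNIV)" by simp
  have s: "(\<lambda>_. 0 :: complex) ` X = (if X = {} then {} else {0})" for X :: "complex set" by auto
  have "{X \<in> space (config_space UNIV). card ((\<lambda>_. 0) ` X \<inter> B) = n} =
    (if card ({} \<inter> B) = n then {{}} else {}) \<union> (if card ({0} \<inter> B) = n then space (config_space UNIV) - {{}} else {})"
    using finite_in_configurations[of "{}" UNIV] by (auto simp: s)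
  also have "\<dots> \<in> sets (config_space UNIV)" using e sets.compl_sets[OF e] by (intro sets.Un) (auto simp del: space_config_space)
  finally show "{X \<in> space (config_space UNIV). card ((\<lambda>_. 0) ` X \<inter> B) = n} \<in> sets (config_space UNIV)" .
qed

lemma expected_tuple_sum_collapse:
  assumes k: "k \<ge> 1" and f: "test_function k U f"
  shows "expected_tuple_sum (map_process (\<lambda>_. 0) (ginibre 0)) k f = 0"
proof -
  have lip: "lipschitz_tuples k f" using f by (simp add: test_function_def)
  obtain Q where Q: "compact Q" "\<And>x i. x \<in> tuples k UNIV \<Longrightarrow> f x \<noteq> 0 \<Longrightarrow> i < k \<Longrightarrow> x i \<in> Q"
    by (rule test_function_support[OF f]) blast
  have m: "(\<lambda>X. \<Sum>\<^sub>\<infinity>x\<in>distinct_tuples k X. f x) \<in> borel_measurable (config_space UNIV)"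
    by (rule tuple_sum_measurable[OF lip Q(1)]) (use Q(2) in auto)
  have m': "(\<lambda>X. \<Sum>\<^sub>\<infinity>x\<in>distinct_tuples k ((\<lambda>_. 0) ` X). f x) \<in> borel_measurable (config_space UNIV)"
    by (rule measurable_compose[OF collapse_measurable m])
  have e: "distinct_tuples k {} = {}" using k by (auto simp: distinct_tuples_def PiE_def Pi_def)
  have c: "(\<lambda>X. (\<lambda>_. 0) ` X :: complex set) \<in> measurable (ginibre 0) (config_space UNIV)"
    using collapse_measurable by (simp add: ginibre_def)
  have t: "(\<lambda>_. {}) \<in> measurable (ginibre_law 0) (config_space UNIV)"
    using finite_in_configurations[of "{}" UNIV] by simp
  show ?thesis
    unfolding expected_tuple_sum_def map_process_def integral_distr[OF c m] unfolding ginibre_0 integral_distr[OF t m']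
    by (simp add: e)
qed

lemma compact_subset_disc:
  assumes "compact Q" "Q \<subseteq> {z. cmod z < R}" "R > 0"
  obtains r where "0 < r" "r < R" "\<And>z. z \<in> Q \<Longrightarrow> cmod z \<le> r"
proof (cases "Q = {}")
  case True
  then show ?thesis using assms(3) by (intro that[of "R / 2"]) auto
next
  case False
  then obtain z where z: "z \<in> Q" "\<And>y. y \<in> Q \<Longrightarrow> cmod y \<le> cmod z"
    using continuous_attains_sup[OF assms(1) False, of cmod] by (auto intro: continuous_intros)
  show ?thesis
  proof (rule that[of "max (cmod z) (R / 2)"])
    show "max (cmod z) (R / 2) < R" using z(1) assms(2,3) by auto
    show "0 < max (cmod z) (R / 2)" using assms(3) by linarith
    show "cmod y \<le> max (cmod z) (R / 2)" if "y \<in> Q" for y using z(2)[OF that] by linarith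
  qed
qed

context conditioned_setting
begin

lemma conditioned_inside:
  assumes k: "test_function k {z. cmod z < R} f" and n: "n > 0"
  shows "expected_tuple_sum (G n) k f = (\<Sum>T\<in>TT n. cplx (prob n T) *
    kernel_integral k f (mode_kernel n (\<lambda>l. 1 - \<alpha> n l) ({..<n} - T)))"
proof -
  interpret mapped_test_function "\<lambda>z. z" "\<lambda>z. z" k "{z. cmod z < R}" f
    by standard (use k in auto)
  have F: "(LINT y|lborels k. F y * D y) = (LINT y|lborels k. f y * D y)" for D
    by (rule Bochner_Integration.integral_cong) (auto simp: F_def space_PiM)
  have "expected_tuple_sum (G n) k f =
    expected_tuple_sum (map_process (\<lambda>z. z) (G n)) k f"
    by (simp add: map_process_id)
  also have "\<dots> = (\<Sum>T\<in>TT n. cplx (prob n T) *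
    kernel_integral k F (mode_kernel n (\<lambda>l. 1 - \<alpha> n l) ({..<n} - T)))"
    using n R Nc_le unfolding prob_def \<alpha>_def
    by (subst expected_conditioned_inside) (auto simp: cond_avg_eq_prob)
  finally show ?thesis unfolding F .
qed

text \<open>All modes are outer ones, so the inner kernel is an empty sum, and the reference process
  has no points. Both expectations vanish exactly, which is what little-o relative to a zero count
  demands.\<close>

lemma part_inside_degenerate:
  assumes c1: "c = 1" and k: "k \<ge> 1" and f: "test_function k {z. cmod z < R} f" and n: "n > 0"
  shows "expected_tuple_sum (G n) k f = 0"
    and "expected_tuple_sum (map_process (\<lambda>z. cplx (sqrt (real (M n) / real n)) * z) (ginibre (M n))) k f = 0"
proof -
  have Nc: "Nc n = n" unfolding Nc_def using c1 by simp
  have T: "{..<n} - T = {}" if "T \<in> TT n" for T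
    using that card_subset_eq[of "{..<n}" T] unfolding Nc size_subsets_def by auto
  have z: "kernel_det k (mode_kernel n \<gamma> {}) y = 0" for y :: "nat \<Rightarrow> complex" and \<gamma>
    using leibniz_det_scale[of k 0 "\<lambda>_ _. 0"] k by (cases k) (auto simp: mode_kernel_def)
  show "expected_tuple_sum (G n) k f = 0"
    unfolding conditioned_inside[OF f n] by (intro sum.neutral ballI) (simp add: T z)
  have "M n = 0" using Nc by (simp add: M_def)
  then show "expected_tuple_sum (map_process (\<lambda>z. cplx (sqrt (real (M n) / real n)) * z) (ginibre (M n))) k f = 0"
    using expected_tuple_sum_collapse[OF k f] by simp
qed

lemma scaled_expectations:
  assumes M: "M n > 0"
  defines "P \<equiv> map_process (\<lambda>z. cplx (sqrt (real (M n) / real n)) * z) (ginibre (M n))"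
  shows "test_function k U f \<Longrightarrow> expected_tuple_sum P k f =
      kernel_integral k f (mode_kernel n (\<lambda>_. 1) {..<M n})"
    and "cplx (expected_count P (ball 0 1)) =
      kernel_integral 1 ball_test (mode_kernel n (\<lambda>_. 1) {..<M n})"
proof -
  have n: "n > 0" using M by (auto simp: M_def)
  let ?s = "cplx (sqrt (real (M n) / real n))"
  have s: "?s \<noteq> 0" using M n by simp
  have cont: "continuous_on UNIV (\<lambda>z. ?s * z)" "continuous_on UNIV (\<lambda>z. z / ?s)"
    using s by (intro continuous_intros; simp)+
  have inv: "?s * (z / ?s) = z" "?s * z / ?s = z" for z using s by auto
  show "expected_tuple_sum P k f =
      kernel_integral k f (mode_kernel n (\<lambda>_. 1) {..<M n})"
    if f: "test_function k U f"
  proof -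
    interpret mapped_test_function "\<lambda>z. ?s * z" "\<lambda>z. z / ?s" k U f
      by (intro mapped_test_function.intro cont inv f)
    show ?thesis
      unfolding P_def expected_ginibre[OF M] F_def by (rule scaled_ginibre_integral[OF M n f_borel])
  qed
  show "cplx (expected_count P (ball 0 1)) =
      kernel_integral 1 ball_test (mode_kernel n (\<lambda>_. 1) {..<M n})"
    unfolding P_def expected_count_ginibre[OF cont inv M] scaled_ginibre_integral[OF M n ball_test_measurable, symmetric] by simp
qed

lemma part_inside:
  "behaves_asymptotically_as (\<lambda>n. G n)
     (\<lambda>n. map_process (\<lambda>z. cplx (sqrt (real (M n) / real n)) * z) (ginibre (M n))) {z. cmod z < R}"
  unfolding behaves_asymptotically_as_def
proof (intro allI impI)
  fix k :: nat and f assume k: "1 \<le> k" and f: "test_function k {z. cmod z < R} f"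
  let ?P = "\<lambda>n. map_process (\<lambda>z. cplx (sqrt (real (M n) / real n)) * z) (ginibre (M n))"
  show "(\<lambda>n. expected_tuple_sum (G n) k f - expected_tuple_sum (?P n) k f)
    \<in> o(\<lambda>n. cplx (expected_count (?P n) (ball 0 1) ^ k))"
  proof (cases "c = 1")
    case True
    have "\<forall>\<^sub>F n in sequentially. expected_tuple_sum (G n) k f - expected_tuple_sum (?P n) k f = 0"
      using eventually_gt_at_top[of 0]
      by eventually_elim (simp add: part_inside_degenerate[OF True k f])
    from landau_o.small.in_cong[OF this] show ?thesis by simp
  next
    case False
    then have c1: "c < 1" using c by simp
    have M: "M n > 0" if "n > 0" for n
    proof -
      have "0 < (1 - c) * real n" using c1 that by simp
      then show ?thesis using M_bounds(1)[of n] by simp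
    qed
    obtain C0 where C0: "\<And>x. x \<in> tuples k UNIV \<Longrightarrow> cmod (f x) \<le> C0" by (rule test_function_bounded[OF f]) blast
    obtain Q where Q: "compact Q" "Q \<subseteq> {z. cmod z < R}"
      and supp: "\<And>x i. x \<in> tuples k UNIV \<Longrightarrow> f x \<noteq> 0 \<Longrightarrow> i < k \<Longrightarrow> x i \<in> Q"
      by (rule test_function_support[OF f]) blast
    note Qm = compact_borel_finite[OF Q(1)]
    have fm: "f \<in> borel_measurable (lborels k)"
      using f by (intro lipschitz_tuples_measurable) (simp add: test_function_def)
    obtain r where r: "0 < r" "r < R" "\<And>z. z \<in> Q \<Longrightarrow> cmod z \<le> r"
      by (rule compact_subset_disc[OF Q R(1)]) blast
    let ?L = "kernel_integral k f (bulk_kernel {0<..<1 - c})"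
    obtain err where err: "err \<longlonglongrightarrow> 0" "\<forall>\<^sub>F n in sequentially. \<forall>J\<subseteq>{..<n}. \<forall>x y. (cmod x)\<^sup>2 \<in> {0..r\<^sup>2} \<longrightarrow> (cmod y)\<^sup>2 \<in> {0..r\<^sup>2} \<longrightarrow>
        (\<Sum>l\<in>J. cmod (mode n l x y) * \<bar>1 / (1 - \<alpha> n l) - 1\<bar>) \<le> err n"
      by (rule error_inside[OF r(1,2)])
    have Q2: "(cmod z)\<^sup>2 \<in> {0..r\<^sup>2}" if "z \<in> Q" for z
      using power_mono[OF r(3)[OF that], of 2] by simp
    have A_lim: "(\<lambda>n. (\<Sum>T\<in>TT n. cplx (prob n T) *
        kernel_integral k f (mode_kernel n (\<lambda>l. 1 - \<alpha> n l) ({..<n} - T))) / of_nat n ^ k) \<longlonglongrightarrow> ?L"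
    proof (rule bulk_limit[where Q=Q and ?C0.0=C0 and err=err and X="{0, sqrt (1 - c)}" and D="\<lambda>n T. {..<n} - T"])
      show "f y \<noteq> 0 \<Longrightarrow> y \<in> tuples k UNIV \<Longrightarrow> i < k \<Longrightarrow> y i \<in> Q" for y i by (rule supp)
      show "\<forall>\<^sub>F n in sequentially. \<forall>J\<subseteq>{..<n}. \<forall>x\<in>Q. \<forall>y\<in>Q. (\<Sum>l\<in>J. cmod (mode n l x y) * \<bar>1 / (1 - \<alpha> n l) - 1\<bar>) \<le> err n"
        using err(2) by eventually_elim (use Q2 in blast)
      fix z assume z: "z \<in> Q" "cmod z \<notin> {0, sqrt (1 - c)}"
      then have "(cmod z)\<^sup>2 > 0" "(cmod z)\<^sup>2 \<noteq> 1 - c" using real_sqrt_unique[of "cmod z" "1 - c"] by auto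
      then show "(\<lambda>n. \<Sum>T\<in>TT n. prob n T * \<bar>(\<Sum>l\<in>{..<n} - T. pois (real n * (cmod z)\<^sup>2) l) - indicat_real {0<..<1 - c} ((cmod z)\<^sup>2)\<bar>) \<longlonglongrightarrow> 0"
        by (rule window_inside)
    qed (use fm C0 Qm prob_space_eventually err(1) in auto)
    have A: "(\<lambda>n. expected_tuple_sum (G n) k f / of_nat n ^ k) \<longlonglongrightarrow> ?L"
    proof (rule Lim_transform_eventually[OF A_lim])
      show "\<forall>\<^sub>F n in sequentially. (\<Sum>T\<in>TT n. cplx (prob n T) *
        kernel_integral k f (mode_kernel n (\<lambda>l. 1 - \<alpha> n l) ({..<n} - T))) / of_nat n ^ k
        = expected_tuple_sum (G n) k f / of_nat n ^ k"
        using eventually_gt_at_top[of 0] by eventually_elim (simp only: conditioned_inside[OF f])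
    qed
    have B_lim: "(\<lambda>n. kernel_integral k f (mode_kernel n (\<lambda>_. 1) {..<M n}) / of_nat n ^ k) \<longlonglongrightarrow> ?L"
      by (rule plain_bulk_limit[OF fm, where ?C0.0=C0 and Q=Q and B=M and b="1 - c"])
        (use C0 Qm supp M_ratio M_le c1 in auto)
    have B: "(\<lambda>n. expected_tuple_sum (?P n) k f / of_nat n ^ k) \<longlonglongrightarrow> ?L"
    proof (rule Lim_transform_eventually[OF B_lim])
      show "\<forall>\<^sub>F n in sequentially. kernel_integral k f (mode_kernel n (\<lambda>_. 1) {..<M n}) / of_nat n ^ k
        = expected_tuple_sum (?P n) k f / of_nat n ^ k"
        using eventually_gt_at_top[of 0] by eventually_elim (simp only: scaled_expectations(1)[OF M f])
    qed
    have e_lim: "(\<lambda>n. kernel_integral 1 ball_test (mode_kernel n (\<lambda>_. 1) {..<M n}) / of_nat n) \<longlonglongrightarrow> cplx (min 1 (1 - c))"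
      using c1 by (intro plain_count_limit M_le M_ratio) auto
    have e: "(\<lambda>n. cplx (expected_count (?P n) (ball 0 1)) / of_nat n) \<longlonglongrightarrow> cplx (min 1 (1 - c))"
    proof (rule Lim_transform_eventually[OF e_lim])
      show "\<forall>\<^sub>F n in sequentially. kernel_integral 1 ball_test (mode_kernel n (\<lambda>_. 1) {..<M n}) / of_nat n = cplx (expected_count (?P n) (ball 0 1)) / of_nat n"
        using eventually_gt_at_top[of 0] by eventually_elim (simp only: scaled_expectations(2)[OF M])
    qed
    show ?thesis by (rule smallo_of_common_limit[OF A B e]) (use c1 in simp)
  qed
qed

end

section \<open>The edge\<close>

lemma floor_ratio_tendsto:
  assumes x: "x \<ge> 0"
  shows "(\<lambda>n. real (nat \<lfloor>real n * x\<rfloor>) / real n) \<longlonglongrightarrow> x"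
proof (rule real_tendsto_sandwich)
  have fl: "real n * x - 1 \<le> real (nat \<lfloor>real n * x\<rfloor>) \<and> real (nat \<lfloor>real n * x\<rfloor>) \<le> real n * x" for n
  proof -
    have "0 \<le> real n * x" using x by simp
    then show ?thesis by linarith
  qed
  show "\<forall>\<^sub>F n in sequentially. x - 1 / real n \<le> real (nat \<lfloor>real n * x\<rfloor>) / real n"
    using eventually_gt_at_top[of 0]
  proof eventually_elim
    case (elim n)
    have "x - 1 / real n = (real n * x - 1) / real n" using elim by (simp add: diff_divide_distrib)
    also have "\<dots> \<le> real (nat \<lfloor>real n * x\<rfloor>) / real n" using fl[of n] by (intro divide_right_mono) auto
    finally show ?case .
  qed
  show "\<forall>\<^sub>F n in sequentially. real (nat \<lfloor>real n * x\<rfloor>) / real n \<le> x"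
    using eventually_gt_at_top[of 0]
    by eventually_elim (use fl in \<open>simp add: pos_divide_le_eq mult.commute\<close>)
  show "(\<lambda>n. x - 1 / real n) \<longlonglongrightarrow> x"
    using tendsto_diff[OF tendsto_const[of x] lim_1_over_n[where 'a=real]] by simp
qed simp

lemma of_nat_mult_Ln_tendsto:
  fixes u :: complex
  shows "(\<lambda>n. of_nat n * Ln (1 + u / of_nat n)) \<longlonglongrightarrow> u"
proof (cases "u = 0")
  case False
  have "(Ln has_field_derivative inverse 1) (at 1)" by (rule has_field_derivative_Ln) (simp add: complex_nonpos_Reals_iff)
  then have "((\<lambda>h. (Ln (1 + h) - Ln 1) / h) \<longlongrightarrow> 1) (at 0)" unfolding DERIV_def by simp
  moreover have "filterlim (\<lambda>n. u / of_nat n) (at 0) sequentially"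
    unfolding filterlim_at
  proof
    show "\<forall>\<^sub>F n in sequentially. u / of_nat n \<in> UNIV \<and> u / of_nat n \<noteq> 0"
      using eventually_gt_at_top[of 0] by eventually_elim (use False in simp)
    show "(\<lambda>n. u / of_nat n) \<longlonglongrightarrow> 0"
      using tendsto_mult_right_zero[OF lim_1_over_n[where 'a=complex], of u] by simp
  qed
  ultimately have "(\<lambda>n. (Ln (1 + u / of_nat n) - Ln 1) / (u / of_nat n)) \<longlonglongrightarrow> 1"
    by (rule filterlim_compose)
  then have "(\<lambda>n. u * ((Ln (1 + u / of_nat n) - Ln 1) / (u / of_nat n))) \<longlonglongrightarrow> u * 1" by (intro tendsto_intros)
  then show ?thesis using False by (simp add: mult.commute)
qed simp

lemma power_one_plus_tendsto:
  fixes u :: complex and l :: "nat \<Rightarrow> nat"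
  assumes l: "(\<lambda>n. real (l n) / real n) \<longlonglongrightarrow> x"
  shows "(\<lambda>n. (1 + u / of_nat n) ^ l n) \<longlonglongrightarrow> exp (cplx x * u)"
proof -
  have "(\<lambda>n. exp (cplx (real (l n) / real n) * (of_nat n * Ln (1 + u / of_nat n)))) \<longlonglongrightarrow> exp (cplx x * u)"
    by (intro tendsto_intros of_nat_mult_Ln_tendsto l)
  moreover have "\<forall>\<^sub>F n in sequentially. exp (cplx (real (l n) / real n) * (of_nat n * Ln (1 + u / of_nat n))) = (1 + u / of_nat n) ^ l n"
  proof -
    have "(\<lambda>n. 1 + u / of_nat n) \<longlonglongrightarrow> 1"
      using tendsto_add[OF tendsto_const[of 1] tendsto_mult_right_zero[OF lim_1_over_n[where 'a=complex], of u]] by simp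
    then have "\<forall>\<^sub>F n in sequentially. 1 + u / of_nat n \<noteq> 0"
      by (rule tendsto_imp_eventually_ne) simp
    then show ?thesis using eventually_gt_at_top[of 0]
    proof eventually_elim
      case (elim n)
      have "cplx (real (l n) / real n) * (of_nat n * Ln (1 + u / of_nat n)) = of_nat (l n) * Ln (1 + u / of_nat n)"
        using elim by simp
      then show ?case using elim by (simp only: exp_of_nat_mult exp_Ln not_False_eq_True)
    qed
  qed
  ultimately show ?thesis by (rule Lim_transform_eventually)
qed

text \<open>Going down from \<open>l\<close>, successive Poisson probabilities have the ratios
  \<open>(l - j) / L\<close>. Truncated subtraction makes every product beyond \<open>l\<close>
  zero, so the finite sum can be written as a series whose form does not depend on
  \<open>l\<close>.\<close>

lemma pois_cdf_quotient:
  assumes L: "L > 0"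
  shows "pois_cdf L l / pois L l = (\<Sum>i. \<Prod>j<i. real (l - j) / L)"
proof -
  have shift: "pois L (l - i) = pois L l * (\<Prod>j<i. real (l - j) / L)" if "i \<le> l" for i
    using that
  proof (induction i)
    case (Suc i)
    have "Suc (l - Suc i) = l - i" using Suc.prems by simp
    then have "real (l - i) * pois L (l - i) = L * pois L (l - Suc i)" using pois_Suc[of "l - Suc i" L] by simp
    then show ?case using Suc L by (simp add: field_simps)
  qed simp
  have "pois_cdf L l = (\<Sum>i<Suc l. pois L (Suc l - Suc i))"
    unfolding sum.nat_diff_reindex by (simp only: pois_cdf_def lessThan_Suc_atMost)
  also have "\<dots> = pois L l * (\<Sum>i<Suc l. \<Prod>j<i. real (l - j) / L)"
    unfolding sum_distrib_left by (intro sum.cong refl) (simp only: diff_Suc_Suc shift lessThan_iff less_Suc_eq_le)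
  also have "(\<Sum>i<Suc l. \<Prod>j<i. real (l - j) / L) = (\<Sum>i. \<Prod>j<i. real (l - j) / L)"
  proof (intro suminf_finite[symmetric] prod_zero)
    fix i assume "i \<notin> {..<Suc l}"
    then show "\<exists>j\<in>{..<i}. real (l - j) / L = 0" by (intro bexI[of _ l]) auto
  qed auto
  finally show ?thesis using pois_pos[OF L, of l] by simp
qed

text \<open>In the series of \<open>pois_cdf_quotient\<close> each factor tends to
  \<open>x / \<rho>\<close> and is bounded by it, so by Tannery the series tends to the geometric
  series of that ratio; the hazard rate is its reciprocal.\<close>

lemma pois_hazard_below:
  fixes l :: "nat \<Rightarrow> nat"
  assumes x: "0 \<le> x" "x < \<rho>" and l: "\<And>n. real (l n) \<le> real n * x" "(\<lambda>n. real (l n) / real n) \<longlonglongrightarrow> x"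
  shows "(\<lambda>n. pois (real n * \<rho>) (l n) / pois_cdf (real n * \<rho>) (l n)) \<longlonglongrightarrow> 1 - x / \<rho>"
proof -
  have \<rho>: "\<rho> > 0" and q: "0 \<le> x / \<rho>" "x / \<rho> < 1" using x by auto
  have fac: "0 \<le> real (l n - j) / (real n * \<rho>) \<and> real (l n - j) / (real n * \<rho>) \<le> x / \<rho>" for n j
  proof (cases "n = 0")
    case False
    have "real (l n - j) \<le> real n * x" using l(1)[of n] by linarith
    then have "real (l n - j) / (real n * \<rho>) \<le> real n * x / (real n * \<rho>)" using \<rho> by (intro divide_right_mono) auto
    then show ?thesis using False \<rho> by simp
  qed (use q in auto)
  have lim: "(\<lambda>n. real (l n - j) / (real n * \<rho>)) \<longlonglongrightarrow> x / \<rho>" for j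
  proof -
    have lo: "(\<lambda>n. real (l n) / real n - real j * (1 / real n)) \<longlonglongrightarrow> x"
      using tendsto_diff[OF l(2) tendsto_mult_right_zero[OF lim_1_over_n[where 'a=real], of "real j"]] by simp
    have "(\<lambda>n. real (l n - j) / real n) \<longlonglongrightarrow> x"
    proof (rule real_tendsto_sandwich[OF always_eventually always_eventually lo l(2)]; intro allI)
      fix n
      show "real (l n) / real n - real j * (1 / real n) \<le> real (l n - j) / real n"
        by (simp add: divide_right_mono flip: diff_divide_distrib)
      show "real (l n - j) / real n \<le> real (l n) / real n" by (intro divide_right_mono) auto
    qed
    then have "(\<lambda>n. real (l n - j) / real n / \<rho>) \<longlonglongrightarrow> x / \<rho>" using \<rho> by (intro tendsto_intros) auto
    then show ?thesis by simp
  qed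
  have bd: "norm (\<Prod>j<i. real (l n - j) / (real n * \<rho>)) \<le> (x / \<rho>) ^ i" for i n
  proof -
    have "(\<Prod>j<i. real (l n - j) / (real n * \<rho>)) \<le> (\<Prod>j<i. x / \<rho>)" by (intro prod_mono) (simp only: fac)
    moreover have "0 \<le> (\<Prod>j<i. real (l n - j) / (real n * \<rho>))" by (intro prod_nonneg) (simp only: fac)
    ultimately show ?thesis by simp
  qed
  have "(\<lambda>n. \<Sum>i. \<Prod>j<i. real (l n - j) / (real n * \<rho>)) \<longlonglongrightarrow> (\<Sum>i. (x / \<rho>) ^ i)"
  proof (rule tannerys_theorem[THEN conjunct2, THEN conjunct2, of _ _ _ "\<lambda>i. (x / \<rho>) ^ i"])
    show "(\<lambda>n. \<Prod>j<i. real (l n - j) / (real n * \<rho>)) \<longlonglongrightarrow> (x / \<rho>) ^ i" for i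
      using tendsto_prod[of "{..<i}" "\<lambda>j n. real (l n - j) / (real n * \<rho>)" "\<lambda>_. x / \<rho>" sequentially, OF lim] by simp
    show "summable (\<lambda>i. (x / \<rho>) ^ i)" using q by (intro summable_geometric) auto
    show "\<forall>\<^sub>F (i, n) in sequentially \<times>\<^sub>F sequentially. norm (\<Prod>j<i. real (l n - j) / (real n * \<rho>)) \<le> (x / \<rho>) ^ i"
      by (rule always_eventually) (simp only: split_paired_All prod.case bd simp_thms)
  qed simp
  also have "(\<Sum>i. (x / \<rho>) ^ i) = 1 / (1 - x / \<rho>)" using q by (intro suminf_geometric) auto
  finally have "(\<lambda>n. inverse (\<Sum>i. \<Prod>j<i. real (l n - j) / (real n * \<rho>))) \<longlonglongrightarrow> inverse (1 / (1 - x / \<rho>))"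
    using q by (intro tendsto_inverse) auto
  then have "(\<lambda>n. inverse (\<Sum>i. \<Prod>j<i. real (l n - j) / (real n * \<rho>))) \<longlonglongrightarrow> 1 - x / \<rho>" by simp
  moreover have "\<forall>\<^sub>F n in sequentially. inverse (\<Sum>i. \<Prod>j<i. real (l n - j) / (real n * \<rho>)) = pois (real n * \<rho>) (l n) / pois_cdf (real n * \<rho>) (l n)"
    using eventually_gt_at_top[of 0]
  proof eventually_elim
    case (elim n)
    then show ?case using \<rho> pois_cdf_quotient[of "real n * \<rho>" "l n"] by (metis inverse_divide mult_pos_pos of_nat_0_less_iff)
  qed
  ultimately show ?thesis by (rule Lim_transform_eventually)
qed

text \<open>Above the mean the distribution function tends to 1 and the single probability to 0,
  both by Chebyshev.\<close>

lemma pois_hazard_above: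
  fixes l :: "nat \<Rightarrow> nat"
  assumes x: "0 < \<rho>" "\<rho> < x" and l: "(\<lambda>n. real (l n) / real n) \<longlonglongrightarrow> x"
  shows "(\<lambda>n. pois (real n * \<rho>) (l n) / pois_cdf (real n * \<rho>) (l n)) \<longlonglongrightarrow> 0"
proof -
  define \<delta> where "\<delta> = (x - \<rho>) / 2"
  have \<delta>: "\<delta> > 0" using x by (simp add: \<delta>_def)
  define e where "e n = \<rho> / \<delta>\<^sup>2 * (1 / real n)" for n
  have e0: "e \<longlonglongrightarrow> 0" unfolding e_def by (intro tendsto_mult_right_zero lim_1_over_n)
  have "\<forall>\<^sub>F n in sequentially. real (l n) / real n > \<rho> + \<delta>"
    using l by (rule order_tendstoD) (use x in \<open>simp add: \<delta>_def field_simps\<close>)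
  moreover have "\<forall>\<^sub>F n in sequentially. e n < 1" using e0 by (rule order_tendstoD) simp
  ultimately have up: "\<forall>\<^sub>F n in sequentially. pois (real n * \<rho>) (l n) / pois_cdf (real n * \<rho>) (l n) \<le> e n / (1 - e n)"
    using eventually_gt_at_top[of 0]
  proof eventually_elim
    case (elim n)
    have n: "n > 0" by fact
    have "(\<rho> + \<delta>) * real n < real (l n)" using elim(1) n by (simp add: pos_less_divide_eq)
    then have ln: "real n * \<rho> + \<delta> * real n \<le> real (l n)" by (simp add: algebra_simps)
    have en: "real n * \<rho> / (\<delta> * real n)\<^sup>2 = e n" using n by (simp add: e_def power2_eq_square)
    have "(\<Sum>j\<in>{l n}. pois (real n * \<rho>) j) \<le> real n * \<rho> / (\<delta> * real n)\<^sup>2"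
      using x \<delta> n ln by (intro pois_chebyshev) auto
    then have p: "pois (real n * \<rho>) (l n) \<le> e n" using en by simp
    have "1 - pois_cdf (real n * \<rho>) (l n) \<le> real n * \<rho> / (\<delta> * real n)\<^sup>2"
      using x \<delta> n ln by (intro pois_upper_tail) auto
    then have c: "1 - e n \<le> pois_cdf (real n * \<rho>) (l n)" using en by simp
    have "pois (real n * \<rho>) (l n) \<ge> 0" using x by (intro pois_nonneg) auto
    then show ?case using p c elim(2) by (intro frac_le) auto
  qed
  have nn: "\<forall>\<^sub>F n in sequentially. 0 \<le> pois (real n * \<rho>) (l n) / pois_cdf (real n * \<rho>) (l n)"
    using x by (intro always_eventually allI divide_nonneg_nonneg pois_nonneg)
      (auto simp: pois_cdf_def intro!: sum_nonneg pois_nonneg)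
  have "(\<lambda>n. e n / (1 - e n)) \<longlonglongrightarrow> 0 / (1 - 0)" using e0 by (intro tendsto_intros) auto
  then have lim: "(\<lambda>n. e n / (1 - e n)) \<longlonglongrightarrow> 0" by simp
  show ?thesis by (rule real_tendsto_sandwich[OF nn up tendsto_const lim])
qed

text \<open>An average over modes becomes the integral of a step function on \<open>[0, 1)\<close>,
  so that dominated convergence can take the place of uniform estimates.\<close>

lemma riemann_sum_eq_integral:
  fixes h :: "nat \<Rightarrow> complex"
  assumes n: "n > 0"
  shows "(\<Sum>l<n. h l) / of_nat n = (LINT x|lborel. indicator {0..<1} x *\<^sub>R h (nat \<lfloor>real n * x\<rfloor>))"
    and "(\<lambda>x. indicator {0..<1} x *\<^sub>R h (nat \<lfloor>real n * x\<rfloor>)) \<in> borel_measurable lborel"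
proof -
  let ?I = "\<lambda>l. {real l / real n..<(real l + 1) / real n}"
  have pw: "indicator {0..<1} x *\<^sub>R h (nat \<lfloor>real n * x\<rfloor>) = (\<Sum>l<n. indicator (?I l) x *\<^sub>R h l)" for x :: real
  proof -
    have mem: "x \<in> ?I l \<longleftrightarrow> 0 \<le> x \<and> nat \<lfloor>real n * x\<rfloor> = l" for l
    proof -
      have "x \<in> ?I l \<longleftrightarrow> real l \<le> real n * x \<and> real n * x < real l + 1"
        using n by (simp add: pos_divide_le_eq pos_less_divide_eq mult.commute)
      also have "\<dots> \<longleftrightarrow> \<lfloor>real n * x\<rfloor> = int l" by (simp add: floor_eq_iff)
      also have "\<dots> \<longleftrightarrow> 0 \<le> \<lfloor>real n * x\<rfloor> \<and> nat \<lfloor>real n * x\<rfloor> = l" by linarith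
      also have "0 \<le> \<lfloor>real n * x\<rfloor> \<longleftrightarrow> 0 \<le> x" using n by (simp add: zero_le_mult_iff)
      finally show ?thesis .
    qed
    have less: "nat \<lfloor>real n * x\<rfloor> < n \<longleftrightarrow> x < 1" if "0 \<le> x"
    proof -
      have "nat \<lfloor>real n * x\<rfloor> < n \<longleftrightarrow> \<lfloor>real n * x\<rfloor> < int n" using that n by (simp add: nat_less_iff)
      also have "\<dots> \<longleftrightarrow> real n * x < real n" by (simp add: floor_less_iff)
      finally show ?thesis using n by simp
    qed
    have "(\<Sum>l<n. indicator (?I l) x *\<^sub>R h l) = (\<Sum>l<n. if l = nat \<lfloor>real n * x\<rfloor> then (if 0 \<le> x then h l else 0) else 0)"
      by (intro sum.cong refl) (simp add: indicator_def mem del: atLeastLessThan_iff)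
    also have "\<dots> = (if nat \<lfloor>real n * x\<rfloor> < n then (if 0 \<le> x then h (nat \<lfloor>real n * x\<rfloor>) else 0) else 0)"
      by (simp only: sum.delta finite_lessThan lessThan_iff)
    also have "\<dots> = indicator {0..<1} x *\<^sub>R h (nat \<lfloor>real n * x\<rfloor>)"
      using less by (simp add: indicator_def)
    finally show ?thesis by simp
  qed
  show "(\<lambda>x. indicator {0..<1} x *\<^sub>R h (nat \<lfloor>real n * x\<rfloor>)) \<in> borel_measurable lborel"
    unfolding pw by measurable
  have len: "(real l + 1) / real n - real l / real n = 1 / real n" for l by (simp add: add_divide_distrib)
  have le: "real l / real n \<le> (real l + 1) / real n" for l by (intro divide_right_mono) auto
  have "(LINT x|lborel. indicator {0..<1} x *\<^sub>R h (nat \<lfloor>real n * x\<rfloor>)) = (\<Sum>l<n. (LINT x|lborel. indicator (?I l) x *\<^sub>R h l))"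
    unfolding pw using le by (intro Bochner_Integration.integral_sum integrable_scaleR_left) auto
  also have "\<dots> = (\<Sum>l<n. (1 / real n) *\<^sub>R h l)"
    using le by (intro sum.cong refl) (simp add: len)
  also have "\<dots> = (\<Sum>l<n. h l) / of_nat n" by (simp add: scaleR_conv_of_real sum_divide_distrib)
  finally show "(\<Sum>l<n. h l) / of_nat n = (LINT x|lborel. indicator {0..<1} x *\<^sub>R h (nat \<lfloor>real n * x\<rfloor>))" by simp
qed

text \<open>The origin of the edge kernel. In \<open>y = (x - r) / a\<close>, which runs from -1 to
  0, the integrand is a multiple of \<open>- y * exp (y * s)\<close>; integration by parts gives the
  antiderivative \<open>(1 / s\<^sup>2 - y / s) * exp (y * s)\<close>, and the end
  \<open>y = -1\<close> produces the term with \<open>exp (- s)\<close>.\<close>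

lemma edge_integral:
  fixes s :: complex and b r a :: real
  assumes s: "s \<noteq> 0" and a: "a > 0" "a = r - b"
  shows "(LINT x|lborel. indicator {b..r} x *\<^sub>R (cplx (r - x) * exp (cplx ((x - r) / a) * s))) =
    a\<^sup>2 *\<^sub>R ((1 - (s + 1) * exp (- s)) / s\<^sup>2)"
proof -
  let ?y = "\<lambda>x. cplx ((x - r) / a)"
  define A where "A x = cplx (a\<^sup>2) * ((1 / s\<^sup>2 - ?y x / s) * exp (?y x * s))" for x
  have br: "b \<le> r" using a by simp
  have "(LINT x|lborel. indicator {b..r} x *\<^sub>R (cplx (r - x) * exp (cplx ((x - r) / a) * s))) = A r - A b"
  proof (rule integral_FTC_Icc[OF br])
    show "continuous_on {b..r} (\<lambda>x. cplx (r - x) * exp (?y x * s))"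
      using a by (intro continuous_intros) auto
    fix x
    have y: "(?y has_vector_derivative cplx (1 / a)) (at x within {b..r})"
      using a by (auto intro!: derivative_eq_intros simp: has_vector_derivative_complex_iff)
    have E: "((\<lambda>x. exp (?y x * s)) has_vector_derivative (cplx (1 / a) * s * exp (?y x * s))) (at x within {b..r})"
      using field_vector_diff_chain_within[OF has_vector_derivative_mult_left[OF y, of s], of exp "exp (?y x * s)"]
      by (simp add: o_def DERIV_exp has_field_derivative_at_within)
    have "(A has_vector_derivative cplx (a\<^sup>2) * ((1 / s\<^sup>2 - ?y x / s) * (cplx (1 / a) * s * exp (?y x * s)) +
        (0 - cplx (1 / a) / s) * exp (?y x * s))) (at x within {b..r})"
      unfolding A_def
      by (intro has_vector_derivative_mult_right has_vector_derivative_mult has_vector_derivative_diff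
          has_vector_derivative_divide has_vector_derivative_const y E)
    also have "cplx (a\<^sup>2) * ((1 / s\<^sup>2 - ?y x / s) * (cplx (1 / a) * s * exp (?y x * s)) +
        (0 - cplx (1 / a) / s) * exp (?y x * s)) = cplx (r - x) * exp (?y x * s)"
    proof -
      have "cplx (a\<^sup>2) * ((1 / s\<^sup>2 - ?y x / s) * (cplx (1 / a) * s * e) +
        (0 - cplx (1 / a) / s) * e) = - (cplx a * ?y x) * e" for e
        using s a(1) by (simp add: field_simps power2_eq_square)
      moreover have "- (cplx a * ?y x) = cplx (r - x)" using a(1) by simp
      ultimately show ?thesis by (simp only:)
    qed
    finally show "(A has_vector_derivative cplx (r - x) * exp (?y x * s)) (at x within {b..r})" .
  qed
  also have "A r - A b = a\<^sup>2 *\<^sub>R ((1 - (s + 1) * exp (- s)) / s\<^sup>2)"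
  proof -
    have "?y r = 0" "?y b = - 1" using a by (auto simp: field_simps)
    then have "A r - A b = cplx (a\<^sup>2) * (1 / s\<^sup>2 - (1 / s\<^sup>2 + 1 / s) * exp (- s))"
      by (simp add: A_def algebra_simps)
    also have "1 / s\<^sup>2 - (1 / s\<^sup>2 + 1 / s) * exp (- s) = (1 - (s + 1) * exp (- s)) / s\<^sup>2"
      using s by (simp add: field_simps power2_eq_square)
    finally show ?thesis by (simp add: scaleR_conv_of_real)
  qed
  finally show ?thesis .
qed

lemma card_near_le:
  assumes y: "y \<ge> 0"
  shows "real (card {l \<in> {..<n}. \<bar>real l - real m\<bar> < y}) \<le> 2 * y + 1"
proof -
  have "{l \<in> {..<n}. \<bar>real l - real m\<bar> < y} \<subseteq> {m - nat \<lfloor>y\<rfloor>..m + nat \<lfloor>y\<rfloor>}"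
  proof
    fix l assume "l \<in> {l \<in> {..<n}. \<bar>real l - real m\<bar> < y}"
    then have "\<bar>int l - int m\<bar> \<le> \<lfloor>y\<rfloor>" by (simp add: le_floor_iff)
    then show "l \<in> {m - nat \<lfloor>y\<rfloor>..m + nat \<lfloor>y\<rfloor>}" by auto
  qed
  then have "card {l \<in> {..<n}. \<bar>real l - real m\<bar> < y} \<le> card {m - nat \<lfloor>y\<rfloor>..m + nat \<lfloor>y\<rfloor>}"
    by (intro card_mono) auto
  also have "\<dots> \<le> 2 * nat \<lfloor>y\<rfloor> + 1" by simp
  finally have "real (card {l \<in> {..<n}. \<bar>real l - real m\<bar> < y}) \<le> real (2 * nat \<lfloor>y\<rfloor> + 1)" by (simp only: of_nat_le_iff)
  also have "\<dots> \<le> 2 * y + 1" using y by simp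
  finally show ?thesis .
qed

section \<open>Mode sums near the circle and their limit\<close>

context conditioned_setting
begin

definition gap :: real where "gap = R\<^sup>2 - 1 + c"

lemma gap_pos: "gap > 0" using c by (simp add: gap_def)

text \<open>At the edge all modes have terms of comparable size, so the plain average of the
  mismatch probabilities is what counts. The modes for which nothing is known lie within
  \<open>\<eta> * n\<close> of \<open>M n\<close> and form a fraction of about
  \<open>2 * \<eta>\<close>, with \<eta> as small as desired.\<close>

lemma mis_average_tendsto: "(\<lambda>n. (\<Sum>l<n. mis n l) / real n) \<longlonglongrightarrow> 0"
proof (rule order_tendstoI)
  fix e :: real assume "e < 0"
  have "\<forall>\<^sub>F n in sequentially. 0 \<le> (\<Sum>l<n. mis n l) / real n"
    using eventually_gt_at_top[of 0] by eventually_elim (auto intro!: divide_nonneg_nonneg sum_nonneg mis_nonneg)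
  then show "\<forall>\<^sub>F n in sequentially. e < (\<Sum>l<n. mis n l) / real n"
    by eventually_elim (use \<open>e < 0\<close> in linarith)
next
  fix e :: real assume e: "0 < e"
  \<comment> \<open>The cap \<open>e / 8\<close> makes the contribution \<open>2 * \<eta>\<close> of
    the near modes at most a quarter of \<open>e\<close>; the far modes and the rounding contribute
    less than a quarter each.\<close>
  define \<eta> where "\<eta> = min (gap / 8) (e / 8)"
  have \<eta>: "0 < \<eta>" "\<eta> < (R\<^sup>2 - (1 - c)) / 4" "\<eta> \<le> e / 8" using e gap_pos by (auto simp: \<eta>_def gap_def min_def)
  obtain \<epsilon> where \<epsilon>: "\<epsilon> \<longlonglongrightarrow> 0"
    "\<forall>\<^sub>F n in sequentially. \<forall>l<n. \<eta> * real n \<le> \<bar>real l - real (M n)\<bar> \<longrightarrow> mis n l \<le> \<epsilon> n"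
    by (rule mis_far[OF \<eta>(1,2)]) blast
  have "\<forall>\<^sub>F n in sequentially. \<bar>\<epsilon> n\<bar> < e / 4"
    using tendsto_rabs_zero[OF \<epsilon>(1)] e by (intro order_tendstoD) auto
  moreover have "\<forall>\<^sub>F n in sequentially. 1 / real n < e / 4"
    using lim_1_over_n[where 'a=real] e by (intro order_tendstoD) auto
  ultimately show "\<forall>\<^sub>F n in sequentially. (\<Sum>l<n. mis n l) / real n < e"
    using \<epsilon>(2) eventually_gt_at_top[of 0]
  proof eventually_elim
    case (elim n)
    have n: "n > 0" by fact
    let ?near = "{l \<in> {..<n}. \<bar>real l - real (M n)\<bar> < \<eta> * real n}"
    have "(\<Sum>l<n. mis n l) \<le> (\<Sum>l<n. \<bar>\<epsilon> n\<bar> + (if \<bar>real l - real (M n)\<bar> < \<eta> * real n then 1 else 0))"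
    proof (rule sum_mono)
      fix l assume "l \<in> {..<n}"
      then show "mis n l \<le> \<bar>\<epsilon> n\<bar> + (if \<bar>real l - real (M n)\<bar> < \<eta> * real n then 1 else 0)"
        using mis_le_1[OF n, of l] elim(3) by (cases "\<bar>real l - real (M n)\<bar> < \<eta> * real n") fastforce+
    qed
    also have "\<dots> = real n * \<bar>\<epsilon> n\<bar> + real (card ?near)"
      by (simp add: sum.distrib sum.inter_filter[symmetric])
    also have "\<dots> \<le> real n * \<bar>\<epsilon> n\<bar> + (2 * (\<eta> * real n) + 1)"
      using \<eta>(1) by (intro add_left_mono card_near_le) simp
    finally have "(\<Sum>l<n. mis n l) / real n \<le> (real n * \<bar>\<epsilon> n\<bar> + (2 * (\<eta> * real n) + 1)) / real n"
      by (rule divide_right_mono) simp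
    also have "\<dots> = \<bar>\<epsilon> n\<bar> + 2 * \<eta> + 1 / real n" using n by (simp add: field_simps)
    finally show ?case using elim(1,2) \<eta>(3) e by linarith
  qed
qed

text \<open>The point with rescaled coordinate \<zeta> is \<open>R * edge_shift n \<zeta>\<close>,
  because the dilation is by \<open>n * gap / R\<close>.\<close>

definition edge_shift :: "nat \<Rightarrow> complex \<Rightarrow> complex" where
  "edge_shift n \<zeta> = 1 + \<zeta> / cplx gap / of_nat n"

text \<open>The ratio of mode \<open>l\<close> at two edge points to its value at the point
  \<open>R\<close>; after renormalisation the hazard rate is the only Poisson quantity left.\<close>

definition edge_factor :: "nat \<Rightarrow> nat \<Rightarrow> complex \<Rightarrow> complex \<Rightarrow> complex" where
  "edge_factor n l \<zeta> \<omega> = edge_shift n \<zeta> ^ l * cnj (edge_shift n \<omega> ^ l) *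
     cplx (exp (- (R\<^sup>2 / 2) * (real n * ((cmod (edge_shift n \<zeta>))\<^sup>2 - 1) + real n * ((cmod (edge_shift n \<omega>))\<^sup>2 - 1))))"

definition edge_sum :: "nat \<Rightarrow> nat set \<Rightarrow> complex \<Rightarrow> complex \<Rightarrow> complex" where
  "edge_sum n T \<zeta> \<omega> = (\<Sum>l\<in>T. cplx (pois (real n * R\<^sup>2) l / \<alpha> n l) * edge_factor n l \<zeta> \<omega>) / of_nat n"

lemma mode_edge:
  "mode n l (cplx R * edge_shift n \<zeta>) (cplx R * edge_shift n \<omega>) =
    cplx (pois (real n * R\<^sup>2) l) * edge_factor n l \<zeta> \<omega>"
proof -
  let ?u = "edge_shift n \<zeta>" and ?v = "edge_shift n \<omega>"
  have 1: "of_nat n * (cplx R * ?u) * cnj (cplx R * ?v) = cplx (real n * R\<^sup>2) * (?u * cnj ?v)"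
    by (simp add: power2_eq_square mult_ac)
  have 2: "- real n * ((cmod (cplx R * ?u))\<^sup>2 + (cmod (cplx R * ?v))\<^sup>2) / 2 =
      - (real n * R\<^sup>2) + - (R\<^sup>2 / 2) * (real n * ((cmod ?u)\<^sup>2 - 1) + real n * ((cmod ?v)\<^sup>2 - 1))"
    by (simp add: norm_mult power_mult_distrib field_simps)
  show ?thesis
    unfolding mode_def 1 2 pois_def edge_factor_def exp_add by (simp add: power_mult_distrib mult_ac)
qed

lemma cmod_edge_shift: "Re \<zeta> \<ge> 0 \<Longrightarrow> 1 \<le> cmod (edge_shift n \<zeta>)"
proof -
  assume "Re \<zeta> \<ge> 0"
  then have "0 \<le> Re (\<zeta> / cplx gap / of_nat n)"
    using gap_pos by (simp add: Re_divide_of_nat Re_divide_of_real)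
  then have "1 \<le> Re (edge_shift n \<zeta>)" by (simp add: edge_shift_def)
  then show ?thesis using complex_Re_le_cmod order.trans by blast
qed

text \<open>The powers are at most \<open>(1 + B / gap / n) ^ n\<close>, hence at most
  \<open>exp (B / gap)\<close>. The Gaussian factor is at most 1 because points with nonnegative
  rescaled real part do not lie inside the circle.\<close>

lemma cmod_edge_factor_le:
  assumes z: "Re \<zeta> \<ge> 0" "cmod \<zeta> \<le> B" and w: "Re \<omega> \<ge> 0" "cmod \<omega> \<le> B" and l: "l < n"
  shows "cmod (edge_factor n l \<zeta> \<omega>) \<le> exp (2 * B / gap)"
proof -
  have n: "n > 0" using l by simp
  have B: "B \<ge> 0" using z(2) norm_ge_zero order.trans by blast
  have pw: "cmod (edge_shift n \<xi>) ^ l \<le> exp (B / gap)" if "Re \<xi> \<ge> 0" "cmod \<xi> \<le> B" for \<xi>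
  proof -
    have "cmod (edge_shift n \<xi>) ^ l \<le> cmod (edge_shift n \<xi>) ^ n"
      using cmod_edge_shift[OF that(1)] l by (intro power_increasing) auto
    also have "\<dots> \<le> (1 + B / gap / real n) ^ n"
    proof (intro power_mono norm_ge_zero)
      have "cmod (edge_shift n \<xi>) \<le> 1 + cmod (\<xi> / cplx gap / of_nat n)"
        unfolding edge_shift_def using norm_triangle_ineq[of 1] by (metis norm_one)
      also have "cmod (\<xi> / cplx gap / of_nat n) \<le> B / gap / real n"
        using gap_pos that(2)
        by (simp only: norm_divide norm_of_real norm_of_nat abs_of_pos) (intro divide_right_mono; simp)
      finally show "cmod (edge_shift n \<xi>) \<le> 1 + B / gap / real n" by simp
    qed
    also have "\<dots> \<le> exp (B / gap)"
    proof (rule exp_ge_one_plus_x_over_n_power_n)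
      have "0 \<le> B / gap" using B gap_pos by simp
      then show "- real n \<le> B / gap" by linarith
    qed (use n in simp)
    finally show ?thesis .
  qed
  have nn: "0 \<le> real n * ((cmod (edge_shift n \<xi>))\<^sup>2 - 1)" if "Re \<xi> \<ge> 0" for \<xi>
    using cmod_edge_shift[OF that, of n] by simp
  have "0 \<le> (R\<^sup>2 / 2) * (real n * ((cmod (edge_shift n \<zeta>))\<^sup>2 - 1) + real n * ((cmod (edge_shift n \<omega>))\<^sup>2 - 1))"
    by (intro mult_nonneg_nonneg add_nonneg_nonneg nn z w) simp
  then have ex: "exp (- (R\<^sup>2 / 2) * (real n * ((cmod (edge_shift n \<zeta>))\<^sup>2 - 1) + real n * ((cmod (edge_shift n \<omega>))\<^sup>2 - 1))) \<le> 1"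
    by (simp only: exp_le_one_iff mult_minus_left neg_le_0_iff_le)
  have "cmod (edge_factor n l \<zeta> \<omega>) \<le> exp (B / gap) * exp (B / gap) * 1"
    unfolding edge_factor_def norm_mult complex_mod_cnj norm_power norm_of_real abs_exp_cancel
    by (intro mult_mono pw z w ex mult_nonneg_nonneg) auto
  also have "\<dots> = exp (2 * B / gap)" by (simp flip: exp_add)
  finally show ?thesis .
qed

lemma edge_factor_tendsto:
  fixes l :: "nat \<Rightarrow> nat"
  assumes l: "(\<lambda>n. real (l n) / real n) \<longlonglongrightarrow> x"
  shows "(\<lambda>n. edge_factor n (l n) \<zeta> \<omega>) \<longlonglongrightarrow>
    exp (cplx (x / gap) * (\<zeta> + cnj \<omega>)) * cplx (exp (- (R\<^sup>2 / gap) * (Re \<zeta> + Re \<omega>)))"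
proof -
  \<comment> \<open>The square of \<open>cmod (1 + u / n)\<close> is \<open>1 + 2 * Re u / n\<close>
    up to order \<open>1 / n ^ 2\<close>.\<close>
  have sq: "(\<lambda>n. real n * ((cmod (edge_shift n \<xi>))\<^sup>2 - 1)) \<longlonglongrightarrow> 2 * Re \<xi> / gap" for \<xi>
  proof -
    have "(\<lambda>n. 2 * Re \<xi> / gap + (cmod \<xi> / gap)\<^sup>2 * (1 / real n)) \<longlonglongrightarrow> 2 * Re \<xi> / gap + 0"
      by (intro tendsto_add tendsto_const tendsto_mult_right_zero lim_1_over_n)
    moreover have "\<forall>\<^sub>F n in sequentially. 2 * Re \<xi> / gap + (cmod \<xi> / gap)\<^sup>2 * (1 / real n) = real n * ((cmod (edge_shift n \<xi>))\<^sup>2 - 1)"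
      using eventually_gt_at_top[of 0]
    proof eventually_elim
      case (elim n)
      have "(cmod (edge_shift n \<xi>))\<^sup>2 = (1 + Re \<xi> / gap / real n)\<^sup>2 + (Im \<xi> / gap / real n)\<^sup>2"
        by (simp add: edge_shift_def cmod_power2 Re_divide_of_nat Im_divide_of_nat Re_divide_of_real Im_divide_of_real)
      moreover have "(cmod \<xi> / gap)\<^sup>2 = (Re \<xi> / gap)\<^sup>2 + (Im \<xi> / gap)\<^sup>2"
        by (simp add: power_divide cmod_power2 add_divide_distrib)
      ultimately show ?case using elim gap_pos by (simp add: field_simps power2_eq_square)
    qed
    ultimately show ?thesis by (simp add: Lim_transform_eventually)
  qed
  have pw: "(\<lambda>n. edge_shift n \<xi> ^ l n) \<longlonglongrightarrow> exp (cplx x * (\<xi> / cplx gap))" for \<xi>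
    unfolding edge_shift_def by (rule power_one_plus_tendsto[OF l])
  have "(\<lambda>n. edge_factor n (l n) \<zeta> \<omega>) \<longlonglongrightarrow> exp (cplx x * (\<zeta> / cplx gap)) *
      cnj (exp (cplx x * (\<omega> / cplx gap))) * cplx (exp (- (R\<^sup>2 / 2) * (2 * Re \<zeta> / gap + 2 * Re \<omega> / gap)))"
    unfolding edge_factor_def by (intro tendsto_intros pw sq)
  also have "exp (cplx x * (\<zeta> / cplx gap)) * cnj (exp (cplx x * (\<omega> / cplx gap)))
      = exp (cplx (x / gap) * (\<zeta> + cnj \<omega>))"
    by (simp add: exp_cnj distrib_left flip: exp_add)
  also have "- (R\<^sup>2 / 2) * (2 * Re \<zeta> / gap + 2 * Re \<omega> / gap) = - (R\<^sup>2 / gap) * (Re \<zeta> + Re \<omega>)"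
    by (simp add: add_divide_distrib distrib_left)
  finally show ?thesis .
qed

lemma hazard_le_1: "n > 0 \<Longrightarrow> 0 \<le> pois (real n * R\<^sup>2) l / \<alpha> n l \<and> pois (real n * R\<^sup>2) l / \<alpha> n l \<le> 1"
proof -
  assume n: "n > 0"
  have "pois (real n * R\<^sup>2) l \<le> \<alpha> n l"
    unfolding \<alpha>_def pois_cdf_def by (intro member_le_sum) (auto intro!: pois_nonneg)
  then show ?thesis using \<alpha>_pos[OF n, of l] pois_nonneg[of "real n * R\<^sup>2" l] by simp
qed

lemma cmod_edge_term_le:
  assumes "Re \<zeta> \<ge> 0" "cmod \<zeta> \<le> B" "Re \<omega> \<ge> 0" "cmod \<omega> \<le> B" "l < n"
  shows "cmod (cplx (pois (real n * R\<^sup>2) l / \<alpha> n l) * edge_factor n l \<zeta> \<omega>) \<le> exp (2 * B / gap)"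
proof -
  have "cmod (cplx (pois (real n * R\<^sup>2) l / \<alpha> n l) * edge_factor n l \<zeta> \<omega>) \<le> 1 * exp (2 * B / gap)"
    unfolding norm_mult norm_of_real using hazard_le_1[of n l] assms(5)
    by (intro mult_mono cmod_edge_factor_le[OF assms]) auto
  then show ?thesis by simp
qed

lemma cmod_edge_sum_le:
  assumes "Re \<zeta> \<ge> 0" "cmod \<zeta> \<le> B" "Re \<omega> \<ge> 0" "cmod \<omega> \<le> B" "T \<subseteq> {..<n}" "n > 0"
  shows "cmod (edge_sum n T \<zeta> \<omega>) \<le> exp (2 * B / gap)"
proof -
  have "cmod (\<Sum>l\<in>T. cplx (pois (real n * R\<^sup>2) l / \<alpha> n l) * edge_factor n l \<zeta> \<omega>) \<le> (\<Sum>l\<in>T. exp (2 * B / gap))"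
    using assms(5) by (intro sum_norm_le cmod_edge_term_le[OF assms(1-4)]) auto
  also have "\<dots> = real (card T) * exp (2 * B / gap)" by simp
  also have "\<dots> \<le> real n * exp (2 * B / gap)"
    using card_mono[OF _ assms(5)] by (intro mult_right_mono) auto
  finally show ?thesis using assms(6) by (simp add: edge_sum_def norm_divide pos_divide_le_eq mult.commute)
qed

lemma edge_mismatch_tendsto:
  assumes "Re \<zeta> \<ge> 0" "Re \<omega> \<ge> 0"
  shows "(\<lambda>n. \<Sum>T\<in>TT n. prob n T * cmod (edge_sum n T \<zeta> \<omega> - edge_sum n {M n..<n} \<zeta> \<omega>)) \<longlonglongrightarrow> 0"
proof -
  define B where "B = max (cmod \<zeta>) (cmod \<omega>)"
  have B: "cmod \<zeta> \<le> B" "cmod \<omega> \<le> B" by (auto simp: B_def)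
  let ?C = "exp (2 * B / gap)"
  have nn: "\<forall>\<^sub>F n in sequentially. 0 \<le> (\<Sum>T\<in>TT n. prob n T * cmod (edge_sum n T \<zeta> \<omega> - edge_sum n {M n..<n} \<zeta> \<omega>))"
    using prob_space_eventually by eventually_elim (auto intro!: sum_nonneg)
  have up: "\<forall>\<^sub>F n in sequentially. (\<Sum>T\<in>TT n. prob n T * cmod (edge_sum n T \<zeta> \<omega> - edge_sum n {M n..<n} \<zeta> \<omega>))
      \<le> ?C * ((\<Sum>l<n. mis n l) / real n)"
    using eventually_gt_at_top[of 0]
  proof eventually_elim
    case (elim n)
    let ?v = "\<lambda>l. cplx (pois (real n * R\<^sup>2) l / \<alpha> n l) * edge_factor n l \<zeta> \<omega>"
    have "(\<Sum>T\<in>TT n. prob n T * cmod (edge_sum n T \<zeta> \<omega> - edge_sum n {M n..<n} \<zeta> \<omega>)) \<le> (\<Sum>l<n. mis n l * (?C / real n))"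
    proof (rule expected_mismatch[OF elim])
      fix T assume "T \<in> TT n"
      then have T: "T \<subseteq> {..<n}" by (simp add: size_subsets_def)
      have "cmod ((\<Sum>l\<in>T. ?v l) - (\<Sum>l\<in>{M n..<n}. ?v l)) \<le> (\<Sum>l\<in>{l \<in> {..<n}. (l \<in> T) \<noteq> (l \<in> {M n..<n})}. cmod (?v l))"
        using T by (intro norm_sum_diff_le_mismatch) auto
      also have "\<dots> \<le> (\<Sum>l\<in>{l \<in> {..<n}. (l \<in> T) \<noteq> (l \<in> {M n..<n})}. ?C)"
        by (intro sum_mono cmod_edge_term_le assms B) auto
      also have "{l \<in> {..<n}. (l \<in> T) \<noteq> (l \<in> {M n..<n})} = {l \<in> {..<n}. (l \<in> T) \<noteq> (M n \<le> l)}" by auto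
      finally have "cmod ((\<Sum>l\<in>T. ?v l) - (\<Sum>l\<in>{M n..<n}. ?v l)) / real n \<le> (\<Sum>l\<in>{l \<in> {..<n}. (l \<in> T) \<noteq> (M n \<le> l)}. ?C) / real n"
        by (rule divide_right_mono) simp
      then show "cmod (edge_sum n T \<zeta> \<omega> - edge_sum n {M n..<n} \<zeta> \<omega>) \<le> (\<Sum>l\<in>{l \<in> {..<n}. (l \<in> T) \<noteq> (M n \<le> l)}. ?C / real n)"
        unfolding edge_sum_def diff_divide_distrib[symmetric] norm_divide norm_of_nat sum_divide_distrib[symmetric] .
    qed simp
    also have "\<dots> = ?C * ((\<Sum>l<n. mis n l) / real n)" unfolding sum_distrib_right[symmetric] by simp
    finally show ?case .
  qed
  have "(\<lambda>n. ?C * ((\<Sum>l<n. mis n l) / real n)) \<longlonglongrightarrow> 0"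
    by (intro tendsto_mult_right_zero mis_average_tendsto)
  then show ?thesis by (rule real_tendsto_sandwich[OF nn up tendsto_const])
qed

text \<open>The factor left by the modes at \<open>x = R\<^sup>2\<close>, where the growth of the
  powers cancels the Gaussian factor in modulus and only the imaginary parts survive.\<close>

definition edge_phase :: "complex \<Rightarrow> complex" where
  "edge_phase \<zeta> = cis (R\<^sup>2 * Im \<zeta> / gap)"

text \<open>The edge sum is a Riemann sum over \<open>x = l / n\<close>. The restriction to the top
  segment cuts the integral off at \<open>1 - c\<close>, the vanishing hazard rate cuts it off at
  \<open>R\<^sup>2\<close>, and in between the integrand is linear times exponential, so that
  \<open>edge_integral\<close> applies with interval length \<open>gap\<close>.\<close>

lemma edge_sum_limit:
  assumes z: "Re \<zeta> > 0" and w: "Re \<omega> > 0"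
  shows "(\<lambda>n. edge_sum n {M n..<n} \<zeta> \<omega>) \<longlonglongrightarrow>
    cplx (pi * gap\<^sup>2 / R\<^sup>2) * (edge_phase \<zeta> * cnj (edge_phase \<omega>) * edge_kernel \<zeta> \<omega>)"
proof -
  let ?s = "\<zeta> + cnj \<omega>"
  have s: "?s \<noteq> 0" using z w by (auto simp: complex_eq_iff)
  define B where "B = max (cmod \<zeta>) (cmod \<omega>)"
  have B: "cmod \<zeta> \<le> B" "cmod \<omega> \<le> B" by (auto simp: B_def)
  let ?C = "exp (2 * B / gap)"
  define h where "h n l = (if M n \<le> l \<and> l < n then cplx (pois (real n * R\<^sup>2) l / \<alpha> n l) * edge_factor n l \<zeta> \<omega> else 0)" for n l
  define E where "E = cplx (exp (- (R\<^sup>2 / gap) * (Re \<zeta> + Re \<omega>)))"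
  define G where "G x = indicator {1 - c..R\<^sup>2} x *\<^sub>R (cplx (1 - x / R\<^sup>2) * (exp (cplx (x / gap) * ?s) * E))" for x :: real
  have R2: "0 < R\<^sup>2" "R\<^sup>2 < 1" using R by (auto simp: abs_square_less_1)
  have bnd: "1 - c < R\<^sup>2" "0 \<le> 1 - c" using c by auto
  have "(\<lambda>n. LINT x|lborel. indicator {0..<1} x *\<^sub>R h n (nat \<lfloor>real n * x\<rfloor>)) \<longlonglongrightarrow> (LINT x|lborel. G x)"
  proof (rule integral_dominated_convergence[where w="\<lambda>x. indicator {0..<1} x *\<^sub>R ?C"])
    show "G \<in> borel_measurable lborel" unfolding G_def by measurable
    show "(\<lambda>x. indicator {0..<1} x *\<^sub>R h n (nat \<lfloor>real n * x\<rfloor>)) \<in> borel_measurable lborel" for n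
    proof (cases "n > 0")
      case True
      then show ?thesis by (rule riemann_sum_eq_integral(2))
    next
      case False
      then have "(\<lambda>x. indicator {0..<1} x *\<^sub>R h n (nat \<lfloor>real n * x\<rfloor>)) = (\<lambda>x. indicator {0..<1} x *\<^sub>R h 0 0)" by simp
      moreover have "(\<lambda>x. indicator {0..<1::real} x *\<^sub>R h 0 0) \<in> borel_measurable lborel" by measurable
      ultimately show ?thesis by (simp only:)
    qed
    show "integrable lborel (\<lambda>x. indicator {0..<1::real} x *\<^sub>R ?C)"
      by (intro integrable_scaleR_left integrable_real_indicator) auto
    have hb: "cmod (h n l) \<le> ?C" for n l
      using cmod_edge_term_le[OF less_imp_le[OF z] B(1) less_imp_le[OF w] B(2)] by (simp add: h_def)
    show "AE x in lborel. norm (indicator {0..<1} x *\<^sub>R h n (nat \<lfloor>real n * x\<rfloor>)) \<le> indicator {0..<1} x *\<^sub>R ?C" for n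
      by (intro AE_I2) (simp add: hb indicator_def)
    \<comment> \<open>The excluded values are the ends of the unit interval, the cut of the top
      segment and the transition of the hazard rate, where pointwise convergence is not
      claimed.\<close>
    have "AE x in lborel. x \<notin> {0, 1 - c, R\<^sup>2, 1::real}"
      by (intro AE_not_in countable_imp_null_set_lborel) auto
    then show "AE x in lborel. (\<lambda>n. indicator {0..<1} x *\<^sub>R h n (nat \<lfloor>real n * x\<rfloor>)) \<longlonglongrightarrow> G x"
    proof eventually_elim
      case (elim x)
      show ?case
      proof (cases "x \<in> {0..<1}")
        case False
        then have "x \<notin> {1 - c..R\<^sup>2}" using R2 bnd by auto
        then have "G x = 0" by (simp add: G_def)
        then show ?thesis using False by simp
      next
        case True
        then have x: "0 < x" "x < 1" "x \<noteq> 1 - c" "x \<noteq> R\<^sup>2" using elim by auto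
        let ?l = "\<lambda>n. nat \<lfloor>real n * x\<rfloor>"
        have l: "(\<lambda>n. real (?l n) / real n) \<longlonglongrightarrow> x" using x by (intro floor_ratio_tendsto) simp
        have lM: "(\<lambda>n. real (?l n) / real n - real (M n) / real n) \<longlonglongrightarrow> x - (1 - c)"
          by (intro tendsto_diff l M_ratio)
        show ?thesis
        proof (cases "x < 1 - c")
          case True
          then have "\<forall>\<^sub>F n in sequentially. real (?l n) / real n - real (M n) / real n < 0"
            using lM by (intro order_tendstoD) auto
          then have "\<forall>\<^sub>F n in sequentially. indicator {0..<1} x *\<^sub>R h n (?l n) = G x"
            using eventually_gt_at_top[of 0]
          proof eventually_elim
            case (elim n)
            then have "?l n < M n" by (simp add: divide_less_cancel)
            then show ?case using True by (simp add: h_def G_def)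
          qed
          then show ?thesis by (rule tendsto_eventually)
        next
          case False
          then have "\<forall>\<^sub>F n in sequentially. real (?l n) / real n - real (M n) / real n > 0"
            by (intro order_tendstoD(1)[OF lM]) (use x False in linarith)
          then have ev: "\<forall>\<^sub>F n in sequentially. cplx (pois (real n * R\<^sup>2) (?l n) / \<alpha> n (?l n)) * edge_factor n (?l n) \<zeta> \<omega> = indicator {0..<1} x *\<^sub>R h n (?l n)"
            using eventually_gt_at_top[of 0]
          proof eventually_elim
            case (elim n)
            then have "M n < ?l n" by (simp add: divide_less_cancel)
            moreover have "?l n < n"
            proof -
              have "real n * x < real n * 1" using x elim by (intro mult_strict_left_mono) auto
              then show ?thesis using elim by linarith
            qed
            ultimately show ?case using x by (simp add: h_def)
          qed
          have haz: "(\<lambda>n. pois (real n * R\<^sup>2) (?l n) / \<alpha> n (?l n)) \<longlonglongrightarrow> (if x < R\<^sup>2 then 1 - x / R\<^sup>2 else 0)"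
          proof (cases "x < R\<^sup>2")
            case True
            have "real (?l n) \<le> real n * x" for n
            proof -
              have "0 \<le> real n * x" using x by simp
              then show ?thesis by linarith
            qed
            then show ?thesis using True x l unfolding \<alpha>_def by (simp add: pois_hazard_below)
          next
            case False
            then have "R\<^sup>2 < x" using x by linarith
            from pois_hazard_above[OF R2(1) this l] show ?thesis using False unfolding \<alpha>_def by simp
          qed
          have "(\<lambda>n. cplx (pois (real n * R\<^sup>2) (?l n) / \<alpha> n (?l n)) * edge_factor n (?l n) \<zeta> \<omega>) \<longlonglongrightarrow>
            cplx (if x < R\<^sup>2 then 1 - x / R\<^sup>2 else 0) * (exp (cplx (x / gap) * ?s) * E)"
            unfolding E_def by (intro tendsto_mult tendsto_of_real haz edge_factor_tendsto l)
          also have "cplx (if x < R\<^sup>2 then 1 - x / R\<^sup>2 else 0) * (exp (cplx (x / gap) * ?s) * E) = G x"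
            using x False by (simp add: G_def)
          finally show ?thesis using ev by (rule Lim_transform_eventually)
        qed
      qed
    qed
  qed
  moreover have "\<forall>\<^sub>F n in sequentially. (LINT x|lborel. indicator {0..<1} x *\<^sub>R h n (nat \<lfloor>real n * x\<rfloor>)) = edge_sum n {M n..<n} \<zeta> \<omega>"
    using eventually_gt_at_top[of 0]
  proof eventually_elim
    case (elim n)
    have "(\<Sum>l<n. h n l) = (\<Sum>l\<in>{l \<in> {..<n}. M n \<le> l \<and> l < n}. cplx (pois (real n * R\<^sup>2) l / \<alpha> n l) * edge_factor n l \<zeta> \<omega>)"
      unfolding h_def by (rule sum.inter_filter[symmetric]) simp
    also have "{l \<in> {..<n}. M n \<le> l \<and> l < n} = {M n..<n}" by auto
    finally show ?case unfolding riemann_sum_eq_integral(1)[OF elim, symmetric] edge_sum_def by simp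
  qed
  ultimately have lim: "(\<lambda>n. edge_sum n {M n..<n} \<zeta> \<omega>) \<longlonglongrightarrow> (LINT x|lborel. G x)"
    by (rule Lim_transform_eventually)
  \<comment> \<open>The exponential factors evaluated at \<open>x = R\<^sup>2\<close>. Taking them
    out leaves the integrand of \<open>edge_integral\<close>, and they are exactly the two
    phases.\<close>
  let ?D = "exp (cplx (R\<^sup>2 / gap) * ?s) * E"
  have G: "G x = (cplx (1 / R\<^sup>2) * ?D) *
      (indicator {1 - c..R\<^sup>2} x *\<^sub>R (cplx (R\<^sup>2 - x) * exp (cplx ((x - R\<^sup>2) / gap) * ?s)))" for x
  proof -
    have "cplx (x / gap) * ?s = cplx (R\<^sup>2 / gap) * ?s + cplx ((x - R\<^sup>2) / gap) * ?s"
      by (simp add: diff_divide_distrib algebra_simps)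
    then have e: "exp (cplx (x / gap) * ?s) = exp (cplx (R\<^sup>2 / gap) * ?s) * exp (cplx ((x - R\<^sup>2) / gap) * ?s)"
      by (simp only: exp_add)
    have "1 - x / R\<^sup>2 = (1 / R\<^sup>2) * (R\<^sup>2 - x)" using R2 by (simp add: field_simps)
    then have r: "cplx (1 - x / R\<^sup>2) = cplx (1 / R\<^sup>2) * cplx (R\<^sup>2 - x)"
      by (simp only: of_real_mult)
    show ?thesis unfolding G_def e r by (simp only: scaleR_conv_of_real mult_ac)
  qed
  have "(LINT x|lborel. G x) = (cplx (1 / R\<^sup>2) * ?D) * (gap\<^sup>2 *\<^sub>R ((1 - (?s + 1) * exp (- ?s)) / ?s\<^sup>2))"
  proof -
    have gd: "gap = R\<^sup>2 - (1 - c)" by (simp add: gap_def)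
    show ?thesis unfolding G integral_mult_right_zero edge_integral[OF s gap_pos gd] ..
  qed
  also have "?D = edge_phase \<zeta> * cnj (edge_phase \<omega>)"
  proof -
    have e: "cplx (R\<^sup>2 / gap) * ?s + cplx (- (R\<^sup>2 / gap) * (Re \<zeta> + Re \<omega>)) =
      \<i> * cplx (R\<^sup>2 * Im \<zeta> / gap) + \<i> * cplx (- (R\<^sup>2 * Im \<omega> / gap))"
      by (simp add: complex_eq_iff divide_inverse algebra_simps)
    show ?thesis
      unfolding E_def edge_phase_def cis_cnj unfolding cis_conv_exp exp_of_real[symmetric] exp_add[symmetric] e ..
  qed
  also have "cplx (1 / R\<^sup>2) * (edge_phase \<zeta> * cnj (edge_phase \<omega>)) * (gap\<^sup>2 *\<^sub>R ((1 - (?s + 1) * exp (- ?s)) / ?s\<^sup>2)) =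
    cplx (pi * gap\<^sup>2 / R\<^sup>2) * (edge_phase \<zeta> * cnj (edge_phase \<omega>) * edge_kernel \<zeta> \<omega>)"
    by (simp add: edge_kernel_def scaleR_conv_of_real add_ac)
  finally show ?thesis using lim by simp
qed

end

section \<open>From correlation functions to expected tuple sums; the limiting edge process\<close>

lemma PiM_restrict_measurable:
  fixes h :: "(nat \<Rightarrow> complex) \<Rightarrow> 'b::topological_space"
  assumes h: "h \<in> borel_measurable (lborels k)"
  shows "h \<in> borel_measurable (restricted_lborels k E)"
proof -
  have "(\<lambda>x i. x i) \<in> measurable (restricted_lborels k E) (lborels k)"
  proof (rule measurable_PiM_single')
    fix i assume "i \<in> {..<k}"
    then have "(\<lambda>x. x i) \<in> measurable (restricted_lborels k E) (restrict_space lborel E)"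
      by (rule measurable_component_singleton)
    moreover have "(\<lambda>z. z) \<in> measurable (restrict_space lborel E) (lborel :: complex measure)"
      by (intro measurable_restrict_space1 measurable_ident_sets refl)
    ultimately show "(\<lambda>x. x i) \<in> measurable (restricted_lborels k E) (lborel :: complex measure)"
      by (rule measurable_compose)
  qed (auto simp: space_PiM)
  from measurable_compose[OF this h] show ?thesis by simp
qed

lemma nn_integral_PiM_restrict:
  fixes h :: "(nat \<Rightarrow> complex) \<Rightarrow> ennreal"
  assumes E: "E \<in> sets borel" and h: "h \<in> borel_measurable (restricted_lborels k E)"
  shows "(\<integral>\<^sup>+x. h x \<partial>restricted_lborels k E) =
    (\<integral>\<^sup>+x. h x * indicator (tuples k E) x \<partial>lborels k)"
proof -
  let ?L = "lborels k" and ?R = "restricted_lborels k E"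
  let ?S = "restrict_space ?L (tuples k E)"
  have EL: "E \<in> sets lborel" using E by simp
  have PE: "(tuples k E) \<in> sets ?L" using EL by (intro sets_PiM_I_finite) auto
  then have PE': "(tuples k E) \<inter> space ?L \<in> sets ?L" by auto
  interpret R: product_sigma_finite "\<lambda>_::nat. restrict_space lborel E"
    by (intro product_sigma_finite.intro sigma_finite_measure_restrict_space EL) (rule sigma_finite_lborel)
  have id: "(\<lambda>x i. x i) \<in> measurable ?S ?R"
  proof (rule measurable_PiM_single')
    fix i assume i: "i \<in> {..<k}"
    show "(\<lambda>x. x i) \<in> measurable ?S (restrict_space lborel E)"
    proof (rule measurable_restrict_space2)
      show "(\<lambda>x. x i) \<in> space ?S \<rightarrow> E" using i by (auto simp: space_restrict_space)
      show "(\<lambda>x. x i) \<in> measurable ?S lborel"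
        using i by (intro measurable_restrict_space1 measurable_component_singleton)
    qed
  qed (auto simp: space_restrict_space PiE_def)
  have "distr ?S ?R (\<lambda>x. x) = ?R"
  proof (rule R.PiM_eqI)
    fix A :: "nat \<Rightarrow> complex set" assume A: "\<And>i. i \<in> {..<k} \<Longrightarrow> A i \<in> sets (restrict_space lborel E)"
    have A': "A i \<subseteq> E \<and> A i \<in> sets lborel" if "i \<in> {..<k}" for i
      using A[OF that] EL by (subst (asm) sets_restrict_space_iff) auto
    have AP: "(tuples k E) \<inter> (tuples k UNIV) \<inter> Pi\<^sub>E {..<k} A = Pi\<^sub>E {..<k} A" using A' by (auto simp: PiE_iff)
    have "emeasure (distr ?S ?R (\<lambda>x. x)) (Pi\<^sub>E {..<k} A) = emeasure ?S ((\<lambda>x. x) -` Pi\<^sub>E {..<k} A \<inter> space ?S)"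
      using id A by (intro emeasure_distr sets_PiM_I_finite) auto
    also have "(\<lambda>x. x) -` Pi\<^sub>E {..<k} A \<inter> space ?S = Pi\<^sub>E {..<k} A"
      using AP by (auto simp: space_restrict_space space_PiM)
    also have "emeasure ?S (Pi\<^sub>E {..<k} A) = emeasure ?L (Pi\<^sub>E {..<k} A)"
      using A' PE' by (intro emeasure_restrict_space PiE_mono) auto
    also have "\<dots> = (\<Prod>i<k. emeasure lborel (A i))" using A' by (intro lborel_product.emeasure_PiM) auto
    also have "\<dots> = (\<Prod>i<k. emeasure (restrict_space lborel E) (A i))"
      using A' EL by (intro prod.cong refl emeasure_restrict_space[symmetric]) auto
    finally show "emeasure (distr ?S ?R (\<lambda>x. x)) (Pi\<^sub>E {..<k} A) = (\<Prod>i<k. emeasure (restrict_space lborel E) (A i))" .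
  qed auto
  then have "(\<integral>\<^sup>+x. h x \<partial>?R) = (\<integral>\<^sup>+x. h x \<partial>distr ?S ?R (\<lambda>x. x))" by simp
  also have "\<dots> = (\<integral>\<^sup>+x. h x \<partial>?S)" using id h by (subst nn_integral_distr) auto
  also have "\<dots> = (\<integral>\<^sup>+x. h x * indicator (tuples k E) x \<partial>?L)" by (rule nn_integral_restrict_space[OF PE'])
  finally show ?thesis .
qed

text \<open>Correlation functions are characterised by integrals in \<open>ennreal\<close>,
  expectations by Bochner integrals. For a nonnegative integrand with finite integral the two agree;
  the Lipschitz property supplies measurability of the tuple sum.\<close>

lemma nonneg_tuple_expectation:
  fixes g r :: "(nat \<Rightarrow> complex) \<Rightarrow> real"
  assumes pp: "point_process E P" and E: "E \<in> sets borel"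
    and corr: "correlation_function E P k \<rho>" and r: "\<And>x. x \<in> tuples k E \<Longrightarrow> \<rho> x = r x"
    and g: "\<And>x. g x \<ge> 0" and lip: "lipschitz_tuples k (\<lambda>x. cplx (g x))"
    and Q: "compact Q" "Q \<subseteq> E" and supp: "\<And>x i. x \<in> tuples k UNIV \<Longrightarrow> g x \<noteq> 0 \<Longrightarrow> i < k \<Longrightarrow> x i \<in> Q"
    and int: "integrable (lborels k) (\<lambda>x. g x * r x)"
  shows "has_bochner_integral P (\<lambda>X. \<Sum>x\<in>inj_tuples k (X \<inter> Q). g x) (LINT x|lborels k. g x * r x)"
proof -
  have sP: "space P = configurations E" "sets P = sets (config_space E)"
    using pp by (auto simp: point_process_def)
  have fin: "finite (X \<inter> Q)" if "X \<in> configurations E" for X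
    using that Q by (rule finite_configuration_Int)
  have csupp: "x i \<in> Q" if "x \<in> tuples k UNIV" "cplx (g x) \<noteq> 0" "i < k" for x i
    using supp[of x i] that by simp
  have "(\<lambda>X. \<Sum>\<^sub>\<infinity>x\<in>distinct_tuples k X. cplx (g x)) \<in> borel_measurable (config_space E)"
    by (rule tuple_sum_measurable[OF lip Q]) (rule csupp)
  from measurable_compose[OF this borel_measurable_Re]
  have "(\<lambda>X. Re (\<Sum>\<^sub>\<infinity>x\<in>distinct_tuples k X. cplx (g x))) \<in> borel_measurable (config_space E)" .
  then have "(\<lambda>X. Re (\<Sum>\<^sub>\<infinity>x\<in>distinct_tuples k X. cplx (g x))) \<in> borel_measurable P"
    by (simp only: measurable_cong_sets[OF sP(2) refl])
  moreover have "Re (\<Sum>\<^sub>\<infinity>x\<in>distinct_tuples k X. cplx (g x)) = (\<Sum>x\<in>inj_tuples k (X \<inter> Q). g x)" if "X \<in> space P" for X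
    using fin that by (subst tuple_sum_eq_finite[where K=Q]) (auto simp: sP intro: csupp)
  ultimately have m: "(\<lambda>X. \<Sum>x\<in>inj_tuples k (X \<inter> Q). g x) \<in> borel_measurable P"
    by (rule iffD1[OF measurable_cong, rotated])
  have gm: "g \<in> borel_measurable (lborels k)"
    using measurable_compose[OF lipschitz_tuples_measurable[OF lip] borel_measurable_Re] by simp
  have gm': "(\<lambda>x. ennreal (g x)) \<in> borel_measurable (restricted_lborels k E)"
    using PiM_restrict_measurable[OF gm] by measurable
  have \<rho>m: "\<rho> \<in> borel_measurable (restricted_lborels k E)"
    and \<rho>0: "\<And>x. x \<in> tuples k E \<Longrightarrow> 0 \<le> \<rho> x"
    and eq: "\<And>f :: (nat \<Rightarrow> complex) \<Rightarrow> ennreal. f \<in> borel_measurable (restricted_lborels k E) \<Longrightarrow>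
        (\<integral>\<^sup>+X. (\<integral>\<^sup>+x. f x \<partial>count_space (distinct_tuples k X)) \<partial>P) =
        (\<integral>\<^sup>+x. f x * ennreal (\<rho> x) \<partial>restricted_lborels k E)"
    using corr unfolding correlation_function_def by auto
  have zero: "g x * r x \<ge> 0 \<and> ennreal (g x) * ennreal (\<rho> x) * indicator (tuples k E) x = ennreal (g x * r x)"
    if x: "x \<in> tuples k UNIV" for x
  proof (cases "x \<in> tuples k E")
    case True
    then show ?thesis using r[OF True] \<rho>0[OF True] g[of x] by (simp add: ennreal_mult)
  next
    case False
    then obtain i where "i < k" "x i \<notin> E" using x by (auto simp: PiE_iff)
    then have "g x = 0" using supp[OF x] Q(2) by blast
    then show ?thesis by simp
  qed
  have "(\<integral>\<^sup>+X. ennreal (\<Sum>x\<in>inj_tuples k (X \<inter> Q). g x) \<partial>P) =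
    (\<integral>\<^sup>+X. (\<integral>\<^sup>+x. ennreal (g x) \<partial>count_space (distinct_tuples k X)) \<partial>P)"
  proof (rule nn_integral_cong)
    fix X assume X: "X \<in> space P"
    have "(\<integral>\<^sup>+x. ennreal (g x) \<partial>count_space (distinct_tuples k X)) = (\<Sum>x\<in>inj_tuples k (X \<inter> Q). ennreal (g x))"
    proof (rule nn_integral_count_space')
      show "finite (inj_tuples k (X \<inter> Q))" using fin X by (intro finite_inj_tuples) (simp add: sP)
      show "inj_tuples k (X \<inter> Q) \<subseteq> distinct_tuples k X"
        by (auto simp: distinct_tuples_eq inj_tuples_def PiE_iff)
      fix x assume x: "x \<in> distinct_tuples k X" "x \<notin> inj_tuples k (X \<inter> Q)"
      then have xU: "x \<in> tuples k UNIV" by (auto simp: distinct_tuples_def PiE_iff)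
      have "g x = 0"
      proof (rule ccontr)
        assume "g x \<noteq> 0"
        then have "x i \<in> Q" if "i < k" for i using supp[OF xU] that by blast
        then show False using x by (auto simp: distinct_tuples_def inj_tuples_def PiE_iff)
      qed
      then show "ennreal (g x) = 0" by simp
    qed
    then show "ennreal (\<Sum>x\<in>inj_tuples k (X \<inter> Q). g x) = (\<integral>\<^sup>+x. ennreal (g x) \<partial>count_space (distinct_tuples k X))"
      using g by (simp add: sum_ennreal)
  qed
  also have "\<dots> = (\<integral>\<^sup>+x. ennreal (g x) * ennreal (\<rho> x) \<partial>restricted_lborels k E)"
    by (rule eq[OF gm'])
  also have "\<dots> = (\<integral>\<^sup>+x. ennreal (g x) * ennreal (\<rho> x) * indicator (tuples k E) x \<partial>lborels k)"
    by (intro nn_integral_PiM_restrict E borel_measurable_times_ennreal gm' measurable_compose[OF \<rho>m measurable_ennreal])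
  also have "\<dots> = (\<integral>\<^sup>+x. ennreal (g x * r x) \<partial>lborels k)"
    using zero by (intro nn_integral_cong) (simp add: space_PiM)
  also have "\<dots> = ennreal (LINT x|lborels k. g x * r x)"
    using zero by (intro nn_integral_eq_integral int AE_I2) (simp add: space_PiM)
  finally have nn: "(\<integral>\<^sup>+X. ennreal (\<Sum>x\<in>inj_tuples k (X \<inter> Q). g x) \<partial>P) = ennreal (LINT x|lborels k. g x * r x)" .
  show ?thesis
  proof (rule has_bochner_integral_nn_integral[OF m _ _ nn])
    show "0 \<le> (LINT x|lborels k. g x * r x)"
      using zero by (intro Bochner_Integration.integral_nonneg_AE AE_I2) (simp add: space_PiM)
  qed (use g in \<open>auto intro!: sum_nonneg\<close>)
qed

text \<open>The test function is split into the positive and negative parts of its real and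
  imaginary parts, which are again Lipschitz and vanish wherever it does. On tuples in
  \<open>E\<close> the determinant equals \<rho> and is real; elsewhere \<open>f\<close> vanishes,
  so working with \<open>Re (D y)\<close> loses nothing.\<close>

lemma determinantal_expectation:
  assumes dp: "determinantal_process E K P" and E: "E \<in> sets borel" and k: "k \<ge> 1" and f: "test_function k E f"
    and Km: "\<And>i j. i < k \<Longrightarrow> j < k \<Longrightarrow> (\<lambda>y. K (y i) (y j)) \<in> borel_measurable (lborels k)"
    and Kb: "\<And>Q. compact Q \<Longrightarrow> Q \<subseteq> E \<Longrightarrow> \<exists>C. \<forall>x\<in>Q. \<forall>y\<in>Q. cmod (K x y) \<le> C"
  shows "expected_tuple_sum P k f = (kernel_integral k f K)"
proof -
  have pp: "point_process E P" using dp by (simp add: determinantal_process_def)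
  obtain \<rho> where \<rho>: "correlation_function E P k \<rho>"
    "\<And>x. x \<in> tuples k E \<Longrightarrow> cplx (\<rho> x) = leibniz_det k (\<lambda>i j. K (x i) (x j))"
    using dp k unfolding determinantal_process_def det_eq_leibniz_det by blast
  obtain Q where Q: "compact Q" "Q \<subseteq> E"
    and supp: "\<And>x i. x \<in> tuples k UNIV \<Longrightarrow> f x \<noteq> 0 \<Longrightarrow> i < k \<Longrightarrow> x i \<in> Q"
    by (rule test_function_support[OF f]) blast
  obtain C0 where C0: "\<And>x. x \<in> tuples k UNIV \<Longrightarrow> cmod (f x) \<le> C0" by (rule test_function_bounded[OF f]) blast
  obtain C where C: "\<And>x y. x \<in> Q \<Longrightarrow> y \<in> Q \<Longrightarrow> cmod (K x y) \<le> C" using Kb[OF Q] by blast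
  have lip: "lipschitz_tuples k f" using f by (simp add: test_function_def)
  have fm: "f \<in> borel_measurable (lborels k)" by (rule lipschitz_tuples_measurable[OF lip])
  define D where "D y = kernel_det k K y" for y
  \<comment> \<open>For \<open>u = 1\<close>, \<open>-1\<close>, \<open>- \<i>\<close> and
    \<open>\<i>\<close> these are the positive and negative parts of \<open>Re (f x)\<close> and of
    \<open>Im (f x)\<close>, in this order.\<close>
  define p where "p u x = max 0 (Re (u * f x))" for u x
  have Dm: "D \<in> borel_measurable (lborels k)"
    unfolding D_def by (intro leibniz_det_measurable Km)
  have plip: "lipschitz_tuples k (\<lambda>x. cplx (p u x))" if u: "cmod u = 1" for u
  proof -
    have "cmod (cplx (p u x) - cplx (p u y)) \<le> cmod (f x - f y)" for x y
    proof -
      have "cmod (cplx (p u x) - cplx (p u y)) = \<bar>p u x - p u y\<bar>"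
        by (simp flip: of_real_diff)
      also have "\<dots> \<le> \<bar>Re (u * f x) - Re (u * f y)\<bar>" unfolding p_def by linarith
      also have "Re (u * f x) - Re (u * f y) = Re (u * (f x - f y))" by (simp only: right_diff_distrib minus_complex.sel)
      also have "\<bar>Re (u * (f x - f y))\<bar> \<le> cmod (u * (f x - f y))" by (rule abs_Re_le_cmod)
      finally show ?thesis using u by (simp add: norm_mult)
    qed
    then show ?thesis using lip unfolding lipschitz_tuples_def by (meson order.trans)
  qed
  have psupp: "x i \<in> Q" if "x \<in> tuples k UNIV" "p u x \<noteq> 0" "i < k" for x i u
  proof -
    have "f x \<noteq> 0" by (rule notI) (use that(2) in \<open>simp add: p_def\<close>)
    then show ?thesis using supp that by blast
  qed
  have pb: "p u x \<le> C0" if "cmod u = 1" "x \<in> tuples k UNIV" for u x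
  proof -
    have "Re (u * f x) \<le> cmod (u * f x)" by (rule complex_Re_le_cmod)
    also have "\<dots> \<le> C0" using that C0 by (simp add: norm_mult)
    finally show ?thesis using C0[OF that(2)] norm_ge_zero[of "f x"] unfolding p_def by linarith
  qed
  have int: "integrable (lborels k) (\<lambda>y. p u y * Re (D y))" if u: "cmod u = 1" for u
  proof -
    have "integrable (lborels k) (\<lambda>y. cplx (p u y) * D y)"
    proof (rule integrable_bounded_support(1)[where Q=Q and C="C0 * (fact k * C ^ k)"])
      show "(\<lambda>y. cplx (p u y) * D y) \<in> borel_measurable (lborels k)"
        using fm Dm unfolding p_def by measurable
      fix y assume y: "y \<in> tuples k Q"
      then have yU: "y \<in> tuples k UNIV" by (auto simp: PiE_iff)
      have "cmod (D y) \<le> fact k * C ^ k"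
        unfolding D_def using y by (intro leibniz_det_bound C) (auto simp: PiE_iff)
      moreover have "\<bar>p u y\<bar> \<le> C0" using pb[OF u yU] by (simp add: p_def)
      ultimately show "cmod (cplx (p u y) * D y) \<le> C0 * (fact k * C ^ k)"
        unfolding norm_mult norm_of_real by (intro mult_mono) auto
    qed (use compact_borel_finite[OF Q(1)] psupp in auto)
    then have "integrable (lborels k) (\<lambda>y. Re (cplx (p u y) * D y))" by (rule integrable_Re)
    then show ?thesis by simp
  qed
  define J where "J u = (LINT y|lborels k. p u y * Re (D y))" for u
  have \<rho>r: "\<rho> x = Re (D x)" if "x \<in> tuples k E" for x
    using \<rho>(2)[OF that] unfolding D_def by (metis Re_complex_of_real)
  have A: "has_bochner_integral P (\<lambda>X. cplx (\<Sum>x\<in>inj_tuples k (X \<inter> Q). p u x)) (cplx (J u))" if "cmod u = 1" for u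
    unfolding J_def
  proof (rule has_bochner_integral_of_real, rule nonneg_tuple_expectation[OF pp E \<rho>(1), where g="p u" and r="\<lambda>y. Re (D y)" and Q=Q])
    show "\<rho> x = Re (D x)" if "x \<in> tuples k E" for x by (rule \<rho>r[OF that])
    show "x i \<in> Q" if "x \<in> tuples k UNIV" "p u x \<noteq> 0" "i < k" for x i by (rule psupp[OF that])
    show "0 \<le> p u x" for x by (simp add: p_def)
  qed (use plip[OF that] Q int[OF that] in simp_all)
  have B: "has_bochner_integral (lborels k) (\<lambda>y. cplx (p u y * Re (D y))) (cplx (J u))" if "cmod u = 1" for u
    unfolding J_def by (intro has_bochner_integral_of_real has_bochner_integral_integrable int that)
  have split: "f x = (cplx (p 1 x) - cplx (p (-1) x)) + \<i> * (cplx (p (- \<i>) x) - cplx (p \<i> x))" for x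
    by (simp add: p_def complex_eq_iff max_def)
  let ?J = "(cplx (J 1) - cplx (J (-1))) + \<i> * (cplx (J (- \<i>)) - cplx (J \<i>))"
  have "has_bochner_integral P (\<lambda>X. (cplx (\<Sum>x\<in>inj_tuples k (X \<inter> Q). p 1 x) - cplx (\<Sum>x\<in>inj_tuples k (X \<inter> Q). p (-1) x))
      + \<i> * (cplx (\<Sum>x\<in>inj_tuples k (X \<inter> Q). p (- \<i>) x) - cplx (\<Sum>x\<in>inj_tuples k (X \<inter> Q). p \<i> x))) ?J"
    by (intro has_bochner_integral_add has_bochner_integral_diff has_bochner_integral_mult_right A) simp_all
  also have "(\<lambda>X. (cplx (\<Sum>x\<in>inj_tuples k (X \<inter> Q). p 1 x) - cplx (\<Sum>x\<in>inj_tuples k (X \<inter> Q). p (-1) x))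
      + \<i> * (cplx (\<Sum>x\<in>inj_tuples k (X \<inter> Q). p (- \<i>) x) - cplx (\<Sum>x\<in>inj_tuples k (X \<inter> Q). p \<i> x)))
      = (\<lambda>X. \<Sum>x\<in>inj_tuples k (X \<inter> Q). f x)"
    unfolding split[abs_def] by (simp only: of_real_sum sum_subtractf sum_distrib_left[symmetric] sum.distrib)
  finally have 1: "(LINT X|P. (\<Sum>x\<in>inj_tuples k (X \<inter> Q). f x)) = ?J" by (rule has_bochner_integral_integral_eq)
  have "has_bochner_integral (lborels k) (\<lambda>y. (cplx (p 1 y * Re (D y)) - cplx (p (-1) y * Re (D y)))
      + \<i> * (cplx (p (- \<i>) y * Re (D y)) - cplx (p \<i> y * Re (D y)))) ?J"
    by (intro has_bochner_integral_add has_bochner_integral_diff has_bochner_integral_mult_right B) simp_all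
  also have "(\<lambda>y. (cplx (p 1 y * Re (D y)) - cplx (p (-1) y * Re (D y)))
      + \<i> * (cplx (p (- \<i>) y * Re (D y)) - cplx (p \<i> y * Re (D y)))) = (\<lambda>y. f y * cplx (Re (D y)))"
    unfolding split[abs_def] by (simp add: algebra_simps)
  finally have 2: "(LINT y|lborels k. f y * cplx (Re (D y))) = ?J" by (rule has_bochner_integral_integral_eq)
  have "expected_tuple_sum P k f = (LINT X|P. (\<Sum>x\<in>inj_tuples k (X \<inter> Q). f x))"
    unfolding expected_tuple_sum_def
  proof (intro Bochner_Integration.integral_cong refl)
    fix X assume "X \<in> space P"
    then have "finite (X \<inter> Q)" using pp Q by (intro finite_configuration_Int) (auto simp: point_process_def)
    then show "(\<Sum>\<^sub>\<infinity>x\<in>distinct_tuples k X. f x) = (\<Sum>x\<in>inj_tuples k (X \<inter> Q). f x)"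
      by (rule tuple_sum_eq_finite) (rule supp)
  qed
  also have "\<dots> = (LINT y|lborels k. f y * D y)"
    unfolding 1 2[symmetric]
  proof (intro Bochner_Integration.integral_cong refl)
    fix y :: "nat \<Rightarrow> complex" assume "y \<in> space (lborels k)"
    then have y: "y \<in> tuples k UNIV" by (simp add: space_PiM)
    show "f y * cplx (Re (D y)) = f y * D y"
    proof (cases "f y = 0")
      case False
      then have "y \<in> tuples k E" using supp[OF y] Q(2) y by (auto simp: PiE_iff)
      then show ?thesis using \<rho>r \<rho>(2) unfolding D_def by simp
    qed simp
  qed
  finally show ?thesis unfolding D_def .
qed

text \<open>With \<open>s = 2 * Re z\<close>, positivity is the strict inequality
  \<open>1 + s < exp s\<close>, and the upper bound is \<open>exp (- s) \<ge> 1 - s\<close>. They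
  make the mean number of edge points in the unit disc positive and finite.\<close>

lemma edge_kernel_diag:
  assumes z: "Re z > 0"
  shows "0 < Re (edge_kernel z z)" "Re (edge_kernel z z) \<le> 1 / pi"
proof -
  define s where "s = 2 * Re z"
  have s: "s > 0" using z by (simp add: s_def)
  have zz: "z + cnj z = cplx s" by (simp add: s_def complex_add_cnj)
  have "- z - cnj z = cplx (- s)" using zz by (simp add: algebra_simps)
  then have ex: "exp (- z - cnj z) = cplx (exp (- s))" by (simp only: exp_of_real)
  have "edge_kernel z z = cplx ((1 - (s + 1) * exp (- s)) / (pi * s\<^sup>2))"
    unfolding edge_kernel_def zz ex by simp
  then have e: "Re (edge_kernel z z) = (1 - (s + 1) * exp (- s)) / (pi * s\<^sup>2)" by (simp only: Re_complex_of_real)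
  have "exp (ln (1 + s)) < exp s" using ln_add_one_self_less_self[OF s] by (rule exp_less_mono)
  then have "s + 1 < exp s" using s by simp
  then have "(s + 1) * exp (- s) < exp s * exp (- s)" by (intro mult_strict_right_mono) auto
  then have "(s + 1) * exp (- s) < 1" by (simp flip: exp_add)
  then show "0 < Re (edge_kernel z z)" unfolding e using s by simp
  have "(s + 1) * (1 - s) \<le> (s + 1) * exp (- s)" using s exp_ge_add_one_self[of "- s"] by (intro mult_left_mono) auto
  then have "1 - (s + 1) * exp (- s) \<le> s\<^sup>2" by (simp add: algebra_simps power2_eq_square)
  then have "(1 - (s + 1) * exp (- s)) / (pi * s\<^sup>2) \<le> s\<^sup>2 / (pi * s\<^sup>2)" by (intro divide_right_mono) auto
  then show "Re (edge_kernel z z) \<le> 1 / pi" unfolding e using s by simp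
qed

lemma edge_kernel_measurable:
  fixes i j k :: nat
  assumes "i < k" "j < k"
  shows "(\<lambda>y. edge_kernel (y i) (y j)) \<in> borel_measurable (lborels k)"
proof -
  note [measurable] = component_measurable[OF assms(1)] component_measurable[OF assms(2)]
  show ?thesis unfolding edge_kernel_def by measurable
qed

lemma bij_betw_singleton_tuples: "bij_betw (\<lambda>z. \<lambda>i\<in>{..<1}. z) X (distinct_tuples 1 X)"
proof (rule bij_betwI[of _ _ _ "\<lambda>x. x 0"])
  fix x assume "x \<in> distinct_tuples 1 X"
  then show "(\<lambda>i\<in>{..<1}. x 0) = x" by (intro ext) (auto simp: distinct_tuples_def PiE_iff extensional_def)
qed (auto simp: distinct_tuples_def PiE_iff inj_on_def)

text \<open>The little-o relation at the edge divides by this constant. The half disc reaches the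
  imaginary axis and is not relatively compact in the half plane, so a configuration could have
  infinitely many points there, in which case \<open>card\<close> would report 0. The first
  correlation function gives a finite mean, which makes the count almost surely finite; then
  \<open>card\<close> agrees with the counting measure.\<close>

lemma edge_process_count_pos:
  assumes dp: "determinantal_process {z. Re z > 0} edge_kernel P"
  shows "expected_count P (ball 0 1) > 0"
proof -
  let ?E = "{z::complex. Re z > 0}" and ?S = "ball (0::complex) 1"
  have oE: "open ?E" by (intro open_Collect_less continuous_intros)
  then have E: "?E \<in> sets borel" by simp
  have pp: "point_process ?E P" using dp by (simp add: determinantal_process_def)
  then have sP: "space P = configurations ?E" "sets P = sets (config_space ?E)" by (auto simp: point_process_def)
  obtain \<rho> where \<rho>: "correlation_function ?E P 1 \<rho>"
    "\<And>x. x \<in> {..<1} \<rightarrow>\<^sub>E ?E \<Longrightarrow> cplx (\<rho> x) = leibniz_det 1 (\<lambda>i j. edge_kernel (x i) (x j))"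
    using dp unfolding determinantal_process_def det_eq_leibniz_det by blast
  have \<rho>m: "\<rho> \<in> borel_measurable (Pi\<^sub>M {..<1} (\<lambda>_. restrict_space lborel ?E))"
    and eq: "\<And>f :: (nat \<Rightarrow> complex) \<Rightarrow> ennreal. f \<in> borel_measurable (Pi\<^sub>M {..<1} (\<lambda>_. restrict_space lborel ?E)) \<Longrightarrow>
        (\<integral>\<^sup>+X. (\<integral>\<^sup>+x. f x \<partial>count_space (distinct_tuples 1 X)) \<partial>P) =
        (\<integral>\<^sup>+x. f x * ennreal (\<rho> x) \<partial>Pi\<^sub>M {..<1} (\<lambda>_. restrict_space lborel ?E))"
    using \<rho>(1) unfolding correlation_function_def by auto
  have comp: "(\<lambda>y. y (0::nat)) \<in> borel_measurable (lborels 1)"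
    by (rule component_measurable) simp
  have im: "(\<lambda>x. indicator ?S (x 0) :: ennreal) \<in> borel_measurable (Pi\<^sub>M {..<1::nat} (\<lambda>_. restrict_space lborel ?E))"
  proof (intro PiM_restrict_measurable measurable_compose[OF comp])
    show "(indicator ?S :: complex \<Rightarrow> ennreal) \<in> borel_measurable borel" by (intro borel_measurable_indicator) simp
  qed
  define v where "v = (\<integral>\<^sup>+z. indicator (?S \<inter> ?E) z * ennreal (Re (edge_kernel z z)) \<partial>lborel)"
  have "(\<lambda>z. edge_kernel z z) \<in> borel_measurable lborel" unfolding edge_kernel_def by measurable
  from measurable_compose[OF measurable_compose[OF this borel_measurable_Re] measurable_ennreal]
  have km: "(\<lambda>z. indicator (?S \<inter> ?E) z * ennreal (Re (edge_kernel z z))) \<in> borel_measurable lborel"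
    using E by (intro borel_measurable_times_ennreal borel_measurable_indicator) auto
  have e1: "{..<1::nat} = {0}" by auto
  have "(\<integral>\<^sup>+X. (\<integral>\<^sup>+x. indicator ?S (x 0) \<partial>count_space (distinct_tuples 1 X)) \<partial>P) =
      (\<integral>\<^sup>+x. indicator ?S (x 0) * ennreal (\<rho> x) * indicator ({..<1} \<rightarrow>\<^sub>E ?E) x \<partial>lborels 1)"
    unfolding eq[OF im]
    by (intro nn_integral_PiM_restrict E borel_measurable_times_ennreal im measurable_compose[OF \<rho>m measurable_ennreal])
  also have "\<dots> = (\<integral>\<^sup>+x. (\<lambda>z. indicator (?S \<inter> ?E) z * ennreal (Re (edge_kernel z z))) (x 0) \<partial>lborels 1)"
  proof (rule nn_integral_cong)
    fix x :: "nat \<Rightarrow> complex" assume "x \<in> space (lborels 1)"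
    then have x: "x \<in> {..<1} \<rightarrow>\<^sub>E UNIV" by (simp add: space_PiM)
    have iff: "x \<in> {..<1} \<rightarrow>\<^sub>E ?E \<longleftrightarrow> x 0 \<in> ?E" using x by (auto simp: PiE_iff)
    have \<rho>x: "\<rho> x = Re (edge_kernel (x 0) (x 0))" if "x 0 \<in> ?E"
      using \<rho>(2)[of x] iff that unfolding leibniz_det_1 by (metis Re_complex_of_real)
    have 1: "indicator ({..<1} \<rightarrow>\<^sub>E ?E) x = (indicator ?E (x 0) :: ennreal)" by (simp only: indicator_def iff)
    have 2: "ennreal (\<rho> x) * indicator ?E (x 0) = ennreal (Re (edge_kernel (x 0) (x 0))) * indicator ?E (x 0)"
      using \<rho>x by (cases "x 0 \<in> ?E") (simp_all only: indicator_simps mult_zero_right not_False_eq_True)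
    show "indicator ?S (x 0) * ennreal (\<rho> x) * indicator ({..<1} \<rightarrow>\<^sub>E ?E) x =
        indicator (?S \<inter> ?E) (x 0) * ennreal (Re (edge_kernel (x 0) (x 0)))"
      unfolding 1 mult.assoc 2 by (simp only: indicator_inter_arith mult_ac)
  qed
  also have "\<dots> = v"
    unfolding e1 v_def using km by (rule lborel_product.product_nn_integral_singleton)
  finally have total: "(\<integral>\<^sup>+X. (\<integral>\<^sup>+x. indicator ?S (x 0) \<partial>count_space (distinct_tuples 1 X)) \<partial>P) = v" .
  have inner: "(\<integral>\<^sup>+x. indicator ?S (x 0) \<partial>count_space (distinct_tuples 1 X)) = emeasure (count_space X) (?S \<inter> X)" for X :: "complex set"
  proof -
    have "(\<integral>\<^sup>+x. indicator ?S (x 0) \<partial>count_space (distinct_tuples 1 X)) = (\<integral>\<^sup>+z. indicator ?S ((\<lambda>i\<in>{..<1::nat}. z) 0) \<partial>count_space X)"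
      by (rule nn_integral_bij_count_space[OF bij_betw_singleton_tuples, symmetric])
    also have "\<dots> = (\<integral>\<^sup>+z. indicator ?S z \<partial>count_space X)" by simp
    also have "\<dots> = emeasure (count_space X) (?S \<inter> X)" by (subst nn_integral_indicator') auto
    finally show ?thesis .
  qed
  have v_fin: "v < \<infinity>"
  proof -
    have "v \<le> (\<integral>\<^sup>+z. ennreal (1 / pi) * indicator ?S z \<partial>lborel)"
      unfolding v_def using edge_kernel_diag(2)
      by (intro nn_integral_mono) (auto simp: indicator_def intro!: ennreal_leI)
    also have "\<dots> = ennreal (1 / pi) * emeasure lborel ?S" by (rule nn_integral_cmult_indicator) simp
    also have "\<dots> < \<infinity>" by (simp add: emeasure_ball unit_ball_vol_2 ennreal_mult_less_top)
    finally show ?thesis .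
  qed
  have v_pos: "v > 0"
  proof (rule ccontr)
    assume "\<not> v > 0"
    then have "v = 0" by simp
    then have "AE z in lborel. indicator (?S \<inter> ?E) z * ennreal (Re (edge_kernel z z)) = 0"
      unfolding v_def by (simp only: nn_integral_0_iff_AE[OF km])
    \<comment> \<open>This small disc lies in both the unit disc and the half plane, where the
      intensity is positive.\<close>
    then have "AE z in lborel. z \<notin> ball (1 / 2 :: complex) (1 / 4)"
    proof eventually_elim
      case (elim z)
      show ?case
      proof
        assume z: "z \<in> ball (1 / 2) (1 / 4)"
        then have d: "cmod (z - 1 / 2) < 1 / 4" by (simp add: dist_norm norm_minus_commute)
        have "\<bar>Re (z - 1 / 2)\<bar> < 1 / 4" using d abs_Re_le_cmod[of "z - 1 / 2"] by linarith
        moreover have "Re (z - 1 / 2) = Re z - 1 / 2" by simp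
        ultimately have "Re z > 0" by linarith
        moreover have "cmod z < 1" using norm_triangle_ineq[of "z - 1 / 2" "1 / 2"] d by simp
        ultimately show False using elim edge_kernel_diag(1)[of z] by (simp add: indicator_def)
      qed
    qed
    then have "emeasure lborel (ball (1 / 2 :: complex) (1 / 4)) = 0"
      by (subst (asm) AE_iff_measurable[of "ball (1 / 2) (1 / 4)"]) auto
    then show False by (simp add: emeasure_ball unit_ball_vol_2)
  qed
  \<comment> \<open>An exhaustion of the half disc by pieces at distance at least
    \<open>1 / (n + 1)\<close> from the boundary, each inside a compact subset of the half
    plane.\<close>
  let ?B = "\<lambda>n::nat. ?S \<inter> {z. 1 / real (Suc n) \<le> Re z}" and ?K = "\<lambda>n::nat. cball (0::complex) 1 \<inter> {z. 1 / real (Suc n) \<le> Re z}"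
  have cl: "closed {z. 1 / real (Suc n) \<le> Re z}" for n by (intro closed_Collect_le continuous_intros)
  have B: "?B n \<in> sets borel" "compact (?K n)" "?K n \<subseteq> ?E" "?B n \<subseteq> ?K n" for n
  proof -
    show "?B n \<in> sets borel" using borel_closed[OF cl] by (intro sets.Int) auto
    show "compact (?K n)" by (intro compact_Int_closed compact_cball cl)
    have pos: "0 < 1 / real (Suc n)" by simp
    show "?K n \<subseteq> ?E"
    proof
      fix z assume "z \<in> ?K n"
      then have "1 / real (Suc n) \<le> Re z" by blast
      from order.strict_trans2[OF pos this] show "z \<in> ?E" by (rule CollectI)
    qed
  qed auto
  have inc: "incseq ?B"
  proof (intro incseq_SucI Int_mono order_refl Collect_mono impI)
    fix n and z :: complex assume "1 / real (Suc n) \<le> Re z"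
    moreover have "1 / real (Suc (Suc n)) \<le> 1 / real (Suc n)" by (intro divide_left_mono) auto
    ultimately show "1 / real (Suc (Suc n)) \<le> Re z" by linarith
  qed
  have un: "X \<inter> (\<Union>n. ?B n) = ?S \<inter> X" if "X \<in> configurations ?E" for X
  proof -
    have "X \<subseteq> ?E" using that by (simp add: configurations_def)
    moreover have "\<exists>n. 1 / real (Suc n) \<le> Re z" if "Re z > 0" for z
      using nat_approx_posE[OF that] by (metis less_imp_le)
    ultimately show ?thesis by blast
  qed
  have cm: "(\<lambda>X. card (?S \<inter> X)) \<in> measurable P (count_space UNIV)"
  proof -
    have "(\<lambda>X. card (X \<inter> (\<Union>n. ?B n))) \<in> measurable (config_space ?E) (count_space UNIV)"
      by (rule config_exhaustion_card_measurable[OF B inc])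
    then have "(\<lambda>X. card (X \<inter> (\<Union>n. ?B n))) \<in> measurable P (count_space UNIV)"
      by (simp only: measurable_cong_sets[OF sP(2) refl])
    moreover have "card (X \<inter> (\<Union>n. ?B n)) = card (?S \<inter> X)" if "X \<in> space P" for X using un that by (simp only: sP)
    ultimately show ?thesis by (rule iffD1[OF measurable_cong, rotated])
  qed
  let ?I = "{X \<in> space P. infinite (?S \<inter> X)}"
  have Im: "?I \<in> sets P"
  proof -
    have "{X \<in> configurations ?E. finite (X \<inter> (\<Union>n. ?B n)) \<and> card (X \<inter> (\<Union>n. ?B n)) = m} \<in> sets P" for m
      unfolding sP(2) by (rule config_exhaustion_count[OF B inc])
    then have "space P - (\<Union>m. {X \<in> configurations ?E. finite (X \<inter> (\<Union>n. ?B n)) \<and> card (X \<inter> (\<Union>n. ?B n)) = m}) \<in> sets P" by blast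
    also have "space P - (\<Union>m. {X \<in> configurations ?E. finite (X \<inter> (\<Union>n. ?B n)) \<and> card (X \<inter> (\<Union>n. ?B n)) = m}) = ?I"
      using un unfolding sP(1) by auto
    finally show ?thesis .
  qed
  \<comment> \<open>Infinite counts with positive probability would make the mean \<open>v\<close>
    infinite.\<close>
  have "\<infinity> * emeasure P ?I = (\<integral>\<^sup>+X. \<infinity> * indicator ?I X \<partial>P)" by (rule nn_integral_cmult_indicator[OF Im, symmetric])
  also have "\<dots> \<le> v" unfolding total[symmetric] inner by (intro nn_integral_mono) (auto simp: indicator_def)
  finally have "emeasure P ?I = 0" using v_fin by (auto simp: ennreal_top_mult top_unique split: if_splits)
  then have "AE X in P. finite (?S \<inter> X)" using Im by (subst AE_iff_measurable[of ?I]) auto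
  then have "(\<integral>\<^sup>+X. ennreal (real (card (?S \<inter> X))) \<partial>P) = v"
    unfolding total[symmetric] inner
    by (intro nn_integral_cong_AE) (auto simp: ennreal_of_nat_eq_real_of_nat elim!: eventually_mono)
  moreover have "(LINT X|P. real (card (?S \<inter> X))) = enn2real (\<integral>\<^sup>+X. ennreal (real (card (?S \<inter> X))) \<partial>P)"
    using measurable_compose[OF cm, of real borel] by (intro integral_eq_nn_integral) auto
  ultimately have "expected_count P ?S = enn2real v" unfolding expected_count_def by (simp add: Int_commute)
  then show ?thesis using v_pos v_fin by (simp add: enn2real_positive_iff)
qed

section \<open>Convergence of the rescaled conditioned ensemble to the edge process\<close>

context conditioned_setting
begin

text \<open>The factor \<open>s\<^sup>2\<close> cancels the Jacobian of the rescaling in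
  \<open>expected_edge\<close>. The remaining constant balances \<open>n / pi\<close> from the
  kernel and the factor \<open>n\<close> hidden in the average \<open>edge_sum\<close>.\<close>

lemma mode_kernel_edge:
  assumes n: "n > 0" and s: "s = real n * gap / R"
  shows "mode_kernel n (\<alpha> n) T (cplx R + (1 / s) *\<^sub>R \<zeta>) (cplx R + (1 / s) *\<^sub>R \<omega>) =
    cplx (s\<^sup>2) * (cplx (R\<^sup>2 / (pi * gap\<^sup>2)) * edge_sum n T \<zeta> \<omega>)"
proof -
  have sh: "cplx R + (1 / s) *\<^sub>R \<xi> = cplx R * edge_shift n \<xi>" for \<xi>
    using n R(1) gap_pos by (simp add: s edge_shift_def scaleR_conv_of_real distrib_left)
  have "(\<Sum>l\<in>T. mode n l (cplx R * edge_shift n \<zeta>) (cplx R * edge_shift n \<omega>) / cplx (\<alpha> n l)) =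
    (\<Sum>l\<in>T. cplx (pois (real n * R\<^sup>2) l / \<alpha> n l) * edge_factor n l \<zeta> \<omega>)"
    by (intro sum.cong refl) (simp add: mode_edge)
  also have "\<dots> = of_nat n * edge_sum n T \<zeta> \<omega>" using n by (simp add: edge_sum_def)
  finally have "mode_kernel n (\<alpha> n) T (cplx R + (1 / s) *\<^sub>R \<zeta>) (cplx R + (1 / s) *\<^sub>R \<omega>) =
    cplx (real n / pi * real n) * edge_sum n T \<zeta> \<omega>"
    unfolding mode_kernel_def sh by simp
  also have "real n / pi * real n = s\<^sup>2 * (R\<^sup>2 / (pi * gap\<^sup>2))"
    using R(1) gap_pos by (simp add: s power2_eq_square)
  finally show ?thesis by (simp only: of_real_mult mult.assoc)
qed

lemma expected_edge:
  assumes n: "n > 0" and f: "test_function k {z. Re z > 0} f"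
  shows "expected_tuple_sum (map_process (\<lambda>z. cplx (real n * (R\<^sup>2 - 1 + c) / R) * (z - cplx R))
      (G n)) k f = (\<Sum>T\<in>TT n. cplx (prob n T) *
    (LINT y|lborels k. f y *
      leibniz_det k (\<lambda>i j. cplx (R\<^sup>2 / (pi * gap\<^sup>2)) * edge_sum n T (y i) (y j))))"
proof -
  define s where "s = real n * gap / R"
  have s: "s > 0" using n R(1) gap_pos by (simp add: s_def)
  have sc: "cplx s \<noteq> 0" using s by simp
  let ?g = "\<lambda>z. cplx s * (z - cplx R)" and ?h = "\<lambda>z. cplx R + z / cplx s"
  have cont: "continuous_on UNIV ?g" "continuous_on UNIV ?h"
    using sc by (intro continuous_intros; simp)+
  have inv: "?g (?h z) = z" "?h (?g z) = z" for z using sc by auto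
  interpret mapped_test_function ?g ?h k "{z. Re z > 0}" f
    by (intro mapped_test_function.intro cont inv f)
  have U: "R < cmod z" if "?g z \<in> {z. Re z > 0}" for z
  proof -
    have "0 < s * (Re z - R)" using that by simp
    then have "R < Re z" using s by (simp add: zero_less_mult_iff)
    then show ?thesis using complex_Re_le_cmod[of z] by linarith
  qed
  have "expected_tuple_sum (map_process ?g (G n)) k f = (\<Sum>T\<in>TT n. cplx (prob n T) *
      kernel_integral k F (mode_kernel n (\<alpha> n) T))"
    by (rule trans[OF expected_conditioned_outside[OF n R(1) Nc_le]]) (erule U, simp only: cond_avg_eq_prob prob_def \<alpha>_def)
  also have "\<dots> = (\<Sum>T\<in>TT n. cplx (prob n T) * (LINT y|lborels k. f y *
      leibniz_det k (\<lambda>i j. cplx (R\<^sup>2 / (pi * gap\<^sup>2)) * edge_sum n T (y i) (y j))))"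
  proof (intro sum.cong refl arg_cong2[where f="(*)"])
    fix T
    let ?K = "\<lambda>x y. cplx (R\<^sup>2 / (pi * gap\<^sup>2)) * edge_sum n T x y"
    have s1: "1 / s \<noteq> 0" using s by simp
    let ?a = "\<lambda>y. \<lambda>i\<in>{..<k}. cplx R + (1 / s) *\<^sub>R y i"
    have "kernel_integral k F (mode_kernel n (\<alpha> n) T) =
      ((1 / s)\<^sup>2) ^ card {..<k} *\<^sub>R (LINT y|lborels k. F (?a y) * leibniz_det k (\<lambda>i j. mode_kernel n (\<alpha> n) T (?a y i) (?a y j)))"
      using s1 by (intro PiM_lborel_integral_affine borel_measurable_times F_borel leibniz_det_measurable mode_kernel_measurable) auto
    also have "(LINT y|lborels k. F (?a y) * leibniz_det k (\<lambda>i j. mode_kernel n (\<alpha> n) T (?a y i) (?a y j))) =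
      (LINT y|lborels k. cplx (s\<^sup>2) ^ k * (f y * kernel_det k ?K y))"
    proof (intro Bochner_Integration.integral_cong refl)
      fix y :: "nat \<Rightarrow> complex" assume "y \<in> space (lborels k)"
      then have "y \<in> extensional {..<k}" by (simp add: space_PiM PiE_def)
      then have "(\<lambda>i\<in>{..<k}. ?g (?a y i)) = y"
        using sc by (intro ext) (auto simp: restrict_def extensional_def scaleR_conv_of_real)
      then have F: "F (?a y) = f y" by (simp only: F_def)
      have "leibniz_det k (\<lambda>i j. mode_kernel n (\<alpha> n) T (?a y i) (?a y j)) = leibniz_det k (\<lambda>i j. cplx (s\<^sup>2) * ?K (y i) (y j))"
        by (rule leibniz_det_cong) (simp add: mode_kernel_edge[OF n s_def] del: of_real_power of_real_divide of_real_mult)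
      then show "F (?a y) * leibniz_det k (\<lambda>i j. mode_kernel n (\<alpha> n) T (?a y i) (?a y j)) =
          cplx (s\<^sup>2) ^ k * (f y * kernel_det k ?K y)"
        unfolding F leibniz_det_scale by (simp only: mult_ac)
    qed
    also have "((1 / s)\<^sup>2) ^ card {..<k} *\<^sub>R (LINT y|lborels k. cplx (s\<^sup>2) ^ k * (f y * kernel_det k ?K y)) =
      (LINT y|lborels k. f y * kernel_det k ?K y)"
    proof -
      have "((1 / s)\<^sup>2) ^ k * (s\<^sup>2) ^ k = 1" using s by (simp add: power_divide)
      then have e: "cplx (((1 / s)\<^sup>2) ^ k) * cplx (s\<^sup>2) ^ k = 1"
        by (simp only: of_real_power[symmetric] of_real_mult[symmetric] of_real_1)
      show ?thesis
        unfolding integral_mult_right_zero scaleR_conv_of_real card_lessThan mult.assoc[symmetric, of "cplx (((1 / s)\<^sup>2) ^ k)"] e mult_1 ..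
    qed
    finally show "kernel_integral k F (mode_kernel n (\<alpha> n) T) =
      (LINT y|lborels k. f y * kernel_det k ?K y)" .
  qed
  finally show ?thesis unfolding s_def gap_def .
qed

lemma edge_sum_measurable:
  fixes i j k :: nat
  assumes "i < k" "j < k"
  shows "(\<lambda>y. edge_sum n T (y i) (y j)) \<in> borel_measurable (lborels k)"
proof -
  note [measurable] = component_measurable[OF assms(1)] component_measurable[OF assms(2)]
  show ?thesis unfolding edge_sum_def edge_factor_def edge_shift_def by measurable
qed

lemma cmod_edge_phase [simp]: "cmod (edge_phase \<zeta>) = 1"
  by (simp add: edge_phase_def)

text \<open>The uniform bound on the edge sums passes to the limit, so no separate estimate of the
  explicit kernel is made.\<close>

lemma edge_limit_bound:
  assumes z: "Re \<zeta> > 0" "cmod \<zeta> \<le> B" and w: "Re \<omega> > 0" "cmod \<omega> \<le> B"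
  shows "cmod (edge_kernel \<zeta> \<omega>) \<le> R\<^sup>2 / (pi * gap\<^sup>2) * exp (2 * B / gap)"
proof -
  let ?r = "R\<^sup>2 / (pi * gap\<^sup>2)"
  have r: "?r > 0" using R(1) gap_pos by simp
  have "(\<lambda>n. cmod (edge_sum n {M n..<n} \<zeta> \<omega>)) \<longlonglongrightarrow>
    cmod (cplx (pi * gap\<^sup>2 / R\<^sup>2) * (edge_phase \<zeta> * cnj (edge_phase \<omega>) * edge_kernel \<zeta> \<omega>))"
    by (intro tendsto_norm edge_sum_limit z w)
  then have "cmod (cplx (pi * gap\<^sup>2 / R\<^sup>2) * (edge_phase \<zeta> * cnj (edge_phase \<omega>) * edge_kernel \<zeta> \<omega>)) \<le> exp (2 * B / gap)"
  proof (rule tendsto_upperbound)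
    show "\<forall>\<^sub>F n in sequentially. cmod (edge_sum n {M n..<n} \<zeta> \<omega>) \<le> exp (2 * B / gap)"
      using eventually_gt_at_top[of 0]
      by eventually_elim (use z w in \<open>intro cmod_edge_sum_le; auto\<close>)
  qed simp
  then have "(1 / ?r) * cmod (edge_kernel \<zeta> \<omega>) \<le> exp (2 * B / gap)"
    by (simp only: norm_mult norm_of_real complex_mod_cnj cmod_edge_phase mult_1) simp
  then have "?r * ((1 / ?r) * cmod (edge_kernel \<zeta> \<omega>)) \<le> ?r * exp (2 * B / gap)"
    using r by (intro mult_left_mono) auto
  moreover have "?r * ((1 / ?r) * cmod (edge_kernel \<zeta> \<omega>)) = cmod (edge_kernel \<zeta> \<omega>)" using R(1) gap_pos by simp
  ultimately show ?thesis by simp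
qed

lemma part_edge:
  assumes dp: "determinantal_process {z. Re z > 0} edge_kernel \<X>"
  shows "behaves_asymptotically_as
     (\<lambda>n. map_process (\<lambda>z. cplx (real n * (R\<^sup>2 - 1 + c) / R) * (z - cplx R)) (G n))
     (\<lambda>_. \<X>) {z. Re z > 0}"
  unfolding behaves_asymptotically_as_def
proof (intro allI impI)
  fix k :: nat and f assume k: "1 \<le> k" and f: "test_function k {z. Re z > 0} f"
  let ?E = "{z::complex. Re z > 0}"
  have oE: "open ?E" by (intro open_Collect_less continuous_intros)
  then have E: "?E \<in> sets borel" by simp
  obtain C0 where C0: "\<And>x. x \<in> tuples k UNIV \<Longrightarrow> cmod (f x) \<le> C0" by (rule test_function_bounded[OF f]) blast
  obtain Q where Q: "compact Q" "Q \<subseteq> ?E"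
    and supp: "\<And>x i. x \<in> tuples k UNIV \<Longrightarrow> f x \<noteq> 0 \<Longrightarrow> i < k \<Longrightarrow> x i \<in> Q"
    by (rule test_function_support[OF f]) blast
  note Qm = compact_borel_finite[OF Q(1)]
  have fm: "f \<in> borel_measurable (lborels k)"
    using f by (intro lipschitz_tuples_measurable) (simp add: test_function_def)
  have bounded: "\<exists>B. \<forall>z\<in>S. 0 < Re z \<and> cmod z \<le> B" if "compact S" "S \<subseteq> ?E" for S
    using compact_imp_bounded[OF that(1)] that(2) unfolding bounded_iff by blast
  obtain B where B: "\<And>z. z \<in> Q \<Longrightarrow> 0 < Re z \<and> cmod z \<le> B" using bounded[OF Q] by blast
  let ?r = "R\<^sup>2 / (pi * gap\<^sup>2)"
  let ?C = "?r * exp (2 * B / gap)"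
  have r: "?r > 0" using R(1) gap_pos by simp
  let ?K = "\<lambda>n T x y. cplx ?r * edge_sum n T x y"
  \<comment> \<open>The entrywise limit still carries the phases; they disappear only after the
    determinant is formed.\<close>
  define Kl where "Kl x y = edge_phase x * cnj (edge_phase y) * edge_kernel x y" for x y
  let ?A = "\<lambda>n. expected_tuple_sum (map_process (\<lambda>z. cplx (real n * (R\<^sup>2 - 1 + c) / R) * (z - cplx R)) (G n)) k f"
  let ?L = "kernel_integral k f Kl"
  have "(\<lambda>n. \<Sum>T\<in>TT n. cplx (prob n T) *
      kernel_integral k f (?K n T)) \<longlonglongrightarrow> ?L"
  proof (rule mixture_correlations_tendsto[where ?C0.0=C0 and Q=Q and C="?C"])
    show "f y \<noteq> 0 \<Longrightarrow> y \<in> tuples k UNIV \<Longrightarrow> i < k \<Longrightarrow> y i \<in> Q" for y i by (rule supp)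
    show "(\<lambda>y. ?K n T (y i) (y j)) \<in> borel_measurable (lborels k)" if "i < k" "j < k" for n T i j
      by (intro borel_measurable_times borel_measurable_const edge_sum_measurable that)
    show "(\<lambda>y. Kl (y i) (y j)) \<in> borel_measurable (lborels k)" if "i < k" "j < k" for i j
    proof -
      note [measurable] = component_measurable[OF that(1)] component_measurable[OF that(2)]
      show ?thesis unfolding Kl_def edge_phase_def edge_kernel_def cis_conv_exp by measurable
    qed
    show "\<forall>\<^sub>F n in sequentially. \<forall>T\<in>TT n. \<forall>x\<in>Q. \<forall>y\<in>Q. cmod (?K n T x y) \<le> ?C"
      using eventually_gt_at_top[of 0]
    proof eventually_elim
      case (elim n)
      show ?case
      proof (intro ballI)
        fix T x y assume T: "T \<in> TT n" and xy: "x \<in> Q" "y \<in> Q"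
        have "cmod (edge_sum n T x y) \<le> exp (2 * B / gap)"
          using B[OF xy(1)] B[OF xy(2)] T elim by (intro cmod_edge_sum_le) (auto simp: size_subsets_def)
        then show "cmod (?K n T x y) \<le> ?C"
          unfolding norm_mult norm_of_real using r by (intro mult_mono) auto
      qed
    qed
    show "cmod (Kl x y) \<le> ?C" if "x \<in> Q" "y \<in> Q" for x y
      using edge_limit_bound[of x B y] B[OF that(1)] B[OF that(2)] by (simp add: Kl_def norm_mult)
    show "AE y in lborels k. y \<in> tuples k Q \<longrightarrow> (\<forall>i<k. \<forall>j<k.
        (\<lambda>n. \<Sum>T\<in>TT n. prob n T * cmod (?K n T (y i) (y j) - Kl (y i) (y j))) \<longlonglongrightarrow> 0)"
    proof (intro AE_I2 impI allI)
      fix y :: "nat \<Rightarrow> complex" and i j assume y: "y \<in> tuples k Q" and ij: "i < k" "j < k"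
      have pos: "Re (y i) > 0" "Re (y j) > 0" using y ij B by (auto simp: PiE_iff)
      let ?e = "\<lambda>n T. edge_sum n T (y i) (y j)"
      have "(\<lambda>n. ?K n {M n..<n} (y i) (y j) - Kl (y i) (y j)) \<longlonglongrightarrow>
        cplx ?r * (cplx (pi * gap\<^sup>2 / R\<^sup>2) * Kl (y i) (y j)) - Kl (y i) (y j)"
        unfolding Kl_def by (intro tendsto_intros edge_sum_limit pos)
      also have "cplx ?r * (cplx (pi * gap\<^sup>2 / R\<^sup>2) * Kl (y i) (y j)) - Kl (y i) (y j) = 0"
      proof -
        have "?r * (pi * gap\<^sup>2 / R\<^sup>2) = 1" using R(1) gap_pos by simp
        then have "cplx ?r * cplx (pi * gap\<^sup>2 / R\<^sup>2) = 1"
          by (simp only: of_real_mult[symmetric] of_real_1)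
        then show ?thesis by (simp only: mult.assoc[symmetric]) simp
      qed
      finally have d: "(\<lambda>n. cmod (?K n {M n..<n} (y i) (y j) - Kl (y i) (y j))) \<longlonglongrightarrow> 0" by (rule tendsto_norm_zero)
      have lim: "(\<lambda>n. ?r * (\<Sum>T\<in>TT n. prob n T * cmod (?e n T - ?e n {M n..<n})) + cmod (?K n {M n..<n} (y i) (y j) - Kl (y i) (y j))) \<longlonglongrightarrow> 0"
        using tendsto_add[OF tendsto_mult_right_zero[OF edge_mismatch_tendsto, of "y i" "y j" ?r] d] pos by simp
      have nn: "\<forall>\<^sub>F n in sequentially. 0 \<le> (\<Sum>T\<in>TT n. prob n T * cmod (?K n T (y i) (y j) - Kl (y i) (y j)))"
        using prob_space_eventually by eventually_elim (auto intro!: sum_nonneg)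
      have up: "\<forall>\<^sub>F n in sequentially. (\<Sum>T\<in>TT n. prob n T * cmod (?K n T (y i) (y j) - Kl (y i) (y j))) \<le>
          ?r * (\<Sum>T\<in>TT n. prob n T * cmod (?e n T - ?e n {M n..<n})) + cmod (?K n {M n..<n} (y i) (y j) - Kl (y i) (y j))"
        using prob_space_eventually
      proof eventually_elim
        case (elim n)
        let ?d = "cmod (?K n {M n..<n} (y i) (y j) - Kl (y i) (y j))"
        have "(\<Sum>T\<in>TT n. prob n T * cmod (?K n T (y i) (y j) - Kl (y i) (y j))) \<le>
          (\<Sum>T\<in>TT n. prob n T * (?r * cmod (?e n T - ?e n {M n..<n}) + ?d))"
        proof (intro sum_mono mult_left_mono)
          fix T assume "T \<in> TT n"
          then show "0 \<le> prob n T" using elim by blast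
          have "cmod (?K n T (y i) (y j) - Kl (y i) (y j)) \<le> cmod (?K n T (y i) (y j) - ?K n {M n..<n} (y i) (y j)) + ?d"
            using norm_triangle_ineq[of "?K n T (y i) (y j) - ?K n {M n..<n} (y i) (y j)" "?K n {M n..<n} (y i) (y j) - Kl (y i) (y j)"]
            by (simp only: add_diff_eq diff_add_cancel)
          also have "?K n T (y i) (y j) - ?K n {M n..<n} (y i) (y j) = cplx ?r * (?e n T - ?e n {M n..<n})"
            by (simp only: right_diff_distrib)
          also have "cmod (cplx ?r * (?e n T - ?e n {M n..<n})) = ?r * cmod (?e n T - ?e n {M n..<n})"
            unfolding norm_mult norm_of_real using r by (simp only: abs_of_pos)
          finally show "cmod (?K n T (y i) (y j) - Kl (y i) (y j)) \<le> ?r * cmod (?e n T - ?e n {M n..<n}) + ?d" .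
        qed
        also have "\<dots> = ?r * (\<Sum>T\<in>TT n. prob n T * cmod (?e n T - ?e n {M n..<n})) + (\<Sum>T\<in>TT n. prob n T) * ?d"
          by (simp only: distrib_left sum.distrib sum_distrib_left sum_distrib_right mult.left_commute)
        also have "(\<Sum>T\<in>TT n. prob n T) * ?d = ?d" using elim by (simp only: mult_1)
        finally show ?case .
      qed
      show "(\<lambda>n. \<Sum>T\<in>TT n. prob n T * cmod (?K n T (y i) (y j) - Kl (y i) (y j))) \<longlonglongrightarrow> 0"
        by (rule real_tendsto_sandwich[OF nn up tendsto_const lim])
    qed
  qed (use fm C0 Qm prob_space_eventually in auto)
  then have A: "?A \<longlonglongrightarrow> ?L"
  proof (rule Lim_transform_eventually)
    show "\<forall>\<^sub>F n in sequentially. (\<Sum>T\<in>TT n. cplx (prob n T) *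
      kernel_integral k f (?K n T)) = ?A n"
      using eventually_gt_at_top[of 0] by eventually_elim (simp only: expected_edge[OF _ f])
  qed
  have "expected_tuple_sum \<X> k f = (kernel_integral k f edge_kernel)"
  proof (rule determinantal_expectation[OF dp E k f edge_kernel_measurable])
    fix S assume "compact S" "S \<subseteq> ?E"
    then obtain B' where "\<And>z. z \<in> S \<Longrightarrow> 0 < Re z \<and> cmod z \<le> B'" using bounded[of S] by blast
    then show "\<exists>C. \<forall>x\<in>S. \<forall>y\<in>S. cmod (edge_kernel x y) \<le> C"
      by (intro exI[of _ "?r * exp (2 * B' / gap)"] ballI edge_limit_bound) blast+
  qed
  also have "\<dots> = ?L" unfolding Kl_def by (simp only: leibniz_det_conjugate_phase cmod_edge_phase)
  finally have X: "expected_tuple_sum \<X> k f = ?L" .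
  have e: "expected_count \<X> (ball 0 1) > 0" by (rule edge_process_count_pos[OF dp])
  show "(\<lambda>n. ?A n - expected_tuple_sum \<X> k f) \<in> o(\<lambda>_. cplx (expected_count \<X> (ball 0 1) ^ k))"
  proof (rule smalloI_tendsto)
    have "(\<lambda>n. (?A n - ?L) / cplx (expected_count \<X> (ball 0 1) ^ k)) \<longlonglongrightarrow> (?L - ?L) / cplx (expected_count \<X> (ball 0 1) ^ k)"
      using e by (intro tendsto_intros A) auto
    then show "(\<lambda>n. (?A n - expected_tuple_sum \<X> k f) / cplx (expected_count \<X> (ball 0 1) ^ k)) \<longlonglongrightarrow> 0"
      unfolding X by simp
  qed (use e in simp)
qed

end

theorem theorem1p2:
  fixes R c :: real
  fixes N\<^sub>c :: "nat \<Rightarrow> nat" and G :: "nat \<Rightarrow> complex set measure"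
  assumes "0 < R" "R < 1" "1 - R\<^sup>2 < c" "c \<le> 1"
  defines "N\<^sub>c \<equiv> \<lambda>N. nat \<lfloor>c * real N\<rfloor>"
  defines "G \<equiv> \<lambda>N. conditioned_ginibre N (N\<^sub>c N) R"
  shows "behaves_asymptotically_as G
           (\<lambda>N. map_process (\<lambda>z. complex_of_real (sqrt (real (N - N\<^sub>c N) / real N)) * z)
                  (ginibre (N - N\<^sub>c N)))
           {z. cmod z < R} \<and>
         (\<forall>\<epsilon> > 0. behaves_asymptotically_as G ginibre {z. cmod z > R + \<epsilon>}) \<and>
         (\<forall>\<X>. determinantal_process {z. Re z > 0} edge_kernel \<X> \<longrightarrow>
           behaves_asymptotically_as
             (\<lambda>N. map_process
                    (\<lambda>z. complex_of_real (real N * (R\<^sup>2 - 1 + c) / R) * (z - complex_of_real R)) (G N))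
             (\<lambda>N. \<X>)
             {z. Re z > 0})"
proof -
  interpret conditioned_setting R c by (rule conditioned_setting.intro) (fact assms)+
  have Nc: "N\<^sub>c = Nc" by (simp add: N\<^sub>c_def Nc_def fun_eq_iff)
  show ?thesis
    using part_inside part_outside part_edge unfolding G_def Nc M_def by blast
qed

end
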